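(* Let $\varphi:\widetilde\Gamma\to\Gamma$ be a folded chain of loops of genus $g$ that is either uniform $k$-gonal (for some integer $k\ge2$) or has generic edge lengths, and let $r\ge -1$ be an integer. Then $V^r(\Gamma,\varphi)$ is pure-dimensional, i.e. all its maximal cells have the same dimension. Moreover, if $\dim V^r(\Gamma,\varphi)\ge 1$, then $V^r(\Gamma,\varphi)$ is connected in codimension $1$, i.e. any two maximal cells are connected by a sequence of cells whose codimension relative to $V^r(\Gamma,\varphi)$ is at most $1$.
   Context: Chain of loops. $\Gamma$ is a metric graph made of $g\ge2$ loops $\gamma_1,\dots,\gamma_g$. The loop $\gamma_a$ has a left vertex $l_a$ and a right vertex $r_a$, joined by an upper arc of length $\ell_a>0$ and a lower arc of length $m_a>0$; for $a<g$ the vertex $r_a$ is joined to $l_{a+1}$ by a bridge. The torsion of $\gamma_a$ is the least positive integer $k$ such that $k\,m_a$ is an integer multiple of $\ell_a+m_a$ (if it exists). The chain is uniform $k$-gonal if every loop has torsion $k$; edge lengths are generic if no loop has finite torsion (all $m_a/(\ell_a+m_a)$ irrational), in which case one sets $k=0$ and "congruent mod $k$" means "equal". Folded chain of loops. $\widetilde\Gamma$ is a chain of $2g-1$ loops $\widetilde\gamma_1,\dots,\widetilde\gamma_{2g-1}$, and $\varphi:\widetilde\Gamma\to\Gamma$ is the double cover such that: for $a<g$, each of $\widetilde\gamma_a$ and $\widetilde\gamma_{2g-a}$ maps isometrically onto $\gamma_a$; $\widetilde\gamma_g$ consists of two edges, each of length $\ell_g+m_g$, joining two vertices over $l_g$,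 each edge mapping isometrically onto the loop $\gamma_g$; each bridge of $\Gamma$ from $r_a$ to $l_{a+1}$ has two isometric preimages, one joining $\widetilde\gamma_a$ to $\widetilde\gamma_{a+1}$ and one joining $\widetilde\gamma_{2g-a}$ to $\widetilde\gamma_{2g-a-1}$ (for $a=g-1$ they are attached to the two different vertices of $\widetilde\gamma_g$). Locus. With the usual divisor theory on metric graphs (chip-firing equivalence, canonical divisor $K_\Gamma$, Baker--Norine rank $r(\cdot)$, pushforward $\varphi_*$), $$V^r(\Gamma,\varphi)=\{[D]\in\mathrm{Pic}^{2g-2}(\widetilde\Gamma): \varphi_*[D]=[K_\Gamma],\ r(D)\ge r,\ r(D)\equiv r \bmod 2\}.$$ Cells. Let $T_r=\{(x,y)\in\mathbb Z_{\ge1}^2: x+y\le r+1\}$. A staircase Prym tableau of type $(g,r,k)$ is a map $t:T_r\to\{1,\dots,g-1\}$ that is strictly increasing in each coordinate and such that $t(x,y)=t(x',y')$ implies $x-y\equiv x'-y'\pmod k$. Given $t$, let $P(t)$ be the set of classes of divisors $\sum_{a=1}^{g-1}(p_a+p'_a)+q-w$ on $\widetilde\Gamma$, where: $p_a\in\widetilde\gamma_a$ is the point lying over the point of $\gamma_a$ at counterclockwise distance $\xi_a$ from $r_a$, and $p'_a\in\widetilde\gamma_{2g-a}$ is the point lying over the point of $\gamma_a$ at clockwise distance $\xi_a$ from the mirror image $l_a$ of $r_a$ (i.e. the image of $\varphi(p_a)$ under the reflection of $\gamma_a$ exchanging $l_a$ and $r_a$ and preserving each arc); $\xi_a=m_a(x-y)$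 if $a=t(x,y)$, and $\xi_a\in\mathbb R$ is arbitrary if $a$ is not in the image of $t$; $q$ is the vertex of $\widetilde\gamma_g$ adjacent to the bridge to $\widetilde\gamma_{g+1}$ if $r$ is even, and to $\widetilde\gamma_{g-1}$ if $r$ is odd; and $w\in\widetilde\gamma_{2g-1}$ is the point over $l_1$. The locus $V^r(\Gamma,\varphi)$ is the union of the tori $P(t)$; its cells are the $P(t)$ and their nonempty intersections, a maximal cell is one maximal under inclusion, and in a connecting sequence of cells consecutive cells are comparable under inclusion. *)

theory Defs
  imports
    Complex_Main
    "HOL-Library.FuncSet"
    "HOL-Library.Poly_Mapping"
    "HOL-Library.Real_Mod"
    "HOL-Number_Theory.Cong"
begin

section \<open>Metric graphs\<close>

text \<open>
  A metric graph is given by a finite model: each edge \<open>e\<close> is a segment of length \<open>elen G e\<close>,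
  oriented arbitrarily from \<open>tail G e\<close> to \<open>head G e\<close>. Parallel edges and loop edges are allowed.
\<close>

record ('v, 'e) metric_graph =
  verts :: "'v set"
  edges :: "'e set"
  tail :: "'e \<Rightarrow> 'v"
  head :: "'e \<Rightarrow> 'v"
  elen :: "'e \<Rightarrow> real"

datatype ('v, 'e) point = Vertex 'v | Inner 'e real

definition points :: "('v, 'e) metric_graph \<Rightarrow> ('v, 'e) point set" where
  "points G = Vertex ` verts G \<union> {Inner e s | e s. e \<in> edges G \<and> 0 < s \<and> s < elen G e}"

text \<open>The point of the edge \<open>e\<close> at distance \<open>s \<in> {0..elen G e}\<close> from its tail.\<close>

definition edge_point :: "('v, 'e) metric_graph \<Rightarrow> 'e \<Rightarrow> real \<Rightarrow> ('v, 'e) point" where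
  "edge_point G e s =
     (if s = 0 then Vertex (tail G e) else if s = elen G e then Vertex (head G e) else Inner e s)"


section \<open>Divisor theory on metric graphs\<close>

text \<open>
  Divisors are elements of the free abelian group on the points, in the library's
  representation by finitely supported maps to the integers.
\<close>

type_synonym ('v, 'e) divisor = "('v, 'e) point \<Rightarrow>\<^sub>0 int"

definition divisors :: "('v, 'e) metric_graph \<Rightarrow> ('v, 'e) divisor set" where
  "divisors G = {D. Poly_Mapping.keys D \<subseteq> points G}"

definition div_degree :: "('v, 'e) divisor \<Rightarrow> int" where
  "div_degree D = (\<Sum>p\<in>Poly_Mapping.keys D. Poly_Mapping.lookup D p)"

definition effective :: "('v, 'e) divisor \<Rightarrow> bool" where
  "effective D \<longleftrightarrow> (\<forall>p. 0 \<le> Poly_Mapping.lookup D p)"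

text \<open>
  Continuous piecewise linear functions with integer slopes on \<open>{0..L}\<close>; as each linear
  piece is taken on a closed interval, continuity is included.
\<close>

definition integer_piecewise_linear :: "real \<Rightarrow> (real \<Rightarrow> real) \<Rightarrow> bool" where
  "integer_piecewise_linear L h \<longleftrightarrow>
     (\<exists>B. finite B \<and>
        (\<forall>a b. 0 \<le> a \<and> a < b \<and> b \<le> L \<and> {a<..<b} \<inter> B = {} \<longrightarrow>
           (\<exists>n::int. \<forall>s\<in>{a..b}. h s = h a + of_int n * (s - a))))"

definition rational_function :: "('v, 'e) metric_graph \<Rightarrow> (('v, 'e) point \<Rightarrow> real) \<Rightarrow> bool" where
  "rational_function G f \<longleftrightarrow>
     (\<forall>e\<in>edges G. integer_piecewise_linear (elen G e) (\<lambda>s. f (edge_point G e s)))"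

text \<open>One-sided outgoing slopes of \<open>h\<close> at \<open>s\<close>, in the two directions of the line.\<close>

definition slope_right :: "(real \<Rightarrow> real) \<Rightarrow> real \<Rightarrow> real" where
  "slope_right h s = Lim (at_right 0) (\<lambda>t. (h (s + t) - h s) / t)"

definition slope_left :: "(real \<Rightarrow> real) \<Rightarrow> real \<Rightarrow> real" where
  "slope_left h s = Lim (at_right 0) (\<lambda>t. (h (s - t) - h s) / t)"

text \<open>The order of \<open>f\<close> at a point is the sum of its outgoing slopes over all tangent directions.\<close>

fun ord_at :: "('v, 'e) metric_graph \<Rightarrow> (('v, 'e) point \<Rightarrow> real) \<Rightarrow> ('v, 'e) point \<Rightarrow> real" where
  "ord_at G f (Vertex v) =
     (\<Sum>e | e \<in> edges G \<and> tail G e = v. slope_right (\<lambda>s. f (edge_point G e s)) 0)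
   + (\<Sum>e | e \<in> edges G \<and> head G e = v. slope_left (\<lambda>s. f (edge_point G e s)) (elen G e))"
| "ord_at G f (Inner e s) =
     slope_right (\<lambda>s. f (edge_point G e s)) s + slope_left (\<lambda>s. f (edge_point G e s)) s"

definition principal :: "('v, 'e) metric_graph \<Rightarrow> ('v, 'e) divisor set" where
  "principal G =
     {D \<in> divisors G. \<exists>f. rational_function G f \<and>
        (\<forall>p\<in>points G. of_int (Poly_Mapping.lookup D p) = ord_at G f p)}"

definition lin_equiv :: "('v, 'e) metric_graph \<Rightarrow> (('v, 'e) divisor \<times> ('v, 'e) divisor) set" where
  "lin_equiv G = {(D, E). D \<in> divisors G \<and> E \<in> divisors G \<and> D - E \<in> principal G}"

definition div_class :: "('v, 'e) metric_graph \<Rightarrow> ('v, 'e) divisor \<Rightarrow> ('v, 'e) divisor set" where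
  "div_class G D = lin_equiv G `` {D}"

definition equiv_effective :: "('v, 'e) metric_graph \<Rightarrow> ('v, 'e) divisor \<Rightarrow> bool" where
  "equiv_effective G D \<longleftrightarrow> (\<exists>E\<in>div_class G D. effective E)"

text \<open>
  The Baker--Norine rank. On a nonempty graph the \<open>GREATEST\<close> is attained, since only
  \<open>d \<le> div_degree D\<close> can qualify.
\<close>

definition bn_rank :: "('v, 'e) metric_graph \<Rightarrow> ('v, 'e) divisor \<Rightarrow> int" where
  "bn_rank G D =
     (if equiv_effective G D
      then int (GREATEST d::nat.
             \<forall>E\<in>divisors G. effective E \<and> div_degree E = int d \<longrightarrow> equiv_effective G (D - E))
      else - 1)"

definition valence :: "('v, 'e) metric_graph \<Rightarrow> 'v \<Rightarrow> nat" where
  "valence G v = card {e \<in> edges G. tail G e = v} + card {e \<in> edges G. head G e = v}"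

definition canonical_divisor :: "('v, 'e) metric_graph \<Rightarrow> ('v, 'e) divisor" where
  "canonical_divisor G =
     (\<Sum>v\<in>verts G. frag_cmul (int (valence G v) - 2) (frag_of (Vertex v)))"

definition pushforward ::
    "(('v, 'e) point \<Rightarrow> ('w, 'f) point) \<Rightarrow> ('v, 'e) divisor \<Rightarrow> ('w, 'f) divisor" where
  "pushforward \<phi> = frag_extend (\<lambda>p. frag_of (\<phi> p))"


section \<open>Chains of loops\<close>

record loop_chain =
  loops :: nat
  upper_len :: "nat \<Rightarrow> real"
  lower_len :: "nat \<Rightarrow> real"
  bridge_len :: "nat \<Rightarrow> real"

definition loop_len :: "loop_chain \<Rightarrow> nat \<Rightarrow> real" where
  "loop_len C a = upper_len C a + lower_len C a"

definition is_loop_chain :: "loop_chain \<Rightarrow> bool" where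
  "is_loop_chain C \<longleftrightarrow>
     (\<forall>a\<in>{1..loops C}. 0 < upper_len C a \<and> 0 < lower_len C a) \<and>
     (\<forall>a\<in>{1..<loops C}. 0 < bridge_len C a)"

datatype chain_vertex = LV nat | RV nat
datatype chain_edge = Upper nat | Lower nat | Bridge nat

text \<open>
  Both arcs of a loop are oriented counterclockwise: the upper one from right to left, the
  lower one from left to right. The bridge \<open>Bridge a\<close> runs from loop \<open>a\<close> to loop \<open>a + 1\<close>.
\<close>

fun chain_tail :: "chain_edge \<Rightarrow> chain_vertex" where
  "chain_tail (Upper a) = RV a"
| "chain_tail (Lower a) = LV a"
| "chain_tail (Bridge a) = RV a"

fun chain_head :: "chain_edge \<Rightarrow> chain_vertex" where
  "chain_head (Upper a) = LV a"
| "chain_head (Lower a) = RV a"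
| "chain_head (Bridge a) = LV (a + 1)"

fun chain_elen :: "loop_chain \<Rightarrow> chain_edge \<Rightarrow> real" where
  "chain_elen C (Upper a) = upper_len C a"
| "chain_elen C (Lower a) = lower_len C a"
| "chain_elen C (Bridge a) = bridge_len C a"

type_synonym chain_point = "(chain_vertex, chain_edge) point"
type_synonym chain_divisor = "(chain_vertex, chain_edge) divisor"

definition chain_graph :: "loop_chain \<Rightarrow> (chain_vertex, chain_edge) metric_graph" where
  "chain_graph C =
     \<lparr> verts = LV ` {1..loops C} \<union> RV ` {1..loops C},
       edges = Upper ` {1..loops C} \<union> Lower ` {1..loops C} \<union> Bridge ` {1..<loops C},
       tail = chain_tail,
       head = chain_head,
       elen = chain_elen C \<rparr>"

text \<open>
  \<open>loop_point C a x\<close> is the point of the loop \<open>a\<close> at counterclockwise distance \<open>x\<close> from its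
  right vertex, for an arbitrary real \<open>x\<close> (negative distances run clockwise).
\<close>

definition loop_point :: "loop_chain \<Rightarrow> nat \<Rightarrow> real \<Rightarrow> chain_point" where
  "loop_point C a x =
     (let s = x rmod loop_len C a in
      if s \<le> upper_len C a then edge_point (chain_graph C) (Upper a) s
      else edge_point (chain_graph C) (Lower a) (s - upper_len C a))"

definition has_torsion :: "loop_chain \<Rightarrow> nat \<Rightarrow> nat \<Rightarrow> bool" where
  "has_torsion C a k \<longleftrightarrow>
     (let P = (\<lambda>j::nat. 0 < j \<and> (\<exists>n::int. of_nat j * lower_len C a = of_int n * loop_len C a))
      in P k \<and> (\<forall>j. P j \<longrightarrow> k \<le> j))"

definition uniform_gonal :: "loop_chain \<Rightarrow> nat \<Rightarrow> bool" where
  "uniform_gonal C k \<longleftrightarrow> (\<forall>a\<in>{1..loops C}. has_torsion C a k)"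

definition generic_lengths :: "loop_chain \<Rightarrow> bool" where
  "generic_lengths C \<longleftrightarrow> (\<forall>a\<in>{1..loops C}. \<nexists>k. has_torsion C a k)"


section \<open>The folded chain of loops\<close>

text \<open>
  The double cover of a chain of \<open>g\<close> loops is the chain of \<open>2 * g - 1\<close> loops below, numbered
  and drawn from left to right, so that loop \<open>2 * g - a\<close> (for \<open>a < g\<close>) is traversed in the
  opposite direction: its left vertex lies over the right vertex of loop \<open>a\<close> and vice versa.
\<close>

definition fold_index :: "loop_chain \<Rightarrow> nat \<Rightarrow> nat" where
  "fold_index C i = (if i \<le> loops C then i else 2 * loops C - i)"

definition double_chain :: "loop_chain \<Rightarrow> loop_chain" where
  "double_chain C =
     (let g = loops C in
      \<lparr> loops = 2 * g - 1,
        upper_len = (\<lambda>i. if i = g then loop_len C g else upper_len C (fold_index C i)),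
        lower_len = (\<lambda>i. if i = g then loop_len C g else lower_len C (fold_index C i)),
        bridge_len = (\<lambda>i. if i < g then bridge_len C i else bridge_len C (2 * g - 1 - i)) \<rparr>)"

text \<open>
  The covering map. Beyond the middle loop, edges are mapped with reversed orientation.
  Going once around the middle loop counterclockwise goes twice around loop \<open>g\<close>: the point
  at distance \<open>s\<close> from the tail of either edge of the middle loop is mapped to the point at
  counterclockwise distance \<open>s\<close> from the left vertex of loop \<open>g\<close>, that is, at counterclockwise
  distance \<open>upper_len C g + s\<close> from its right vertex.
\<close>

fun fold_map :: "loop_chain \<Rightarrow> chain_point \<Rightarrow> chain_point" where
  "fold_map C (Vertex (LV i)) =
     Vertex (if i \<le> loops C then LV i else RV (2 * loops C - i))"
| "fold_map C (Vertex (RV i)) =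
     Vertex (if i < loops C then RV i else LV (2 * loops C - i))"
| "fold_map C (Inner (Upper i) s) =
     (let g = loops C in
      if i < g then Inner (Upper i) s
      else if i = g then loop_point C g (upper_len C g + s)
      else Inner (Upper (2 * g - i)) (upper_len C (2 * g - i) - s))"
| "fold_map C (Inner (Lower i) s) =
     (let g = loops C in
      if i < g then Inner (Lower i) s
      else if i = g then loop_point C g (upper_len C g + s)
      else Inner (Lower (2 * g - i)) (lower_len C (2 * g - i) - s))"
| "fold_map C (Inner (Bridge i) s) =
     (let g = loops C in
      if i < g then Inner (Bridge i) s
      else Inner (Bridge (2 * g - 1 - i)) (bridge_len C (2 * g - 1 - i) - s))"

abbreviation cover_graph :: "loop_chain \<Rightarrow> (chain_vertex, chain_edge) metric_graph" where
  "cover_graph C \<equiv> chain_graph (double_chain C)"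


section \<open>The Prym--Brill--Noether locus\<close>

definition prym_locus :: "loop_chain \<Rightarrow> int \<Rightarrow> chain_divisor set set" where
  "prym_locus C r =
     {div_class (cover_graph C) D | D.
        D \<in> divisors (cover_graph C) \<and>
        div_degree D = 2 * int (loops C) - 2 \<and>
        div_class (chain_graph C) (pushforward (fold_map C) D) =
          div_class (chain_graph C) (canonical_divisor (chain_graph C)) \<and>
        r \<le> bn_rank (cover_graph C) D \<and>
        [bn_rank (cover_graph C) D = r] (mod 2)}"


section \<open>Tableaux, tori and cells\<close>

definition staircase :: "int \<Rightarrow> (nat \<times> nat) set" where
  "staircase r = {(x, y). 1 \<le> x \<and> 1 \<le> y \<and> int x + int y \<le> r + 1}"

text \<open>For \<open>k = 0\<close> the congruence below is an equality.\<close>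

definition prym_tableaux :: "nat \<Rightarrow> int \<Rightarrow> nat \<Rightarrow> (nat \<times> nat \<Rightarrow> nat) set" where
  "prym_tableaux g r k =
     {t \<in> staircase r \<rightarrow>\<^sub>E {1..<g}.
        (\<forall>x x' y. (x, y) \<in> staircase r \<and> (x', y) \<in> staircase r \<and> x < x' \<longrightarrow> t (x, y) < t (x', y)) \<and>
        (\<forall>x y y'. (x, y) \<in> staircase r \<and> (x, y') \<in> staircase r \<and> y < y' \<longrightarrow> t (x, y) < t (x, y')) \<and>
        (\<forall>x y x' y'. (x, y) \<in> staircase r \<and> (x', y') \<in> staircase r \<and> t (x, y) = t (x', y') \<longrightarrow>
           [int x - int y = int x' - int y'] (mod int k))}"

text \<open>
  \<open>D\<close> is the divisor \<open>\<Sum> (p a + p' a) + q - w\<close> with coordinates \<open>\<xi>\<close>. The left vertex of loop \<open>a\<close>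
  is at counterclockwise distance \<open>upper_len C a\<close> from the right vertex, so the point at
  clockwise distance \<open>\<xi> a\<close> from it is \<open>loop_point C a (upper_len C a - \<xi> a)\<close>. The right vertex
  of the last loop of the cover, \<open>RV (2 * g - 1)\<close>, lies over the left vertex of the first loop.
\<close>

definition prym_divisor :: "loop_chain \<Rightarrow> int \<Rightarrow> (nat \<Rightarrow> real) \<Rightarrow> chain_divisor \<Rightarrow> bool" where
  "prym_divisor C r \<xi> D \<longleftrightarrow>
     (let g = loops C;
          q = Vertex (if even r then RV g else LV g);
          w = Vertex (RV (2 * g - 1))
      in \<exists>p p'.
           (\<forall>a\<in>{1..<g}.
              p a \<in> range (loop_point (double_chain C) a) \<and>
              fold_map C (p a) = loop_point C a (\<xi> a) \<and>
              p' a \<in> range (loop_point (double_chain C) (2 * g - a)) \<and>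
              fold_map C (p' a) = loop_point C a (upper_len C a - \<xi> a)) \<and>
           D = (\<Sum>a\<in>{1..<g}. frag_of (p a) + frag_of (p' a)) + frag_of q - frag_of w)"

text \<open>
  Boxes \<open>(x, y)\<close> and \<open>(x', y')\<close> with the same entry \<open>a\<close> may prescribe different reals for \<open>\<xi> a\<close>,
  but these differ by a multiple of the length of loop \<open>a\<close> and so give the same points;
  hence \<open>\<xi> a\<close> is only required to be the value prescribed by one of them.
\<close>

definition tableau_torus ::
    "loop_chain \<Rightarrow> int \<Rightarrow> (nat \<times> nat \<Rightarrow> nat) \<Rightarrow> chain_divisor set set" where
  "tableau_torus C r t =
     {div_class (cover_graph C) D | \<xi> D.
        prym_divisor C r \<xi> D \<and>
        (\<forall>a \<in> t ` staircase r. \<exists>(x, y) \<in> staircase r.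
           t (x, y) = a \<and> \<xi> a = lower_len C a * (real x - real y))}"

definition prym_cells :: "loop_chain \<Rightarrow> int \<Rightarrow> nat \<Rightarrow> chain_divisor set set set" where
  "prym_cells C r k =
     {X. X \<noteq> {} \<and> (\<exists>T. T \<noteq> {} \<and> T \<subseteq> prym_tableaux (loops C) r k \<and>
                        X = (\<Inter>t\<in>T. tableau_torus C r t))}"

definition maximal_cells :: "loop_chain \<Rightarrow> int \<Rightarrow> nat \<Rightarrow> chain_divisor set set set" where
  "maximal_cells C r k =
     {X \<in> prym_cells C r k. \<forall>Y \<in> prym_cells C r k. X \<subseteq> Y \<longrightarrow> Y = X}"

text \<open>
  Every cell is a coordinate subtorus: the coordinates in some set \<open>F\<close> of loops vary freely
  while the others are fixed; its dimension is the number of free circle coordinates.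
\<close>

definition is_coordinate_torus ::
    "loop_chain \<Rightarrow> int \<Rightarrow> nat set \<Rightarrow> chain_divisor set set \<Rightarrow> bool" where
  "is_coordinate_torus C r F X \<longleftrightarrow>
     F \<subseteq> {1..<loops C} \<and>
     (\<exists>\<xi>\<^sub>0. X = {div_class (cover_graph C) D | \<xi> D.
               prym_divisor C r \<xi> D \<and> (\<forall>a \<in> {1..<loops C} - F. \<xi> a = \<xi>\<^sub>0 a)})"

definition cell_dim :: "loop_chain \<Rightarrow> int \<Rightarrow> chain_divisor set set \<Rightarrow> nat" where
  "cell_dim C r X = (THE n. \<exists>F. is_coordinate_torus C r F X \<and> card F = n)"

definition locus_dim :: "loop_chain \<Rightarrow> int \<Rightarrow> nat \<Rightarrow> int" where
  "locus_dim C r k =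
     (if prym_cells C r k = {} then - 1
      else Max ((\<lambda>X. int (cell_dim C r X)) ` prym_cells C r k))"

definition connecting_sequence ::
    "loop_chain \<Rightarrow> int \<Rightarrow> nat \<Rightarrow> chain_divisor set set list \<Rightarrow> bool" where
  "connecting_sequence C r k Xs \<longleftrightarrow>
     set Xs \<subseteq> prym_cells C r k \<and>
     (\<forall>X \<in> set Xs. locus_dim C r k - int (cell_dim C r X) \<le> 1) \<and>
     successively (\<lambda>X Y. X \<subseteq> Y \<or> Y \<subseteq> X) Xs"

end

theory Submission
  imports Defs
begin

text \<open>
  On a chain of loops a divisor class is determined by its degree and one coordinate per loop.
  For a class of rank \<open>\<ge> d\<close>, the least degrees needed on the first \<open>i\<close> loops form strictly
  increasing sequences whose entries move down by one at loop \<open>i\<close> precisely when its coordinate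
  has a prescribed value: the rank is read off by adding to the empty partition, loop by loop,
  all boxes of one residue. On the folded chain the norm condition makes this word of residues
  palindromic. Reflecting the second half in the antidiagonal of a square turns the rank
  condition into a parity condition on the middle loop together with the condition that the
  first \<open>g - 1\<close> letters add at least the staircase \<open>T\<^sub>r\<close>.

  The tori are therefore the partial words of residues mod \<open>k\<close> in \<open>g - 1\<close> positions that reach
  the staircase; smaller words give larger tori. A minimal word is a reduced word of a minimal
  \<open>k\<close>-core containing the staircase. Removing boxes from cores satisfies the commutation and
  braid relations of the affine symmetric group, so all reduced words of one core have the same
  length, and with a spare position they are connected through words with one additional letter.
  The staircase is itself a core unless \<open>k\<close> is odd and small; in that case the minimal cores form
  a chain of cores of equal length, consecutive ones being obtained from a common core.
\<close>

subsection \<open>Moving beads\<close>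

text \<open>The pointwise order reverses inclusion: \<open>a \<le> b\<close> says that the partition
  of \<open>a\<close> contains that of \<open>b\<close>, and \<open>int\<close> is the greatest
  sequence. In this order adding boxes is left adjoint to removing them, and the adjunction carries
  the proof. It moves the second half of a palindromic word to the other side of the inequality,
  where it removes boxes from a square; the antidiagonal reflection preserves row minus column,
  hence residues, and so matches these removals with the additions of the first half. It also turns
  the question whether a word reaches a partition into the question whether the word, read
  backwards, empties it. Removing one residue sorts disjoint pairs of neighbouring positions, so the
  commutation and braid relations are relations between sortings; cores are needed to know that no
  step in them is idle. The obstacle for odd \<open>k\<close> is that the staircase
  \<open>T\<^sub>r\<close> has hooks of all odd lengths up to \<open>2 r - 1\<close>: one of them
  has length \<open>k\<close> exactly for odd \<open>k \<le> 2 r\<close>, and then several cores are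
  minimal above the staircase.\<close>

text \<open>
  A partition is encoded by a sequence \<open>a\<close> with \<open>maya a\<close>, the positions of its beads from left to
  right; \<open>int\<close> is the empty partition and \<open>int j - a j\<close> the \<open>j\<close>-th part. Beads on \<open>P\<close> are moved to
  the left by \<open>lower P\<close>, and \<open>raise P\<close> moves beads to the right onto \<open>P\<close>, whenever the target is free.
\<close>

definition lower :: "(int \<Rightarrow> bool) \<Rightarrow> (nat \<Rightarrow> int) \<Rightarrow> nat \<Rightarrow> int" where
  "lower P a j = (if P (a j) \<and> (j = 0 \<or> a (j - 1) \<noteq> a j - 1) then a j - 1 else a j)"

definition raise :: "(int \<Rightarrow> bool) \<Rightarrow> (nat \<Rightarrow> int) \<Rightarrow> nat \<Rightarrow> int" where
  "raise P b j = (if P (b j + 1) \<and> b (Suc j) \<noteq> b j + 1 then b j + 1 else b j)"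

definition maya :: "(nat \<Rightarrow> int) \<Rightarrow> bool" where
  "maya a \<longleftrightarrow> strict_mono a \<and> (\<forall>j. a j \<le> int j)"

definition sparse :: "(int \<Rightarrow> bool) \<Rightarrow> bool" where
  "sparse P \<longleftrightarrow> (\<forall>z. P z \<longrightarrow> \<not> P (z + 1))"

fun run :: "(nat \<Rightarrow> int \<Rightarrow> bool) \<Rightarrow> nat \<Rightarrow> (nat \<Rightarrow> int) \<Rightarrow> nat \<Rightarrow> int" where
  "run P 0 a = a"
| "run P (Suc n) a = lower (P (Suc n)) (run P n a)"

fun unrun :: "(nat \<Rightarrow> int \<Rightarrow> bool) \<Rightarrow> nat \<Rightarrow> (nat \<Rightarrow> int) \<Rightarrow> nat \<Rightarrow> int" where
  "unrun P 0 b = b"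
| "unrun P (Suc n) b = unrun P n (raise (P (Suc n)) b)"

fun run_down :: "(nat \<Rightarrow> int \<Rightarrow> bool) \<Rightarrow> nat \<Rightarrow> (nat \<Rightarrow> int) \<Rightarrow> nat \<Rightarrow> int" where
  "run_down P 0 a = a"
| "run_down P (Suc n) a = run_down P n (lower (P (Suc n)) a)"

fun raise_up :: "(nat \<Rightarrow> int \<Rightarrow> bool) \<Rightarrow> nat \<Rightarrow> (nat \<Rightarrow> int) \<Rightarrow> nat \<Rightarrow> int" where
  "raise_up P 0 b = b"
| "raise_up P (Suc n) b = raise (P (Suc n)) (raise_up P n b)"

lemma mayaD: "maya a \<Longrightarrow> a j < a (Suc j)" "maya a \<Longrightarrow> a j \<le> int j" "maya a \<Longrightarrow> strict_mono a"
  by (auto simp: maya_def strict_mono_Suc_iff)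

lemma maya_int: "maya int"
  by (auto simp: maya_def strict_mono_Suc_iff)

lemma strict_mono_lower:
  assumes "strict_mono a" shows "strict_mono (lower P a)"
proof -
  have a: "a n < a (Suc n)" for n using assms by (simp add: strict_mono_Suc_iff)
  show ?thesis unfolding strict_mono_Suc_iff
  proof
    fix n show "lower P a n < lower P a (Suc n)"
      using a[of n] by (auto simp: lower_def)
  qed
qed

lemma maya_lower: "maya a \<Longrightarrow> maya (lower P a)"
proof -
  assume a: "maya a"
  have "lower P a j \<le> int j" for j using mayaD(2)[OF a, of j] by (auto simp: lower_def)
  thus ?thesis using strict_mono_lower[of a P] a by (auto simp: maya_def)
qed

lemma strict_mono_raise:
  assumes "strict_mono a" shows "strict_mono (raise P a)"
proof -
  have a: "a n < a (Suc n)" for n using assms by (simp add: strict_mono_Suc_iff)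
  show ?thesis unfolding strict_mono_Suc_iff
  proof
    fix n show "raise P a n < raise P a (Suc n)"
      using a[of n] by (auto simp: raise_def)
  qed
qed

lemma maya_raise: "maya b \<Longrightarrow> maya (raise P b)"
proof -
  assume b: "maya b"
  have "raise P b j \<le> int j" for j
    using mayaD(2)[OF b, of j] mayaD(2)[OF b, of "Suc j"] mayaD(1)[OF b, of j]
    by (auto simp: raise_def)
  thus ?thesis using strict_mono_raise[of b P] b by (auto simp: maya_def)
qed

lemma raise_ge: "b \<le> raise P b"
  by (auto simp: le_fun_def raise_def)

lemma raise_int: "raise P int = int"
  by (auto simp: raise_def)

text \<open>A step changes a bead by at most one, so only rows with \<open>a j = b j + 1\<close>
  matter. If the bead of \<open>b\<close> in such a row were blocked by its successor, the bead of
  \<open>a\<close> in row \<open>j + 1\<close> would have to move although row \<open>j\<close>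
  blocks it; the converse is symmetric.\<close>

lemma lower_le_iff:
  assumes a: "strict_mono a" and b: "strict_mono b"
  shows "lower P a \<le> b \<longleftrightarrow> a \<le> raise P b"
proof
  have am: "a n < a (Suc n)" for n using a by (simp add: strict_mono_Suc_iff)
  have bm: "b n < b (Suc n)" for n using b by (simp add: strict_mono_Suc_iff)
  assume le: "lower P a \<le> b"
  show "a \<le> raise P b" unfolding le_fun_def
  proof
    fix j
    show "a j \<le> raise P b j"
    proof (cases "a j \<le> b j")
      case True thus ?thesis by (auto simp: raise_def)
    next
      case False
      with le have 1: "P (a j)" "a j = b j + 1" "lower P a j = a j - 1"
        unfolding le_fun_def lower_def by (smt (verit))+
      have "b (Suc j) \<noteq> b j + 1"
      proof
        assume 2: "b (Suc j) = b j + 1"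
        have "lower P a (Suc j) \<le> a j" using le 1 2 by (metis le_fun_def)
        thus False using am[of j] by (auto simp: lower_def split: if_splits)
      qed
      thus ?thesis using 1 by (auto simp: raise_def)
    qed
  qed
next
  have am: "a n < a (Suc n)" for n using a by (simp add: strict_mono_Suc_iff)
  have bm: "b n < b (Suc n)" for n using b by (simp add: strict_mono_Suc_iff)
  assume le: "a \<le> raise P b"
  show "lower P a \<le> b" unfolding le_fun_def
  proof
    fix j
    show "lower P a j \<le> b j"
    proof (cases "a j \<le> b j")
      case True thus ?thesis by (auto simp: lower_def)
    next
      case False
      with le have 1: "P (b j + 1)" "a j = b j + 1" "b (Suc j) \<noteq> b j + 1"
        unfolding le_fun_def raise_def by (smt (verit))+
      have "j = 0 \<or> a (j - 1) \<noteq> a j - 1"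
      proof (rule ccontr)
        assume "\<not> ?thesis"
        then obtain i where i: "j = Suc i" "a i = a j - 1" by (cases j) auto
        have "b j \<le> raise P b i" using le 1 i by (auto simp: le_fun_def)
          (metis add_diff_cancel_right')
        thus False using bm[of i] i by (auto simp: raise_def split: if_splits)
      qed
      thus ?thesis using 1 by (auto simp: lower_def)
    qed
  qed
qed

lemma raise_mono:
  assumes "strict_mono b" "strict_mono b'" "b \<le> b'"
  shows "raise P b \<le> raise P b'"
proof -
  have "lower P (raise P b) \<le> b"
    using lower_le_iff[OF strict_mono_raise[OF assms(1)] assms(1), of P P] by simp
  hence "lower P (raise P b) \<le> b'" using assms(3) by simp
  thus ?thesis using lower_le_iff[OF strict_mono_raise[OF assms(1)] assms(2)] by simp
qed

lemma maya_run: "maya a \<Longrightarrow> maya (run P n a)"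
  by (induction n) (auto intro: maya_lower)

lemma maya_raise_up: "maya a \<Longrightarrow> maya (raise_up P n a)"
  by (induction n) (auto intro: maya_raise)

lemma maya_unrun: "maya a \<Longrightarrow> maya (unrun P n a)"
  by (induction n arbitrary: a) (auto intro: maya_raise)

lemma run_le_iff:
  assumes "maya a" "maya b"
  shows "run P n a \<le> b \<longleftrightarrow> a \<le> unrun P n b"
  using assms(2)
  by (induction n arbitrary: b)
    (auto simp: lower_le_iff mayaD(3) maya_run[OF assms(1)] maya_raise)

lemma run_down_le_iff:
  assumes "maya a" "maya b"
  shows "run_down P n a \<le> b \<longleftrightarrow> a \<le> raise_up P n b"
  using assms(1)
  by (induction n arbitrary: a)
    (auto simp: lower_le_iff mayaD(3) maya_lower maya_raise_up[OF assms(2)])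

lemma maya_le_int: "maya a \<Longrightarrow> a \<le> int"
  by (auto simp: maya_def le_fun_def)

text \<open>As \<open>int\<close> is the greatest \<open>maya\<close> sequence, the adjoint
  inequality \<open>int \<le> unrun P n b\<close> is an equation. Reaching a partition is tested by
  emptying it: one fixed partition shrinks, instead of an unknown one growing.\<close>

lemma run_le_iff_unrun:
  assumes "maya b"
  shows "run P n int \<le> b \<longleftrightarrow> unrun P n b = int"
  using run_le_iff[OF maya_int assms, of P n] maya_le_int[OF maya_unrun[OF assms, of P n]]
  by (metis order.antisym order.refl)

section \<open>Words read backwards and palindromes\<close>

lemma run_Suc_front: "run P (Suc n) a = run (\<lambda>i. P (Suc i)) n (lower (P 1) a)"
  by (induction n) auto

lemma run_add: "run P (n + m) a = run (\<lambda>i. P (n + i)) m (run P n a)"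
  by (induction m) auto

lemma run_reverse:
  "(\<And>i. 1 \<le> i \<Longrightarrow> i \<le> n \<Longrightarrow> Q i = P (Suc n - i)) \<Longrightarrow> run Q n a = run_down P n a"
proof (induction n arbitrary: Q a)
  case (Suc n)
  have "run Q (Suc n) a = run (\<lambda>i. Q (Suc i)) n (lower (Q 1) a)" by (rule run_Suc_front)
  also have "\<dots> = run_down P n (lower (Q 1) a)"
    by (rule Suc.IH) (use Suc.prems in auto)
  also have "Q 1 = P (Suc n)" using Suc.prems[of 1] by simp
  finally show ?case by simp
qed simp

lemma run_cong:
  "(\<And>i. 1 \<le> i \<Longrightarrow> i \<le> n \<Longrightarrow> P i = Q i) \<Longrightarrow> run P n a = run Q n a"
  by (induction n) auto

text \<open>The second half appears as \<open>run_down\<close>, whose adjoint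
  \<open>raise_up\<close> uses the letters in the order of the first half. This makes the two halves
  comparable letter by letter.\<close>

lemma run_palindrome:
  assumes "\<And>i. 1 \<le> i \<Longrightarrow> i \<le> n \<Longrightarrow> P (Suc n + i) = P (Suc n - i)"
  shows "run P (Suc (n + n)) a = run_down P n (lower (P (Suc n)) (run P n a))"
proof -
  have "run P (Suc (n + n)) a = run P (Suc n + n) a" by simp
  also have "\<dots> = run (\<lambda>i. P (Suc n + i)) n (run P (Suc n) a)" by (rule run_add)
  also have "\<dots> = run_down P n (run P (Suc n) a)"
    by (rule run_reverse) (use assms in auto)
  finally show ?thesis by simp
qed

definition square :: "nat \<Rightarrow> nat \<Rightarrow> int" where
  "square d j = (if j < d then int j - int d else int j)"

lemma maya_square: "maya (square d)"
  by (auto simp: maya_def strict_mono_Suc_iff square_def)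

text \<open>Parts decrease weakly, so a part of length at least \<open>\<rho> + 1\<close> in row
  \<open>\<rho>\<close> already carries the whole square. Rank at least \<open>\<rho>\<close> will
  enter as the negative bead on the right.\<close>

lemma le_square_iff:
  assumes "maya a" shows "a \<le> square (Suc \<rho>) \<longleftrightarrow> a \<rho> \<le> -1"
proof
  assume "a \<le> square (Suc \<rho>)"
  hence "a \<rho> \<le> square (Suc \<rho>) \<rho>" by (simp add: le_fun_def)
  thus "a \<rho> \<le> -1" by (simp add: square_def)
next
  assume r: "a \<rho> \<le> -1"
  have "a j \<le> int j - int \<rho> - 1" if "j \<le> \<rho>" for j
    using that
  proof (induction rule: inc_induct)
    case (step n) thus ?case using mayaD(1)[OF assms, of n] by simp
  qed (use r in simp)
  hence "a j \<le> square (Suc \<rho>) j" for j using mayaD(2)[OF assms, of j]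
    by (cases "j \<le> \<rho>") (force simp: square_def)+
  thus "a \<le> square (Suc \<rho>)" by (auto simp: le_fun_def square_def)
qed

text \<open>
  Inside the \<open>d\<close> by \<open>d\<close> square, \<open>raise_up\<close> removes boxes exactly where \<open>run\<close> adds their
  images under the reflection in the antidiagonal.
\<close>

lemma raise_up_square:
  assumes sp: "\<And>i. sparse (P i)"
  shows "(i < d \<and> j < d \<longrightarrow>
      (raise_up P n (square d) j \<le> int i + int j - int d \<longleftrightarrow> int i + int j - int d < run P n int i))
    \<and> (\<forall>j\<ge>d. raise_up P n (square d) j = int j) \<and> (\<forall>j. raise_up P n (square d) j \<ge> int j - int d)"
proof (induction n arbitrary: i j)
  case 0 show ?case by (auto simp: square_def)
next
  case (Suc n)
  let ?b = "raise_up P n (square d)" and ?a = "run P n int" and ?P = "P (Suc n)"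
  have IH: "?b j \<le> int i + int j - int d \<longleftrightarrow> int i + int j - int d < ?a i" if "i < d" "j < d" for i j
    using Suc that by blast
  have bd: "?b j = int j" if "j \<ge> d" for j using Suc that by blast
  have bge: "?b j \<ge> int j - int d" for j using Suc by blast
  have mb: "maya ?b" by (rule maya_raise_up[OF maya_square])
  have ma: "maya ?a" by (rule maya_run[OF maya_int])
  have bmon: "?b j < ?b (Suc j)" for j using mayaD(1)[OF mb] .
  have amon: "?a j < ?a (Suc j)" for j using mayaD(1)[OF ma] .
  have main: "raise ?P ?b j \<le> int i + int j - int d \<longleftrightarrow> int i + int j - int d < lower ?P ?a i"
    if ij: "i < d" "j < d"
  proof -
    \<comment> \<open>Counting rows and columns from 0, the box in row \<open>j\<close> and column
      \<open>d - 1 - i\<close> and its mirror image in row \<open>i\<close> and column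
      \<open>d - 1 - j\<close> both have row minus column \<open>v + 1\<close>; removing the one and
      adding the other is governed by the same value \<open>?P (v + 1)\<close>.\<close>
    define v where "v = int i + int j - int d"
    have eq0: "?b j \<le> v \<longleftrightarrow> v < ?a i" using IH[OF ij] by (simp add: v_def)
    have up: "?b (Suc j) \<le> v + 1 \<longleftrightarrow> v + 1 < ?a i"
    proof (cases "Suc j < d")
      case True
      thus ?thesis using IH[OF ij(1) True] by (simp add: v_def algebra_simps)
    next
      case False
      hence "Suc j = d" using ij by simp
      thus ?thesis using bd[of "Suc j"] mayaD(2)[OF ma, of i] ij by (simp add: v_def)
    qed
    have dn: "(i = 0 \<or> ?a (i - 1) \<noteq> v) \<longleftrightarrow> \<not> (?b j \<le> v - 1)" if "?a i = v + 1"
    proof (cases i)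
      case 0 thus ?thesis using bge[of j] by (simp add: v_def)
    next
      case (Suc i')
      have "?b j \<le> v - 1 \<longleftrightarrow> v - 1 < ?a i'"
        using IH[of i' j] ij Suc by (simp add: v_def algebra_simps)
      moreover have "?a i' < v + 1" using amon[of i'] Suc that by simp
      ultimately show ?thesis using Suc by auto
    qed
    have "(?P (v + 1) \<and> ?b j = v \<and> ?b (Suc j) \<noteq> v + 1) \<longleftrightarrow>
          (?P (v + 1) \<and> ?a i = v + 1 \<and> (i = 0 \<or> ?a (i - 1) \<noteq> v))"
      using eq0 up dn bmon[of j] by (smt (verit))
    hence "raise ?P ?b j \<le> v \<longleftrightarrow> v < lower ?P ?a i"
      using eq0 unfolding raise_def lower_def
      by (smt (verit) sp[unfolded sparse_def])
    thus ?thesis by (simp add: v_def)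
  qed
  have "raise ?P ?b j = int j" if "j \<ge> d" for j using bd[OF that] bd[of "Suc j"] that
    by (auto simp: raise_def)
  moreover have "raise ?P ?b j \<ge> int j - int d" for j using bge[of j] by (auto simp: raise_def)
  ultimately show ?case using main by auto
qed

text \<open>
  With the middle loop included: the boxes off the antidiagonal of the square take care of
  each other, and only the antidiagonal remains.
\<close>

lemma palindrome_rank_iff:
  assumes sp: "\<And>i. sparse (P i)"
    and pal: "\<And>i. 1 \<le> i \<Longrightarrow> i \<le> n \<Longrightarrow> P (Suc n + i) = P (Suc n - i)"
  shows "run P (Suc (n + n)) int \<rho> \<le> -1 \<longleftrightarrow>
    (\<forall>j\<le>\<rho>. lower (P (Suc n)) (run P n int) j \<le> 2 * int j - int \<rho> - 1)"
proof -
  define d where "d = Suc \<rho>"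
  define a where "a = run P n int"
  define c where "c = lower (P (Suc n)) a"
  define b where "b = raise_up P n (square d)"
  have mc: "maya c"
    by (auto simp: a_def c_def intro!: maya_lower maya_run maya_int maya_raise_up maya_square)
  have ca: "c j \<le> a j" "a j \<le> c j + 1" for j by (auto simp: c_def lower_def)
  have rel: "b j \<le> int i + int j - int d \<longleftrightarrow> int i + int j - int d < a i" if "i < d" "j < d" for i j
    using raise_up_square[OF sp, where i=i and j=j and d=d and n=n] that by (auto simp: a_def b_def)
  have bd: "b j = int j" if "j \<ge> d" for j
    using raise_up_square[OF sp, where i=j and j=j and d=d and n=n] that by (auto simp: b_def)
  have bge: "b j \<ge> int j - int d" for j
    using raise_up_square[OF sp, where i=j and j=j and d=d and n=n] by (auto simp: b_def)
  have "run P (Suc (n + n)) int \<rho> \<le> -1 \<longleftrightarrow> run_down P n c \<le> square d"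
    using run_palindrome[OF pal, of int] le_square_iff[of "run P (Suc (n + n)) int" \<rho>]
      maya_run[OF maya_int, of P "Suc (n + n)"]
    by (simp add: d_def c_def a_def)
  also have "\<dots> \<longleftrightarrow> c \<le> b" using run_down_le_iff[OF mc maya_square, of P n d] by (simp add: b_def)
  also have "\<dots> \<longleftrightarrow> (\<forall>j<d. c j \<le> 2 * int j - int d)"
  proof
    assume le: "c \<le> b"
    show "\<forall>j<d. c j \<le> 2 * int j - int d"
    proof (intro allI impI, rule ccontr)
      fix j assume j: "j < d" and n: "\<not> c j \<le> 2 * int j - int d"
      have "c j \<le> b j" using le by (simp add: le_fun_def)
      thus False using rel[OF j j] n ca(1)[of j] by simp
    qed
  next
    assume H: "\<forall>j<d. c j \<le> 2 * int j - int d"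
    show "c \<le> b" unfolding le_fun_def
    proof (rule allI, rule ccontr)
      fix j assume n: "\<not> c j \<le> b j"
      have j: "j < d" using n bd[of j] mayaD(2)[OF mc, of j] by (metis not_le)
      \<comment> \<open>Row \<open>j\<close> of \<open>b\<close> has \<open>d - i\<close> boxes. The
        mirror image of its last box lies in row \<open>i\<close>, before row \<open>j\<close>, and
        there the antidiagonal condition \<open>H\<close> is violated.\<close>
      define i where "i = nat (b j + int d - int j)"
      have i: "int i = b j + int d - int j" using bge[of j] by (simp add: i_def)
      have lt: "i < j" using i n H j by (smt (verit) of_nat_less_iff)
      hence "a i > int i + int j - int d" using rel[of i j] i j by auto
      thus False using H lt j ca(2)[of i] by (smt (verit) less_trans of_nat_less_iff)
    qed
  qed
  finally show ?thesis by (simp add: d_def c_def a_def less_Suc_eq_le algebra_simps)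
qed

text \<open>The antidiagonal boxes of the square have row minus column \<open>2 j - \<rho>\<close>,
  all of one parity. If it is the parity of \<open>\<epsilon>\<close>, the middle letter adds all of
  them as soon as the staircase before them is filled. Otherwise it adds none, so the first half
  already contains them, and with them the next larger staircase. Hence the rank has the parity of
  \<open>\<epsilon>\<close> whenever it is not \<open>-1\<close>.\<close>

lemma palindrome_rank_parity:
  assumes sp: "\<And>i. sparse (P i)"
    and pal: "\<And>i. 1 \<le> i \<Longrightarrow> i \<le> n \<Longrightarrow> P (Suc n + i) = P (Suc n - i)"
    and mid: "\<And>z. P (Suc n) z \<longleftrightarrow> even (z - \<epsilon>)"
  shows "even (int \<rho> - \<epsilon>) \<Longrightarrow>
      run P (Suc (n + n)) int \<rho> \<le> -1 \<longleftrightarrow> (\<forall>j. run P n int j \<le> 2 * int j - int \<rho>)"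
    and "odd (int \<rho> - \<epsilon>) \<Longrightarrow> run P (Suc (n + n)) int \<rho> \<le> -1 \<Longrightarrow>
      run P (Suc (n + n)) int (Suc \<rho>) \<le> -1"
    and "even \<epsilon> \<Longrightarrow> run P (Suc (n + n)) int 0 \<le> -1"
proof -
  let ?a = "run P n int"
  have ma: "maya ?a" by (rule maya_run[OF maya_int])
  have A: "run P (Suc (n + n)) int \<rho> \<le> -1 \<longleftrightarrow> (\<forall>j. run P n int j \<le> 2 * int j - int \<rho>)"
    if ev: "even (int \<rho> - \<epsilon>)" for \<rho>
  proof -
    have "(\<forall>j\<le>\<rho>. lower (P (Suc n)) ?a j \<le> 2 * int j - int \<rho> - 1) \<longleftrightarrow>
          (\<forall>j. ?a j \<le> 2 * int j - int \<rho>)"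
    proof
      assume H: "\<forall>j\<le>\<rho>. lower (P (Suc n)) ?a j \<le> 2 * int j - int \<rho> - 1"
      show "\<forall>j. ?a j \<le> 2 * int j - int \<rho>"
      proof
        fix j show "?a j \<le> 2 * int j - int \<rho>"
        proof (cases "j \<le> \<rho>")
          case True thus ?thesis using H[rule_format, OF True] by (auto simp: lower_def split: if_splits)
        next
          case False thus ?thesis using mayaD(2)[OF ma, of j] by simp
        qed
      qed
    next
      assume H: "\<forall>j. ?a j \<le> 2 * int j - int \<rho>"
      show "\<forall>j\<le>\<rho>. lower (P (Suc n)) ?a j \<le> 2 * int j - int \<rho> - 1"
      proof (intro allI impI)
        fix j
        show "lower (P (Suc n)) ?a j \<le> 2 * int j - int \<rho> - 1"
        proof (cases "?a j = 2 * int j - int \<rho>")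
          case True
          have "P (Suc n) (?a j)" using True ev by (simp add: mid)
          moreover have "j = 0 \<or> ?a (j - 1) \<noteq> ?a j - 1"
            using H[rule_format, of "j - 1"] True by (cases j) auto
          ultimately show ?thesis using True by (simp add: lower_def)
        next
          case False thus ?thesis using H[rule_format, of j] by (auto simp: lower_def)
        qed
      qed
    qed
    thus ?thesis using palindrome_rank_iff[OF sp pal, of \<rho>] by simp
  qed
  show "even (int \<rho> - \<epsilon>) \<Longrightarrow>
      run P (Suc (n + n)) int \<rho> \<le> -1 \<longleftrightarrow> (\<forall>j. run P n int j \<le> 2 * int j - int \<rho>)"
    by (rule A)
  show "run P (Suc (n + n)) int (Suc \<rho>) \<le> -1"
    if od: "odd (int \<rho> - \<epsilon>)" and G: "run P (Suc (n + n)) int \<rho> \<le> -1"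
  proof -
    have H: "lower (P (Suc n)) ?a j \<le> 2 * int j - int \<rho> - 1" if "j \<le> \<rho>" for j
      using palindrome_rank_iff[OF sp pal, of \<rho>] G that by blast
    have "?a j \<le> 2 * int j - int (Suc \<rho>)" for j
    proof (cases "j \<le> \<rho>")
      case True
      show ?thesis
      proof (rule ccontr)
        assume n: "\<not> ?thesis"
        with H[OF True] have "P (Suc n) (?a j)" "?a j = 2 * int j - int \<rho>"
          by (auto simp: lower_def split: if_splits)
        thus False using od by (simp add: mid)
      qed
    next
      case False thus ?thesis using mayaD(2)[OF ma, of j] by simp
    qed
    moreover have "even (int (Suc \<rho>) - \<epsilon>)" using od by simp
    ultimately show ?thesis using A by blast
  qed
  show "even \<epsilon> \<Longrightarrow> run P (Suc (n + n)) int 0 \<le> -1"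
  proof (subst A)
    show "\<forall>j. ?a j \<le> 2 * int j - int 0"
    proof
      fix j show "?a j \<le> 2 * int j - int 0" using mayaD(2)[OF ma, of j] by simp
    qed
  qed auto
qed

subsection \<open>Cores\<close>

text \<open>Allows bead configurations to be compared as sets, so that identities between
  compositions of moves become Boolean identities at each position.\<close>

lemma strict_mono_range_eq:
  fixes f g :: "nat \<Rightarrow> int"
  assumes f: "strict_mono f" and g: "strict_mono g" and eq: "range f = range g"
  shows "f = g"
proof
  fix n show "f n = g n"
  proof (induction n rule: less_induct)
    case (less n)
    obtain m where m: "f n = g m" using eq by (metis rangeE rangeI)
    obtain l where l: "g n = f l" using eq by (metis rangeE rangeI)
    have "m \<ge> n"
    proof (rule ccontr)
      assume "\<not> m \<ge> n"
      hence "f m = f n" using less m by simp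
      thus False using \<open>\<not> m \<ge> n\<close> strict_monoD[OF f, of m n] by simp
    qed
    moreover have "l \<ge> n"
    proof (rule ccontr)
      assume "\<not> l \<ge> n"
      hence "g l = g n" using less l by simp
      thus False using \<open>\<not> l \<ge> n\<close> strict_monoD[OF g, of l n] by simp
    qed
    ultimately have "g n \<le> g m" "f n \<le> f l"
      using strict_mono_mono[OF f] strict_mono_mono[OF g] by (simp_all add: monoD)
    hence "g n \<le> f n" "f n \<le> g n" unfolding m[symmetric] l[symmetric] by simp_all
    thus ?case by simp
  qed
qed

lemma Suc_not_in_range_iff:
  fixes b :: "nat \<Rightarrow> int"
  assumes "strict_mono b"
  shows "b j + 1 \<in> range b \<longleftrightarrow> b (Suc j) = b j + 1"
proof
  assume "b j + 1 \<in> range b"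
  then obtain i where i: "b i = b j + 1" by auto
  hence "j < i" using assms by (metis less_add_one strict_mono_less)
  hence "b (Suc j) \<le> b i" "b j < b (Suc j)"
    using assms by (auto simp: strict_mono_less_eq strict_mono_less)
  thus "b (Suc j) = b j + 1" using i by simp
qed (metis rangeI)

lemma pred_not_in_range_iff:
  fixes b :: "nat \<Rightarrow> int"
  assumes "strict_mono b"
  shows "b j - 1 \<in> range b \<longleftrightarrow> j \<noteq> 0 \<and> b (j - 1) = b j - 1"
proof
  assume "b j - 1 \<in> range b"
  then obtain i where i: "b i = b j - 1" by auto
  hence "b i < b j" by simp
  hence "i < j" using assms by (simp add: strict_mono_less)
  hence "b i \<le> b (j - 1)" "b (j - 1) < b j"
    using assms by (auto simp: strict_mono_less_eq strict_mono_less)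
  thus "j \<noteq> 0 \<and> b (j - 1) = b j - 1" using i \<open>i < j\<close> by simp
qed (metis rangeI)

lemma bump_up_iff:
  fixes S :: "int set"
  shows "(\<exists>y\<in>S. z = (if P (y + 1) \<and> y + 1 \<notin> S then y + 1 else y)) \<longleftrightarrow>
    (z - 1 \<in> S \<and> P z \<and> z \<notin> S) \<or> (z \<in> S \<and> \<not> (P (z + 1) \<and> z + 1 \<notin> S))"
    (is "?L \<longleftrightarrow> ?R")
proof
  assume ?R
  thus ?L by (elim disjE) (auto intro: bexI[of _ "z - 1"] bexI[of _ z])
qed (auto split: if_splits)

lemma bump_down_iff:
  fixes S :: "int set"
  shows "(\<exists>y\<in>S. z = (if P y \<and> y - 1 \<notin> S then y - 1 else y)) \<longleftrightarrow>
    (z + 1 \<in> S \<and> P (z + 1) \<and> z \<notin> S) \<or> (z \<in> S \<and> \<not> (P z \<and> z - 1 \<notin> S))"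
    (is "?L \<longleftrightarrow> ?R")
proof
  assume ?R
  thus ?L by (elim disjE) (auto intro: bexI[of _ "z + 1"] bexI[of _ z])
qed (auto split: if_splits)

text \<open>For sparse \<open>P\<close> the pairs \<open>z - 1\<close>, \<open>z\<close> with
  \<open>P z\<close> are disjoint, and \<open>raise\<close> sorts each of them: the right position
  receives the disjunction of the two occupancies, the left one the conjunction. In
  \<open>range_lower\<close> the two sides are exchanged.\<close>

lemma range_raise:
  assumes "strict_mono b" "sparse P"
  shows "z \<in> range (raise P b) \<longleftrightarrow>
    (if P z then z \<in> range b \<or> z - 1 \<in> range b
     else if P (z + 1) then z \<in> range b \<and> z + 1 \<in> range b else z \<in> range b)"
proof -
  have r: "raise P b j = (if P (b j + 1) \<and> b j + 1 \<notin> range b then b j + 1 else b j)" for j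
    unfolding raise_def Suc_not_in_range_iff[OF assms(1)] by auto
  have "z \<in> range (raise P b) \<longleftrightarrow>
     (\<exists>y \<in> range b. z = (if P (y + 1) \<and> y + 1 \<notin> range b then y + 1 else y))"
    unfolding image_def by (simp add: r) blast
  also have "\<dots> \<longleftrightarrow> (z - 1 \<in> range b \<and> P z \<and> z \<notin> range b) \<or> (z \<in> range b \<and> \<not> (P (z + 1) \<and> z + 1 \<notin> range b))"
    by (rule bump_up_iff)
  also have "\<dots> \<longleftrightarrow> (if P z then z \<in> range b \<or> z - 1 \<in> range b
     else if P (z + 1) then z \<in> range b \<and> z + 1 \<in> range b else z \<in> range b)"
    using assms(2) unfolding sparse_def by auto
  finally show ?thesis .
qed

lemma range_lower:
  assumes "strict_mono b" "sparse P"
  shows "z \<in> range (lower P b) \<longleftrightarrow>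
    (if P z then z \<in> range b \<and> z - 1 \<in> range b
     else if P (z + 1) then z \<in> range b \<or> z + 1 \<in> range b else z \<in> range b)"
proof -
  have r: "lower P b j = (if P (b j) \<and> b j - 1 \<notin> range b then b j - 1 else b j)" for j
    unfolding lower_def pred_not_in_range_iff[OF assms(1)] by auto
  have "z \<in> range (lower P b) \<longleftrightarrow>
     (\<exists>y \<in> range b. z = (if P y \<and> y - 1 \<notin> range b then y - 1 else y))"
    unfolding image_def by (simp add: r) blast
  also have "\<dots> \<longleftrightarrow> (z + 1 \<in> range b \<and> P (z + 1) \<and> z \<notin> range b) \<or> (z \<in> range b \<and> \<not> (P z \<and> z - 1 \<notin> range b))"
    by (rule bump_down_iff)
  also have "\<dots> \<longleftrightarrow> (if P z then z \<in> range b \<and> z - 1 \<in> range b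
     else if P (z + 1) then z \<in> range b \<or> z + 1 \<in> range b else z \<in> range b)"
    using assms(2) unfolding sparse_def by auto
  finally show ?thesis .
qed

lemma raise_neq_iff:
  assumes "strict_mono b"
  shows "raise P b \<noteq> b \<longleftrightarrow> (\<exists>z. P z \<and> z - 1 \<in> range b \<and> z \<notin> range b)"
proof -
  have "raise P b \<noteq> b \<longleftrightarrow> (\<exists>j. P (b j + 1) \<and> b j + 1 \<notin> range b)"
    unfolding fun_eq_iff raise_def Suc_not_in_range_iff[OF assms] by auto
  also have "\<dots> \<longleftrightarrow> (\<exists>z. P z \<and> z - 1 \<in> range b \<and> z \<notin> range b)"
  proof
    assume "\<exists>j. P (b j + 1) \<and> b j + 1 \<notin> range b"
    then obtain j where "P (b j + 1)" "b j + 1 \<notin> range b" by blast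
    thus "\<exists>z. P z \<and> z - 1 \<in> range b \<and> z \<notin> range b"
      by (intro exI[of _ "b j + 1"]) auto
  next
    assume "\<exists>z. P z \<and> z - 1 \<in> range b \<and> z \<notin> range b"
    then obtain z j where "P z" "z - 1 = b j" "z \<notin> range b" by auto
    hence "P (b j + 1) \<and> b j + 1 \<notin> range b" by (metis diff_add_cancel)
    thus "\<exists>j. P (b j + 1) \<and> b j + 1 \<notin> range b" by blast
  qed
  finally show ?thesis .
qed

text \<open>The pairs sorted by \<open>P\<close> are disjoint from those sorted by
  \<open>Q\<close>.\<close>

lemma raise_commute:
  assumes b: "strict_mono b" and P: "sparse P" and Q: "sparse Q"
    and PQ: "\<And>z. P z \<Longrightarrow> \<not> Q z \<and> \<not> Q (z + 1) \<and> \<not> Q (z - 1)"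
  shows "raise P (raise Q b) = raise Q (raise P b)"
proof (rule strict_mono_range_eq)
  note rr = range_raise[OF b P] range_raise[OF b Q]
    range_raise[OF strict_mono_raise[OF b] P] range_raise[OF strict_mono_raise[OF b] Q]
  have PQ': "P z \<longrightarrow> \<not> Q z \<and> \<not> Q (z + 1) \<and> \<not> Q (z - 1)" for z using PQ by blast
  have "z \<in> range (raise P (raise Q b)) \<longleftrightarrow> z \<in> range (raise Q (raise P b))" for z
    using PQ'[of z] PQ'[of "z + 1"] PQ'[of "z - 1"] PQ'[of "z + 2"]
    by (cases "P z"; cases "P (z + 1)"; cases "Q z"; cases "Q (z + 1)") (simp_all add: rr add.commute)
  thus "range (raise P (raise Q b)) = range (raise Q (raise P b))" by blast
qed (simp_all add: strict_mono_raise b)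

text \<open>The windows \<open>z - 1\<close>, \<open>z\<close>, \<open>z + 1\<close> with
  \<open>P z\<close> are pairwise disjoint; \<open>P\<close> sorts their left pairs and
  \<open>Q\<close> their right pairs, and either side of the equation sorts each window
  completely.\<close>

lemma raise_braid:
  assumes b: "strict_mono b" and P: "\<And>z. P z \<Longrightarrow> \<not> P (z + 1) \<and> \<not> P (z + 2)"
    and QP: "\<And>z. Q z \<longleftrightarrow> P (z - 1)"
  shows "raise P (raise Q (raise P b)) = raise Q (raise P (raise Q b))"
proof (rule strict_mono_range_eq)
  have P': "sparse P" and Q': "sparse Q" using P QP by (auto simp: sparse_def)
      (metis diff_add_cancel)
  note sm = strict_mono_raise
  note rr = range_raise[OF b P'] range_raise[OF b Q']
    range_raise[OF sm[OF b] P'] range_raise[OF sm[OF b] Q']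
    range_raise[OF sm[OF sm[OF b]] P'] range_raise[OF sm[OF sm[OF b]] Q']
  have PP: "P z \<longrightarrow> \<not> P (z + 1) \<and> \<not> P (z + 2)" for z using P by blast
  have "z \<in> range (raise P (raise Q (raise P b))) \<longleftrightarrow> z \<in> range (raise Q (raise P (raise Q b)))" for z
    using PP[of z] PP[of "z + 1"] PP[of "z - 1"] PP[of "z - 2"] PP[of "z - 3"]
    by (cases "P (z + 1)"; cases "P z"; cases "P (z - 1)") (auto simp: rr QP add.commute simp del: image_iff elim: disjE del: rangeE imageE)
  thus "range (raise P (raise Q (raise P b))) = range (raise Q (raise P (raise Q b)))" by blast
qed (simp_all add: strict_mono_raise b)

text \<open>A missing letter is the empty predicate. For \<open>k = 0\<close> congruence is
  equality, so the generic case needs no separate treatment.\<close>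

definition res :: "nat \<Rightarrow> int option \<Rightarrow> int \<Rightarrow> bool" where
  "res k co z \<longleftrightarrow> (case co of None \<Rightarrow> False | Some c \<Rightarrow> [z = c] (mod int k))"

lemma res_simps [simp]: "\<not> res k None z" "res k (Some c) z \<longleftrightarrow> [z = c] (mod int k)"
  by (auto simp: res_def)

lemma sparse_res: "k \<noteq> 1 \<Longrightarrow> sparse (res k co)"
proof (cases co)
  case (Some c)
  assume k: "k \<noteq> 1"
  have "\<not> [z + 1 = c] (mod int k)" if "[z = c] (mod int k)" for z
  proof
    assume "[z + 1 = c] (mod int k)"
    hence "[z + 1 = z] (mod int k)" using that by (metis cong_sym cong_trans)
    thus False using k by (auto simp: cong_iff_dvd_diff)
  qed
  thus ?thesis using Some by (auto simp: sparse_def)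
qed (auto simp: sparse_def)

lemma raise_None [simp]: "raise (res k None) b = b"
  by (auto simp: raise_def)

text \<open>The bead form of a \<open>k\<close>-core: no hook of length \<open>k\<close> can be
  removed. For \<open>k = 0\<close> every partition is a core.\<close>

definition core :: "nat \<Rightarrow> (nat \<Rightarrow> int) \<Rightarrow> bool" where
  "core k b \<longleftrightarrow> maya b \<and> (\<forall>z\<in>range b. z + int k \<in> range b)"

lemma core_mono: "core k b \<Longrightarrow> strict_mono b" and core_maya: "core k b \<Longrightarrow> maya b"
  by (auto simp: core_def mayaD)

lemma core_cong:
  assumes "core k b" "z \<in> range b" "[w = z] (mod int k)" "z \<le> w"
  shows "w \<in> range b"
proof -
  obtain q where q: "w = z + int k * q" using assms(3) by (metis cong_iff_lin cong_sym)
  have step: "z + int k * int n \<in> range b" for n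
  proof (induction n)
    case (Suc n)
    have "z + int k * int n + int k \<in> range b" using Suc assms(1) unfolding core_def by blast
    thus ?case by (simp add: algebra_simps)
  qed (use assms in simp)
  show ?thesis
  proof (cases "k = 0")
    case True thus ?thesis using q assms(2) by simp
  next
    case False
    hence "q \<ge> 0" using q assms(4) by (simp add: zero_le_mult_iff)
    thus ?thesis using step[of "nat q"] q by simp
  qed
qed

lemma core_int: "core k int"
proof -
  have "int n + int k \<in> range int" for n by (metis of_nat_add rangeI)
  thus ?thesis by (auto simp: core_def maya_int)
qed

lemma res_shift: "res k co (z + int k + y) \<longleftrightarrow> res k co (z + y)"
proof -
  have e: "z + int k + y = (z + y) + int k" by simp
  show ?thesis unfolding e by (cases co) (auto simp: cong_def)
qed

text \<open>Sorting is monotone in the set of beads, and since the predicate is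
  \<open>k\<close>-periodic it commutes with the shift by \<open>k\<close>.\<close>

lemma core_raise:
  assumes k: "k \<noteq> 1" and b: "core k b" shows "core k (raise (res k co) b)"
proof -
  have "z + int k \<in> range (raise (res k co) b)" if "z \<in> range (raise (res k co) b)" for z
  proof -
    have cl: "y + int k \<in> range b" if "y \<in> range b" for y using b that by (auto simp: core_def)
    have 1: "res k co (z + int k) \<longleftrightarrow> res k co z" "res k co (z + int k + 1) \<longleftrightarrow> res k co (z + 1)"
      using res_shift[of k co z 0] res_shift[of k co z 1] by simp_all
    show ?thesis using that cl[of z] cl[of "z - 1"] cl[of "z + 1"]
      unfolding range_raise[OF core_mono[OF b] sparse_res[OF k]] 1
      by (simp add: algebra_simps split: if_splits) blast
  qed
  thus ?thesis using core_maya[OF b] by (auto simp: core_def maya_raise)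
qed

lemma core_lower:
  assumes k: "k \<noteq> 1" and b: "core k b" shows "core k (lower (res k co) b)"
proof -
  have "z + int k \<in> range (lower (res k co) b)" if "z \<in> range (lower (res k co) b)" for z
  proof -
    have cl: "y + int k \<in> range b" if "y \<in> range b" for y using b that by (auto simp: core_def)
    have 1: "res k co (z + int k) \<longleftrightarrow> res k co z" "res k co (z + int k + 1) \<longleftrightarrow> res k co (z + 1)"
      using res_shift[of k co z 0] res_shift[of k co z 1] by simp_all
    show ?thesis using that cl[of z] cl[of "z - 1"] cl[of "z + 1"]
      unfolding range_lower[OF core_mono[OF b] sparse_res[OF k]] 1
      by (simp add: algebra_simps split: if_splits) blast
  qed
  thus ?thesis using core_maya[OF b] by (auto simp: core_def maya_lower)
qed

lemma core_run: "k \<noteq> 1 \<Longrightarrow> core k (run (\<lambda>i. res k (w i)) n int)"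
  by (induction n) (auto intro: core_lower core_int)

abbreviation rs :: "nat \<Rightarrow> int \<Rightarrow> (nat \<Rightarrow> int) \<Rightarrow> nat \<Rightarrow> int" where
  "rs k c \<equiv> raise (res k (Some c))"

lemma rs_cong: "[c = d] (mod int k) \<Longrightarrow> rs k c = rs k d"
proof -
  assume "[c = d] (mod int k)"
  hence "res k (Some c) = res k (Some d)" by (auto simp: fun_eq_iff) (metis cong_sym cong_trans)+
  thus ?thesis by simp
qed

lemma cong_shift: "[z = c + 1] (mod int k) \<longleftrightarrow> [z - 1 = c] (mod int k)"
  by (simp add: cong_iff_dvd_diff algebra_simps)

text \<open>
  On a core, two adjacent residues can only both be removable if the patterns
  \<open>100\<close> and \<open>110\<close> both occur.
\<close>

lemma diamond_adjacent:
  assumes k: "k \<noteq> 1" and b: "core k b"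
    and c: "rs k c b \<noteq> b" and d: "rs k (c + 1) b \<noteq> b"
  shows "rs k c (rs k (c + 1) (rs k c b)) = rs k (c + 1) (rs k c (rs k (c + 1) b))"
    and "rs k (c + 1) (rs k c b) \<noteq> rs k c b"
    and "rs k c (rs k (c + 1) (rs k c b)) \<noteq> rs k (c + 1) (rs k c b)"
    and "rs k c (rs k (c + 1) b) \<noteq> rs k (c + 1) b"
    and "rs k (c + 1) (rs k c (rs k (c + 1) b)) \<noteq> rs k c (rs k (c + 1) b)"
proof -
  have sm: "strict_mono b" by (rule core_mono[OF b])
  obtain p where p: "[p + 1 = c] (mod int k)" "p \<in> range b" "p + 1 \<notin> range b"
    using c unfolding raise_neq_iff[OF sm] by (metis diff_add_cancel res_simps(2))
  obtain q' where q': "[q' = c + 1] (mod int k)" "q' - 1 \<in> range b" "q' \<notin> range b"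
    using d unfolding raise_neq_iff[OF sm] by auto
  \<comment> \<open>Now \<open>p\<close> and \<open>q\<close> are left ends of windows of three
    positions in the same residue class. The window at \<open>p\<close> begins with 10, the one at
    \<open>q\<close> ends with 10; the core property forces \<open>p < q\<close> and completes them
    to 100 and 110.\<close>
  define q where "q = q' - 2"
  have q: "[q + 1 = c] (mod int k)" "q + 1 \<in> range b" "q + 2 \<notin> range b"
    using q' by (simp_all add: q_def cong_shift)
  have cg: "[p = q] (mod int k)"
    using p(1) q(1) by (metis cong_add_rcancel cong_sym cong_trans)
  have pq: "p < q"
  proof (rule ccontr)
    assume "\<not> p < q"
    hence "p + 1 \<in> range b"
      using core_cong[OF b q(2), of "p + 1"] cg by (simp add: cong_add_rcancel)
    thus False using p by simp
  qed
  have q0: "q \<in> range b" using core_cong[OF b p(2), of q] cg pq by (auto simp: cong_sym)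
  have p2: "p + 2 \<notin> range b"
  proof
    assume "p + 2 \<in> range b"
    hence "q + 2 \<in> range b" using core_cong[OF b, of "p + 2" "q + 2"] cg pq
      by (auto simp: cong_sym cong_add_rcancel)
    thus False using q by simp
  qed
  have k0: "k \<noteq> 0" using cg pq by (cases "k = 0") (auto simp: cong_def)
  have k2: "k \<noteq> 2"
  proof
    assume k2: "k = 2"
    have "[q + 2 = q] (mod int k)" using k2 by (simp add: cong_def)
    thus False using core_cong[OF b q0, of "q + 2"] q(3) by simp
  qed
  have k3: "k \<ge> 3" using k k0 k2 by simp
  define P where "P = res k (Some c)"
  define Q where "Q = res k (Some (c + 1))"
  have QP: "Q z \<longleftrightarrow> P (z - 1)" for z by (simp add: P_def Q_def cong_shift)
  have nd: "\<not> [z + y = c] (mod int k)" if "[z = c] (mod int k)" "y = 1 \<or> y = 2" for z y :: int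
  proof
    assume "[z + y = c] (mod int k)"
    hence "[z + y = z] (mod int k)" using that(1) by (metis cong_sym cong_trans)
    hence "int k dvd y" by (simp add: cong_iff_dvd_diff)
    hence "int k \<le> y" using that(2) by (auto intro: zdvd_imp_le)
    thus False using k3 that(2) by auto
  qed
  have PP: "\<not> P (z + 1) \<and> \<not> P (z + 2)" if "P z" for z using nd that by (simp add: P_def)
  have P': "sparse P" and Q': "sparse Q" using sparse_res[OF k] by (auto simp: P_def Q_def)
  note smr = strict_mono_raise
  note rr = range_raise[OF sm P'] range_raise[OF sm Q']
    range_raise[OF smr[OF sm] P'] range_raise[OF smr[OF sm] Q'] QP
  have Pp: "P (p + 1)" and Pq: "P (q + 1)" using p q by (auto simp: P_def)
  have PPn: "\<not> P v" if "P w" "v = w + 1 \<or> v = w + 2 \<or> w = v + 1 \<or> w = v + 2" for v w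
    using that PP[of v] PP[of w] by auto
  have np: "\<not> P p" "\<not> P (p + 2)" "\<not> P (p + 3)" "\<not> P (p - 1)"
    by (rule PPn[OF Pp], simp)+
  have nq: "\<not> P q" "\<not> P (q + 2)" "\<not> P (q + 3)" "\<not> P (q - 1)"
    by (rule PPn[OF Pq], simp)+
  note np = np nq
  show "rs k c (rs k (c + 1) (rs k c b)) = rs k (c + 1) (rs k c (rs k (c + 1) b))"
    using raise_braid[OF sm, of P Q] PP QP by (auto simp: P_def Q_def)
  \<comment> \<open>In the window 100 the bead travels through both pairs, so \<open>Q\<close> acts
    after \<open>P\<close>. In the window 110 the order is reversed, and this window makes the third
    step of \<open>P\<close>, \<open>Q\<close>, \<open>P\<close> effective.\<close>
  have "raise Q (raise P b) \<noteq> raise P b"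
    unfolding raise_neq_iff[OF smr[OF sm]]
    by (rule exI[of _ "p + 2"]) (use p p2 Pp np in \<open>simp add: rr add.commute\<close>)
  thus "rs k (c + 1) (rs k c b) \<noteq> rs k c b" by (simp add: P_def Q_def)
  have "raise P (raise Q (raise P b)) \<noteq> raise Q (raise P b)"
    unfolding raise_neq_iff[OF smr[OF smr[OF sm]]]
    by (rule exI[of _ "q + 1"]) (use q q0 Pq np in \<open>simp add: rr add.commute\<close>)
  thus "rs k c (rs k (c + 1) (rs k c b)) \<noteq> rs k (c + 1) (rs k c b)" by (simp add: P_def Q_def)
  have "raise P (raise Q b) \<noteq> raise Q b"
    unfolding raise_neq_iff[OF smr[OF sm]]
    by (rule exI[of _ "q + 1"]) (use q q0 Pq np in \<open>simp add: rr add.commute\<close>)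
  thus "rs k c (rs k (c + 1) b) \<noteq> rs k (c + 1) b" by (simp add: P_def Q_def)
  have "raise Q (raise P (raise Q b)) \<noteq> raise P (raise Q b)"
    unfolding raise_neq_iff[OF smr[OF smr[OF sm]]]
    by (rule exI[of _ "p + 2"]) (use p p2 Pp np in \<open>simp add: rr add.commute\<close>)
  thus "rs k (c + 1) (rs k c (rs k (c + 1) b)) \<noteq> rs k c (rs k (c + 1) b)" by (simp add: P_def Q_def)
qed

text \<open>Local confluence of removals: residues adjacent modulo \<open>k\<close> satisfy the
  braid relation, all other distinct residues commute. The inequalities record that no step is idle,
  so both sides have equal length.\<close>

lemma diamond:
  assumes k: "k \<noteq> 1" and b: "core k b"
    and c: "rs k c b \<noteq> b" and d: "rs k d b \<noteq> b" and ncd: "\<not> [c = d] (mod int k)"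
  obtains
    (commute) "rs k d (rs k c b) = rs k c (rs k d b)"
       "rs k d (rs k c b) \<noteq> rs k c b" "rs k c (rs k d b) \<noteq> rs k d b"
  | (braid) "rs k c (rs k d (rs k c b)) = rs k d (rs k c (rs k d b))"
       "rs k d (rs k c b) \<noteq> rs k c b" "rs k c (rs k d (rs k c b)) \<noteq> rs k d (rs k c b)"
       "rs k c (rs k d b) \<noteq> rs k d b" "rs k d (rs k c (rs k d b)) \<noteq> rs k c (rs k d b)"
proof -
  have sm: "strict_mono b" by (rule core_mono[OF b])
  consider "[d = c + 1] (mod int k)" | "[c = d + 1] (mod int k)"
    | "\<not> [d = c + 1] (mod int k)" "\<not> [c = d + 1] (mod int k)" by blast
  thus ?thesis
  proof cases
    case 1
    thus ?thesis using diamond_adjacent[OF k b c] braid d by (simp add: rs_cong[OF 1])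
  next
    case 2
    thus ?thesis using diamond_adjacent[OF k b d] braid c by (simp add: rs_cong[OF 2])
  next
    case 3
    define P where "P = res k (Some c)"
    define Q where "Q = res k (Some d)"
    have P': "sparse P" and Q': "sparse Q" using sparse_res[OF k] by (auto simp: P_def Q_def)
    have PQ: "\<not> Q z \<and> \<not> Q (z + 1) \<and> \<not> Q (z - 1)" if "P z" for z
    proof -
      have z: "[c = z] (mod int k)" using that by (simp add: P_def cong_sym)
      have "\<not> Q z" using ncd z by (auto simp: Q_def dest: cong_trans)
      moreover have "\<not> Q (z + 1)"
      proof
        assume "Q (z + 1)"
        hence "[d = z + 1] (mod int k)" by (simp add: Q_def cong_sym)
        thus False using 3(1) z by (metis cong_add_rcancel cong_sym cong_trans)
      qed
      moreover have "\<not> Q (z - 1)"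
      proof
        assume "Q (z - 1)"
        hence "[z = d + 1] (mod int k)" by (simp add: Q_def cong_shift)
        thus False using 3(2) z by (metis cong_trans)
      qed
      ultimately show ?thesis by blast
    qed
    have QP: "\<not> P z \<and> \<not> P (z + 1) \<and> \<not> P (z - 1)" if "Q z" for z
      using PQ[of z] PQ[of "z + 1"] PQ[of "z - 1"] that by auto
    have eff: "raise Q (raise P b) \<noteq> raise P b"
      if P': "sparse P" and Q: "raise Q b \<noteq> b" and QP: "\<And>z. Q z \<Longrightarrow> \<not> P z \<and> \<not> P (z + 1) \<and> \<not> P (z - 1)"
      for P Q
    proof -
      obtain z where z: "Q z" "z - 1 \<in> range b" "z \<notin> range b"
        using Q unfolding raise_neq_iff[OF sm] by blast
      show ?thesis unfolding raise_neq_iff[OF strict_mono_raise[OF sm]]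
        by (rule exI[of _ z]) (use z QP[of z] in \<open>auto simp: range_raise[OF sm P']\<close>)
    qed
    show ?thesis
    proof (rule commute)
      show "rs k d (rs k c b) = rs k c (rs k d b)"
        unfolding P_def[symmetric] Q_def[symmetric] by (rule raise_commute[OF sm P' Q' PQ, symmetric])
      show "rs k d (rs k c b) \<noteq> rs k c b"
        using d unfolding P_def[symmetric] Q_def[symmetric] by (rule eff[OF P' _ QP])
      show "rs k c (rs k d b) \<noteq> rs k d b"
        using c unfolding P_def[symmetric] Q_def[symmetric] by (rule eff[OF Q' _ PQ])
    qed
  qed
qed

section \<open>The length of a core\<close>

inductive red :: "nat \<Rightarrow> nat \<Rightarrow> (nat \<Rightarrow> int) \<Rightarrow> bool" for k where
  red_int: "red k 0 int"
| red_step: "rs k c b \<noteq> b \<Longrightarrow> c mod int k = c \<Longrightarrow> red k n (rs k c b) \<Longrightarrow> red k (Suc n) b"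

lemma red_stepI: "rs k c b \<noteq> b \<Longrightarrow> red k n (rs k c b) \<Longrightarrow> red k (Suc n) b"
proof -
  assume a: "rs k c b \<noteq> b" "red k n (rs k c b)"
  have "rs k (c mod int k) = rs k c" by (rule rs_cong) (simp add: cong_def)
  thus ?thesis using a by (intro red_step[of k "c mod int k"]) auto
qed

text \<open>The letters that empty \<open>b\<close> also empty the smaller partition of
  \<open>b'\<close>, because \<open>raise\<close> is monotone; letters that become idle are dropped.
  This supplies a length for the common core at the bottom of a diamond.\<close>

lemma red_mono: "red k n b \<Longrightarrow> maya b \<Longrightarrow> maya b' \<Longrightarrow> b \<le> b' \<Longrightarrow> \<exists>p. red k p b'"
proof (induction arbitrary: b' rule: red.induct)
  case red_int
  hence "b' = int" using maya_le_int[of b'] by simp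
  thus ?case using red.red_int by blast
next
  case (red_step c b n)
  have "\<exists>p. red k p (rs k c b')"
    by (rule red_step.IH) (use red_step.prems in \<open>auto intro!: maya_raise raise_mono mayaD(3)\<close>)
  thus ?case by (metis red_stepI)
qed

text \<open>Two first removals with different residues are joined by \<open>diamond\<close>. The
  common core at the bottom has some length by \<open>red_mono\<close>, and the induction
  hypothesis, applied above it on both sides, equates the remaining lengths.\<close>

lemma red_unique:
  assumes k: "k \<noteq> 1"
  shows "red k n b \<Longrightarrow> core k b \<Longrightarrow> red k m b \<Longrightarrow> m = n"
proof (induction n arbitrary: b m)
  case 0
  hence b: "b = int" by (auto elim: red.cases)
  from 0(3) show ?case by cases (use b in \<open>auto simp: raise_int\<close>)
next
  case (Suc n)
  from Suc.prems(1) obtain c where c: "rs k c b \<noteq> b" "red k n (rs k c b)"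
    by (cases rule: red.cases) auto
  have nint: "b \<noteq> int" using c by (auto simp: raise_int)
  from Suc.prems(3) nint obtain d m' where d: "rs k d b \<noteq> b" "red k m' (rs k d b)" "m = Suc m'"
    by (cases rule: red.cases) auto
  have cc: "core k (rs k c b)" and cd: "core k (rs k d b)"
    using core_raise[OF k Suc.prems(2)] by auto
  have "m' = n"
  proof (cases "[c = d] (mod int k)")
    case True
    thus ?thesis using Suc.IH[OF c(2) cc] d(2) rs_cong by metis
  next
    case False
    have clear: "\<exists>p. red k p x" if "rs k c b \<le> x" "core k x" for x
      using red_mono[OF c(2)] core_maya cc that by blast
    from k Suc.prems(2) c(1) d(1) False show ?thesis
    proof (cases rule: diamond)
      case commute
      obtain p where p: "red k p (rs k d (rs k c b))"
        using clear[OF raise_ge core_raise[OF k cc]] by blast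
      have "Suc p = n" by (rule Suc.IH[OF c(2) cc]) (rule red_stepI[OF commute(2) p])
      moreover have "red k (Suc p) (rs k d b)"
        by (rule red_stepI[of k c]) (use commute p in auto)
      ultimately show ?thesis using Suc.IH[OF _ cd d(2)] by blast
    next
      case braid
      obtain p where p: "red k p (rs k c (rs k d (rs k c b)))"
        using clear[OF order.trans[OF raise_ge raise_ge] core_raise[OF k core_raise[OF k cc]]] by blast
      have "Suc (Suc p) = n"
        by (rule Suc.IH[OF c(2) cc]) (rule red_stepI[OF braid(2) red_stepI[OF braid(3) p]])
      moreover have "red k (Suc (Suc p)) (rs k d b)"
        by (rule red_stepI[OF braid(4)], rule red_stepI[OF braid(5)]) (use braid p in auto)
      ultimately show ?thesis using Suc.IH[OF _ cd d(2)] by blast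
    qed
  qed
  thus ?case using d by simp
qed

subsection \<open>Reduced words\<close>

text \<open>
  A letter \<open>w i = None\<close> moves no bead; the torus attached to a partial word \<open>w\<close> leaves the
  coordinates of these loops free.
\<close>

abbreviation clr :: "nat \<Rightarrow> (nat \<Rightarrow> int option) \<Rightarrow> nat \<Rightarrow> (nat \<Rightarrow> int) \<Rightarrow> nat \<Rightarrow> int" where
  "clr k w \<equiv> unrun (\<lambda>i. res k (w i))"

text \<open>One representative per residue, so that the inclusion of tori becomes the order of
  partial maps.\<close>

definition normal :: "nat \<Rightarrow> (nat \<Rightarrow> int option) \<Rightarrow> bool" where
  "normal k w \<longleftrightarrow> (\<forall>i c. w i = Some c \<longrightarrow> c mod int k = c)"

definition redword :: "nat \<Rightarrow> nat \<Rightarrow> (nat \<Rightarrow> int) \<Rightarrow> (nat \<Rightarrow> int option) \<Rightarrow> bool" where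
  "redword k N b w \<longleftrightarrow>
     dom w \<subseteq> {1..N} \<and> normal k w \<and> clr k w N b = int \<and> red k (card (dom w)) b"

lemma unrun_cong:
  "(\<And>i. 1 \<le> i \<Longrightarrow> i \<le> N \<Longrightarrow> P i = Q i) \<Longrightarrow> unrun P N b = unrun Q N b"
  by (induction N arbitrary: b) auto

lemma clr_upd: "M > N \<Longrightarrow> clr k (w(M := x)) N b = clr k w N b"
  by (rule unrun_cong) auto

lemma redwordI:
  "dom w \<subseteq> {1..N} \<Longrightarrow> normal k w \<Longrightarrow> clr k w N b = int \<Longrightarrow> red k (card (dom w)) b \<Longrightarrow>
   redword k N b w"
  by (simp add: redword_def)

lemma redwordD:
  assumes "redword k N b w"
  shows "dom w \<subseteq> {1..N}" "normal k w" "clr k w N b = int" "red k (card (dom w)) b"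
  using assms by (simp_all add: redword_def)

lemma redword_None: "redword k N b w \<Longrightarrow> M > N \<Longrightarrow> w M = None"
  by (auto simp: redword_def)

lemma dom_mono_Suc: "dom w \<subseteq> {1..N} \<Longrightarrow> dom w \<subseteq> {1..Suc N}"
  by auto

lemma finite_dom_redword: "redword k N b w \<Longrightarrow> finite (dom w)"
  unfolding redword_def by (meson finite_atLeastAtMost finite_subset)

text \<open>Reading from the last position, letters that remove nothing are dropped. Every letter
  that remains is a step of \<open>red\<close>, so the subword is as long as the core.\<close>

lemma subword_exists:
  assumes "core k b" "k \<noteq> 1" "normal k w" "dom w \<subseteq> {1..N}" "clr k w N b = int"
  shows "\<exists>v. v \<subseteq>\<^sub>m w \<and> redword k N b v"
  using assms
proof (induction N arbitrary: b w)
  case 0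
  hence "w = Map.empty" "b = int" by auto
  thus ?case by (auto simp: redword_def normal_def red.red_int)
next
  case (Suc N)
  let ?u = "w(Suc N := None)"
  let ?b = "raise (res k (w (Suc N))) b"
  have "\<exists>v. v \<subseteq>\<^sub>m ?u \<and> redword k N ?b v"
  proof (rule Suc.IH)
    show "core k ?b" by (rule core_raise) fact+
    show "dom ?u \<subseteq> {1..N}" using Suc.prems(4) by (auto simp: le_Suc_eq)
    show "normal k ?u" using Suc.prems(3) by (auto simp: normal_def)
    show "clr k ?u N ?b = int" unfolding clr_upd[OF lessI] using Suc.prems(5) by simp
  qed fact
  then obtain v where v: "v \<subseteq>\<^sub>m ?u" "redword k N ?b v" by blast
  have vN: "v (Suc N) = None" using v(2) by (auto simp: redword_def)
  have vw: "v \<subseteq>\<^sub>m w" using v(1) by (auto simp: map_le_def split: if_splits)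
  show ?case
  proof (cases "?b = b")
    case True
    have "redword k (Suc N) b v"
      using redwordD[OF v(2)] True vN by (intro redwordI dom_mono_Suc) simp_all
    thus ?thesis using vw by blast
  next
    case False
    then obtain c where c: "w (Suc N) = Some c" by (cases "w (Suc N)") auto
    let ?v = "v(Suc N := Some c)"
    have "card (dom ?v) = Suc (card (dom v))"
      using vN finite_dom_redword[OF v(2)] by (simp add: domIff)
    moreover have "red k (Suc (card (dom v))) b"
      using v(2) False c by (intro red_stepI[of k c]) (auto simp: redword_def)
    moreover have "normal k ?v" using v(2) Suc.prems(3) c by (auto simp: redword_def normal_def)
    moreover have "clr k ?v (Suc N) b = int"
      using redwordD(3)[OF v(2)] c clr_upd[OF lessI, of k v N "Some c"] by simp
    moreover have "dom ?v \<subseteq> {1..Suc N}" using redwordD(1)[OF v(2)] by auto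
    ultimately have "redword k (Suc N) b ?v" by (intro redwordI) simp_all
    moreover have "?v \<subseteq>\<^sub>m w" using vw c by (auto simp: map_le_def)
    ultimately show ?thesis by blast
  qed
qed

lemma redword_skip: "redword k N b w \<Longrightarrow> redword k (Suc N) b w"
proof -
  assume w: "redword k N b w"
  show ?thesis using redwordD[OF w] redword_None[OF w lessI]
    by (intro redwordI dom_mono_Suc) simp_all
qed

lemma redword_add:
  assumes "redword k N (rs k c b) w" "rs k c b \<noteq> b" "c mod int k = c"
  shows "redword k (Suc N) b (w(Suc N \<mapsto> c))"
proof -
  have "w (Suc N) = None" using assms(1) by (auto simp: redword_def)
  hence "card (dom (w(Suc N \<mapsto> c))) = Suc (card (dom w))"
    using finite_dom_redword[OF assms(1)] by (simp add: domIff)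
  moreover have "red k (Suc (card (dom w))) b"
    using assms by (intro red_stepI[of k c]) (auto simp: redword_def)
  moreover have "clr k (w(Suc N \<mapsto> c)) (Suc N) b = int"
    using redwordD(3)[OF assms(1)] clr_upd[OF lessI, of k w N "Some c"] by simp
  moreover have "dom (w(Suc N \<mapsto> c)) \<subseteq> {1..Suc N}" using redwordD(1)[OF assms(1)] by auto
  moreover have "normal k (w(Suc N \<mapsto> c))"
    using redwordD(2)[OF assms(1)] assms(3) by (auto simp: normal_def)
  ultimately show ?thesis by (intro redwordI) simp_all
qed

text \<open>If the last letter were idle, the other letters would clear \<open>b\<close> and contain
  a reduced word with fewer letters than the length of \<open>b\<close>, contrary to
  \<open>red_unique\<close>. The same count shows that the truncated word is reduced.\<close>

lemma redword_remove:
  assumes k: "k \<noteq> 1" and b: "core k b" and w: "redword k (Suc N) b w" and c: "w (Suc N) = Some c"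
  shows "rs k c b \<noteq> b" "redword k N (rs k c b) (w(Suc N := None))" "c mod int k = c"
    "card (dom w) = Suc (card (dom (w(Suc N := None))))"
proof -
  let ?u = "w(Suc N := None)"
  have cb: "core k (rs k c b)" by (rule core_raise[OF k b])
  have fin: "finite (dom w)" by (rule finite_dom_redword[OF w])
  show card: "card (dom w) = Suc (card (dom ?u))"
    using card.remove[OF fin, of "Suc N"] c by (simp add: domIff)
  show "c mod int k = c" using w c by (auto simp: redword_def normal_def)
  have du: "dom ?u \<subseteq> {1..N}" using w by (auto simp: redword_def le_Suc_eq)
  have nu: "normal k ?u" using w by (auto simp: redword_def normal_def)
  have clu: "clr k ?u N (rs k c b) = int"
    using redwordD(3)[OF w] c unfolding clr_upd[OF lessI] by simp
  obtain v where v: "v \<subseteq>\<^sub>m ?u" "redword k N (rs k c b) v"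
    using subword_exists[OF cb k nu du clu] by blast
  have "dom v \<subseteq> dom ?u" using v(1) by (rule map_le_implies_dom_le)
  hence le: "card (dom v) \<le> card (dom ?u)" using fin by (intro card_mono) auto
  have rv: "red k (card (dom v)) (rs k c b)" using v by (simp add: redword_def)
  have rw: "red k (Suc (card (dom ?u))) b" using w card by (simp add: redword_def)
  show ne: "rs k c b \<noteq> b"
  proof
    assume "rs k c b = b"
    hence "card (dom v) = Suc (card (dom ?u))" using red_unique[OF k rw b] rv by simp
    thus False using le by simp
  qed
  have "Suc (card (dom v)) = Suc (card (dom ?u))"
    using red_unique[OF k rw b red_stepI[OF ne rv]] .
  hence "red k (card (dom ?u)) (rs k c b)" using rv by simp
  thus "redword k N (rs k c b) ?u" using du nu clu by (auto simp: redword_def)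
qed

text \<open>Used to confine a reduced word to an initial segment of positions, which leaves the last
  ones free for rearrangements.\<close>

lemma redword_exists:
  assumes "red k n b" "n \<le> N" shows "\<exists>w. redword k N b w \<and> card (dom w) = n"
  using assms
proof (induction N arbitrary: n b)
  case 0
  hence "n = 0" by simp
  moreover have "b = int" using 0 calculation by (auto elim: red.cases)
  ultimately show ?case by (intro exI[of _ Map.empty]) (auto simp: redword_def normal_def red.red_int)
next
  case (Suc N)
  from Suc.prems(1) show ?case
  proof cases
    case red_int
    hence "\<exists>w. redword k N b w \<and> card (dom w) = n" using Suc by simp
    thus ?thesis using redword_skip by blast
  next
    case (red_step c m)
    then obtain w where w: "redword k N (rs k c b) w" "card (dom w) = m"
      using Suc by (metis Suc_le_mono)
    have "w (Suc N) = None" using w(1) by (auto simp: redword_def)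
    hence "card (dom (w(Suc N \<mapsto> c))) = n"
      using finite_dom_redword[OF w(1)] w(2) red_step by (simp add: domIff)
    thus ?thesis using redword_add[OF w(1)] red_step by blast
  qed
qed

section \<open>Connecting reduced words\<close>

text \<open>The extension \<open>W\<close> bounds the union of the two words by one letter more than
  either of them; the two tori will then meet in codimension at most one.\<close>

definition wlink :: "nat \<Rightarrow> nat \<Rightarrow> (nat \<Rightarrow> int) \<Rightarrow> ((nat \<Rightarrow> int option) \<times> (nat \<Rightarrow> int option)) set" where
  "wlink k N b = {(w, v). redword k N b w \<and> redword k N b v \<and>
     (\<exists>W. w \<subseteq>\<^sub>m W \<and> v \<subseteq>\<^sub>m W \<and> finite (dom W) \<and> card (dom W) \<le> Suc (card (dom w)))}"

lemma wlinkI: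
  "redword k N b w \<Longrightarrow> redword k N b v \<Longrightarrow> w \<subseteq>\<^sub>m W \<Longrightarrow> v \<subseteq>\<^sub>m W \<Longrightarrow> finite (dom W) \<Longrightarrow>
   card (dom W) \<le> Suc (card (dom w)) \<Longrightarrow> (w, v) \<in> (wlink k N b)\<^sup>*"
  by (auto simp: wlink_def)

lemma redword_card:
  "k \<noteq> 1 \<Longrightarrow> core k b \<Longrightarrow> redword k N b w \<Longrightarrow> redword k N b v \<Longrightarrow> card (dom w) = card (dom v)"
  unfolding redword_def using red_unique by blast

lemma wlink_sym:
  assumes "k \<noteq> 1" "core k b" shows "sym ((wlink k N b)\<^sup>*)"
proof (rule sym_rtrancl)
  show "sym (wlink k N b)"
  proof (rule symI)
    fix w v assume a: "(w, v) \<in> wlink k N b"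
    hence "card (dom w) = card (dom v)" using redword_card[OF assms] by (auto simp: wlink_def)
    thus "(v, w) \<in> wlink k N b" using a unfolding wlink_def by fastforce
  qed
qed

lemma wlink_lift:
  assumes "(w, v) \<in> (wlink k N (rs k c b))\<^sup>*" "rs k c b \<noteq> b" "c mod int k = c"
  shows "(w(Suc N \<mapsto> c), v(Suc N \<mapsto> c)) \<in> (wlink k (Suc N) b)\<^sup>*"
  using assms(1)
proof induction
  case (step v u)
  have "(v(Suc N \<mapsto> c), u(Suc N \<mapsto> c)) \<in> (wlink k (Suc N) b)\<^sup>*"
  proof -
    obtain W where W: "redword k N (rs k c b) v" "redword k N (rs k c b) u"
        "v \<subseteq>\<^sub>m W" "u \<subseteq>\<^sub>m W" "finite (dom W)" "card (dom W) \<le> Suc (card (dom v))"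
      using step(2) by (auto simp: wlink_def)
    have "v (Suc N) = None" using W(1) by (auto simp: redword_def)
    hence c: "card (dom (v(Suc N \<mapsto> c))) = Suc (card (dom v))"
      using finite_dom_redword[OF W(1)] by (simp add: domIff)
    have "card (dom (W(Suc N \<mapsto> c))) \<le> Suc (card (dom W))"
      using W(5) by (simp add: card_insert_if)
    hence "card (dom (W(Suc N \<mapsto> c))) \<le> Suc (card (dom (v(Suc N \<mapsto> c))))"
      using W(6) c by linarith
    moreover have "v(Suc N \<mapsto> c) \<subseteq>\<^sub>m W(Suc N \<mapsto> c)" "u(Suc N \<mapsto> c) \<subseteq>\<^sub>m W(Suc N \<mapsto> c)"
      using W(3,4) by (auto intro: map_le_upd)
    moreover have "finite (dom (W(Suc N \<mapsto> c)))" using W(5) by simp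
    ultimately show ?thesis
      using wlinkI[OF redword_add[OF W(1) assms(2,3)] redword_add[OF W(2) assms(2,3)]] by blast
  qed
  thus ?case using step.IH by (rule rtrancl_trans[rotated])
qed simp

lemma clr_None:
  assumes "\<And>i. M < i \<Longrightarrow> i \<le> N \<Longrightarrow> w i = None" "M \<le> N"
  shows "clr k w N b = clr k w M b"
  using assms(2,1)
proof (induction N rule: dec_induct)
  case (step n) thus ?case by simp
qed simp

text \<open>The last letter slides over empty positions without affecting the clearing, and the word
  that carries it at both places has just one letter more. Afterwards final letters can be compared
  at the common position \<open>N\<close>.\<close>

lemma redword_shift:
  assumes k: "k \<noteq> 1" and b: "core k b" and w: "redword k N b w" and n: "card (dom w) \<noteq> 0"
  obtains v c where "(w, v) \<in> (wlink k N b)\<^sup>*" "redword k N b v" "v N = Some c"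
proof (cases "w N")
  case (Some c)
  thus ?thesis using that[of w c] w by simp
next
  case None
  have fin: "finite (dom w)" by (rule finite_dom_redword[OF w])
  define M where "M = Max (dom w)"
  have ne: "dom w \<noteq> {}" using n by auto
  have M: "M \<in> dom w" unfolding M_def by (rule Max_in[OF fin ne])
  have above: "w i = None" if "i > M" for i
  proof -
    have "i \<notin> dom w" using that Max_ge[OF fin, of i] by (auto simp: M_def simp del: domIff)
    thus ?thesis by (simp add: domIff)
  qed
  obtain c where c: "w M = Some c" using M by auto
  have MN: "1 \<le> M" "M < N" using M w None by (auto simp: redword_def subset_iff)
      (metis domI le_neq_implies_less option.distinct(1))
  obtain M' N' where M': "M = Suc M'" and N': "N = Suc N'" using MN by (cases M; cases N) auto
  define v where "v = w(M := None, N := Some c)"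
  have dv: "dom v = insert N (dom w - {M})" by (auto simp: v_def)
  have cv: "card (dom v) = card (dom w)"
  proof -
    have "N \<notin> dom w" using None by (simp add: domIff)
    hence "card (dom v) = Suc (card (dom w - {M}))" using fin by (simp add: dv)
    thus ?thesis using card.remove[OF fin M] by simp
  qed
  have "clr k w N b = clr k w M b" by (rule clr_None) (use above MN in auto)
  hence 1: "clr k w N b = clr k w M' (rs k c b)" using c M' by simp
  have "clr k v N b = clr k v N' (rs k c b)" by (simp add: N' v_def)
  also have "\<dots> = clr k v M' (rs k c b)"
    by (rule clr_None) (use above MN M' N' in \<open>auto simp: v_def\<close>)
  also have "\<dots> = clr k w M' (rs k c b)" by (rule unrun_cong) (use MN M' in \<open>auto simp: v_def\<close>)
  finally have 2: "clr k v N b = clr k w N b" using 1 by simp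
  have nv: "normal k v" using w c by (auto simp: v_def redword_def normal_def)
  have "dom v \<subseteq> {1..N}" using w MN by (auto simp: dv redword_def)
  hence v: "redword k N b v" using w 2 cv nv by (simp add: redword_def)
  have "(w, v) \<in> (wlink k N b)\<^sup>*"
    by (rule wlinkI[OF w v, of "w(N \<mapsto> c)"])
      (use fin None c in \<open>auto simp: map_le_def v_def card_insert_if\<close>)
  thus ?thesis using that[of v c] v by (simp add: v_def)
qed

text \<open>
  With a spare slot, the two sides of a commutation or braid relation fit into one word with a
  single additional letter.
\<close>

lemma redwords_connected:
  assumes "k \<noteq> 1" "core k b" "redword k N b w" "redword k N b v" "card (dom w) < N"
  shows "(w, v) \<in> (wlink k N b)\<^sup>*"
  using assms(2-)
proof (induction N arbitrary: b w v)
  case (Suc N)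
  note k = \<open>k \<noteq> 1\<close> and b = \<open>core k b\<close>
  note sy = symD[OF wlink_sym[OF k b, of "Suc N"]]
  have cwv: "card (dom w) = card (dom v)" by (rule redword_card[OF k b Suc.prems(2,3)])
  show ?case
  proof (cases "card (dom w) = 0")
    case True
    hence "dom w = {}" "dom v = {}"
      using cwv finite_dom_redword[OF Suc.prems(2)] finite_dom_redword[OF Suc.prems(3)] by auto
    hence "w = v" by simp
    thus ?thesis by simp
  next
    case False
    obtain w' c where w': "(w, w') \<in> (wlink k (Suc N) b)\<^sup>*" "redword k (Suc N) b w'" "w' (Suc N) = Some c"
      using redword_shift[OF k b Suc.prems(2) False] by blast
    obtain v' d where v': "(v, v') \<in> (wlink k (Suc N) b)\<^sup>*" "redword k (Suc N) b v'" "v' (Suc N) = Some d"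
      using redword_shift[OF k b Suc.prems(3)] False cwv by metis
    have cw': "card (dom w') = card (dom w)" "card (dom v') = card (dom w)"
      using redword_card[OF k b] w'(2) v'(2) Suc.prems(2) by blast+
    note rw = redword_remove[OF k b w'(2,3)] and rv = redword_remove[OF k b v'(2,3)]
    \<comment> \<open>Words with equal final letter: it is removed, and the induction hypothesis
      applies to the core below, with one letter and one position fewer, so a spare position
      remains.\<close>
    have up: "(x, y) \<in> (wlink k (Suc N) b)\<^sup>*"
      if x: "redword k (Suc N) b x" "x (Suc N) = Some e" and y: "redword k (Suc N) b y" "y (Suc N) = Some e"
      for x y e
    proof -
      note rx = redword_remove[OF k b x] and ry = redword_remove[OF k b y]
      have "card (dom x) < Suc N" using redword_card[OF k b x(1) Suc.prems(2)] Suc.prems(4) by simp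
      hence "(x(Suc N := None), y(Suc N := None)) \<in> (wlink k N (rs k e b))\<^sup>*"
        using Suc.IH[OF core_raise[OF k b] rx(2) ry(2)] rx(4)
        by (simp del: fun_upd_apply dom_fun_upd)
      from wlink_lift[OF this rx(1) rx(3)]
      have "(x(Suc N \<mapsto> e), y(Suc N \<mapsto> e)) \<in> (wlink k (Suc N) b)\<^sup>*" by simp
      moreover have "x(Suc N \<mapsto> e) = x" "y(Suc N \<mapsto> e) = y" using x(2) y(2) by auto
      ultimately show ?thesis by simp
    qed
    have mid: "(w', v') \<in> (wlink k (Suc N) b)\<^sup>*"
    proof (cases "c = d")
      case True thus ?thesis using up[OF w'(2,3) v'(2)] v'(3) by simp
    next
      case False
      hence ncd: "\<not> [c = d] (mod int k)" using rw(3) rv(3) by (simp add: cong_def)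
      have cb: "core k (rs k c b)" "core k (rs k d b)" using core_raise[OF k b] by auto
      let ?n = "card (dom (w'(Suc N := None)))"
      have redc: "red k ?n (rs k c b)" using rw(2) by (simp add: redword_def)
      have nN: "?n < N" using rw(4) cw' Suc.prems(4) by simp
      have clear: "\<exists>p. red k p x" if "rs k c b \<le> x" "core k x" for x
        using red_mono[OF redc] core_maya cb that by blast
      note normc = rw(3) and normd = rv(3)
      from k b rw(1) rv(1) ncd show ?thesis
      proof (cases rule: diamond)
        case commute
        define b2 where "b2 = rs k d (rs k c b)"
        obtain p where p: "red k p b2"
          using clear[OF raise_ge core_raise[OF k cb(1)]] unfolding b2_def by blast
        have "Suc p = ?n"
          by (rule red_unique[OF k redc cb(1)]) (rule red_stepI[OF commute(2) p[unfolded b2_def]])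
        then obtain N0 where N0: "N = Suc (Suc N0)" "p \<le> N0" using nN
          by (cases N; cases "N - 1") auto
        obtain x where x: "redword k N0 b2 x" "card (dom x) = p"
          using redword_exists[OF p N0(2)] by blast
        have xn: "x (Suc N0) = None" "x (Suc (Suc N0)) = None" "x (Suc (Suc (Suc N0))) = None"
          using x(1) by (auto simp: redword_def)
        have fx: "finite (dom x)" by (rule finite_dom_redword[OF x(1)])
        \<comment> \<open>Clearing reads from the right. In the last three positions the words end
          in \<open>_ d c\<close>, \<open>c d _\<close> and \<open>c _ d\<close>. The first two are
          contained in \<open>c d c\<close>, the last two in \<open>c d d\<close>.\<close>
        let ?v1 = "x(Suc (Suc N0) \<mapsto> d, Suc (Suc (Suc N0)) \<mapsto> c)"
        let ?v2 = "x(Suc N0 \<mapsto> c, Suc (Suc N0) \<mapsto> d)"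
        let ?v3 = "x(Suc N0 \<mapsto> c, Suc (Suc (Suc N0)) \<mapsto> d)"
        have x2: "redword k N0 (rs k c (rs k d b)) x" using x(1) commute(1) by (simp add: b2_def)
        have v1: "redword k (Suc N) b ?v1" unfolding N0(1)
          by (intro redword_add redword_skip x(1)[unfolded b2_def] commute(2) rw(1) normc normd)
        have v2: "redword k (Suc N) b ?v2" unfolding N0(1)
          by (intro redword_add redword_skip x2 commute(3) rv(1) normc normd)
        have v3: "redword k (Suc N) b ?v3" unfolding N0(1)
          by (intro redword_add redword_skip x2 commute(3) rv(1) normc normd)
        have "(?v1, ?v2) \<in> (wlink k (Suc N) b)\<^sup>*"
          by (rule wlinkI[OF v1 v2, of "?v2(Suc (Suc (Suc N0)) \<mapsto> c)"])
            (use xn fx in \<open>auto simp: map_le_def card_insert_if domIff\<close>)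
        also have "(?v2, ?v3) \<in> (wlink k (Suc N) b)\<^sup>*"
          by (rule wlinkI[OF v2 v3, of "?v2(Suc (Suc (Suc N0)) \<mapsto> d)"])
            (use xn fx in \<open>auto simp: map_le_def card_insert_if domIff\<close>)
        finally have "(?v1, ?v3) \<in> (wlink k (Suc N) b)\<^sup>*" .
        moreover have "(w', ?v1) \<in> (wlink k (Suc N) b)\<^sup>*"
          by (rule up[OF w'(2,3) v1]) (simp add: N0)
        moreover have "(?v3, v') \<in> (wlink k (Suc N) b)\<^sup>*"
          by (rule up[OF v3 _ v'(2,3)]) (simp add: N0)
        ultimately show ?thesis by (meson rtrancl_trans)
      next
        case braid
        define b3 where "b3 = rs k c (rs k d (rs k c b))"
        obtain p where p: "red k p b3"
          using clear[OF order.trans[OF raise_ge raise_ge] core_raise[OF k core_raise[OF k cb(1)]]]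
          unfolding b3_def by blast
        have "Suc (Suc p) = ?n"
          by (rule red_unique[OF k redc cb(1)])
            (rule red_stepI[OF braid(2) red_stepI[OF braid(3) p[unfolded b3_def]]])
        then obtain N0 where N0: "N = Suc (Suc (Suc N0))" "p \<le> N0" using nN
          by (cases N; cases "N - 1"; cases "N - 2") auto
        obtain x where x: "redword k N0 b3 x" "card (dom x) = p"
          using redword_exists[OF p N0(2)] by blast
        let ?s1 = "Suc N0" and ?s2 = "Suc (Suc N0)" and ?s3 = "Suc (Suc (Suc N0))"
          and ?s4 = "Suc (Suc (Suc (Suc N0)))"
        have xn: "x ?s1 = None" "x ?s2 = None" "x ?s3 = None" "x ?s4 = None"
          using x(1) by (auto simp: redword_def)
        have fx: "finite (dom x)" by (rule finite_dom_redword[OF x(1)])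
        \<comment> \<open>The endings are \<open>_ c d c\<close>, \<open>d c d _\<close> and
          \<open>d c _ d\<close>, with common extensions \<open>d c d c\<close> and
          \<open>d c d d\<close>. The spare position is what gives room for the fourth
          letter.\<close>
        let ?v1 = "x(?s2 \<mapsto> c, ?s3 \<mapsto> d, ?s4 \<mapsto> c)"
        let ?v2 = "x(?s1 \<mapsto> d, ?s2 \<mapsto> c, ?s3 \<mapsto> d)"
        let ?v3 = "x(?s1 \<mapsto> d, ?s2 \<mapsto> c, ?s4 \<mapsto> d)"
        have x2: "redword k N0 (rs k d (rs k c (rs k d b))) x" using x(1) braid(1) by (simp add: b3_def)
        have v1: "redword k (Suc N) b ?v1" unfolding N0(1)
          by (intro redword_add redword_skip x(1)[unfolded b3_def] braid(2,3) rw(1) normc normd)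
        have v2: "redword k (Suc N) b ?v2" unfolding N0(1)
          by (intro redword_add redword_skip x2 braid(4,5) rv(1) normc normd)
        have v3: "redword k (Suc N) b ?v3" unfolding N0(1)
          by (intro redword_add redword_skip x2 braid(4,5) rv(1) normc normd)
        have "(?v1, ?v2) \<in> (wlink k (Suc N) b)\<^sup>*"
          by (rule wlinkI[OF v1 v2, of "?v2(?s4 \<mapsto> c)"])
            (use xn fx in \<open>auto simp: map_le_def card_insert_if domIff\<close>)
        also have "(?v2, ?v3) \<in> (wlink k (Suc N) b)\<^sup>*"
          by (rule wlinkI[OF v2 v3, of "?v2(?s4 \<mapsto> d)"])
            (use xn fx in \<open>auto simp: map_le_def card_insert_if domIff\<close>)
        finally have "(?v1, ?v3) \<in> (wlink k (Suc N) b)\<^sup>*" .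
        moreover have "(w', ?v1) \<in> (wlink k (Suc N) b)\<^sup>*"
          by (rule up[OF w'(2,3) v1]) (simp add: N0)
        moreover have "(?v3, v') \<in> (wlink k (Suc N) b)\<^sup>*"
          by (rule up[OF v3 _ v'(2,3)]) (simp add: N0)
        ultimately show ?thesis by (meson rtrancl_trans)
      qed
    qed
    show ?thesis using w'(1) mid sy[OF v'(1)] by (meson rtrancl_trans)
  qed
qed simp

subsection \<open>Minimal cores containing the staircase\<close>

definition cap :: "(nat \<Rightarrow> int) \<Rightarrow> nat \<Rightarrow> int" where
  "cap v j = min (int j) (v j)"

text \<open>The bead form of \<open>staircase r\<close>: row \<open>j\<close>, counted from 0, has
  \<open>r - j\<close> boxes as long as this is positive.\<close>

definition stair :: "int \<Rightarrow> nat \<Rightarrow> int" where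
  "stair r = cap (\<lambda>j. 2 * int j - r)"

lemma strict_mono_diff:
  fixes v :: "nat \<Rightarrow> int"
  assumes "strict_mono v" "i \<le> j" shows "v i + int (j - i) \<le> v j"
  using assms(2)
proof (induction rule: dec_induct)
  case (step n)
  have "v n < v (Suc n)" using assms(1) by (simp add: strict_mono_Suc_iff)
  thus ?case using step by (simp add: Suc_diff_le)
qed simp

lemma maya_cap: "strict_mono v \<Longrightarrow> maya (cap v)"
  by (auto simp: maya_def cap_def strict_mono_Suc_iff intro: min.strict_coboundedI2)

lemma le_cap_iff: "maya a \<Longrightarrow> a \<le> cap v \<longleftrightarrow> (\<forall>j. a j \<le> v j)"
  by (auto simp: maya_def le_fun_def cap_def)

text \<open>A strictly increasing \<open>v\<close> that has reached the diagonal
  \<open>int j\<close> stays on or above it, so from there on the capped sequence occupies every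
  position. A shifted bead is either a bead of \<open>v\<close> below the diagonal or falls into
  this full part.\<close>

lemma core_cap:
  assumes v: "strict_mono v" and per: "\<And>j. \<exists>i. v i = v j + int k"
  shows "core k (cap v)"
proof -
  have id: "cap v n = int n" if "v i \<ge> int i" "i \<le> n" for i n
    using strict_mono_diff[OF v that(2)] that by (simp add: cap_def)
  have "cap v j + int k \<in> range (cap v)" for j
  proof (cases "v j \<ge> int j")
    case True
    hence "cap v j = int j" "cap v (j + k) = int (j + k)" using id[OF True] by auto
    hence "cap v (j + k) = cap v j + int k" by simp
    thus ?thesis by (metis rangeI)
  next
    case False
    hence cj: "cap v j = v j" by (simp add: cap_def)
    obtain i where i: "v i = v j + int k" using per by blast
    show ?thesis
    proof (cases "v i \<le> int i")
      case True
      hence "cap v i = cap v j + int k" using cj i by (simp add: cap_def)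
      thus ?thesis by (metis rangeI)
    next
      case False
      have "cap v (nat (v i)) = int (nat (v i))" by (rule id[of i]) (use False in auto)
      hence "cap v (nat (v i)) = cap v j + int k" using False cj i by simp
      thus ?thesis by (metis rangeI)
    qed
  qed
  thus ?thesis using maya_cap[OF v] by (auto simp: core_def)
qed

lemma maya_stair: "maya (stair r)"
  unfolding stair_def by (rule maya_cap) (simp add: strict_mono_Suc_iff)

lemma le_stair_iff: "maya a \<Longrightarrow> a \<le> stair r \<longleftrightarrow> (\<forall>j. a j \<le> 2 * int j - r)"
  unfolding stair_def by (rule le_cap_iff)

lemma core_stair_even: "even k \<Longrightarrow> core k (stair r)"
  unfolding stair_def
proof (rule core_cap)
  fix j assume "even k"
  hence "2 * int (j + k div 2) - r = 2 * int j - r + int k" by auto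
  thus "\<exists>i. 2 * int i - r = 2 * int j - r + int k" by blast
qed (simp add: strict_mono_Suc_iff)

lemma core_stair_large:
  assumes "2 * r + 1 \<le> int k" "r \<ge> -1" shows "core k (stair r)"
proof -
  have "stair r j + int k \<in> range (stair r)" for j
  proof -
    \<comment> \<open>For \<open>r \<ge> 0\<close> all beads are at least \<open>- r\<close> and all
      positions from \<open>r\<close> on are occupied, so a shift by \<open>2 r + 1\<close> or more
      always meets a bead.\<close>
    have ge: "stair r j + int k \<ge> r" "stair r j + int k \<ge> 0"
      using assms by (auto simp: stair_def cap_def min_def)
    hence "stair r (nat (stair r j + int k)) = stair r j + int k"
      by (simp add: stair_def cap_def min_def)
    thus ?thesis by (metis rangeI)
  qed
  thus ?thesis using maya_stair by (auto simp: core_def)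
qed

text \<open>
  For odd \<open>k = 2 h + 1\<close> the staircase is not a core; the minimal cores containing it are the
  partitions \<open>cap (bend h R K)\<close> with \<open>h \<le> K \<le> R\<close>. Below the \<open>K\<close>-th element, \<open>h\<close> of the \<open>k\<close>
  residue classes are occupied, above it \<open>h + 1\<close>.
\<close>

definition bend :: "nat \<Rightarrow> nat \<Rightarrow> nat \<Rightarrow> nat \<Rightarrow> int" where
  "bend h R K j =
     (if j < K then
        let i = K - 1 - j in
        2 * int K - int R - 2 - 2 * int (i mod h) - int (i div h) * (2 * int h + 1)
      else
        let i = j - K in
        2 * int K - int R + int (i div Suc h) * (2 * int h + 1)
          + (if i mod Suc h = 0 then 0 else 2 * int (i mod Suc h) - 1))"

lemma bend_below:
  "bend h R (Suc (i + j)) j =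
     2 * int (Suc (i + j)) - int R - 2 - 2 * int (i mod h) - int (i div h) * (2 * int h + 1)"
  by (simp add: bend_def Let_def)

lemma bend_above:
  "bend h R K (K + i) = 2 * int K - int R + int (i div Suc h) * (2 * int h + 1)
          + (if i mod Suc h = 0 then 0 else 2 * int (i mod Suc h) - 1)"
  by (simp add: bend_def Let_def)

lemma bend_step:
  assumes "h > 0" shows "bend h R K j < bend h R K (Suc j)" "j \<ge> K \<Longrightarrow> bend h R K (Suc j) \<le> bend h R K j + 2"
proof -
  consider i where "K = Suc (Suc i + j)" | "K = Suc j" | i where "j = K + i"
  proof (cases "j < K")
    case True
    then obtain i where "K = Suc (i + j)" by (metis add.commute less_iff_Suc_add add_Suc_right)
    thus ?thesis using that by (cases i) auto
  next
    case False thus ?thesis using that by (metis le_add_diff_inverse not_le)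
  qed
  hence "bend h R K j < bend h R K (Suc j) \<and> (j \<ge> K \<longrightarrow> bend h R K (Suc j) \<le> bend h R K j + 2)"
  proof cases
    case 1
    have "bend h R K (Suc j) = 2 * int K - int R - 2 - 2 * int (i mod h) - int (i div h) * (2 * int h + 1)"
      using bend_below[of h R i "Suc j"] 1 by simp
    moreover have "bend h R K j = 2 * int K - int R - 2 - 2 * int (Suc i mod h) - int (Suc i div h) * (2 * int h + 1)"
      using bend_below[of h R "Suc i" j] 1 by simp
    ultimately show ?thesis using assms 1 by (auto simp: mod_Suc div_Suc algebra_simps split: if_splits)
  next
    case 2
    have "bend h R K (Suc j) = 2 * int K - int R" using bend_above[of h R K 0] 2 by simp
    moreover have "bend h R K j = 2 * int K - int R - 2" using bend_below[of h R 0 j] 2 by simp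
    ultimately show ?thesis using 2 by simp
  next
    case 3
    have "bend h R K (Suc j) = 2 * int K - int R + int (Suc i div Suc h) * (2 * int h + 1)
          + (if Suc i mod Suc h = 0 then 0 else 2 * int (Suc i mod Suc h) - 1)"
      using bend_above[of h R K "Suc i"] 3 by simp
    moreover have "bend h R K j = 2 * int K - int R + int (i div Suc h) * (2 * int h + 1)
          + (if i mod Suc h = 0 then 0 else 2 * int (i mod Suc h) - 1)"
      using bend_above[of h R K i] 3 by simp
    ultimately show ?thesis using assms by (auto simp: mod_Suc div_Suc algebra_simps split: if_splits)
  qed
  thus "bend h R K j < bend h R K (Suc j)" "j \<ge> K \<Longrightarrow> bend h R K (Suc j) \<le> bend h R K j + 2" by auto
qed

lemma strict_mono_bend: "h > 0 \<Longrightarrow> strict_mono (bend h R K)"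
  by (simp add: strict_mono_Suc_iff bend_step)

lemma bend_below_period:
  assumes "h > 0" "j + h < K" shows "bend h R K (j + h) = bend h R K j + (2 * int h + 1)"
proof -
  obtain i where i: "K = Suc (i + (j + h))" using assms(2) by (metis add.commute less_iff_Suc_add add_Suc_right)
  have "bend h R K (j + h) = 2 * int K - int R - 2 - 2 * int (i mod h) - int (i div h) * (2 * int h + 1)"
    using bend_below[of h R i "j + h"] i by simp
  moreover have "bend h R K j = 2 * int K - int R - 2 - 2 * int ((i + h) mod h) - int ((i + h) div h) * (2 * int h + 1)"
    using bend_below[of h R "i + h" j] i by (simp add: ac_simps)
  ultimately show ?thesis using assms(1) by (simp add: algebra_simps)
qed

lemma bend_above_period:
  assumes "K \<le> j" shows "bend h R K (j + Suc h) = bend h R K j + (2 * int h + 1)"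
proof -
  obtain i where i: "j = K + i" using assms by (metis le_add_diff_inverse)
  have "bend h R K (j + Suc h) = 2 * int K - int R + int ((i + Suc h) div Suc h) * (2 * int h + 1)
          + (if (i + Suc h) mod Suc h = 0 then 0 else 2 * int ((i + Suc h) mod Suc h) - 1)"
    using bend_above[of h R K "i + Suc h"] i by (simp only: add.assoc)
  moreover have "(i + Suc h) div Suc h = Suc (i div Suc h)" "(i + Suc h) mod Suc h = i mod Suc h"
    by (simp_all del: add_Suc_right)
  ultimately have "bend h R K (j + Suc h) = 2 * int K - int R + int (Suc (i div Suc h)) * (2 * int h + 1)
          + (if i mod Suc h = 0 then 0 else 2 * int (i mod Suc h) - 1)"
    by (simp only:)
  moreover have "bend h R K j = 2 * int K - int R + int (i div Suc h) * (2 * int h + 1)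
          + (if i mod Suc h = 0 then 0 else 2 * int (i mod Suc h) - 1)"
    using bend_above[of h R K i] i by (simp only:)
  moreover have "x + int (Suc q) * y + e = (x + int q * y + e) + y" for x y e :: int and q
    by (simp add: algebra_simps)
  ultimately show ?thesis by (simp only:)
qed

section \<open>Bent staircases as greatest sequences\<close>

lemma bend_below_near:
  assumes "j < K" "K \<le> j + h" shows "bend h R K j = 2 * int j - int R"
proof -
  obtain i where i: "K = Suc (i + j)" using assms(1) by (metis add.commute less_iff_Suc_add add_Suc_right)
  thus ?thesis using bend_below[of h R i j] assms(2) by simp
qed

lemma bend_above_near:
  assumes "K < j" "j \<le> K + h" shows "bend h R K j = 2 * int j - int R - 1"
proof -
  obtain i where i: "j = K + i" using assms(1) by (metis less_imp_le le_add_diff_inverse)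
  have "i mod Suc h = i" "i div Suc h = 0" "i \<noteq> 0" using assms i by auto
  thus ?thesis using bend_above[of h R K i] i by simp
qed

lemma bend_at: "bend h R K K = 2 * int K - int R"
  using bend_above[of h R K 0] by simp

lemma core_bend:
  assumes "h > 0" shows "core (2 * h + 1) (cap (bend h R K))"
proof (rule core_cap[OF strict_mono_bend[OF assms]])
  fix j
  consider "j + h < K" | "j < K" "K \<le> j + h" | "K \<le> j" by linarith
  thus "\<exists>i. bend h R K i = bend h R K j + int (2 * h + 1)"
  proof cases
    case 1 thus ?thesis using bend_below_period[OF assms 1, of R] by (intro exI[of _ "j + h"]) simp
  next
    case 2
    have "bend h R K (j + Suc h) = 2 * int (j + Suc h) - int R - 1"
      by (rule bend_above_near) (use 2 in auto)
    thus ?thesis using bend_below_near[OF 2, of R] by (intro exI[of _ "j + Suc h"]) simp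
  next
    case 3 thus ?thesis using bend_above_period[OF 3, of h R] by (intro exI[of _ "j + Suc h"]) simp
  qed
qed

text \<open>The bound has slope 2. Before \<open>K\<close> a step of \<open>h\<close> rows changes
  \<open>bend\<close> by \<open>2 h + 1\<close>, more than the bound; after \<open>K\<close> a step
  of \<open>h + 1\<close> rows changes it by \<open>2 h + 1\<close>, less than the bound. So
  \<open>bend\<close> falls away from the bound on both sides of \<open>K\<close>.\<close>

lemma bend_le:
  assumes "h > 0" shows "bend h R K j \<le> 2 * int j - int R"
proof (cases "j < K")
  case True
  thus ?thesis
  proof (induction "K - j" arbitrary: j rule: less_induct)
    case less
    show ?case
    proof (cases "j + h < K")
      case True
      have "bend h R K (j + h) \<le> 2 * int (j + h) - int R"
        by (rule less.hyps) (use True assms in auto)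
      thus ?thesis using bend_below_period[OF assms True, of R] by simp
    next
      case False thus ?thesis using bend_below_near[of j K h R] less by simp
    qed
  qed
next
  case False
  hence "K \<le> j" by simp
  thus ?thesis
  proof (induction j rule: less_induct)
    case (less j)
    consider "j = K" | "K < j" "j \<le> K + h" | "K + Suc h \<le> j" using less.prems by linarith
    thus ?case
    proof cases
      case 3
      have "bend h R K (j - Suc h) \<le> 2 * int (j - Suc h) - int R" using less.IH[of "j - Suc h"] 3 by simp
      thus ?thesis using bend_above_period[of K "j - Suc h" h R] 3 by simp
    qed (use bend_at bend_above_near in auto)
  qed
qed

text \<open>In the rows from \<open>K - h\<close> to \<open>K\<close> the sequence
  \<open>bend\<close> attains the bound \<open>st\<close>, and elsewhere its recursions are the
  extreme cases of \<open>lo\<close> and \<open>hi\<close>. Hence it is the greatest sequence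
  satisfying all three.\<close>

lemma le_bend:
  assumes h: "h > 0" and hK: "h \<le> K" and st: "\<And>j. a j \<le> 2 * int j - int R"
    and lo: "\<And>j. j + h < K \<Longrightarrow> a j + (2 * int h + 1) \<le> a (j + h)"
    and hi: "\<And>j. K \<le> j + h \<Longrightarrow> a (j + Suc h) \<le> a j + (2 * int h + 1)"
  shows "a j \<le> bend h R K j"
proof (cases "j < K")
  case True
  thus ?thesis
  proof (induction "K - j" arbitrary: j rule: less_induct)
    case less
    show ?case
    proof (cases "j + h < K")
      case True
      have "a (j + h) \<le> bend h R K (j + h)" by (rule less.hyps) (use True h in auto)
      thus ?thesis using bend_below_period[OF h True, of R] lo[OF True] by simp
    next
      case False thus ?thesis using bend_below_near[of j K h R] less st by simp
    qed
  qed
next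
  case False
  hence "K \<le> j" by simp
  thus ?thesis
  proof (induction j rule: less_induct)
    case (less j)
    consider "j = K" | "K < j" "j \<le> K + h" | "K + Suc h \<le> j" using less.prems by linarith
    thus ?case
    proof cases
      case 1 thus ?thesis using bend_at st by simp
    next
      case 2
      \<comment> \<open>In these rows \<open>st\<close> is not sharp: \<open>hi\<close> from row
        \<open>j - h - 1\<close> gives \<open>2 (j - h - 1) - R + (2 h + 1)\<close>, one less than
        the bound.\<close>
      have "a j \<le> a (j - Suc h) + (2 * int h + 1)" using hi[of "j - Suc h"] 2 hK by simp
      thus ?thesis using bend_above_near[OF 2, of R] st[of "j - Suc h"] 2 hK by simp
    next
      case 3
      then obtain i where i: "j = i + Suc h" "K \<le> i" by (metis add_leD1 add_le_cancel_right le_add_diff_inverse2 add.commute)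
      have "a i \<le> bend h R K i" using less.IH[of i] i by simp
      thus ?thesis using bend_above_period[of K i h R] hi[of i] i by simp
    qed
  qed
qed

lemma core_shift_index:
  assumes "core k a" "k > 0" obtains i where "a i = a j + int k" "j < i"
proof -
  have "a j + int k \<in> range a" using assms by (auto simp: core_def)
  then obtain i where i: "a i = a j + int k" by auto
  hence "a j < a i" using assms by simp
  hence "j < i" using core_mono[OF assms(1)] by (simp add: strict_mono_less)
  thus ?thesis using that i by blast
qed

text \<open>\<open>G j\<close> says that the \<open>k\<close> positions after the bead
  \<open>a j\<close> contain at least \<open>h + 1\<close> beads. In a core an occupied residue
  class stays occupied, so \<open>G\<close> persists once it holds, and the bend is placed where it
  begins. The shift by \<open>h\<close> in \<open>K = J + h\<close> is the difference between the
  row \<open>j\<close> and the row bounded through it.\<close>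

lemma core_le_bend:
  assumes a: "core (2 * h + 1) a" and h: "h > 0" and st: "\<And>j. a j \<le> 2 * int j - int R" and R: "h \<le> R"
  shows "\<exists>K. h \<le> K \<and> K \<le> R \<and> a \<le> cap (bend h R K)"
proof -
  have sm: "strict_mono a" by (rule core_mono[OF a])
  note le = strict_mono_less_eq[OF sm]
  define G where "G j \<longleftrightarrow> a (j + Suc h) \<le> a j + (2 * int h + 1)" for j
  have G_Suc: "G (Suc j)" if "G j" for j
  proof -
    obtain i where i: "a i = a (Suc j) + int (2 * h + 1)" by (rule core_shift_index[OF a]) auto
    have "a j < a (Suc j)" using sm by (simp add: strict_mono_Suc_iff)
    hence "a (j + Suc h) < a i" using that i by (simp add: G_def)
    hence "Suc (j + Suc h) \<le> i" using sm by (simp add: strict_mono_less)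
    hence "a (Suc j + Suc h) \<le> a i" by (simp add: le)
    thus ?thesis using i by (simp add: G_def)
  qed
  have G_mono: "G j" if "G i" "i \<le> j" for i j
    using that(2,1) by (induction rule: dec_induct) (auto intro: G_Suc)
  have lo: "a j + (2 * int h + 1) \<le> a (j + h)" if "\<not> G j" for j
  proof -
    obtain i where i: "a i = a j + int (2 * h + 1)" by (rule core_shift_index[OF a]) auto
    hence "a i < a (j + Suc h)" using that by (simp add: G_def)
    hence "i \<le> j + h" using sm by (simp add: strict_mono_less)
    hence "a i \<le> a (j + h)" by (simp add: le)
    thus ?thesis using i by simp
  qed
  show ?thesis
  proof (cases "\<exists>J. G J \<and> J + h \<le> R")
    case True
    define J where "J = (LEAST J. G J)"
    have GJ: "G J" unfolding J_def using True by (metis LeastI)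
    have JR: "J + h \<le> R" using True unfolding J_def by (meson Least_le le_trans add_le_mono1)
    have nG: "\<not> G j" if "j < J" for j using that not_less_Least unfolding J_def by blast
    have "a j \<le> bend h R (J + h) j" for j
      by (rule le_bend[OF h _ st]) (use lo nG GJ G_mono in \<open>auto simp: G_def\<close>)
    hence "a \<le> cap (bend h R (J + h))" by (simp add: le_cap_iff[OF core_maya[OF a]])
    thus ?thesis using JR by (intro exI[of _ "J + h"]) simp
  next
    case False
    \<comment> \<open>The change of density comes too late or never, so \<open>K = R\<close> is
      taken. Row \<open>R\<close> then touches the diagonal, and later rows are covered by
      \<open>a j \<le> int j\<close>.\<close>
    have "a j \<le> bend h R R j" for j
    proof (cases "j < R")
      case True
      define a' where "a' i = (if i < R then a i else bend h R R i)" for i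
      have "a' j \<le> bend h R R j"
      proof (cases "j < R")
        case True
        thus ?thesis
        proof (induction "R - j" arbitrary: j rule: less_induct)
          case less
          show ?case
          proof (cases "j + h < R")
            case True
            have "a' (j + h) \<le> bend h R R (j + h)" using less True h by simp
            moreover have "\<not> G j" using False True by auto
            ultimately show ?thesis using bend_below_period[OF h True, of R] lo[of j] True by (simp add: a'_def)
          next
            case False thus ?thesis using bend_below_near[of j R h R] less st by (simp add: a'_def)
          qed
        qed
      qed (simp add: a'_def)
      thus ?thesis using True by (simp add: a'_def)
    next
      case False
      have "bend h R R R + int (j - R) \<le> bend h R R j"
        by (rule strict_mono_diff[OF strict_mono_bend[OF h]]) (use False in simp)
      thus ?thesis using False mayaD(2)[OF core_maya[OF a], of j] by (simp add: bend_at)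
    qed
    hence "a \<le> cap (bend h R R)" by (simp add: le_cap_iff[OF core_maya[OF a]])
    thus ?thesis using R by blast
  qed
qed

text \<open>As \<open>raise\<close> changes nothing, each pair of positions reads 00, 01 or 11.
  Turning 01 into 10 is undone by sorting, and the other two are unaffected.\<close>

lemma raise_lower:
  assumes b: "strict_mono b" and P: "sparse P" and eq: "raise P b = b"
  shows "raise P (lower P b) = b"
proof (rule strict_mono_range_eq)
  have sl: "strict_mono (lower P b)" by (rule strict_mono_lower[OF b])
  have "z \<in> range (raise P (lower P b)) \<longleftrightarrow> z \<in> range b" for z
  proof -
    have 1: "P z \<longrightarrow> z - 1 \<in> range b \<longrightarrow> z \<in> range b" "P (z + 1) \<longrightarrow> z \<in> range b \<longrightarrow> z + 1 \<in> range b"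
      using eq raise_neq_iff[OF b, of P] by (metis, metis add_diff_cancel_right')
    have 2: "P z \<longrightarrow> \<not> P (z + 1) \<and> \<not> P (z - 1)" "P (z + 1) \<longrightarrow> \<not> P (z + 2)"
      using P unfolding sparse_def by (metis diff_add_cancel, metis add.assoc one_add_one)
    show ?thesis using 1 2
      by (cases "P z"; cases "P (z + 1)")
        (auto simp: range_raise[OF sl P] range_lower[OF b P] add.commute simp del: image_iff del: rangeE imageE)
  qed
  thus "range (raise P (lower P b)) = range b" by blast
qed (simp_all add: strict_mono_raise strict_mono_lower b)

lemma mult_dvd_small: "int k dvd x \<Longrightarrow> 0 < x \<Longrightarrow> x < 2 * int k \<Longrightarrow> x = int k"
proof -
  assume a: "int k dvd x" "0 < x" "x < 2 * int k"
  then obtain y where y: "x = int k * y" by (auto simp: dvd_def)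
  have "0 < y" using a y by (simp add: zero_less_mult_iff)
  moreover have "y < 2" using a y by (metis mult.commute mult_less_cancel_left_disj of_nat_less_0_iff)
  ultimately have "y = 1" by simp
  thus ?thesis using y by simp
qed

text \<open>Here \<open>m\<close> is the bead of row \<open>K\<close>. The residues of the other
  beads relative to \<open>m\<close> decide which rows can move when residue \<open>m + 1\<close> is
  added or residue \<open>m + 2\<close> is removed.\<close>

lemma bend_res_below:
  assumes h: "h > 0" and j: "j < K" and m: "m = 2 * int K - int R" and k: "k = 2 * h + 1"
  shows "\<not> [bend h R K j = m] (mod int k)"
    and "[bend h R K j = m + 1] (mod int k) \<longleftrightarrow> (K - 1 - j) mod h = h - 1"
proof -
  obtain i where i: "K = Suc (i + j)" using j by (metis add.commute less_iff_Suc_add add_Suc_right)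
  define s q where "s = i mod h" and "q = i div h"
  have b: "bend h R K j = m - (2 + 2 * int s) - int q * int k"
    using bend_below[of h R i j] i m by (simp add: s_def q_def k algebra_simps)
  have s: "s < h" using h by (simp add: s_def)
  show "\<not> [bend h R K j = m] (mod int k)"
  proof
    assume "[bend h R K j = m] (mod int k)"
    hence "int k dvd bend h R K j - m" by (simp add: cong_iff_dvd_diff)
    moreover have "bend h R K j - m = - (2 + 2 * int s) - int q * int k" unfolding b by linarith
    ultimately have "int k dvd - (2 + 2 * int s) - int q * int k" by (simp only:)
    hence "int k dvd (2 + 2 * int s)" by (metis dvd_add_times_triv_right_iff dvd_minus_iff diff_add_cancel dvd_triv_right dvd_diff_right_iff dvd_add)
    hence "2 + 2 * int s = int k" using s by (intro mult_dvd_small) (auto simp: k)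
    thus False by (simp add: k) presburger
  qed
  have "[bend h R K j = m + 1] (mod int k) \<longleftrightarrow> int k dvd - (3 + 2 * int s) - int q * int k"
    by (simp add: cong_iff_dvd_diff b algebra_simps)
  also have "\<dots> \<longleftrightarrow> int k dvd (3 + 2 * int s)"
    by (metis dvd_minus_iff dvd_triv_right dvd_diff_left_iff)
  also have "\<dots> \<longleftrightarrow> s = h - 1"
  proof
    assume "int k dvd (3 + 2 * int s)"
    hence "3 + 2 * int s = int k" using s by (intro mult_dvd_small) (auto simp: k)
    thus "s = h - 1" by (simp add: k)
  next
    assume "s = h - 1" thus "int k dvd (3 + 2 * int s)" using h by (simp add: k)
  qed
  finally show "[bend h R K j = m + 1] (mod int k) \<longleftrightarrow> (K - 1 - j) mod h = h - 1"
    using i by (simp add: s_def)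
qed

lemma bend_res_above:
  assumes h: "h > 0" and m: "m = 2 * int K - int R" and k: "k = 2 * h + 1"
  shows "[bend h R K (K + i) = m] (mod int k) \<longleftrightarrow> i mod Suc h = 0"
    and "[bend h R K (K + i) = m + 1] (mod int k) \<longleftrightarrow> i mod Suc h = 1"
proof -
  define s q where "s = i mod Suc h" and "q = i div Suc h"
  define e where "e = (if s = 0 then 0 else 2 * int s - 1)"
  have b: "bend h R K (K + i) = m + e + int q * int k"
    using bend_above[of h R K i] m
    by (cases "i mod Suc h = 0") (simp_all add: s_def q_def e_def k algebra_simps)
  have s: "s \<le> h" by (simp add: s_def less_Suc_eq_le[symmetric])
  have e: "0 \<le> e" "e < int k" using s by (auto simp: e_def k)
  have dv: "int k dvd x \<longleftrightarrow> x = 0" if "- int k < x" "x < int k" for x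
    using that zdvd_not_zless[of x "int k"] zdvd_not_zless[of "- x" "int k"] by (cases "x = 0"; cases "x > 0") auto
  have "[bend h R K (K + i) = m] (mod int k) \<longleftrightarrow> int k dvd e + int q * int k"
    by (simp add: cong_iff_dvd_diff b)
  also have "\<dots> \<longleftrightarrow> e = 0" using dv[of e] e by simp
  finally show "[bend h R K (K + i) = m] (mod int k) \<longleftrightarrow> i mod Suc h = 0"
    by (auto simp: e_def s_def split: if_splits)
  have "[bend h R K (K + i) = m + 1] (mod int k) \<longleftrightarrow> int k dvd (e - 1) + int q * int k"
    by (simp add: cong_iff_dvd_diff b algebra_simps)
  also have "\<dots> \<longleftrightarrow> e = 1" using dv[of "e - 1"] e k h by simp
  finally show "[bend h R K (K + i) = m + 1] (mod int k) \<longleftrightarrow> i mod Suc h = 1"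
    by (auto simp: e_def s_def split: if_splits)
qed

lemma bend_next:
  assumes h: "h > 0" and m: "m = 2 * int K - int R" and k: "k = 2 * h + 1" and j: "K \<le> j"
  shows "[bend h R K j = m] (mod int k) \<Longrightarrow> bend h R K (Suc j) = bend h R K j + 1"
    and "[bend h R K j = m + 1] (mod int k) \<Longrightarrow> bend h R K (Suc j) = bend h R K j + 2"
    and "[bend h R K (Suc j) = m + 1] (mod int k) \<Longrightarrow> bend h R K (Suc j) = bend h R K j + 1"
proof -
  obtain i where i: "j = K + i" using j by (metis le_add_diff_inverse)
  note r = bend_res_above[OF h m k]
  have a: "bend h R K j = 2 * int K - int R + int (i div Suc h) * (2 * int h + 1)
          + (if i mod Suc h = 0 then 0 else 2 * int (i mod Suc h) - 1)"
    using bend_above[of h R K i] i by simp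
  have b: "bend h R K (Suc j) = 2 * int K - int R + int (Suc i div Suc h) * (2 * int h + 1)
          + (if Suc i mod Suc h = 0 then 0 else 2 * int (Suc i mod Suc h) - 1)"
    using bend_above[of h R K "Suc i"] i by simp
  show "bend h R K (Suc j) = bend h R K j + 1" if "[bend h R K j = m] (mod int k)"
  proof -
    have "i mod Suc h = 0" using that r(1)[of i] i by simp
    thus ?thesis unfolding a b using h by (simp add: mod_Suc div_Suc)
  qed
  show "bend h R K (Suc j) = bend h R K j + 2" if "[bend h R K j = m + 1] (mod int k)"
  proof -
    have "i mod Suc h = 1" using that r(2)[of i] i by simp
    thus ?thesis unfolding a b using h by (simp add: mod_Suc div_Suc algebra_simps)
  qed
  show "bend h R K (Suc j) = bend h R K j + 1" if "[bend h R K (Suc j) = m + 1] (mod int k)"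
  proof -
    have "Suc i mod Suc h = 1" using that r(2)[of "Suc i"] i by simp
    hence "i mod Suc h = 0" "Suc i div Suc h = i div Suc h"
      using h by (auto simp: mod_Suc div_Suc split: if_splits)
    thus ?thesis unfolding a b using \<open>Suc i mod Suc h = 1\<close> by simp
  qed
qed

text \<open>Only beads of residue \<open>m + 1\<close> change. Before \<open>K\<close> they move
  left, which adds boxes of residue \<open>m + 1\<close>; after \<open>K\<close> they move right,
  which removes boxes of residue \<open>m + 2\<close> wherever the capped row is not empty.\<close>

lemma bend_Suc:
  assumes h: "h > 0" and m: "m = 2 * int K - int R" and k: "k = 2 * h + 1"
  shows "bend h R (Suc K) j = bend h R K j +
    (if [bend h R K j = m + 1] (mod int k) then if j < K then -1 else 1 else 0)"
proof -
  consider i where "K = Suc (i + j)" | "j = K" | i where "j = Suc K + i"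
    by (metis add.commute add_Suc_right less_iff_Suc_add linorder_neqE_nat)
  thus ?thesis
  proof cases
    case 1
    have a: "bend h R K j = 2 * int K - int R - 2 - 2 * int (i mod h) - int (i div h) * (2 * int h + 1)"
      using bend_below[of h R i j] 1 by simp
    have b: "bend h R (Suc K) j = 2 * int (Suc K) - int R - 2 - 2 * int (Suc i mod h) - int (Suc i div h) * (2 * int h + 1)"
      using bend_below[of h R "Suc i" j] 1 by simp
    have j: "j < K" using 1 by simp
    have c: "[bend h R K j = m + 1] (mod int k) \<longleftrightarrow> i mod h = h - 1"
      using bend_res_below(2)[OF h j m k] 1 by simp
    show ?thesis unfolding c unfolding a b using j h
      by (auto simp: mod_Suc div_Suc algebra_simps)
  next
    case 2
    have "\<not> [bend h R K K = m + 1] (mod int k)" using bend_res_above(2)[OF h m k, of 0] by simp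
    moreover have "bend h R (Suc K) K = 2 * int (Suc K) - int R - 2" using bend_below[of h R 0 K] by simp
    ultimately show ?thesis using 2 bend_at[of h R K] by simp
  next
    case 3
    have a: "bend h R K j = 2 * int K - int R + int (Suc i div Suc h) * (2 * int h + 1)
          + (if Suc i mod Suc h = 0 then 0 else 2 * int (Suc i mod Suc h) - 1)"
      using bend_above[of h R K "Suc i"] 3 by simp
    have b: "bend h R (Suc K) j = 2 * int (Suc K) - int R + int (i div Suc h) * (2 * int h + 1)
          + (if i mod Suc h = 0 then 0 else 2 * int (i mod Suc h) - 1)"
      using bend_above[of h R "Suc K" i] 3 by simp
    have c: "[bend h R K j = m + 1] (mod int k) \<longleftrightarrow> Suc i mod Suc h = 1"
      using bend_res_above(2)[OF h m k, of "Suc i"] 3 by simp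
    show ?thesis unfolding c unfolding a b using 3 h
      by (auto simp: mod_Suc div_Suc algebra_simps split: if_splits)
  qed
qed

text \<open>
  Consecutive minimal cores are obtained from a common core by removing boxes of two
  adjacent residues.
\<close>

lemma bend_link:
  assumes h: "h > 0" and hK: "h \<le> K" and KR: "K < R"
  obtains U c d where "core (2 * h + 1) U"
    "rs (2 * h + 1) c U = cap (bend h R K)" "cap (bend h R K) \<noteq> U"
    "rs (2 * h + 1) d U = cap (bend h R (Suc K))" "cap (bend h R (Suc K)) \<noteq> U"
proof -
  define k where "k = 2 * h + 1"
  define m where "m = 2 * int K - int R"
  define B where "B = bend h R K"
  define V where "V = cap B"
  define V' where "V' = cap (bend h R (Suc K))"
  \<comment> \<open>\<open>U\<close> contains \<open>V\<close> and all boxes of residue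
    \<open>m + 1\<close> that can be added to it; these lie in the rows before \<open>K\<close> that
    \<open>bend_Suc\<close> enlarges. Removing the residue \<open>m + 1\<close> gives back
    \<open>V\<close>, and removing \<open>m + 2\<close> instead shortens the rows after
    \<open>K\<close>.\<close>
  define U where "U = lower (res k (Some (m + 1))) V"
  have k1: "k \<noteq> 1" using h by (simp add: k_def)
  note rb = bend_res_below[OF h _ m_def k_def, folded B_def]
  note nx = bend_next[OF h m_def k_def, folded B_def]
  have B': "bend h R (Suc K) j = B j + (if [B j = m + 1] (mod int k) then if j < K then -1 else 1 else 0)" for j
    unfolding B_def by (rule bend_Suc[OF h m_def k_def])
  have lt: "B j < int j" if "j < K" for j using bend_le[OF h, of R K j] that KR by (simp add: B_def)
  have mono: "B j < B (Suc j)" "K \<le> j \<Longrightarrow> B (Suc j) \<le> B j + 2" for j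
    using bend_step[OF h] by (auto simp: B_def)
  have BK: "B K = m" by (simp add: B_def bend_at m_def)
  have mK: "m < int K" using KR by (simp add: m_def)
  have Vlow: "V j = B j" if "j < K" for j using lt[OF that] by (simp add: V_def cap_def)
  have Vcore: "core k V" unfolding V_def B_def k_def by (rule core_bend[OF h])
  have ncong: "\<not> [x = m + 1] (mod int k)" if "[x = m] (mod int k)" for x
    using sparse_res[OF k1, of "Some m"] that
    by (auto simp: sparse_def cong_iff_dvd_diff) (metis add_diff_cancel_right' diff_add_eq_diff_diff_swap dvd_diff_commute dvd_diff that cong_iff_dvd_diff k1 add.commute diff_add_cancel dvd_minus_iff int_dvd_int_iff minus_diff_eq nat_dvd_1_iff_1 of_nat_1)
  have cong1: "[x - 1 = m] (mod int k) \<longleftrightarrow> [x = m + 1] (mod int k)" for x by (simp add: cong_shift)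
  have Vprev: "V (j - 1) = V j - 1 \<and> j \<noteq> 0" if j: "K \<le> j" and c: "[V j = m + 1] (mod int k)" for j
  proof -
    have jK: "j \<noteq> K"
    proof
      assume "j = K"
      hence "V j = m" using BK mK by (simp add: V_def cap_def)
      thus False using c ncong[of m] by simp
    qed
    then obtain i where i: "j = Suc i" "K \<le> i" using j by (cases j) auto
    show ?thesis
    proof (cases "B j \<le> int j")
      case True
      hence "B j = B i + 1" using nx(3)[OF i(2)] c i by (simp add: V_def cap_def)
      thus ?thesis using True i by (simp add: V_def cap_def)
    next
      case False
      thus ?thesis using mono(2)[OF i(2)] i by (simp add: V_def cap_def)
    qed
  qed
  have Uj: "U j = (if j < K \<and> [B j = m + 1] (mod int k) then B j - 1 else V j)" for j
  proof (cases "j < K")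
    case True
    have "j = 0 \<or> V (j - 1) \<noteq> V j - 1" if "[B j = m + 1] (mod int k)"
    proof (cases j)
      case (Suc i)
      have "\<not> [V i = m] (mod int k)" using rb(1)[of i] Vlow[of i] Suc True by simp
      thus ?thesis using that cong1[of "B j"] Vlow[OF True] Suc by auto
    qed simp
    thus ?thesis using True Vlow[OF True] by (auto simp: U_def lower_def)
  next
    case False
    thus ?thesis using Vprev[of j] by (auto simp: U_def lower_def)
  qed
  have "raise (res k (Some (m + 1))) V = V"
  proof
    fix j
    have "V (Suc j) = V j + 1" if c: "[V j + 1 = m + 1] (mod int k)"
    proof -
      have c': "[V j = m] (mod int k)" using c by (simp add: cong_add_rcancel)
      hence j: "K \<le> j" using rb(1)[of j] Vlow[of j] by (metis not_le)
      show ?thesis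
      proof (cases "B j \<le> int j")
        case True
        thus ?thesis using nx(1)[OF j] c' by (simp add: V_def cap_def)
      next
        case False thus ?thesis using mono(1)[of j] by (simp add: V_def cap_def)
      qed
    qed
    thus "raise (res k (Some (m + 1))) V j = V j" by (auto simp: raise_def)
  qed
  hence 1: "rs k (m + 1) U = V"
    unfolding U_def by (intro raise_lower core_mono[OF Vcore] sparse_res[OF k1])
  have Uc: "core k U" unfolding U_def by (rule core_lower[OF k1 Vcore])
  have 2: "rs k (m + 2) U = V'"
  proof
    fix j
    have cd: "[x + 1 = m + 2] (mod int k) \<longleftrightarrow> [x = m + 1] (mod int k)" for x
      using cong_shift[of "x + 1" "m + 1" k] by (simp add: add.commute)
    show "rs k (m + 2) U j = V' j"
    proof (cases "j < K")
      case True
      have "\<not> [U j = m + 1] (mod int k)"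
        using Uj[of j] True Vlow[OF True] ncong[of "B j - 1"] cong1[of "B j"] by auto
      hence "rs k (m + 2) U j = U j" by (simp add: raise_def cd)
      thus ?thesis using Uj[of j] B'[of j] True lt[OF True] Vlow[OF True] by (auto simp: V'_def cap_def)
    next
      case False
      hence j: "K \<le> j" by simp
      have Us: "U j = V j" "U (Suc j) = V (Suc j)" using Uj[of j] Uj[of "Suc j"] j by auto
      have B'j: "bend h R (Suc K) j = B j + (if [B j = m + 1] (mod int k) then 1 else 0)"
        using B'[of j] j by simp
      show ?thesis
      proof (cases "B j \<le> int j")
        case True
        hence Vj: "V j = B j" by (simp add: V_def cap_def)
        show ?thesis
        proof (cases "[B j = m + 1] (mod int k)")
          case c: True
          have "V (Suc j) = min (int j + 1) (B j + 2)"
            using nx(2)[OF j c] by (simp add: V_def cap_def add.commute)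
          hence "rs k (m + 2) U j = (if B j < int j then B j + 1 else B j)"
            using Us Vj c True by (auto simp: raise_def cd)
          thus ?thesis using B'j c True by (auto simp: V'_def cap_def)
        next
          case c: False
          hence "rs k (m + 2) U j = B j" using Us Vj by (simp add: raise_def cd)
          thus ?thesis using B'j c True by (simp add: V'_def cap_def)
        qed
      next
        case gt: False
        hence "V j = int j" "V (Suc j) = int j + 1" using mono(1)[of j] by (simp_all add: V_def cap_def)
        hence "rs k (m + 2) U j = int j" using Us by (simp add: raise_def)
        thus ?thesis using B'j gt by (simp add: V'_def cap_def)
      qed
    qed
  qed
  \<comment> \<open>Row \<open>K - h\<close>, which exists because of \<open>h \<le> K\<close>, is
    the last row before \<open>K\<close> with a bead of residue \<open>m + 1\<close>.\<close>
  have "U (K - h) \<noteq> V (K - h)"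
  proof -
    have j: "K - h < K" using h hK by simp
    have "[B (K - h) = m + 1] (mod int k)" using rb(2)[OF j] h hK by simp
    thus ?thesis using Uj[of "K - h"] j Vlow[OF j] by simp
  qed
  hence 3: "V \<noteq> U" by auto
  \<comment> \<open>Row \<open>K + 1\<close> of \<open>V\<close> is not empty because
    \<open>K < R\<close>, so it does lose a box.\<close>
  have "V' (Suc K) \<noteq> U (Suc K)"
  proof -
    have "B (Suc K) = 2 * int (Suc K) - int R - 1" unfolding B_def by (rule bend_above_near) (use h in auto)
    thus ?thesis using Uj[of "Suc K"] KR bend_at[of h R "Suc K"] by (simp add: V_def V'_def cap_def)
  qed
  hence 4: "V' \<noteq> U" by auto
  show ?thesis using that[of U "m + 1" "m + 2"] Uc 1 2 3 4 by (simp add: k_def V_def V'_def B_def)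
qed

section \<open>Good words and minimal cores\<close>

definition covers :: "nat \<Rightarrow> nat \<Rightarrow> (nat \<Rightarrow> int) set" where
  "covers k R = (if odd k \<and> k \<le> 2 * R then {cap (bend (k div 2) R K) | K. k div 2 \<le> K \<and> K \<le> R} else {})"

definition good :: "nat \<Rightarrow> int \<Rightarrow> nat \<Rightarrow> (nat \<Rightarrow> int option) \<Rightarrow> bool" where
  "good k r N w \<longleftrightarrow> dom w \<subseteq> {1..N} \<and> normal k w \<and> (\<forall>j. run (\<lambda>i. res k (w i)) N int j \<le> 2 * int j - r)"

definition min_good :: "nat \<Rightarrow> int \<Rightarrow> nat \<Rightarrow> (nat \<Rightarrow> int option) \<Rightarrow> bool" where
  "min_good k r N w \<longleftrightarrow> good k r N w \<and> (\<forall>v. v \<subseteq>\<^sub>m w \<longrightarrow> good k r N v \<longrightarrow> v = w)"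

lemma good_finite: "good k r N w \<Longrightarrow> finite (dom w)"
  unfolding good_def by (meson finite_atLeastAtMost finite_subset)

lemma min_good_exists:
  assumes "good k r N w" shows "\<exists>v. v \<subseteq>\<^sub>m w \<and> min_good k r N v"
  using assms
proof (induction "card (dom w)" arbitrary: w rule: less_induct)
  case less
  show ?case
  proof (cases "min_good k r N w")
    case False
    then obtain v where v: "v \<subseteq>\<^sub>m w" "good k r N v" "v \<noteq> w" using less.prems by (auto simp: min_good_def)
    have "dom v \<noteq> dom w" using v(1,3) by (auto simp: map_le_def fun_eq_iff) (metis domIff)
    hence "dom v \<subset> dom w" using map_le_implies_dom_le[OF v(1)] by blast
    hence "card (dom v) < card (dom w)" using good_finite[OF less.prems] by (rule psubset_card_mono[rotated])
    thus ?thesis using less.hyps v(1,2) by (meson map_le_trans)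
  qed (use map_le_refl in blast)
qed

text \<open>The emptiness of \<open>covers\<close> marks the cases in which the staircase is itself
  a core.\<close>

definition min_cores :: "nat \<Rightarrow> int \<Rightarrow> (nat \<Rightarrow> int) set" where
  "min_cores k r = (if covers k (nat r) = {} then {stair r} else covers k (nat r))"

lemma odd_ge3: "odd (k::nat) \<Longrightarrow> k \<noteq> 1 \<Longrightarrow> k div 2 > 0 \<and> k = 2 * (k div 2) + 1"
  by (auto elim!: oddE)

lemma min_cores_core:
  assumes k: "k \<noteq> 1" and r: "r \<ge> -1" and u: "u \<in> min_cores k r" shows "core k u"
proof (cases "odd k \<and> k \<le> 2 * nat r")
  case True
  then obtain K where "u = cap (bend (k div 2) (nat r) K)"
    using u by (auto simp: min_cores_def covers_def split: if_splits)
  thus ?thesis using core_bend[of "k div 2" "nat r" K] odd_ge3[of k] True k by auto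
next
  case False
  hence "u = stair r" using u by (auto simp: min_cores_def covers_def)
  thus ?thesis using False r core_stair_even[of k r] core_stair_large[of r k] by auto
qed

lemma le_stair_iff_min_cores:
  assumes k: "k \<noteq> 1" and r: "r \<ge> -1" and a: "core k a"
  shows "(\<forall>j. a j \<le> 2 * int j - r) \<longleftrightarrow> (\<exists>u\<in>min_cores k r. a \<le> u)"
proof (cases "odd k \<and> k \<le> 2 * nat r")
  case True
  have "cap (bend (k div 2) (nat r) (nat r)) \<in> covers k (nat r)" using True by (auto simp: covers_def)
  hence m: "min_cores k r = {cap (bend (k div 2) (nat r) K) | K. k div 2 \<le> K \<and> K \<le> nat r}"
    using True by (auto simp: min_cores_def covers_def)
  have h: "k div 2 > 0" "k = 2 * (k div 2) + 1" using odd_ge3[of k] True k by auto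
  have rr: "int (nat r) = r" using True by (cases "r \<ge> 0") auto
  show ?thesis
  proof
    assume st: "\<forall>j. a j \<le> 2 * int j - r"
    obtain K where "k div 2 \<le> K \<and> K \<le> nat r \<and> a \<le> cap (bend (k div 2) (nat r) K)"
      using core_le_bend[of "k div 2" a "nat r"] a h st rr True by auto
    thus "\<exists>u\<in>min_cores k r. a \<le> u" unfolding m by blast
  next
    assume "\<exists>u\<in>min_cores k r. a \<le> u"
    then obtain K where K: "a \<le> cap (bend (k div 2) (nat r) K)" unfolding m by blast
    show "\<forall>j. a j \<le> 2 * int j - r"
    proof
      fix j
      have "a j \<le> bend (k div 2) (nat r) K j" using K le_cap_iff[OF core_maya[OF a]] by blast
      thus "a j \<le> 2 * int j - r" using bend_le[OF h(1), of "nat r" K j] rr by simp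
    qed
  qed
next
  case False
  hence "min_cores k r = {stair r}" by (auto simp: min_cores_def covers_def)
  thus ?thesis using le_stair_iff[OF core_maya[OF a]] by simp
qed

text \<open>Runs of residue letters are cores, so containing the staircase means containing a
  minimal core, and the adjunction turns this into clearing it.\<close>

lemma good_iff_min_cores:
  assumes k: "k \<noteq> 1" and r: "r \<ge> -1"
  shows "good k r N w \<longleftrightarrow> dom w \<subseteq> {1..N} \<and> normal k w \<and> (\<exists>u\<in>min_cores k r. clr k w N u = int)"
  unfolding good_def le_stair_iff_min_cores[OF k r core_run[OF k]]
  using run_le_iff_unrun[OF core_maya[OF min_cores_core[OF k r]]] by blast

definition linked :: "nat \<Rightarrow> int \<Rightarrow> nat \<Rightarrow> ((nat \<Rightarrow> int option) \<times> (nat \<Rightarrow> int option)) set" where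
  "linked k r N = {(w, v). min_good k r N w \<and> min_good k r N v \<and>
     (\<exists>W. w \<subseteq>\<^sub>m W \<and> v \<subseteq>\<^sub>m W \<and> finite (dom W) \<and> card (dom W) \<le> Suc (card (dom w)))}"

text \<open>Induction along the chain of minimal cores for an abstract equivalence, as it serves
  twice: for equality of lengths and for connectivity of words.\<close>

lemma min_cores_chain:
  assumes k: "k \<noteq> 1" and r: "r \<ge> -1"
    and refl: "\<And>u. u \<in> min_cores k r \<Longrightarrow> Q u u"
    and trans: "\<And>u v w. Q u v \<Longrightarrow> Q v w \<Longrightarrow> Q u w" and sym: "\<And>u v. Q u v \<Longrightarrow> Q v u"
    and link: "\<And>u v U c d. u \<in> min_cores k r \<Longrightarrow> v \<in> min_cores k r \<Longrightarrow> core k U \<Longrightarrow>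
        rs k c U = u \<Longrightarrow> u \<noteq> U \<Longrightarrow> rs k d U = v \<Longrightarrow> v \<noteq> U \<Longrightarrow> Q u v"
    and u: "u \<in> min_cores k r" and v: "v \<in> min_cores k r"
  shows "Q u v"
proof (cases "odd k \<and> k \<le> 2 * nat r")
  case True
  let ?h = "k div 2" and ?R = "nat r"
  have h: "?h > 0" "2 * ?h + 1 = k" using odd_ge3[of k] True k by auto
  have "cap (bend ?h ?R ?R) \<in> covers k ?R" using True by (auto simp: covers_def)
  hence m: "min_cores k r = {cap (bend ?h ?R K) | K. ?h \<le> K \<and> K \<le> ?R}"
    using True by (auto simp: min_cores_def covers_def)
  have mem: "cap (bend ?h ?R K) \<in> min_cores k r" if "?h \<le> K" "K \<le> ?R" for K using m that by blast
  have main: "Q (cap (bend ?h ?R K)) (cap (bend ?h ?R L))" if "?h \<le> K" "K \<le> L" "L \<le> ?R" for K L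
    using that(2,3)
  proof (induction rule: dec_induct)
    case base thus ?case using refl mem that by simp
  next
    case (step n)
    have hn: "?h \<le> n" "n < ?R" using step that by auto
    have "Q (cap (bend ?h ?R K)) (cap (bend ?h ?R n))" using step.IH hn by simp
    moreover have "Q (cap (bend ?h ?R n)) (cap (bend ?h ?R (Suc n)))"
    proof (rule bend_link[OF h(1) hn, unfolded h(2)])
      fix U c d
      assume "core k U" "rs k c U = cap (bend ?h ?R n)" "cap (bend ?h ?R n) \<noteq> U"
        "rs k d U = cap (bend ?h ?R (Suc n))" "cap (bend ?h ?R (Suc n)) \<noteq> U"
      thus ?thesis by (intro link[of _ _ U c d] mem) (use hn in auto)
    qed
    ultimately show ?case by (rule trans)
  qed
  obtain K L where "u = cap (bend ?h ?R K)" "?h \<le> K" "K \<le> ?R" "v = cap (bend ?h ?R L)" "?h \<le> L" "L \<le> ?R"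
    using u v unfolding m by blast
  thus ?thesis using main[of K L] main[of L K] sym by (metis nat_le_linear)
next
  case False
  hence "min_cores k r = {stair r}" by (auto simp: min_cores_def covers_def)
  thus ?thesis using u v refl by simp
qed

text \<open>Neighbouring minimal cores both arise from one core \<open>U\<close> by a single
  effective removal, and the length of \<open>U\<close> is unique.\<close>

lemma red_min_cores:
  assumes k: "k \<noteq> 1" and r: "r \<ge> -1" and u: "u \<in> min_cores k r" and v: "v \<in> min_cores k r"
    and red: "red k n u"
  shows "red k n v"
proof -
  have 1: "red k n v"
    if asm: "u \<in> min_cores k r" "v \<in> min_cores k r" "core k U" "rs k c U = u" "u \<noteq> U" "rs k d U = v" "v \<noteq> U" "red k n u"
    for u v U c d n
  proof -
    have U: "red k (Suc n) U" using red_stepI[of k c U n] asm by simp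
    have "U \<le> v" using raise_ge[of U "res k (Some d)"] asm by simp
    then obtain p where p: "red k p v"
      using red_mono[OF U core_maya[OF asm(3)]] core_maya[OF min_cores_core[OF k r asm(2)]] by blast
    hence "red k (Suc p) U" using red_stepI[of k d U p] asm by simp
    thus ?thesis using red_unique[OF k U asm(3)] p by auto
  qed
  have "\<forall>n. red k n u \<longleftrightarrow> red k n v"
    by (rule min_cores_chain[OF k r _ _ _ _ u v]) (use 1 in \<open>blast+\<close>)
  thus ?thesis using red by blast
qed

text \<open>A minimal good word clears some minimal core and contains a reduced word of it, so it is
  that reduced word. Conversely, a good subword of a reduced word contains a reduced word of a
  possibly different minimal core; all of these have the same length, so no letter was lost.\<close>

lemma min_good_iff_redword:
  assumes k: "k \<noteq> 1" and r: "r \<ge> -1"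
  shows "min_good k r N w \<longleftrightarrow> (\<exists>u\<in>min_cores k r. redword k N u w)"
proof
  assume w: "min_good k r N w"
  then obtain u where u: "u \<in> min_cores k r" "clr k w N u = int" and w1: "dom w \<subseteq> {1..N}" "normal k w"
    unfolding min_good_def good_iff_min_cores[OF k r] by blast
  obtain v where v: "v \<subseteq>\<^sub>m w" "redword k N u v"
    using subword_exists[OF min_cores_core[OF k r u(1)] k w1(2,1) u(2)] by blast
  have "good k r N v" unfolding good_iff_min_cores[OF k r] using redwordD[OF v(2)] u(1) by blast
  hence "v = w" using w v(1) by (auto simp: min_good_def)
  thus "\<exists>u\<in>min_cores k r. redword k N u w" using v u by blast
next
  assume "\<exists>u\<in>min_cores k r. redword k N u w"
  then obtain u where u: "u \<in> min_cores k r" "redword k N u w" by blast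
  have "good k r N w" unfolding good_iff_min_cores[OF k r] using redwordD[OF u(2)] u(1) by blast
  moreover have "v = w" if v: "v \<subseteq>\<^sub>m w" "good k r N v" for v
  proof -
    obtain u' where u': "u' \<in> min_cores k r" "clr k v N u' = int" "dom v \<subseteq> {1..N}" "normal k v"
      using v(2) unfolding good_iff_min_cores[OF k r] by blast
    obtain v' where v': "v' \<subseteq>\<^sub>m v" "redword k N u' v'"
      using subword_exists[OF min_cores_core[OF k r u'(1)] k u'(4,3,2)] by blast
    have "red k (card (dom w)) u'"
      by (rule red_min_cores[OF k r u(1) u'(1)]) (rule redwordD(4)[OF u(2)])
    hence "card (dom v') = card (dom w)"
      using red_unique[OF k _ min_cores_core[OF k r u'(1)] redwordD(4)[OF v'(2)]] by blast
    moreover have "dom v' \<subseteq> dom w" using map_le_implies_dom_le map_le_trans[OF v'(1) v(1)] by blast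
    ultimately have "dom v' = dom w" using finite_dom_redword[OF u(2)] by (metis card_subset_eq)
    hence "dom v = dom w" using map_le_implies_dom_le[OF v'(1)] map_le_implies_dom_le[OF v(1)] by blast
    thus "v = w" using v(1) by (metis map_le_antisym map_le_def)
  qed
  ultimately show "min_good k r N w" by (auto simp: min_good_def)
qed

lemma min_good_card:
  assumes k: "k \<noteq> 1" and r: "r \<ge> -1" and w: "min_good k r N w" and v: "min_good k r N v"
  shows "card (dom w) = card (dom v)"
proof -
  obtain u u' where u: "u \<in> min_cores k r" "redword k N u w" "u' \<in> min_cores k r" "redword k N u' v"
    using w v unfolding min_good_iff_redword[OF k r] by blast
  have "red k (card (dom w)) u'" by (rule red_min_cores[OF k r u(1,3)]) (rule redwordD(4)[OF u(2)])
  thus ?thesis using red_unique[OF k _ min_cores_core[OF k r u(3)] redwordD(4)[OF u(4)]] by simp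
qed

lemma min_good_connected:
  assumes k: "k \<noteq> 1" and r: "r \<ge> -1" and w: "min_good k r N w" and v: "min_good k r N v"
    and N: "card (dom w) < N"
  shows "(w, v) \<in> (linked k r N)\<^sup>*"
proof -
  let ?L = "(linked k r N)\<^sup>*"
  define n where "n = card (dom w)"
  have card: "card (dom x) = n" if "min_good k r N x" for x
    using min_good_card[OF k r that w] by (simp add: n_def)
  have rw: "min_good k r N x" if "redword k N u x" "u \<in> min_cores k r" for x u
    using that min_good_iff_redword[OF k r] by blast
  have sym: "sym ?L"
  proof (rule sym_rtrancl, rule symI)
    fix x y assume a: "(x, y) \<in> linked k r N"
    hence "card (dom x) = card (dom y)" using card by (auto simp: linked_def)
    thus "(y, x) \<in> linked k r N" using a unfolding linked_def by fastforce
  qed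
  have same: "(x, y) \<in> ?L" if u: "u \<in> min_cores k r" and x: "redword k N u x" and y: "redword k N u y" for u x y
  proof -
    have sub: "wlink k N u \<subseteq> linked k r N"
      unfolding wlink_def linked_def using rw u by blast
    have "(x, y) \<in> (wlink k N u)\<^sup>*"
      using redwords_connected[OF k min_cores_core[OF k r u] x y] N card[OF rw[OF x u]] by (simp add: n_def)
    thus ?thesis using rtrancl_mono[OF sub] by blast
  qed
  obtain uw uv where uw: "uw \<in> min_cores k r" "redword k N uw w" and uv: "uv \<in> min_cores k r" "redword k N uv v"
    using w v unfolding min_good_iff_redword[OF k r] by blast
  define Q where "Q u u' \<longleftrightarrow> u \<in> min_cores k r \<and> u' \<in> min_cores k r \<and>
      (\<forall>x y. redword k N u x \<longrightarrow> redword k N u' y \<longrightarrow> (x, y) \<in> ?L)" for u u'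
  have ex: "\<exists>x. redword k N u x" if "u \<in> min_cores k r" for u
  proof -
    have "red k n u" unfolding n_def
      by (rule red_min_cores[OF k r uw(1) that]) (rule redwordD(4)[OF uw(2)])
    thus ?thesis using redword_exists[of k n u N] N by (auto simp: n_def)
  qed
  have "Q uw uv"
  proof (rule min_cores_chain[OF k r _ _ _ _ uw(1) uv(1)])
    show "Q u u" if "u \<in> min_cores k r" for u using that same by (auto simp: Q_def)
    show "Q u u''" if "Q u u'" "Q u' u''" for u u' u''
    proof -
      have "u' \<in> min_cores k r" using that by (simp add: Q_def)
      then obtain z where "redword k N u' z" using ex by blast
      thus ?thesis using that unfolding Q_def by (meson rtrancl_trans)
    qed
    show "Q u' u" if "Q u u'" for u u' using that symD[OF sym] by (auto simp: Q_def)
    show "Q u u'" if u: "u \<in> min_cores k r" "u' \<in> min_cores k r" and U: "core k U"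
      "rs k c U = u" "u \<noteq> U" "rs k d U = u'" "u' \<noteq> U" for u u' U c d
    proof -
      obtain N' where N': "N = Suc N'" using N by (cases N) auto
      have "red k n u" unfolding n_def
        by (rule red_min_cores[OF k r uw(1) u(1)]) (rule redwordD(4)[OF uw(2)])
      then obtain x where x: "redword k N' u x" "card (dom x) = n"
        using redword_exists[of k n u N'] N N' by (auto simp: n_def)
      define c' where "c' = c mod int k"
      have c': "rs k c' = rs k c" "c' mod int k = c'" by (auto simp: c'_def cong_def intro: rs_cong)
      \<comment> \<open>A reduced word of \<open>U\<close> whose final letter leads to
        \<open>u\<close>. Since \<open>U \<le> u'\<close>, it also clears \<open>u'\<close>, so it
        contains a reduced word \<open>y\<close> of \<open>u'\<close> besides \<open>x\<close>, and
        it has only one letter more than \<open>x\<close>.\<close>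
      let ?W = "x(Suc N' \<mapsto> c')"
      have W: "redword k N U ?W" unfolding N' by (rule redword_add) (use x U c' in auto)
      have "unrun (\<lambda>i. res k (?W i)) N U \<le> unrun (\<lambda>i. res k (?W i)) N u'"
      proof -
        have le: "U \<le> u'" using raise_ge[of U "res k (Some d)"] U by simp
        have "int \<le> unrun (\<lambda>i. res k (?W i)) N U" using redwordD(3)[OF W] by simp
        hence "run (\<lambda>i. res k (?W i)) N int \<le> U" using run_le_iff[OF maya_int core_maya[OF U(1)]] by blast
        hence "run (\<lambda>i. res k (?W i)) N int \<le> u'" using le by (rule order.trans)
        hence "unrun (\<lambda>i. res k (?W i)) N u' = int"
          using run_le_iff_unrun[OF core_maya[OF min_cores_core[OF k r u(2)]]] by blast
        thus ?thesis using redwordD(3)[OF W] by simp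
      qed
      hence "clr k ?W N u' = int"
        using redwordD(3)[OF W] maya_le_int[OF maya_unrun[OF core_maya[OF min_cores_core[OF k r u(2)]]]]
        by (metis order.antisym)
      then obtain y where y: "y \<subseteq>\<^sub>m ?W" "redword k N u' y"
        using subword_exists[OF min_cores_core[OF k r u(2)] k redwordD(2,1)[OF W]] by blast
      have xN: "redword k N u x" unfolding N' by (rule redword_skip[OF x(1)])
      have xW: "x \<subseteq>\<^sub>m ?W" using redword_None[OF x(1) lessI] by (auto simp: map_le_def)
      have "card (dom ?W) \<le> Suc (card (dom x))"
        using finite_dom_redword[OF x(1)] by (simp add: card_insert_if)
      hence "(x, y) \<in> linked k r N"
        unfolding linked_def using xN y xW rw u finite_dom_redword[OF W] by blast
      hence xy: "(x, y) \<in> ?L" by blast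
      have "(a, b) \<in> ?L" if "redword k N u a" "redword k N u' b" for a b
        using same[OF u(1) that(1) xN] xy same[OF u(2) y(2) that(2)] by (meson rtrancl_trans)
      thus ?thesis using u by (auto simp: Q_def)
    qed
  qed
  thus ?thesis using uw uv by (auto simp: Q_def)
qed

subsection \<open>Words of tableaux\<close>

text \<open>Before the box \<open>(x, y)\<close> is added, the bead of its row is at
  \<open>(y - 1) - (x - 1) = y - x\<close>; this is the residue of the letter. The choice among
  boxes with the same entry is immaterial by the congruence condition on tableaux.\<close>

definition tab_word :: "nat \<Rightarrow> int \<Rightarrow> (nat \<times> nat \<Rightarrow> nat) \<Rightarrow> nat \<Rightarrow> int option" where
  "tab_word k r t i =
     (if i \<in> t ` staircase r
      then let b = SOME b. b \<in> staircase r \<and> t b = i in Some ((int (snd b) - int (fst b)) mod int k)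
      else None)"

lemma in_staircase: "(x, y) \<in> staircase r \<longleftrightarrow> 1 \<le> x \<and> 1 \<le> y \<and> int x + int y \<le> r + 1"
  by (auto simp: staircase_def)

lemma prym_tableauxD:
  assumes "t \<in> prym_tableaux g r k"
  shows "b \<in> staircase r \<Longrightarrow> t b \<in> {1..<g}"
    and "(x, y) \<in> staircase r \<Longrightarrow> (x', y) \<in> staircase r \<Longrightarrow> x < x' \<Longrightarrow> t (x, y) < t (x', y)"
    and "(x, y) \<in> staircase r \<Longrightarrow> (x, y') \<in> staircase r \<Longrightarrow> y < y' \<Longrightarrow> t (x, y) < t (x, y')"
    and "(x, y) \<in> staircase r \<Longrightarrow> (x', y') \<in> staircase r \<Longrightarrow> t (x, y) = t (x', y') \<Longrightarrow>
           [int x - int y = int x' - int y'] (mod int k)"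
proof -
  show "b \<in> staircase r \<Longrightarrow> t b \<in> {1..<g}" using assms unfolding prym_tableaux_def by blast
qed (use assms in \<open>unfold prym_tableaux_def, blast+\<close>)

lemma tab_word_box:
  assumes t: "t \<in> prym_tableaux g r k" and b: "(x, y) \<in> staircase r"
  shows "tab_word k r t (t (x, y)) = Some ((int y - int x) mod int k)"
proof -
  define b where "b = (SOME b. b \<in> staircase r \<and> t b = t (x, y))"
  have "b \<in> staircase r \<and> t b = t (x, y)" unfolding b_def by (rule someI[of _ "(x, y)"]) (use b in simp)
  hence "[int (fst b) - int (snd b) = int x - int y] (mod int k)"
    using prym_tableauxD(4)[OF t, of "fst b" "snd b" x y] b by simp
  hence "(int (snd b) - int (fst b)) mod int k = (int y - int x) mod int k"
    by (metis cong_def cong_minus_minus_iff minus_diff_eq)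
  thus ?thesis using b by (auto simp: tab_word_def Let_def b_def)
qed

lemma tab_word_Some:
  assumes t: "t \<in> prym_tableaux g r k" and c: "tab_word k r t i = Some c"
  obtains x y where "(x, y) \<in> staircase r" "t (x, y) = i" "c = (int y - int x) mod int k"
proof -
  have "i \<in> t ` staircase r" using c by (auto simp: tab_word_def split: if_splits)
  then obtain x y where "(x, y) \<in> staircase r" "t (x, y) = i" by auto
  thus ?thesis using tab_word_box[OF t, of x y] c that by simp
qed

lemma run_antimono: "i \<le> j \<Longrightarrow> run P j a n \<le> run P i a n"
proof (induction rule: dec_induct)
  case (step m)
  have "run P (Suc m) a n \<le> run P m a n" by (simp add: lower_def)
  thus ?case using step by simp
qed simp

text \<open>After \<open>i\<close> letters every box with entry at most \<open>i\<close> is present: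
  its neighbours in row and column have smaller entries, so it can be added when its letter comes,
  unless it is there already. Letters may add further boxes, hence inequalities only.\<close>

lemma tab_word_good:
  assumes t: "t \<in> prym_tableaux (Suc N) r k"
  shows "good k r N (tab_word k r t)"
proof -
  define A where "A i = run (\<lambda>i. res k (tab_word k r t i)) i int" for i
  have maya: "maya (A i)" for i unfolding A_def by (rule maya_run[OF maya_int])
  have main: "A i (y - 1) \<le> int y - 1 - int x" if "(x, y) \<in> staircase r" "t (x, y) \<le> i" for x y i
    using that
  proof (induction i arbitrary: x y)
    case 0
    thus ?case using prym_tableauxD(1)[OF t, of "(x, y)"] by simp
  next
    case (Suc i)
    show ?case
    proof (cases "t (x, y) \<le> i")
      case True
      have "A (Suc i) (y - 1) \<le> A i (y - 1)" unfolding A_def by (rule run_antimono) simp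
      thus ?thesis using Suc.IH[OF Suc.prems(1) True] by simp
    next
      case False
      hence ti: "t (x, y) = Suc i" using Suc.prems by simp
      have xy: "1 \<le> x" "1 \<le> y" "int x + int y \<le> r + 1" using Suc.prems by (auto simp: in_staircase)
      have 1: "A i (y - 1) \<le> int y - int x"
      proof (cases "x = 1")
        case True thus ?thesis using mayaD(2)[OF maya, of i "y - 1"] xy by simp
      next
        case False
        hence b: "(x - 1, y) \<in> staircase r" using xy by (auto simp: in_staircase)
        hence "t (x - 1, y) \<le> i" using prym_tableauxD(2)[OF t b Suc.prems(1)] ti xy by simp
        thus ?thesis using Suc.IH[OF b] xy by (simp add: of_nat_diff)
      qed
      have 2: "y - 1 = 0 \<or> A i (y - 1 - 1) < int y - int x - 1"
      proof (cases "y = 1")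
        case False
        hence b: "(x, y - 1) \<in> staircase r" using xy by (auto simp: in_staircase)
        hence "t (x, y - 1) \<le> i" using prym_tableauxD(3)[OF t b Suc.prems(1)] ti xy by simp
        thus ?thesis using Suc.IH[OF b] xy by (simp add: of_nat_diff)
      qed simp
      have w: "tab_word k r t (Suc i) = Some ((int y - int x) mod int k)"
        using tab_word_box[OF t Suc.prems(1)] ti by simp
      have "A (Suc i) = lower (res k (tab_word k r t (Suc i))) (A i)" by (simp add: A_def)
      hence l: "A (Suc i) = lower (res k (Some ((int y - int x) mod int k))) (A i)" using w by simp
      show ?thesis
      proof (cases "A i (y - 1) = int y - int x")
        case True
        have "res k (Some ((int y - int x) mod int k)) (A i (y - 1))"
          unfolding True by (simp add: cong_def)
        moreover have "y - 1 = 0 \<or> A i (y - 1 - 1) \<noteq> A i (y - 1) - 1" using 2 True by linarith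
        ultimately have "A (Suc i) (y - 1) = A i (y - 1) - 1" unfolding l lower_def by (simp only: simp_thms if_True)
        thus ?thesis using True by simp
      next
        case False
        have "A (Suc i) (y - 1) \<le> A i (y - 1)" unfolding A_def by (rule run_antimono) simp
        thus ?thesis using 1 False by linarith
      qed
    qed
  qed
  have "A N j \<le> 2 * int j - r" for j
  proof (cases "int j < r")
    case True
    have b: "(nat (r - int j), j + 1) \<in> staircase r" using True by (simp add: in_staircase)
    moreover have "t (nat (r - int j), j + 1) \<le> N" using prym_tableauxD(1)[OF t b] by simp
    ultimately show ?thesis using main[of "nat (r - int j)" "j + 1" N] True by simp
  next
    case False thus ?thesis using mayaD(2)[OF maya, of N j] by simp
  qed
  moreover have "dom (tab_word k r t) \<subseteq> {1..N}"
  proof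
    fix i assume "i \<in> dom (tab_word k r t)"
    then obtain c where "tab_word k r t i = Some c" by auto
    from tab_word_Some[OF t this] obtain x y where "(x, y) \<in> staircase r" "t (x, y) = i" by metis
    thus "i \<in> {1..N}" using prym_tableauxD(1)[OF t, of "(x, y)"] by auto
  qed
  moreover have "normal k (tab_word k r t)"
    unfolding normal_def by (auto simp: tab_word_def Let_def split: if_splits)
  ultimately show ?thesis by (auto simp: good_def A_def)
qed

text \<open>Each box of the staircase is labelled with the time at which the run covers it. Boxes
  covered at the same time share the residue of that letter, which is the congruence condition;
  letters that label no box do not occur in the word of this tableau.\<close>

lemma good_tab_word:
  assumes w: "good k r N w"
  shows "\<exists>t\<in>prym_tableaux (Suc N) r k. tab_word k r t \<subseteq>\<^sub>m w"
proof -
  define A where "A i = run (\<lambda>i. res k (w i)) i int" for i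
  have maya: "maya (A i)" for i unfolding A_def by (rule maya_run[OF maya_int])
  define f where "f x y = (LEAST i. A i (y - 1) \<le> int y - 1 - int x)" for x y
  define t where "t = restrict (\<lambda>(x, y). f x y) (staircase r)"
  have tf: "t (x, y) = f x y" if "(x, y) \<in> staircase r" for x y using that by (simp add: t_def)
  have AN: "A N (y - 1) \<le> int y - 1 - int x" if "(x, y) \<in> staircase r" for x y
  proof -
    have "A N (y - 1) \<le> 2 * int (y - 1) - r" using w by (simp add: good_def A_def)
    thus ?thesis using that by (simp add: in_staircase of_nat_diff)
  qed
  have fle: "f x y \<le> i" if "A i (y - 1) \<le> int y - 1 - int x" for x y i
    unfolding f_def by (rule Least_le) (rule that)
  have fN: "f x y \<le> N" if "(x, y) \<in> staircase r" for x y by (rule fle[OF AN[OF that]])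
  have step: "\<exists>i. f x y = Suc i \<and> A i (y - 1) = int y - int x \<and> res k (w (Suc i)) (int y - int x)
      \<and> (y = 1 \<or> A i (y - 2) < int y - int x - 1)" if xy: "(x, y) \<in> staircase r" for x y
  proof -
    have F: "A (f x y) (y - 1) \<le> int y - 1 - int x"
      unfolding f_def by (rule LeastI) (rule AN[OF xy])
    have "f x y \<noteq> 0"
    proof
      assume "f x y = 0"
      hence "int (y - 1) \<le> int y - 1 - int x" using F by (simp add: A_def)
      moreover have "1 \<le> x" "1 \<le> y" using xy by (auto simp: in_staircase)
      ultimately show False by linarith
    qed
    then obtain i where i: "f x y = Suc i" by (cases "f x y") auto
    have n: "\<not> A i (y - 1) \<le> int y - 1 - int x" using fle[of i y x] i by auto
    have A: "A (Suc i) = lower (res k (w (Suc i))) (A i)" by (simp add: A_def)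
    have l: "res k (w (Suc i)) (A i (y - 1))" "y - 1 = 0 \<or> A i (y - 1 - 1) \<noteq> A i (y - 1) - 1"
        "A i (y - 1) = int y - int x"
      using F n unfolding i A by (auto simp: lower_def split: if_splits)
    \<comment> \<open>The bead of the preceding row is smaller and does not block the move, so it
      lies lower still: that row has already covered \<open>(x, y - 1)\<close>. This makes the
      labels increase strictly in \<open>y\<close>.\<close>
    have "A i (y - 2) < A i (y - 1)" if "y \<noteq> 1"
      using that xy by (intro strict_monoD[OF mayaD(3)[OF maya]]) (auto simp: in_staircase)
    hence "y = 1 \<or> A i (y - 2) < int y - int x - 1"
      using l xy by (cases "y = 1") (auto simp: in_staircase numeral_2_eq_2)
    thus ?thesis using i l by auto
  qed
  have "t \<in> prym_tableaux (Suc N) r k"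
    unfolding prym_tableaux_def
  proof (intro CollectI conjI allI impI)
    show "t \<in> staircase r \<rightarrow>\<^sub>E {1..<Suc N}"
    proof (intro PiE_I)
      fix b assume b: "b \<in> staircase r"
      obtain x y where xy: "b = (x, y)" by (cases b)
      show "t b \<in> {1..<Suc N}" using step[of x y] fN[of x y] b tf[of x y] unfolding xy by auto
    qed (auto simp: t_def)
  next
    fix x x' y assume a: "(x, y) \<in> staircase r \<and> (x', y) \<in> staircase r \<and> x < x'"
    obtain i where "f x' y = Suc i" "A i (y - 1) = int y - int x'" using step a by blast
    moreover have "f x y \<le> i" by (rule fle) (use calculation a in auto)
    ultimately show "t (x, y) < t (x', y)" using tf a by auto
  next
    fix x y y' assume a: "(x, y) \<in> staircase r \<and> (x, y') \<in> staircase r \<and> y < y'"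
    hence y: "1 \<le> y" "y' \<noteq> 1" by (auto simp: in_staircase)
    then obtain i where i: "f x y' = Suc i" "A i (y' - 2) < int y' - int x - 1" using step[of x y'] a by blast
    have "A i (y - 1) + int ((y' - 2) - (y - 1)) \<le> A i (y' - 2)"
      by (rule strict_mono_diff[OF mayaD(3)[OF maya]]) (use a y in auto)
    hence "A i (y - 1) \<le> int y - 1 - int x" using i a y by (simp add: of_nat_diff)
    hence "f x y \<le> i" by (rule fle)
    thus "t (x, y) < t (x, y')" using tf a i by auto
  next
    fix x y x' y' assume a: "(x, y) \<in> staircase r \<and> (x', y') \<in> staircase r \<and> t (x, y) = t (x', y')"
    hence f: "f x y = f x' y'" using tf by auto
    obtain i where i: "f x y = Suc i" "res k (w (Suc i)) (int y - int x)" using step a by blast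
    obtain j where j: "f x' y' = Suc j" "res k (w (Suc j)) (int y' - int x')" using step a by blast
    have ij: "j = i" using i j f by simp
    obtain c where c: "w (Suc i) = Some c" using i(2) by (cases "w (Suc i)") auto
    have "[int y - int x = int y' - int x'] (mod int k)"
      using i(2) j(2) c ij by simp (metis cong_sym cong_trans)
    thus "[int x - int y = int x' - int y'] (mod int k)"
      by (metis cong_minus_minus_iff minus_diff_eq)
  qed
  moreover from this have "tab_word k r t \<subseteq>\<^sub>m w"
  proof (unfold map_le_def, intro ballI)
    fix i assume "i \<in> dom (tab_word k r t)"
    then obtain c where c: "tab_word k r t i = Some c" by auto
    obtain x y where xy: "(x, y) \<in> staircase r" "t (x, y) = i" "c = (int y - int x) mod int k"
      using tab_word_Some[OF calculation c] .
    obtain j where j: "f x y = Suc j" "res k (w (Suc j)) (int y - int x)" using step xy by blast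
    hence "Suc j = i" using tf xy by simp
    then obtain d where d: "w i = Some d" "[int y - int x = d] (mod int k)" using j(2) by (cases "w i") auto
    have "d = c" using w d xy(3) by (auto simp: good_def normal_def cong_def)
    thus "tab_word k r t i = w i" using c d by simp
  qed
  ultimately show ?thesis by blast
qed

subsection \<open>Piecewise linear functions\<close>

text \<open>\<open>d q\<close> is the change of slope at \<open>y q\<close>. The break points are
  indexed by an abstract set, later by the points of a divisor, so several of them may share a
  position.\<close>

definition ramps :: "'a set \<Rightarrow> ('a \<Rightarrow> real) \<Rightarrow> ('a \<Rightarrow> int) \<Rightarrow> real \<Rightarrow> real" where
  "ramps K y d s = (\<Sum>q\<in>K. of_int (d q) * max 0 (s - y q))"

lemma ramps_linear:
  assumes K: "finite K" and gap: "\<And>q. q \<in> K \<Longrightarrow> y q \<le> a \<or> b \<le> y q" and s: "a \<le> s" "s \<le> b"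
  shows "ramps K y d s = ramps K y d a + of_int (\<Sum>q | q \<in> K \<and> y q \<le> a. d q) * (s - a)"
proof -
  have "ramps K y d s = (\<Sum>q\<in>K. of_int (d q) * max 0 (a - y q) + (if y q \<le> a then of_int (d q) * (s - a) else 0))"
    unfolding ramps_def
  proof (rule sum.cong)
    fix q assume "q \<in> K"
    thus "of_int (d q) * max 0 (s - y q) =
        of_int (d q) * max 0 (a - y q) + (if y q \<le> a then of_int (d q) * (s - a) else 0)"
      using gap[of q] s by (auto simp: max_def algebra_simps)
  qed simp
  also have "\<dots> = ramps K y d a + (\<Sum>q | q \<in> K \<and> y q \<le> a. of_int (d q) * (s - a))"
    unfolding ramps_def sum.distrib using K by (simp add: sum.inter_filter)
  finally show ?thesis by (simp add: sum_distrib_right)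
qed

lemma slope_rightI:
  assumes "\<delta> > 0" "\<And>t. 0 < t \<Longrightarrow> t < \<delta> \<Longrightarrow> h (s + t) = h s + c * t"
  shows "slope_right h s = c"
  unfolding slope_right_def
proof (rule tendsto_Lim)
  have "eventually (\<lambda>t. (h (s + t) - h s) / t = c) (at_right 0)"
    using assms by (auto simp: eventually_at_right_field intro!: exI[of _ \<delta>])
  thus "((\<lambda>t. (h (s + t) - h s) / t) \<longlongrightarrow> c) (at_right 0)"
    by (rule tendsto_eventually)
qed simp

lemma slope_leftI:
  assumes "\<delta> > 0" "\<And>t. 0 < t \<Longrightarrow> t < \<delta> \<Longrightarrow> h (s - t) = h s + c * t"
  shows "slope_left h s = c"
  unfolding slope_left_def
proof (rule tendsto_Lim)
  have "eventually (\<lambda>t. (h (s - t) - h s) / t = c) (at_right 0)"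
    using assms by (auto simp: eventually_at_right_field intro!: exI[of _ \<delta>])
  thus "((\<lambda>t. (h (s - t) - h s) / t) \<longlongrightarrow> c) (at_right 0)"
    by (rule tendsto_eventually)
qed simp

lemma gap_exists:
  fixes Y :: "real set"
  assumes "finite Y" shows "\<exists>\<delta>>0. \<forall>y\<in>Y. y = s \<or> \<delta> \<le> \<bar>y - s\<bar>"
  using assms
proof induction
  case empty show ?case by (intro exI[of _ 1]) simp
next
  case (insert y Y)
  then obtain \<delta> where "\<delta> > 0" "\<forall>y\<in>Y. y = s \<or> \<delta> \<le> \<bar>y - s\<bar>" by blast
  thus ?case by (intro exI[of _ "if y = s then \<delta> else min \<delta> \<bar>y - s\<bar>"]) auto
qed

definition ramp_form :: "real \<Rightarrow> (real \<Rightarrow> real) \<Rightarrow> real \<Rightarrow> int \<Rightarrow> 'a set \<Rightarrow> ('a \<Rightarrow> real) \<Rightarrow> ('a \<Rightarrow> int) \<Rightarrow> bool" where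
  "ramp_form L h c n K y d \<longleftrightarrow> finite K \<and> (\<forall>s\<in>{0..L}. h s = c + of_int n * s + ramps K y d s)"

lemma ramp_form_linear:
  assumes "ramp_form L h c n K y d" "\<And>q. q \<in> K \<Longrightarrow> y q \<le> a \<or> b \<le> y q" "0 \<le> a" "b \<le> L" "a \<le> s" "s \<le> b"
  shows "h s = h a + of_int (n + (\<Sum>q | q \<in> K \<and> y q \<le> a. d q)) * (s - a)"
proof -
  have K: "finite K" and h: "\<And>s. s \<in> {0..L} \<Longrightarrow> h s = c + of_int n * s + ramps K y d s"
    using assms(1) by (auto simp: ramp_form_def)
  have "h s = c + of_int n * s + ramps K y d s" "h a = c + of_int n * a + ramps K y d a"
    using assms by (auto intro: h)
  thus ?thesis using ramps_linear[OF K, of y a b s d] assms(2,5,6) by (simp add: algebra_simps)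
qed

lemma ramp_form_ipl:
  assumes "ramp_form L h c n K y d" shows "integer_piecewise_linear L h"
  unfolding integer_piecewise_linear_def
proof (rule exI[of _ "y ` K"], intro conjI allI impI)
  show "finite (y ` K)" using assms by (simp add: ramp_form_def)
  fix a b assume ab: "0 \<le> a \<and> a < b \<and> b \<le> L \<and> {a<..<b} \<inter> y ` K = {}"
  have "\<forall>s\<in>{a..b}. h s = h a + of_int (n + (\<Sum>q | q \<in> K \<and> y q \<le> a. d q)) * (s - a)"
  proof
    fix s assume s: "s \<in> {a..b}"
    show "h s = h a + of_int (n + (\<Sum>q | q \<in> K \<and> y q \<le> a. d q)) * (s - a)"
    proof (rule ramp_form_linear[OF assms, of a b])
      fix q assume "q \<in> K" thus "y q \<le> a \<or> b \<le> y q" using ab by force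
    qed (use ab s in auto)
  qed
  thus "\<exists>n::int. \<forall>s\<in>{a..b}. h s = h a + of_int n * (s - a)" by blast
qed

lemma ramp_form_slope_right:
  assumes R: "ramp_form L h c n K y d" and s: "0 \<le> s" "s < L"
  shows "slope_right h s = of_int (n + (\<Sum>q | q \<in> K \<and> y q \<le> s. d q))"
proof -
  have "finite (y ` K)" using R by (simp add: ramp_form_def)
  then obtain \<delta> where \<delta>: "\<delta> > 0" "\<forall>x\<in>y ` K. x = s \<or> \<delta> \<le> \<bar>x - s\<bar>" using gap_exists by blast
  show ?thesis
  proof (rule slope_rightI)
    show "min \<delta> (L - s) > 0" using \<delta> s by simp
    fix t assume t: "0 < t" "t < min \<delta> (L - s)"
    have "h (s + t) = h s + of_int (n + (\<Sum>q | q \<in> K \<and> y q \<le> s. d q)) * (s + t - s)"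
    proof (rule ramp_form_linear[OF R, of s "s + t"])
      fix q assume "q \<in> K" thus "y q \<le> s \<or> s + t \<le> y q" using \<delta>(2) t by fastforce
    qed (use s t in auto)
    thus "h (s + t) = h s + of_int (n + (\<Sum>q | q \<in> K \<and> y q \<le> s. d q)) * t" by simp
  qed
qed

lemma ramp_form_slope_left:
  assumes R: "ramp_form L h c n K y d" and s: "0 < s" "s \<le> L"
  shows "slope_left h s = - of_int (n + (\<Sum>q | q \<in> K \<and> y q < s. d q))"
proof -
  have "finite (y ` K)" using R by (simp add: ramp_form_def)
  then obtain \<delta> where \<delta>: "\<delta> > 0" "\<forall>x\<in>y ` K. x = s \<or> \<delta> \<le> \<bar>x - s\<bar>" using gap_exists by blast
  show ?thesis
  proof (rule slope_leftI)
    show "min \<delta> s > 0" using \<delta> s by simp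
    fix t assume t: "0 < t" "t < min \<delta> s"
    have gap: "y q \<le> s - t \<or> s \<le> y q" if "q \<in> K" for q using \<delta>(2) t that by fastforce
    hence eq: "{q. q \<in> K \<and> y q \<le> s - t} = {q. q \<in> K \<and> y q < s}" using t by force
    have "h s = h (s - t) + of_int (n + (\<Sum>q | q \<in> K \<and> y q \<le> s - t. d q)) * (s - (s - t))"
      by (rule ramp_form_linear[OF R gap]) (use s t in auto)
    thus "h (s - t) = h s + - of_int (n + (\<Sum>q | q \<in> K \<and> y q < s. d q)) * t"
      unfolding eq by (simp add: algebra_simps)
  qed
qed

text \<open>Induction on the number of break points inside the interval: the last one is split off
  as one more ramp.\<close>

lemma ipl_ramp_form:
  assumes "0 < L" "integer_piecewise_linear L h"
  shows "\<exists>c n Y d. ramp_form L h c n Y (\<lambda>y. y) d \<and> Y \<subseteq> {0<..<L}"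
proof -
  obtain B where B: "finite B" and lin0: "\<forall>a b. 0 \<le> a \<and> a < b \<and> b \<le> L \<and> {a<..<b} \<inter> B = {} \<longrightarrow>
      (\<exists>n::int. \<forall>s\<in>{a..b}. h s = h a + of_int n * (s - a))"
    using assms(2) unfolding integer_piecewise_linear_def by blast
  have lin: "\<exists>n::int. \<forall>s\<in>{a..b}. h s = h a + of_int n * (s - a)"
    if "0 \<le> a" "a < b" "b \<le> L" "{a<..<b} \<inter> B = {}" for a b
    using lin0 that by blast
  have "\<exists>c n Y d. ramp_form M h c n Y (\<lambda>y. y) d \<and> Y \<subseteq> {0<..<M}" if "0 < M" "M \<le> L" for M
    using that
  proof (induction "card (B \<inter> {0<..<M})" arbitrary: M rule: less_induct)
    case less
    show ?case
    proof (cases "B \<inter> {0<..<M} = {}")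
      case True
      have "{0<..<M} \<inter> B = {}" using True by blast
      hence "\<exists>n::int. \<forall>s\<in>{0..M}. h s = h 0 + of_int n * (s - 0)"
        using less.prems by (intro lin) simp_all
      then obtain n :: int where n: "\<forall>s\<in>{0..M}. h s = h 0 + of_int n * (s - 0)" ..
      have "h s = h 0 + of_int n * s" if "s \<in> {0..M}" for s using bspec[OF n that] by simp
      hence "ramp_form M h (h 0) n {} (\<lambda>y. y) (\<lambda>_. 0)"
        unfolding ramp_form_def ramps_def sum.empty add_0_right by blast
      thus ?thesis by blast
    next
      case False
      define y where "y = Max (B \<inter> {0<..<M})"
      have y: "y \<in> B \<inter> {0<..<M}" unfolding y_def by (rule Max_in) (use B False in auto)
      have gt: "x \<le> y" if "x \<in> B \<inter> {0<..<M}" for x unfolding y_def by (rule Max_ge) (use B that in auto)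
      have "B \<inter> {0<..<y} \<subset> B \<inter> {0<..<M}" using y by auto
      hence "card (B \<inter> {0<..<y}) < card (B \<inter> {0<..<M})" using B by (intro psubset_card_mono) auto
      then obtain c n Y d where R: "ramp_form y h c n Y (\<lambda>y. y) d" and Y: "Y \<subseteq> {0<..<y}"
        using less.hyps[of y] less.prems y by fastforce
      have fY: "finite Y" using R by (simp add: ramp_form_def)
      have yY: "y \<notin> Y" using Y by auto
      have "{y<..<M} \<inter> B = {}" using gt y by force
      hence "\<exists>n::int. \<forall>s\<in>{y..M}. h s = h y + of_int n * (s - y)"
        using y less.prems by (intro lin) simp_all
      then obtain n' :: int where n': "\<forall>s\<in>{y..M}. h s = h y + of_int n' * (s - y)" ..
      \<comment> \<open>Just before \<open>y\<close> the slope is \<open>n + sum d Y\<close>,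
        because all earlier ramps are active there.\<close>
      define e where "e = n' - (n + sum d Y)"
      define d' where "d' = d(y := e)"
      have "h s = c + of_int n * s + ramps (insert y Y) (\<lambda>y. y) d' s" if s: "s \<in> {0..M}" for s
      proof -
        have "ramps (insert y Y) (\<lambda>y. y) d' s = of_int e * max 0 (s - y) + ramps Y (\<lambda>y. y) d s"
        proof -
          have "(\<Sum>q\<in>Y. of_int (d' q) * max 0 (s - q)) = (\<Sum>q\<in>Y. of_int (d q) * max 0 (s - q))"
            using yY by (intro sum.cong) (auto simp: d'_def)
          thus ?thesis unfolding ramps_def using fY yY by (simp add: d'_def)
        qed
        moreover have "h s = c + of_int n * s + ramps Y (\<lambda>y. y) d s + of_int e * max 0 (s - y)"
        proof (cases "s \<le> y")
          case True thus ?thesis using R s by (simp add: ramp_form_def max_def)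
        next
          case False
          have hy: "h y = c + of_int n * y + ramps Y (\<lambda>y. y) d y" using R y by (simp add: ramp_form_def)
          have eq: "{q. q \<in> Y \<and> q \<le> y} = Y" using Y by auto
          have "ramps Y (\<lambda>y. y) d s = ramps Y (\<lambda>y. y) d y + of_int (sum d Y) * (s - y)"
          proof -
            have "q \<le> y \<or> s \<le> q" if "q \<in> Y" for q using Y that by auto
            from ramps_linear[OF fY, of "\<lambda>y. y" y s s d] this show ?thesis using False eq by simp
          qed
          moreover have "h s = h y + of_int n' * (s - y)" using bspec[OF n', of s] False s by simp
          ultimately show ?thesis using hy False by (simp add: e_def algebra_simps)
        qed
        ultimately show ?thesis by simp
      qed
      hence "ramp_form M h c n (insert y Y) (\<lambda>y. y) d'" using fY by (simp add: ramp_form_def)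
      moreover have "insert y Y \<subseteq> {0<..<M}" using Y y by auto
      ultimately show ?thesis by blast
    qed
  qed
  thus ?thesis using assms(1) by blast
qed

text \<open>Integration by parts on an edge, against the linear weight \<open>\<alpha> s + \<beta>\<close>.\<close>

lemma ipl_parts:
  assumes L: "0 < L" and h: "integer_piecewise_linear L h"
    and Z: "finite Z" "Z \<subseteq> {0<..<L}"
    and supp: "\<And>s. 0 < s \<Longrightarrow> s < L \<Longrightarrow> s \<notin> Z \<Longrightarrow> slope_right h s + slope_left h s = 0"
  shows "(\<Sum>s\<in>Z. (slope_right h s + slope_left h s) * (\<alpha> * s + \<beta>)) + slope_right h 0 * \<beta>
      + slope_left h L * (\<alpha> * L + \<beta>) = - \<alpha> * (h L - h 0)"
    and "\<exists>m::int. slope_left h L = of_int m"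
proof -
  obtain c n Y d where R: "ramp_form L h c n Y (\<lambda>y. y) d" and Y: "Y \<subseteq> {0<..<L}"
    using ipl_ramp_form[OF L h] by blast
  have fY: "finite Y" using R by (simp add: ramp_form_def)
  have ord: "slope_right h s + slope_left h s = (if s \<in> Y then of_int (d s) else 0)" if "0 < s" "s < L" for s
  proof -
    have "(\<Sum>q | q \<in> Y \<and> q \<le> s. d q) = (\<Sum>q | q \<in> Y \<and> q < s. d q) + (if s \<in> Y then d s else 0)"
    proof -
      have "{q. q \<in> Y \<and> q \<le> s} = {q. q \<in> Y \<and> q < s} \<union> (if s \<in> Y then {s} else {})"
        by (auto simp: order.order_iff_strict)
      thus ?thesis using fY by (auto simp: sum.union_disjoint add.commute)
    qed
    thus ?thesis using ramp_form_slope_right[OF R, of s] ramp_form_slope_left[OF R, of s] that by simp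
  qed
  have "(\<Sum>s\<in>Z. (slope_right h s + slope_left h s) * (\<alpha> * s + \<beta>)) =
        (\<Sum>s\<in>Z \<union> Y. (slope_right h s + slope_left h s) * (\<alpha> * s + \<beta>))"
    using Z fY Y supp by (intro sum.mono_neutral_left) auto
  also have "\<dots> = (\<Sum>s\<in>Z \<union> Y. if s \<in> Y then of_int (d s) * (\<alpha> * s + \<beta>) else 0)"
    using Z Y ord by (intro sum.cong) auto
  also have "\<dots> = (\<Sum>s\<in>Y. of_int (d s) * (\<alpha> * s + \<beta>))"
    using Z fY by (simp add: sum.If_cases Int_absorb1)
  finally have 1: "(\<Sum>s\<in>Z. (slope_right h s + slope_left h s) * (\<alpha> * s + \<beta>)) = (\<Sum>s\<in>Y. of_int (d s) * (\<alpha> * s + \<beta>))" .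
  have e1: "{q. q \<in> Y \<and> q \<le> 0} = {}" "{q. q \<in> Y \<and> q < L} = Y" using Y by force+
  have 2: "slope_right h 0 = of_int n" using ramp_form_slope_right[OF R, of 0] L unfolding e1 by simp
  have 3: "slope_left h L = - of_int (n + sum d Y)" using ramp_form_slope_left[OF R, of L] L unfolding e1 by simp
  have h0: "h 0 = c"
  proof -
    have "ramps Y (\<lambda>y. y) d 0 = 0" unfolding ramps_def using Y by (intro sum.neutral) (force simp: max_def)
    thus ?thesis using R L by (simp add: ramp_form_def)
  qed
  have "ramps Y (\<lambda>y. y) d L = (\<Sum>s\<in>Y. of_int (d s) * (L - s))"
    unfolding ramps_def using Y by (intro sum.cong) (force simp: max_def)+
  hence hL: "h L = c + of_int n * L + (\<Sum>s\<in>Y. of_int (d s) * (L - s))" using R L by (simp add: ramp_form_def)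
  have "(\<Sum>s\<in>Y. of_int (d s) * (\<alpha> * s + \<beta>)) =
      of_int (sum d Y) * (\<alpha> * L + \<beta>) - \<alpha> * (\<Sum>s\<in>Y. of_int (d s) * (L - s))"
  proof -
    have "(\<Sum>s\<in>Y. of_int (d s) * (\<alpha> * s + \<beta>)) =
        (\<Sum>s\<in>Y. of_int (d s) * (\<alpha> * L + \<beta>) - \<alpha> * (of_int (d s) * (L - s)))"
      by (intro sum.cong) (simp_all add: algebra_simps)
    thus ?thesis by (simp add: sum_subtractf sum_distrib_left sum_distrib_right)
  qed
  thus "(\<Sum>s\<in>Z. (slope_right h s + slope_left h s) * (\<alpha> * s + \<beta>)) + slope_right h 0 * \<beta>
      + slope_left h L * (\<alpha> * L + \<beta>) = - \<alpha> * (h L - h 0)"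
    unfolding 1 2 3 h0 hL by (simp add: algebra_simps)
  show "\<exists>m::int. slope_left h L = of_int m" unfolding 3 by (metis of_int_minus)
qed

subsection \<open>Weighted degrees of divisors\<close>

text \<open>The integral of \<open>W\<close> against the divisor. The weight 1 gives the degree, and
  the retractions to the loops give the Abel--Jacobi coordinates.\<close>

definition weigh :: "('a \<Rightarrow> real) \<Rightarrow> ('a \<Rightarrow>\<^sub>0 int) \<Rightarrow> real" where
  "weigh W D = (\<Sum>p\<in>Poly_Mapping.keys D. of_int (Poly_Mapping.lookup D p) * W p)"

lemma weigh_superset:
  assumes "finite A" "Poly_Mapping.keys D \<subseteq> A"
  shows "weigh W D = (\<Sum>p\<in>A. of_int (Poly_Mapping.lookup D p) * W p)"
  unfolding weigh_def using assms
  by (intro sum.mono_neutral_left) (auto simp: in_keys_iff)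

lemma weigh_add: "weigh W (D + E) = weigh W D + weigh W E"
proof -
  let ?A = "Poly_Mapping.keys D \<union> Poly_Mapping.keys E"
  have "weigh W (D + E) = (\<Sum>p\<in>?A. of_int (Poly_Mapping.lookup (D + E) p) * W p)"
    by (rule weigh_superset) (auto simp: Poly_Mapping.keys_add)
  also have "\<dots> = (\<Sum>p\<in>?A. of_int (Poly_Mapping.lookup D p) * W p) + (\<Sum>p\<in>?A. of_int (Poly_Mapping.lookup E p) * W p)"
    by (simp add: lookup_add algebra_simps sum.distrib)
  also have "\<dots> = weigh W D + weigh W E"
    using weigh_superset[of ?A D W] weigh_superset[of ?A E W] by simp
  finally show ?thesis .
qed

lemma weigh_cmul: "weigh W (frag_cmul c D) = of_int c * weigh W D"
proof -
  have "weigh W (frag_cmul c D) = (\<Sum>p\<in>Poly_Mapping.keys D. of_int (Poly_Mapping.lookup (frag_cmul c D) p) * W p)"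
    by (rule weigh_superset) (auto simp: keys_cmul)
  thus ?thesis by (simp add: weigh_def sum_distrib_left mult.assoc)
qed

lemma weigh_0 [simp]: "weigh W 0 = 0"
  by (simp add: weigh_def)

lemma weigh_minus: "weigh W (- D) = - weigh W D"
  using weigh_cmul[of W "-1" D] by simp

lemma weigh_diff: "weigh W (D - E) = weigh W D - weigh W E"
  using weigh_add[of W D "- E"] weigh_minus[of W E] by simp

lemma weigh_frag_of: "weigh W (frag_of p) = W p"
  by (simp add: weigh_def)

lemma weigh_sum: "weigh W (\<Sum>i\<in>I. D i) = (\<Sum>i\<in>I. weigh W (D i))"
  by (induction I rule: infinite_finite_induct) (auto simp: weigh_add)

lemmas weigh_simps = weigh_add weigh_cmul weigh_minus weigh_diff weigh_frag_of weigh_sum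

lemma div_degree_weigh: "of_int (div_degree D) = weigh (\<lambda>_. 1) D"
  by (simp add: div_degree_def weigh_def)

lemma divisors_add: "D \<in> divisors G \<Longrightarrow> E \<in> divisors G \<Longrightarrow> D + E \<in> divisors G"
  unfolding divisors_def using Poly_Mapping.keys_add[of D E] by auto

lemma divisors_diff: "D \<in> divisors G \<Longrightarrow> E \<in> divisors G \<Longrightarrow> D - E \<in> divisors G"
  unfolding divisors_def using keys_diff[of D E] by auto

lemma divisors_cmul: "D \<in> divisors G \<Longrightarrow> frag_cmul c D \<in> divisors G"
  unfolding divisors_def using keys_cmul[of c D] by auto

lemma divisors_0: "0 \<in> divisors G"
  by (simp add: divisors_def)

lemma divisors_sum: "(\<And>i. i \<in> I \<Longrightarrow> D i \<in> divisors G) \<Longrightarrow> (\<Sum>i\<in>I. D i) \<in> divisors G"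
  by (induction I rule: infinite_finite_induct) (auto intro: divisors_add divisors_0)

lemma divisors_frag_of: "frag_of p \<in> divisors G \<longleftrightarrow> p \<in> points G"
  by (simp add: divisors_def)

text \<open>Green's formula, edge by edge. \<open>W\<close> is affine along each edge and correct at
  the tail, but may jump at the head; the jump is multiplied by an integral slope
  \<open>m e\<close>. This admits the weight \<open>pos C i\<close>, which takes values in a circle
  and jumps by the length of the loop.\<close>

lemma weigh_principal:
  assumes fin: "finite (verts G)" "finite (edges G)"
    and th: "\<And>e. e \<in> edges G \<Longrightarrow> tail G e \<in> verts G \<and> head G e \<in> verts G \<and> 0 < elen G e"
    and D: "D \<in> divisors G" and f: "rational_function G f"
    and ord: "\<And>p. p \<in> points G \<Longrightarrow> of_int (Poly_Mapping.lookup D p) = ord_at G f p"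
    and W: "\<And>e s. e \<in> edges G \<Longrightarrow> 0 < s \<Longrightarrow> s < elen G e \<Longrightarrow> W (Inner e s) = \<alpha> e * s + \<beta> e"
    and Wt: "\<And>e. e \<in> edges G \<Longrightarrow> W (Vertex (tail G e)) = \<beta> e"
  shows "\<exists>m. weigh W D = (\<Sum>e\<in>edges G. - \<alpha> e * (f (Vertex (head G e)) - f (Vertex (tail G e)))
     + of_int (m e) * (W (Vertex (head G e)) - \<alpha> e * elen G e - \<beta> e))"
proof -
  define h where "h e s = f (edge_point G e s)" for e s
  define Z where "Z e = {s. Inner e s \<in> Poly_Mapping.keys D}" for e
  have ptZ: "0 < s \<and> s < elen G e" if "s \<in> Z e" for e s
    using that D by (auto simp: Z_def divisors_def points_def)
  have finZ: "finite (Z e)" for e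
  proof -
    have "Z e \<subseteq> (\<lambda>p. case p of Inner e' s \<Rightarrow> s | Vertex v \<Rightarrow> 0) ` Poly_Mapping.keys D"
    proof
      fix s assume "s \<in> Z e"
      thus "s \<in> (\<lambda>p. case p of Inner e' s \<Rightarrow> s | Vertex v \<Rightarrow> 0) ` Poly_Mapping.keys D"
        unfolding Z_def by (intro image_eqI[of _ _ "Inner e s"]) simp_all
    qed
    thus ?thesis using finite_surj finite_keys by blast
  qed
  have ipl: "integer_piecewise_linear (elen G e) (h e)" if "e \<in> edges G" for e
    using f that unfolding rational_function_def h_def[abs_def] by blast
  have ordI: "slope_right (h e) s + slope_left (h e) s = of_int (Poly_Mapping.lookup D (Inner e s))"
    if "e \<in> edges G" "0 < s" "s < elen G e" for e s
    using ord[of "Inner e s"] that by (auto simp: points_def h_def[abs_def])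
  define SR where "SR e = slope_right (h e) 0" for e
  define SL where "SL e = slope_left (h e) (elen G e)" for e
  have parts: "(\<Sum>s\<in>Z e. (slope_right (h e) s + slope_left (h e) s) * (\<alpha> e * s + \<beta> e)) + SR e * \<beta> e
      + SL e * (\<alpha> e * elen G e + \<beta> e) = - \<alpha> e * (h e (elen G e) - h e 0)"
    and int: "\<exists>m::int. SL e = of_int m" if e: "e \<in> edges G" for e
  proof -
    have L: "0 < elen G e" using th[OF e] by blast
    have Z: "Z e \<subseteq> {0<..<elen G e}" using ptZ by auto
    have supp: "slope_right (h e) s + slope_left (h e) s = 0" if "0 < s" "s < elen G e" "s \<notin> Z e" for s
      using ordI[OF e that(1,2)] that(3) by (simp add: Z_def in_keys_iff)
    show "(\<Sum>s\<in>Z e. (slope_right (h e) s + slope_left (h e) s) * (\<alpha> e * s + \<beta> e)) + SR e * \<beta> e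
      + SL e * (\<alpha> e * elen G e + \<beta> e) = - \<alpha> e * (h e (elen G e) - h e 0)"
      unfolding SR_def SL_def by (rule ipl_parts(1)[OF L ipl[OF e] finZ Z supp])
    show "\<exists>m::int. SL e = of_int m"
      unfolding SL_def by (rule ipl_parts(2)[OF L ipl[OF e] finZ Z supp])
  qed
  obtain m where m: "\<And>e. e \<in> edges G \<Longrightarrow> SL e = of_int (m e)" using int by metis
  let ?IP = "\<Union>e\<in>edges G. Inner e ` Z e"
  have keys: "Poly_Mapping.keys D \<subseteq> Vertex ` verts G \<union> ?IP"
    using D by (auto simp: divisors_def points_def Z_def)
  have "weigh W D = (\<Sum>p\<in>Vertex ` verts G \<union> ?IP. of_int (Poly_Mapping.lookup D p) * W p)"
    by (rule weigh_superset[OF _ keys]) (use fin finZ in auto)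
  also have "\<dots> = (\<Sum>p\<in>Vertex ` verts G. of_int (Poly_Mapping.lookup D p) * W p)
      + (\<Sum>p\<in>?IP. of_int (Poly_Mapping.lookup D p) * W p)"
    by (rule sum.union_disjoint) (use fin finZ in auto)
  also have "(\<Sum>p\<in>Vertex ` verts G. of_int (Poly_Mapping.lookup D p) * W p)
      = (\<Sum>v\<in>verts G. of_int (Poly_Mapping.lookup D (Vertex v)) * W (Vertex v))"
    by (simp add: sum.reindex inj_on_def)
  also have "\<dots> = (\<Sum>v\<in>verts G. (\<Sum>e | e \<in> edges G \<and> tail G e = v. SR e * W (Vertex (tail G e)))
      + (\<Sum>e | e \<in> edges G \<and> head G e = v. SL e * W (Vertex (head G e))))"
  proof (rule sum.cong)
    fix v assume "v \<in> verts G"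
    hence "of_int (Poly_Mapping.lookup D (Vertex v)) = ord_at G f (Vertex v)" by (intro ord) (simp add: points_def)
    thus "of_int (Poly_Mapping.lookup D (Vertex v)) * W (Vertex v) =
       (\<Sum>e | e \<in> edges G \<and> tail G e = v. SR e * W (Vertex (tail G e)))
      + (\<Sum>e | e \<in> edges G \<and> head G e = v. SL e * W (Vertex (head G e)))"
      by (simp add: SR_def SL_def h_def[abs_def] distrib_right sum_distrib_right)
  qed simp
  also have "\<dots> = (\<Sum>e\<in>edges G. SR e * W (Vertex (tail G e))) + (\<Sum>e\<in>edges G. SL e * W (Vertex (head G e)))"
    unfolding sum.distrib using th fin
    by (intro arg_cong2[where f="(+)"] sum.group) auto
  also have "(\<Sum>p\<in>?IP. of_int (Poly_Mapping.lookup D p) * W p)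
      = (\<Sum>e\<in>edges G. \<Sum>p\<in>Inner e ` Z e. of_int (Poly_Mapping.lookup D p) * W p)"
    by (rule sum.UNION_disjoint) (use fin finZ in auto)
  also have "\<dots> = (\<Sum>e\<in>edges G. \<Sum>s\<in>Z e. (slope_right (h e) s + slope_left (h e) s) * (\<alpha> e * s + \<beta> e))"
  proof (rule sum.cong)
    fix e assume e: "e \<in> edges G"
    have "(\<Sum>p\<in>Inner e ` Z e. of_int (Poly_Mapping.lookup D p) * W p)
        = (\<Sum>s\<in>Z e. of_int (Poly_Mapping.lookup D (Inner e s)) * W (Inner e s))"
      by (simp add: sum.reindex inj_on_def)
    also have "\<dots> = (\<Sum>s\<in>Z e. (slope_right (h e) s + slope_left (h e) s) * (\<alpha> e * s + \<beta> e))"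
      using ptZ ordI[OF e] W[OF e] by (intro sum.cong) auto
    finally show "(\<Sum>p\<in>Inner e ` Z e. of_int (Poly_Mapping.lookup D p) * W p)
       = (\<Sum>s\<in>Z e. (slope_right (h e) s + slope_left (h e) s) * (\<alpha> e * s + \<beta> e))" .
  qed simp
  finally have "weigh W D = (\<Sum>e\<in>edges G. SR e * W (Vertex (tail G e)) + SL e * W (Vertex (head G e))
      + (\<Sum>s\<in>Z e. (slope_right (h e) s + slope_left (h e) s) * (\<alpha> e * s + \<beta> e)))"
    by (simp add: sum.distrib)
  also have "\<dots> = (\<Sum>e\<in>edges G. - \<alpha> e * (f (Vertex (head G e)) - f (Vertex (tail G e)))
     + of_int (m e) * (W (Vertex (head G e)) - \<alpha> e * elen G e - \<beta> e))"
  proof (rule sum.cong)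
    fix e assume e: "e \<in> edges G"
    have "h e (elen G e) = f (Vertex (head G e))" "h e 0 = f (Vertex (tail G e))"
      using th[OF e] by (auto simp: h_def edge_point_def)
    thus "SR e * W (Vertex (tail G e)) + SL e * W (Vertex (head G e))
      + (\<Sum>s\<in>Z e. (slope_right (h e) s + slope_left (h e) s) * (\<alpha> e * s + \<beta> e)) =
      - \<alpha> e * (f (Vertex (head G e)) - f (Vertex (tail G e)))
     + of_int (m e) * (W (Vertex (head G e)) - \<alpha> e * elen G e - \<beta> e)"
      using parts[OF e] m[OF e] Wt[OF e] by (simp add: algebra_simps)
  qed simp
  finally show ?thesis by blast
qed

subsection \<open>Abel--Jacobi for chains of loops\<close>

text \<open>
  Retraction of the chain to the loop \<open>i\<close>, in counterclockwise distance from its right vertex.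
\<close>

fun pos :: "loop_chain \<Rightarrow> nat \<Rightarrow> chain_point \<Rightarrow> real" where
  "pos C i (Vertex (LV j)) = (if j \<le> i then upper_len C i else 0)"
| "pos C i (Vertex (RV j)) = (if j < i then upper_len C i else 0)"
| "pos C i (Inner (Upper j) s) = (if j < i then upper_len C i else if j = i then s else 0)"
| "pos C i (Inner (Lower j) s) = (if j < i then upper_len C i else if j = i then upper_len C i + s else 0)"
| "pos C i (Inner (Bridge j) s) = (if j < i then upper_len C i else 0)"

text \<open>Retraction of the chain to the bridge \<open>i\<close>, in distance from its left end.\<close>

fun bpos :: "loop_chain \<Rightarrow> nat \<Rightarrow> chain_point \<Rightarrow> real" where
  "bpos C i (Vertex (LV j)) = (if j \<le> i then 0 else bridge_len C i)"
| "bpos C i (Vertex (RV j)) = (if j \<le> i then 0 else bridge_len C i)"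
| "bpos C i (Inner (Upper j) s) = (if j \<le> i then 0 else bridge_len C i)"
| "bpos C i (Inner (Lower j) s) = (if j \<le> i then 0 else bridge_len C i)"
| "bpos C i (Inner (Bridge j) s) = (if j < i then 0 else if j = i then s else bridge_len C i)"

abbreviation AJ :: "loop_chain \<Rightarrow> nat \<Rightarrow> chain_divisor \<Rightarrow> real" where
  "AJ C i \<equiv> weigh (pos C i)"

lemma chain_graph_simps:
  "verts (chain_graph C) = LV ` {1..loops C} \<union> RV ` {1..loops C}"
  "edges (chain_graph C) = Upper ` {1..loops C} \<union> Lower ` {1..loops C} \<union> Bridge ` {1..<loops C}"
  "tail (chain_graph C) = chain_tail" "head (chain_graph C) = chain_head"
  "elen (chain_graph C) = chain_elen C"
  by (simp_all add: chain_graph_def)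

lemma chain_graph_ends:
  assumes "is_loop_chain C" "e \<in> edges (chain_graph C)"
  shows "tail (chain_graph C) e \<in> verts (chain_graph C) \<and> head (chain_graph C) e \<in> verts (chain_graph C)
    \<and> 0 < elen (chain_graph C) e"
  using assms by (auto simp: chain_graph_simps is_loop_chain_def)

lemma loop_len_pos: "is_loop_chain C \<Longrightarrow> i \<in> {1..loops C} \<Longrightarrow> 0 < loop_len C i"
  by (auto simp: is_loop_chain_def loop_len_def add_pos_pos)

lemma principal_imp_AJ:
  assumes C: "is_loop_chain C" and D: "D \<in> principal (chain_graph C)"
  shows "div_degree D = 0" and "i \<in> {1..loops C} \<Longrightarrow> \<exists>n::int. AJ C i D = of_int n * loop_len C i"
proof -
  let ?G = "chain_graph C"
  obtain f where D': "D \<in> divisors ?G" and f: "rational_function ?G f"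
    and ord: "\<And>p. p \<in> points ?G \<Longrightarrow> of_int (Poly_Mapping.lookup D p) = ord_at ?G f p"
    using D by (auto simp: principal_def)
  have fin: "finite (verts ?G)" "finite (edges ?G)" by (simp_all add: chain_graph_simps)
  note wp = weigh_principal[OF fin chain_graph_ends[OF C] D' f ord]
  have "\<exists>m. weigh (\<lambda>_. 1) D = (\<Sum>e\<in>edges ?G. - 0 * (f (Vertex (head ?G e)) - f (Vertex (tail ?G e)))
     + of_int (m e) * (1 - 0 * elen ?G e - 1))"
    by (rule wp) auto
  hence "weigh (\<lambda>_. 1) D = 0" by simp
  thus "div_degree D = 0" using div_degree_weigh[of D] by simp
  assume i: "i \<in> {1..loops C}"
  define \<alpha> where "\<alpha> e = (if e = Upper i \<or> e = Lower i then 1 else (0::real))" for e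
  define \<beta> where "\<beta> e = (case e of Upper j \<Rightarrow> if j < i then upper_len C i else 0
     | Lower j \<Rightarrow> if j \<le> i then upper_len C i else 0 | Bridge j \<Rightarrow> if j < i then upper_len C i else 0)" for e
  have "\<exists>m. weigh (pos C i) D = (\<Sum>e\<in>edges ?G. - \<alpha> e * (f (Vertex (head ?G e)) - f (Vertex (tail ?G e)))
     + of_int (m e) * (pos C i (Vertex (head ?G e)) - \<alpha> e * elen ?G e - \<beta> e))"
  proof (rule wp)
    fix e s assume "e \<in> edges ?G"
    thus "pos C i (Inner e s) = \<alpha> e * s + \<beta> e" by (cases e) (auto simp: \<alpha>_def \<beta>_def)
  next
    fix e assume "e \<in> edges ?G"
    thus "pos C i (Vertex (tail ?G e)) = \<beta> e" by (cases e) (auto simp: \<beta>_def chain_graph_simps)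
  qed
  then obtain m where m: "AJ C i D = (\<Sum>e\<in>edges ?G. - \<alpha> e * (f (Vertex (head ?G e)) - f (Vertex (tail ?G e)))
     + of_int (m e) * (pos C i (Vertex (head ?G e)) - \<alpha> e * elen ?G e - \<beta> e))" (is "_ = sum ?t _") by blast
  also have "\<dots> = sum ?t {Upper i, Lower i}"
  proof (rule sum.mono_neutral_right)
    show "\<forall>e\<in>edges ?G - {Upper i, Lower i}. ?t e = 0"
    proof
      fix e assume "e \<in> edges ?G - {Upper i, Lower i}"
      thus "?t e = 0" by (cases e) (auto simp: \<alpha>_def \<beta>_def chain_graph_simps)
    qed
  qed (use i fin in \<open>auto simp: chain_graph_simps\<close>)
  \<comment> \<open>The differences of \<open>f\<close> along the two arcs cancel. What remains is
    the jump of \<open>pos C i\<close> at the head of the lower arc, from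
    \<open>loop_len C i\<close> to 0.\<close>
  also have "\<dots> = - of_int (m (Lower i)) * loop_len C i"
    by (simp add: chain_graph_simps \<alpha>_def \<beta>_def loop_len_def algebra_simps)
  finally show "\<exists>n::int. AJ C i D = of_int n * loop_len C i" by (metis of_int_minus)
qed

lemma chain_point_cases:
  assumes "p \<in> points (chain_graph C)"
  obtains (LV) j where "p = Vertex (LV j)" "j \<in> {1..loops C}"
  | (RV) j where "p = Vertex (RV j)" "j \<in> {1..loops C}"
  | (Upper) j s where "p = Inner (Upper j) s" "j \<in> {1..loops C}" "0 < s" "s < upper_len C j"
  | (Lower) j s where "p = Inner (Lower j) s" "j \<in> {1..loops C}" "0 < s" "s < lower_len C j"
  | (Bridge) j s where "p = Inner (Bridge j) s" "j \<in> {1..<loops C}" "0 < s" "s < bridge_len C j"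
  using assms unfolding points_def chain_graph_simps by auto

lemma chain_lens:
  assumes "is_loop_chain C"
  shows "i \<in> {1..loops C} \<Longrightarrow> 0 < upper_len C i" "i \<in> {1..loops C} \<Longrightarrow> 0 < lower_len C i"
    "i \<in> {1..<loops C} \<Longrightarrow> 0 < bridge_len C i"
  using assms by (auto simp: is_loop_chain_def)

lemma pos_range:
  assumes C: "is_loop_chain C" and i: "i \<in> {1..loops C}" and p: "p \<in> points (chain_graph C)"
  shows "0 \<le> pos C i p" "pos C i p < loop_len C i"
proof -
  have l: "0 < upper_len C i" "0 < lower_len C i" using chain_lens[OF C] i by auto
  show "0 \<le> pos C i p"
    using p by (cases rule: chain_point_cases) (use l in simp_all)
  show "pos C i p < loop_len C i"
    using p by (cases rule: chain_point_cases) (use l in \<open>auto simp: loop_len_def\<close>)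
qed

lemma pos_eq_iffs:
  assumes C: "is_loop_chain C" and i: "i \<in> {1..loops C}" and p: "p \<in> points (chain_graph C)"
  shows "0 < s \<Longrightarrow> s < upper_len C i \<Longrightarrow> pos C i p = s \<longleftrightarrow> p = Inner (Upper i) s"
    and "0 < s \<Longrightarrow> pos C i p = upper_len C i + s \<longleftrightarrow> p = Inner (Lower i) s"
    and "i < loops C \<Longrightarrow> pos C i p = 0 \<or> bpos C i p = 0"
    and "i < loops C \<Longrightarrow> pos C i p = 0 \<and> bpos C i p = 0 \<longleftrightarrow> p = Vertex (RV i)"
    and "i = loops C \<Longrightarrow> pos C i p = 0 \<longleftrightarrow> p = Vertex (RV i)"
proof -
  have l: "0 < upper_len C i" "0 < lower_len C i" using chain_lens[OF C] i by auto
  show "pos C i p = s \<longleftrightarrow> p = Inner (Upper i) s" if "0 < s" "s < upper_len C i"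
    using p by (cases rule: chain_point_cases) (use that l in auto)
  show "pos C i p = upper_len C i + s \<longleftrightarrow> p = Inner (Lower i) s" if "0 < s"
    using p by (cases rule: chain_point_cases) (use that l in auto)
  show "pos C i p = 0 \<or> bpos C i p = 0" if "i < loops C"
    using p by (cases rule: chain_point_cases) (use that l in auto)
  show "pos C i p = 0 \<and> bpos C i p = 0 \<longleftrightarrow> p = Vertex (RV i)" if "i < loops C"
  proof -
    have "0 < bridge_len C i" using chain_lens[OF C] i that by auto
    show ?thesis
      using p by (cases rule: chain_point_cases) (use that l \<open>0 < bridge_len C i\<close> in auto)
  qed
  show "pos C i p = 0 \<longleftrightarrow> p = Vertex (RV i)" if "i = loops C"
    using p by (cases rule: chain_point_cases) (use that l in auto)
qed

lemma pos_eq_upper_iff: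
  assumes C: "is_loop_chain C" and i: "i \<in> {1..loops C}" and p: "p \<in> points (chain_graph C)"
  shows "pos C i p = upper_len C i \<longleftrightarrow> (i > 1 \<and> bpos C (i - 1) p < bridge_len C (i - 1)) \<or> p = Vertex (LV i)"
    and "i > 1 \<Longrightarrow> \<not> bpos C (i - 1) (Vertex (LV i)) < bridge_len C (i - 1)"
proof -
  have l: "0 < upper_len C i" "0 < lower_len C i" using chain_lens[OF C] i by auto
  have b: "i > 1 \<Longrightarrow> 0 < bridge_len C (i - 1)" using i by (intro chain_lens(3)[OF C]) auto
  show "pos C i p = upper_len C i \<longleftrightarrow> (i > 1 \<and> bpos C (i - 1) p < bridge_len C (i - 1)) \<or> p = Vertex (LV i)"
    using p
  proof (cases rule: chain_point_cases)
    case (Bridge j s)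
    consider "j < i - 1" | "j = i - 1" | "j \<ge> i" by linarith
    thus ?thesis by cases (use Bridge l b i in auto)
  qed (use l b i in auto)
  show "\<not> bpos C (i - 1) (Vertex (LV i)) < bridge_len C (i - 1)" if "i > 1"
  proof -
    have "\<not> i \<le> i - 1" using that by simp
    thus ?thesis by simp
  qed
qed

lemma bpos_eq_iffs:
  assumes C: "is_loop_chain C" and i: "i \<in> {1..<loops C}" and p: "p \<in> points (chain_graph C)"
  shows "0 < s \<Longrightarrow> s < bridge_len C i \<Longrightarrow> bpos C i p = s \<longleftrightarrow> p = Inner (Bridge i) s"
    and "0 \<le> bpos C i p" "bpos C i p \<le> bridge_len C i"
proof -
  have l: "0 < bridge_len C i" using chain_lens[OF C] i by auto
  show "bpos C i p = s \<longleftrightarrow> p = Inner (Bridge i) s" if "0 < s" "s < bridge_len C i"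
    using p by (cases rule: chain_point_cases) (use that l in auto)
  show "0 \<le> bpos C i p"
    using p by (cases rule: chain_point_cases) (use l in simp_all)
  show "bpos C i p \<le> bridge_len C i"
    using p by (cases rule: chain_point_cases) (use l in auto)
qed

text \<open>
  A function with the prescribed divisor is a sum of one ramp function for each loop and each
  bridge, pulled back along the retractions \<open>pos\<close> and \<open>bpos\<close>.
\<close>

lemma AJ_imp_principal:
  assumes C: "is_loop_chain C" and D: "D \<in> divisors (chain_graph C)" and deg: "div_degree D = 0"
    and AJ: "\<And>i. i \<in> {1..loops C} \<Longrightarrow> \<exists>n::int. AJ C i D = of_int n * loop_len C i"
  shows "D \<in> principal (chain_graph C)"
proof -
  let ?G = "chain_graph C" and ?g = "loops C"
  define K where "K = Poly_Mapping.keys D"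
  define d where "d = Poly_Mapping.lookup D"
  have finK: "finite K" by (simp add: K_def)
  have Kp: "q \<in> points ?G" if "q \<in> K" for q using D that by (auto simp: K_def divisors_def)
  obtain n :: "nat \<Rightarrow> int" where n: "\<And>i. i \<in> {1..?g} \<Longrightarrow> AJ C i D = of_int (n i) * loop_len C i"
    using AJ by metis
  \<comment> \<open>The linear term is chosen so that \<open>F i\<close> has the same value at 0 and
    at \<open>loop_len C i\<close>, which makes it a function on the circle. This is where the
    condition on \<open>AJ\<close> and the degree 0 enter.\<close>
  define F where "F i x = of_int (n i) * x + ramps K (pos C i) d x" for i x
  define H where "H j x = ramps K (bpos C j) d x" for j x
  define f where "f p = (\<Sum>i\<in>{1..?g}. F i (pos C i p)) + (\<Sum>j\<in>{1..<?g}. H j (bpos C j p))" for p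
  have degK: "sum d K = 0" using deg by (simp add: K_def d_def div_degree_def)
  have F0: "F i 0 = 0" if "i \<in> {1..?g}" for i
  proof -
    have "ramps K (pos C i) d 0 = 0" unfolding ramps_def
    proof (rule sum.neutral, rule ballI)
      fix q assume "q \<in> K"
      hence "0 \<le> pos C i q" using pos_range(1)[OF C that] Kp by blast
      thus "of_int (d q) * max 0 (0 - pos C i q) = 0" by (simp add: max_def)
    qed
    thus ?thesis by (simp add: F_def)
  qed
  have FL: "F i (loop_len C i) = 0" if i: "i \<in> {1..?g}" for i
  proof -
    have "ramps K (pos C i) d (loop_len C i) = (\<Sum>q\<in>K. of_int (d q) * loop_len C i - of_int (d q) * pos C i q)"
      unfolding ramps_def
    proof (rule sum.cong)
      fix q assume "q \<in> K"
      hence "pos C i q < loop_len C i" using pos_range(2)[OF C i] Kp by blast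
      thus "of_int (d q) * max 0 (loop_len C i - pos C i q) = of_int (d q) * loop_len C i - of_int (d q) * pos C i q"
        by (simp add: max_def algebra_simps)
    qed simp
    also have "\<dots> = of_int (sum d K) * loop_len C i - AJ C i D"
      by (simp add: sum_subtractf weigh_def K_def d_def sum_distrib_right)
    finally show ?thesis using n[OF i] degK by (simp add: F_def)
  qed
  have split1: "(\<Sum>i\<in>{1..?g}. F i (pos C i p)) = F a (pos C a p) + (\<Sum>i\<in>{1..?g} - {a}. F i (pos C i p))"
    if "a \<in> {1..?g}" for a p using that by (simp add: sum.remove)
  have split2: "(\<Sum>j\<in>{1..<?g}. H j (bpos C j p)) = H a (bpos C a p) + (\<Sum>j\<in>{1..<?g} - {a}. H j (bpos C j p))"
    if "a \<in> {1..<?g}" for a p using that by (simp add: sum.remove)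
  have RU: "\<exists>c. ramp_form (upper_len C a) (\<lambda>s. f (edge_point ?G (Upper a) s)) c (n a) K (pos C a) d"
    if a: "a \<in> {1..?g}" for a
  proof -
    let ?p = "Vertex (RV a)"
    define c where "c = (\<Sum>i\<in>{1..?g} - {a}. F i (pos C i ?p)) + (\<Sum>j\<in>{1..<?g}. H j (bpos C j ?p))"
    have "f (edge_point ?G (Upper a) s) = c + of_int (n a) * s + ramps K (pos C a) d s"
      if s: "s \<in> {0..upper_len C a}" for s
    proof -
      let ?q = "edge_point ?G (Upper a) s"
      have q: "?q \<in> {Vertex (RV a), Vertex (LV a), Inner (Upper a) s}"
        by (simp add: edge_point_def chain_graph_simps)
      have "(\<Sum>i\<in>{1..?g} - {a}. F i (pos C i ?q)) = (\<Sum>i\<in>{1..?g} - {a}. F i (pos C i ?p))"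
        using q by (intro sum.cong arg_cong[where f="F _"]) auto
      moreover have "(\<Sum>j\<in>{1..<?g}. H j (bpos C j ?q)) = (\<Sum>j\<in>{1..<?g}. H j (bpos C j ?p))"
        using q by (intro sum.cong arg_cong[where f="H _"]) auto
      moreover have "pos C a ?q = s" using s by (auto simp: edge_point_def chain_graph_simps)
      ultimately show ?thesis unfolding f_def split1[OF a] c_def by (simp add: F_def)
    qed
    thus ?thesis using finK unfolding ramp_form_def by blast
  qed
  have RL: "\<exists>c. ramp_form (lower_len C a) (\<lambda>s. f (edge_point ?G (Lower a) s)) c (n a) K
      (\<lambda>q. pos C a q - upper_len C a) d"
    if a: "a \<in> {1..?g}" for a
  proof -
    let ?p = "Vertex (LV a)" and ?u = "upper_len C a"
    define c where "c = (\<Sum>i\<in>{1..?g} - {a}. F i (pos C i ?p)) + (\<Sum>j\<in>{1..<?g}. H j (bpos C j ?p))"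
    have l: "0 < ?u" "0 < lower_len C a" using chain_lens[OF C] a by auto
    have "f (edge_point ?G (Lower a) s) = (c + of_int (n a) * ?u) + of_int (n a) * s + ramps K (\<lambda>q. pos C a q - ?u) d s"
      if s: "s \<in> {0..lower_len C a}" for s
    proof -
      let ?q = "edge_point ?G (Lower a) s"
      have q: "?q \<in> {Vertex (RV a), Vertex (LV a), Inner (Lower a) s}"
        by (simp add: edge_point_def chain_graph_simps)
      have "(\<Sum>i\<in>{1..?g} - {a}. F i (pos C i ?q)) = (\<Sum>i\<in>{1..?g} - {a}. F i (pos C i ?p))"
        using q by (intro sum.cong arg_cong[where f="F _"]) auto
      moreover have "(\<Sum>j\<in>{1..<?g}. H j (bpos C j ?q)) = (\<Sum>j\<in>{1..<?g}. H j (bpos C j ?p))"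
        using q by (intro sum.cong arg_cong[where f="H _"]) auto
      moreover have "F a (pos C a ?q) = F a (?u + s)"
      proof (cases "s = lower_len C a")
        case True
        hence "pos C a ?q = 0" using l by (simp add: edge_point_def chain_graph_simps)
        thus ?thesis using F0[OF a] FL[OF a] True by (simp add: loop_len_def)
      next
        case False
        hence "pos C a ?q = ?u + s" by (auto simp: edge_point_def chain_graph_simps)
        thus ?thesis by simp
      qed
      moreover have "F a (?u + s) = of_int (n a) * ?u + of_int (n a) * s + ramps K (\<lambda>q. pos C a q - ?u) d s"
        by (simp add: F_def ramps_def algebra_simps)
      ultimately show ?thesis unfolding f_def split1[OF a] c_def by simp
    qed
    thus ?thesis using finK unfolding ramp_form_def by blast
  qed
  have RB: "\<exists>c. ramp_form (bridge_len C a) (\<lambda>s. f (edge_point ?G (Bridge a) s)) c 0 K (bpos C a) d"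
    if a: "a \<in> {1..<?g}" for a
  proof -
    let ?p = "Vertex (RV a)"
    define c where "c = (\<Sum>i\<in>{1..?g}. F i (pos C i ?p)) + (\<Sum>j\<in>{1..<?g} - {a}. H j (bpos C j ?p))"
    have "f (edge_point ?G (Bridge a) s) = c + of_int 0 * s + ramps K (bpos C a) d s"
      if s: "s \<in> {0..bridge_len C a}" for s
    proof -
      let ?q = "edge_point ?G (Bridge a) s"
      have q: "?q \<in> {Vertex (RV a), Vertex (LV (a + 1)), Inner (Bridge a) s}"
        by (simp add: edge_point_def chain_graph_simps)
      have "(\<Sum>i\<in>{1..?g}. F i (pos C i ?q)) = (\<Sum>i\<in>{1..?g}. F i (pos C i ?p))"
        using q by (intro sum.cong arg_cong[where f="F _"]) auto
      moreover have "(\<Sum>j\<in>{1..<?g} - {a}. H j (bpos C j ?q)) = (\<Sum>j\<in>{1..<?g} - {a}. H j (bpos C j ?p))"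
        using q by (intro sum.cong arg_cong[where f="H _"]) auto
      moreover have "bpos C a ?q = s" using s by (auto simp: edge_point_def chain_graph_simps)
      ultimately show ?thesis unfolding f_def split2[OF a] c_def by (simp add: H_def)
    qed
    thus ?thesis using finK unfolding ramp_form_def by blast
  qed
  define S where "S P = (\<Sum>q | q \<in> K \<and> P q. d q)" for P
  have S_le: "S (\<lambda>q. y q \<le> s) = S (\<lambda>q. y q < s) + S (\<lambda>q. y q = s)" for y :: "chain_point \<Rightarrow> real" and s
  proof -
    have "{q \<in> K. y q \<le> s} = {q \<in> K. y q < s} \<union> {q \<in> K. y q = s}" by auto
    moreover have "sum d ({q \<in> K. y q < s} \<union> {q \<in> K. y q = s}) = S (\<lambda>q. y q < s) + S (\<lambda>q. y q = s)"
      unfolding S_def by (rule sum.union_disjoint) (use finK in auto)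
    ultimately show ?thesis unfolding S_def by simp
  qed
  have S_pt: "S (\<lambda>q. q = p) = d p" for p
  proof (cases "p \<in> K")
    case True
    hence "{q \<in> K. q = p} = {p}" by auto
    thus ?thesis by (simp add: S_def)
  next
    case False
    hence "{q \<in> K. q = p} = {}" by auto
    thus ?thesis using False by (simp add: S_def d_def K_def in_keys_iff)
  qed
  have S_cong: "S P = S Q" if "\<And>q. q \<in> points ?G \<Longrightarrow> P q \<longleftrightarrow> Q q" for P Q
    unfolding S_def using that Kp by (intro sum.cong) auto
  have S_all: "S P = 0" if "\<And>q. q \<in> points ?G \<Longrightarrow> P q" for P
  proof -
    have "{q \<in> K. P q} = K" using that Kp by auto
    thus ?thesis by (simp add: S_def degK)
  qed
  have S_Un: "S (\<lambda>q. P q \<or> Q q) = S P + S Q" if "\<And>q. \<not> (P q \<and> Q q)" for P Q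
  proof -
    have "{q \<in> K. P q \<or> Q q} = {q \<in> K. P q} \<union> {q \<in> K. Q q}" by auto
    moreover have "sum d ({q \<in> K. P q} \<union> {q \<in> K. Q q}) = S P + S Q"
      unfolding S_def by (rule sum.union_disjoint) (use finK that in auto)
    ultimately show ?thesis unfolding S_def by simp
  qed
  have S_inter: "S P + S Q = S (\<lambda>q. P q \<and> Q q)" if "\<And>q. q \<in> points ?G \<Longrightarrow> P q \<or> Q q" for P Q
  proof -
    have "{q \<in> K. P q} \<union> {q \<in> K. Q q} = K" using that Kp by auto
    moreover have "{q \<in> K. P q} \<inter> {q \<in> K. Q q} = {q \<in> K. P q \<and> Q q}" by auto
    ultimately show ?thesis
      using sum.union_inter[of "{q \<in> K. P q}" "{q \<in> K. Q q}" d] finK degK by (simp add: S_def)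
  qed
  note lens = chain_lens[OF C]
  have sRU: "slope_right (\<lambda>s. f (edge_point ?G (Upper a) s)) s = of_int (n a + S (\<lambda>q. pos C a q \<le> s))"
    if a: "a \<in> {1..?g}" and "0 \<le> s" "s < upper_len C a" for a s
    using RU[OF a] ramp_form_slope_right that unfolding S_def by blast
  have sLU: "slope_left (\<lambda>s. f (edge_point ?G (Upper a) s)) s = - of_int (n a + S (\<lambda>q. pos C a q < s))"
    if a: "a \<in> {1..?g}" and "0 < s" "s \<le> upper_len C a" for a s
    using RU[OF a] ramp_form_slope_left that unfolding S_def by blast
  have sRL: "slope_right (\<lambda>s. f (edge_point ?G (Lower a) s)) s = of_int (n a + S (\<lambda>q. pos C a q - upper_len C a \<le> s))"
    if a: "a \<in> {1..?g}" and "0 \<le> s" "s < lower_len C a" for a s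
    using RL[OF a] ramp_form_slope_right that unfolding S_def by blast
  have sLL: "slope_left (\<lambda>s. f (edge_point ?G (Lower a) s)) s = - of_int (n a + S (\<lambda>q. pos C a q - upper_len C a < s))"
    if a: "a \<in> {1..?g}" and "0 < s" "s \<le> lower_len C a" for a s
    using RL[OF a] ramp_form_slope_left that unfolding S_def by blast
  have sRB: "slope_right (\<lambda>s. f (edge_point ?G (Bridge a) s)) s = of_int (S (\<lambda>q. bpos C a q \<le> s))"
    if a: "a \<in> {1..<?g}" and "0 \<le> s" "s < bridge_len C a" for a s
    using RB[OF a] ramp_form_slope_right[where n=0] that unfolding S_def by fastforce
  have sLB: "slope_left (\<lambda>s. f (edge_point ?G (Bridge a) s)) s = - of_int (S (\<lambda>q. bpos C a q < s))"
    if a: "a \<in> {1..<?g}" and "0 < s" "s \<le> bridge_len C a" for a s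
    using RB[OF a] ramp_form_slope_left[where n=0] that unfolding S_def by fastforce
  have "rational_function ?G f"
    unfolding rational_function_def
  proof
    fix e assume e: "e \<in> edges ?G"
    show "integer_piecewise_linear (elen ?G e) (\<lambda>s. f (edge_point ?G e s))"
    proof (cases e)
      case (Upper a)
      thus ?thesis using RU[of a] ramp_form_ipl e by (auto simp: chain_graph_simps)
    next
      case (Lower a)
      thus ?thesis using RL[of a] ramp_form_ipl e by (auto simp: chain_graph_simps)
    next
      case (Bridge a)
      thus ?thesis using RB[of a] ramp_form_ipl e by (auto simp: chain_graph_simps)
    qed
  qed
  moreover have "of_int (d p) = ord_at ?G f p" if p: "p \<in> points ?G" for p
    using p
  proof (cases rule: chain_point_cases)
    case (Upper a s)
    have "ord_at ?G f p = of_int (S (\<lambda>q. pos C a q = s))"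
      using sRU[of a s] sLU[of a s] S_le[of "pos C a" s] Upper by simp
    also have "S (\<lambda>q. pos C a q = s) = S (\<lambda>q. q = p)"
      using pos_eq_iffs(1)[OF C Upper(2)] Upper by (intro S_cong) simp
    finally show ?thesis by (simp add: S_pt)
  next
    case (Lower a s)
    have "ord_at ?G f p = of_int (S (\<lambda>q. pos C a q - upper_len C a = s))"
      using sRL[of a s] sLL[of a s] S_le[of "\<lambda>q. pos C a q - upper_len C a" s] Lower by simp
    also have "S (\<lambda>q. pos C a q - upper_len C a = s) = S (\<lambda>q. q = p)"
      using pos_eq_iffs(2)[OF C Lower(2)] Lower by (intro S_cong) (simp add: algebra_simps)
    finally show ?thesis by (simp add: S_pt)
  next
    case (Bridge a s)
    have "ord_at ?G f p = of_int (S (\<lambda>q. bpos C a q = s))"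
      using sRB[of a s] sLB[of a s] S_le[of "bpos C a" s] Bridge by simp
    also have "S (\<lambda>q. bpos C a q = s) = S (\<lambda>q. q = p)"
      using bpos_eq_iffs(1)[OF C Bridge(2)] Bridge by (intro S_cong) simp
    finally show ?thesis by (simp add: S_pt)
  next
    case (RV a)
    note a = RV(2)
    have hd: "{e \<in> edges ?G. head ?G e = RV a} = {Lower a}"
      using a by (auto simp: chain_graph_simps elim!: chain_head.elims)
    have tl: "{e \<in> edges ?G. tail ?G e = RV a} = {Upper a} \<union> (if a < ?g then {Bridge a} else {})"
      using a by (auto simp: chain_graph_simps elim!: chain_tail.elims)
    have "S (\<lambda>q. pos C a q - upper_len C a < lower_len C a) = 0"
      by (rule S_all) (use pos_range(2)[OF C a] in \<open>simp add: loop_len_def algebra_simps\<close>)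
    hence 1: "slope_left (\<lambda>s. f (edge_point ?G (Lower a) s)) (lower_len C a) = - of_int (n a)"
      using sLL[OF a, of "lower_len C a"] lens(2)[OF a] by simp
    have "S (\<lambda>q. pos C a q \<le> 0) = S (\<lambda>q. pos C a q = 0)"
    proof (rule S_cong)
      fix q assume "q \<in> points ?G"
      thus "pos C a q \<le> 0 \<longleftrightarrow> pos C a q = 0" using pos_range(1)[OF C a, of q] by auto
    qed
    hence 2: "slope_right (\<lambda>s. f (edge_point ?G (Upper a) s)) 0 = of_int (n a + S (\<lambda>q. pos C a q = 0))"
      using sRU[OF a, of 0] lens(1)[OF a] by simp
    show ?thesis
    proof (cases "a < ?g")
      case True
      hence a': "a \<in> {1..<?g}" using a by simp
      have "S (\<lambda>q. bpos C a q \<le> 0) = S (\<lambda>q. bpos C a q = 0)"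
      proof (rule S_cong)
        fix q assume "q \<in> points ?G"
        thus "bpos C a q \<le> 0 \<longleftrightarrow> bpos C a q = 0" using bpos_eq_iffs(2)[OF C a', of q] by auto
      qed
      hence 3: "slope_right (\<lambda>s. f (edge_point ?G (Bridge a) s)) 0 = of_int (S (\<lambda>q. bpos C a q = 0))"
        using sRB[OF a', of 0] lens(3)[OF a'] by simp
      \<comment> \<open>Every point retracts to the vertex \<open>RV a\<close> in the loop or in the
        bridge, and only the vertex itself does so in both. By inclusion and exclusion in total
        degree 0 only the coefficient at the vertex is left.\<close>
      have "S (\<lambda>q. pos C a q = 0) + S (\<lambda>q. bpos C a q = 0) = S (\<lambda>q. pos C a q = 0 \<and> bpos C a q = 0)"
        by (rule S_inter) (rule pos_eq_iffs(3)[OF C a _ True])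
      also have "\<dots> = S (\<lambda>q. q = p)" unfolding RV(1)
        by (rule S_cong) (rule pos_eq_iffs(4)[OF C a _ True])
      finally have 4: "S (\<lambda>q. pos C a q = 0) + S (\<lambda>q. bpos C a q = 0) = d p" by (simp add: S_pt)
      have "ord_at ?G f p = of_int (S (\<lambda>q. pos C a q = 0) + S (\<lambda>q. bpos C a q = 0))"
        unfolding RV(1) ord_at.simps hd tl using True by (simp add: 1 2 3 chain_graph_simps)
      thus ?thesis unfolding 4 by simp
    next
      case False
      hence ag: "a = ?g" using a by simp
      have "S (\<lambda>q. pos C a q = 0) = S (\<lambda>q. q = p)" unfolding RV(1)
        by (rule S_cong) (rule pos_eq_iffs(5)[OF C a _ ag])
      thus ?thesis unfolding RV(1) ord_at.simps hd tl using False by (simp add: 1 2 S_pt chain_graph_simps)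
    qed
  next
    case (LV a)
    note a = LV(2)
    have tl: "{e \<in> edges ?G. tail ?G e = LV a} = {Lower a}"
      using a by (auto simp: chain_graph_simps elim!: chain_tail.elims)
    have hd: "{e \<in> edges ?G. head ?G e = LV a} = {Upper a} \<union> (if a > 1 then {Bridge (a - 1)} else {})"
      using a by (auto simp: chain_graph_simps image_iff elim!: chain_head.elims)
    have 1: "slope_right (\<lambda>s. f (edge_point ?G (Lower a) s)) 0 = of_int (n a + S (\<lambda>q. pos C a q \<le> upper_len C a))"
      using sRL[OF a, of 0] lens(2)[OF a] by simp
    have 2: "slope_left (\<lambda>s. f (edge_point ?G (Upper a) s)) (upper_len C a) = - of_int (n a + S (\<lambda>q. pos C a q < upper_len C a))"
      using sLU[OF a, of "upper_len C a"] lens(1)[OF a] by simp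
    have 3: "S (\<lambda>q. pos C a q \<le> upper_len C a) - S (\<lambda>q. pos C a q < upper_len C a) = S (\<lambda>q. pos C a q = upper_len C a)"
      using S_le[of "pos C a" "upper_len C a"] by simp
    have 4: "S (\<lambda>q. pos C a q = upper_len C a) =
        S (\<lambda>q. (a > 1 \<and> bpos C (a - 1) q < bridge_len C (a - 1)) \<or> q = p)"
      unfolding LV(1) by (rule S_cong) (rule pos_eq_upper_iff(1)[OF C a])
    show ?thesis
    proof (cases "a > 1")
      case True
      hence a': "a - 1 \<in> {1..<?g}" using a by auto
      have "S (\<lambda>q. bpos C (a - 1) q < bridge_len C (a - 1) \<or> q = p)
          = S (\<lambda>q. bpos C (a - 1) q < bridge_len C (a - 1)) + S (\<lambda>q. q = p)"
        by (rule S_Un) (use pos_eq_upper_iff(2)[OF C a _ True] p LV in auto)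
      hence 5: "S (\<lambda>q. pos C a q = upper_len C a) - S (\<lambda>q. bpos C (a - 1) q < bridge_len C (a - 1)) = d p"
        using 4 True by (simp add: S_pt)
      have 6: "slope_left (\<lambda>s. f (edge_point ?G (Bridge (a - 1)) s)) (bridge_len C (a - 1))
         = - of_int (S (\<lambda>q. bpos C (a - 1) q < bridge_len C (a - 1)))"
        using sLB[OF a', of "bridge_len C (a - 1)"] lens(3)[OF a'] by simp
      have "ord_at ?G f p = of_int ((S (\<lambda>q. pos C a q \<le> upper_len C a) - S (\<lambda>q. pos C a q < upper_len C a))
          - S (\<lambda>q. bpos C (a - 1) q < bridge_len C (a - 1)))"
        unfolding LV(1) ord_at.simps hd tl using True 1 2 6 by (simp add: chain_graph_simps)
      thus ?thesis unfolding 3 5 by simp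
    next
      case False
      have "ord_at ?G f p = of_int (S (\<lambda>q. pos C a q \<le> upper_len C a) - S (\<lambda>q. pos C a q < upper_len C a))"
        unfolding LV(1) ord_at.simps hd tl using False 1 2 by (simp add: chain_graph_simps)
      thus ?thesis unfolding 3 4 using False by (simp add: S_pt)
    qed
  qed
  ultimately show ?thesis using D unfolding principal_def d_def by blast
qed

lemma principal_iff:
  assumes "is_loop_chain C" "D \<in> divisors (chain_graph C)"
  shows "D \<in> principal (chain_graph C) \<longleftrightarrow>
    div_degree D = 0 \<and> (\<forall>i\<in>{1..loops C}. [AJ C i D = 0] (rmod loop_len C i))"
proof -
  have "[x = 0] (rmod L) \<longleftrightarrow> (\<exists>n::int. x = of_int n * L)" for x L
  proof -
    have "[x = 0] (rmod L) \<longleftrightarrow> [0 = x] (rmod L)" by (rule rcong_sym_iff)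
    thus ?thesis by (simp add: rcong_altdef)
  qed
  thus ?thesis using principal_imp_AJ[OF assms(1)] AJ_imp_principal[OF assms] by blast
qed

lemma rcong_diff_0_iff: "[x - y = 0] (rmod m) \<longleftrightarrow> [x = y] (rmod m)"
  using rcong_diff_right_cancel[of x y y m] by simp

lemma loop_point_cases:
  assumes C: "is_loop_chain C" and i: "i \<in> {1..loops C}"
  obtains "x rmod loop_len C i = 0" "loop_point C i x = Vertex (RV i)"
  | "x rmod loop_len C i = upper_len C i" "loop_point C i x = Vertex (LV i)"
  | s where "0 < s" "s < upper_len C i" "x rmod loop_len C i = s" "loop_point C i x = Inner (Upper i) s"
  | s where "0 < s" "s < lower_len C i" "x rmod loop_len C i = upper_len C i + s" "loop_point C i x = Inner (Lower i) s"
proof -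
  define s where "s = x rmod loop_len C i"
  have l: "0 < upper_len C i" "0 < lower_len C i" using chain_lens[OF C] i by auto
  have s: "0 \<le> s" "s < upper_len C i + lower_len C i"
    using rmod_nonneg[of "loop_len C i" x] rmod_less[of "loop_len C i" x] loop_len_pos[OF C i]
    by (auto simp: s_def loop_len_def)
  have lp: "loop_point C i x = (if s \<le> upper_len C i then edge_point (chain_graph C) (Upper i) s
      else edge_point (chain_graph C) (Lower i) (s - upper_len C i))"
    by (simp add: loop_point_def s_def Let_def)
  consider "s = 0" | "s = upper_len C i" | "0 < s" "s < upper_len C i" | "upper_len C i < s" using s by linarith
  thus ?thesis
  proof cases
    case 1
    hence "loop_point C i x = Vertex (RV i)" using lp l by (simp add: edge_point_def chain_graph_simps)
    thus ?thesis using that(1)[folded s_def] 1 by blast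
  next
    case 2
    hence "loop_point C i x = Vertex (LV i)" using lp l by (simp add: edge_point_def chain_graph_simps)
    thus ?thesis using that(2)[folded s_def] 2 by blast
  next
    case 3
    hence "loop_point C i x = Inner (Upper i) s" using lp by (simp add: edge_point_def chain_graph_simps)
    thus ?thesis using that(3)[folded s_def] 3 by blast
  next
    case 4
    hence "loop_point C i x = Inner (Lower i) (s - upper_len C i)"
      using lp s by (simp add: edge_point_def chain_graph_simps)
    moreover have "0 < s - upper_len C i" "s - upper_len C i < lower_len C i"
      "s = upper_len C i + (s - upper_len C i)" using 4 s by auto
    ultimately show ?thesis using that(4)[folded s_def] by blast
  qed
qed

lemma loop_point_in_points:
  assumes C: "is_loop_chain C" and i: "i \<in> {1..loops C}"
  shows "loop_point C i x \<in> points (chain_graph C)"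
  by (rule loop_point_cases[OF C i, of x]) (use i in \<open>auto simp: points_def chain_graph_simps\<close>)

lemma pos_loop_point:
  assumes C: "is_loop_chain C" and i: "i \<in> {1..loops C}"
  shows "pos C i (loop_point C i x) = x rmod loop_len C i"
    and "j \<noteq> i \<Longrightarrow> pos C j (loop_point C i x) = (if i < j then upper_len C j else 0)"
proof -
  show "pos C i (loop_point C i x) = x rmod loop_len C i"
    by (rule loop_point_cases[OF C i, of x]) simp_all
  show "j \<noteq> i \<Longrightarrow> pos C j (loop_point C i x) = (if i < j then upper_len C j else 0)"
    by (rule loop_point_cases[OF C i, of x]) simp_all
qed

lemma loop_point_eq_iff:
  assumes C: "is_loop_chain C" and i: "i \<in> {1..loops C}"
  shows "loop_point C i x = loop_point C i y \<longleftrightarrow> [x = y] (rmod loop_len C i)"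
proof
  assume "loop_point C i x = loop_point C i y"
  thus "[x = y] (rmod loop_len C i)" using pos_loop_point(1)[OF C i] by (metis rcong_def)
next
  assume "[x = y] (rmod loop_len C i)"
  thus "loop_point C i x = loop_point C i y" by (simp add: loop_point_def rcong_def)
qed

lemma div_degree_simps:
  "div_degree (D + E) = div_degree D + div_degree E"
  "div_degree (D - E) = div_degree D - div_degree E"
  "div_degree (frag_cmul c D) = c * div_degree D"
  "div_degree (frag_of p) = 1"
  "div_degree (\<Sum>i\<in>I. F i) = (\<Sum>i\<in>I. div_degree (F i))"
proof -
  have inj: "a = b" if "real_of_int a = real_of_int b" for a b using that by simp
  show "div_degree (D + E) = div_degree D + div_degree E"
    by (rule inj) (simp add: div_degree_weigh weigh_add)
  show "div_degree (D - E) = div_degree D - div_degree E"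
    by (rule inj) (simp add: div_degree_weigh weigh_diff)
  show "div_degree (frag_cmul c D) = c * div_degree D"
    by (rule inj) (simp add: div_degree_weigh weigh_cmul)
  show "div_degree (frag_of p) = 1"
    by (rule inj) (simp add: div_degree_weigh weigh_frag_of)
  show "div_degree (\<Sum>i\<in>I. F i) = (\<Sum>i\<in>I. div_degree (F i))"
    by (rule inj) (simp add: div_degree_weigh weigh_sum)
qed

lemma in_div_class_iff:
  assumes C: "is_loop_chain C" and D: "D \<in> divisors (chain_graph C)"
  shows "E \<in> div_class (chain_graph C) D \<longleftrightarrow> E \<in> divisors (chain_graph C) \<and> div_degree E = div_degree D \<and>
    (\<forall>i\<in>{1..loops C}. [AJ C i D = AJ C i E] (rmod loop_len C i))"
proof -
  have "E \<in> div_class (chain_graph C) D \<longleftrightarrow> E \<in> divisors (chain_graph C) \<and> D - E \<in> principal (chain_graph C)"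
    using D by (auto simp: div_class_def lin_equiv_def)
  thus ?thesis using principal_iff[OF C divisors_diff[OF D]]
    by (auto simp: div_degree_simps weigh_diff rcong_diff_0_iff)
qed

lemma div_class_eq_iff:
  assumes C: "is_loop_chain C" and D: "D \<in> divisors (chain_graph C)" and E: "E \<in> divisors (chain_graph C)"
  shows "div_class (chain_graph C) D = div_class (chain_graph C) E \<longleftrightarrow> div_degree D = div_degree E \<and>
    (\<forall>i\<in>{1..loops C}. [AJ C i D = AJ C i E] (rmod loop_len C i))"
proof
  assume "div_class (chain_graph C) D = div_class (chain_graph C) E"
  moreover have "E \<in> div_class (chain_graph C) E" using in_div_class_iff[OF C E] E by simp
  ultimately show "div_degree D = div_degree E \<and>
    (\<forall>i\<in>{1..loops C}. [AJ C i D = AJ C i E] (rmod loop_len C i))"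
    using in_div_class_iff[OF C D] by auto
next
  assume a: "div_degree D = div_degree E \<and>
    (\<forall>i\<in>{1..loops C}. [AJ C i D = AJ C i E] (rmod loop_len C i))"
  have "(\<forall>i\<in>{1..loops C}. [AJ C i D = AJ C i F] (rmod loop_len C i)) \<longleftrightarrow>
      (\<forall>i\<in>{1..loops C}. [AJ C i E = AJ C i F] (rmod loop_len C i))" for F
    using a by (meson rcong_sym rcong_trans)
  thus "div_class (chain_graph C) D = div_class (chain_graph C) E"
    using a by (intro set_eqI) (simp add: in_div_class_iff[OF C D] in_div_class_iff[OF C E])
qed

subsection \<open>Effective divisors and ranks on chains of loops\<close>

fun loop_index :: "chain_point \<Rightarrow> nat" where
  "loop_index (Vertex (LV j)) = j"
| "loop_index (Vertex (RV j)) = j"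
| "loop_index (Inner (Upper j) s) = j"
| "loop_index (Inner (Lower j) s) = j"
| "loop_index (Inner (Bridge j) s) = j"

text \<open>\<open>t i\<close> counts the chips on the first \<open>i\<close> loops.\<close>

lemma effective_data:
  assumes C: "is_loop_chain C" and E: "E \<in> divisors (chain_graph C)" and eff: "effective E"
  shows "\<exists>t::nat \<Rightarrow> nat. t 0 = 0 \<and> (\<forall>i. t i \<le> t (Suc i)) \<and> int (t (loops C)) = div_degree E \<and>
    (\<forall>i<loops C. t i < t (Suc i) \<or> [AJ C (Suc i) E = upper_len C (Suc i) * t i] (rmod loop_len C (Suc i)))"
proof -
  define K where "K = Poly_Mapping.keys E"
  define d where "d = Poly_Mapping.lookup E"
  define T where "T i = (\<Sum>q | q \<in> K \<and> loop_index q \<le> i. d q)" for i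
  have d0: "0 \<le> d q" for q using eff by (simp add: effective_def d_def)
  have dK: "0 < d q" if "q \<in> K" for q
    using d0[of q] that by (simp add: K_def d_def in_keys_iff order.not_eq_order_implies_strict)
  have fin: "finite K" by (simp add: K_def)
  have Kp: "q \<in> points (chain_graph C)" if "q \<in> K" for q using E that by (auto simp: divisors_def K_def)
  have idx: "loop_index q \<in> {1..loops C}" if "q \<in> K" for q
    using Kp[OF that] by (cases rule: chain_point_cases) auto
  have T0: "0 \<le> T i" for i unfolding T_def by (rule sum_nonneg) (rule d0)
  have split: "T (Suc i) = T i + (\<Sum>q | q \<in> K \<and> loop_index q = Suc i. d q)" for i
  proof -
    have "{q \<in> K. loop_index q \<le> Suc i} = {q \<in> K. loop_index q \<le> i} \<union> {q \<in> K. loop_index q = Suc i}" by auto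
    thus ?thesis unfolding T_def by (simp add: sum.union_disjoint[symmetric] fin Int_def) 
  qed
  have mono: "T i \<le> T (Suc i)" for i unfolding split by (simp add: sum_nonneg d0)
  have "{q \<in> K. loop_index q \<le> 0} = {}" using idx by force
  hence T00: "T 0 = 0" by (simp only: T_def sum.empty)
  have "{q \<in> K. loop_index q \<le> loops C} = K" using idx by auto
  hence TG: "T (loops C) = div_degree E" unfolding T_def by (simp add: div_degree_def K_def d_def)
  have AJ: "T i < T (Suc i) \<or> AJ C (Suc i) E = upper_len C (Suc i) * of_int (T i)" for i
  proof (rule disjCI)
    assume n: "AJ C (Suc i) E \<noteq> upper_len C (Suc i) * of_int (T i)"
    show "T i < T (Suc i)"
    proof (rule ccontr)
      assume "\<not> T i < T (Suc i)"
      hence z: "(\<Sum>q | q \<in> K \<and> loop_index q = Suc i. d q) = 0" using mono[of i] split[of i] by simp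
      have no: "loop_index q \<noteq> Suc i" if "q \<in> K" for q
      proof
        assume "loop_index q = Suc i"
        hence "d q = 0" using z that fin by (subst (asm) sum_nonneg_eq_0_iff) (auto simp: d0)
        thus False using dK[OF that] by simp
      qed
      have "AJ C (Suc i) E = (\<Sum>q\<in>K. if loop_index q \<le> i then upper_len C (Suc i) * of_int (d q) else 0)"
        unfolding weigh_def K_def[symmetric] d_def[symmetric]
      proof (rule sum.cong)
        fix q assume q: "q \<in> K"
        \<comment> \<open>With no chip of index \<open>i + 1\<close>, all earlier chips retract to
          the left vertex of that loop and all later ones to its right vertex, which is at position
          0.\<close>
        have "pos C (Suc i) q = (if loop_index q \<le> i then upper_len C (Suc i) else 0)"
          using Kp[OF q] no[OF q] by (cases rule: chain_point_cases) auto
        thus "of_int (d q) * pos C (Suc i) q = (if loop_index q \<le> i then upper_len C (Suc i) * of_int (d q) else 0)"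
          by simp
      qed simp
      also have "\<dots> = (\<Sum>q | q \<in> K \<and> loop_index q \<le> i. upper_len C (Suc i) * of_int (d q))"
        using fin by (simp add: sum.inter_filter)
      also have "\<dots> = upper_len C (Suc i) * of_int (T i)" by (simp add: T_def sum_distrib_left)
      finally show False using n by simp
    qed
  qed
  define t where "t i = nat (T i)" for i
  have tT: "int (t i) = T i" for i using T0 by (simp add: t_def)
  have "t i < t (Suc i) \<or> [AJ C (Suc i) E = upper_len C (Suc i) * t i] (rmod loop_len C (Suc i))" for i
  proof -
    have e: "of_int (T i) = real (t i)" using tT[of i] by (metis of_int_of_nat_eq)
    from AJ[of i] show ?thesis
    proof
      assume "T i < T (Suc i)" thus ?thesis using tT[of i] tT[of "Suc i"] by linarith
    next
      assume "AJ C (Suc i) E = upper_len C (Suc i) * of_int (T i)"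
      thus ?thesis unfolding e by simp
    qed
  qed
  moreover have "t i \<le> t (Suc i)" for i using mono[of i] by (simp add: t_def)
  moreover have "t 0 = 0" using T00 by (simp add: t_def)
  moreover have "int (t (loops C)) = div_degree E" using TG tT by simp
  ultimately show ?thesis by blast
qed

text \<open>On a loop that receives chips, one of them is used to correct the coordinate. The others
  sit at the right vertex, where they do not affect this coordinate and count only as degree for the
  later loops.\<close>

lemma effective_exists:
  assumes C: "is_loop_chain C" and G: "1 \<le> loops C"
    and mono: "\<And>i. i < loops C \<Longrightarrow> t i \<le> t (Suc i)"
    and z: "\<And>i. i < loops C \<Longrightarrow> t i < t (Suc i) \<or>
      [z (Suc i) = upper_len C (Suc i) * real (t i)] (rmod loop_len C (Suc i))"
  shows "\<exists>E\<in>divisors (chain_graph C). effective E \<and> div_degree E = int (t (loops C)) \<and>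
    (\<forall>i\<in>{1..loops C}. [AJ C i E = z i] (rmod loop_len C i))"
proof -
  let ?G = "chain_graph C"
  \<comment> \<open>The \<open>t i\<close> earlier chips all retract to the left vertex of this loop
    and contribute \<open>upper_len\<close> each.\<close>
  define x where "x i = loop_point C (Suc i) (z (Suc i) - upper_len C (Suc i) * real (t i))" for i
  define F where "F i = (if t i < t (Suc i) then
      frag_cmul (int (t (Suc i) - t i - 1)) (frag_of (Vertex (RV (Suc i)))) + frag_of (x i) else 0)" for i
  define E where "E = frag_cmul (int (t 0)) (frag_of (Vertex (LV 1))) + (\<Sum>i<loops C. F i)"
  have xp: "x i \<in> points ?G" if "i < loops C" for i
    unfolding x_def using that by (intro loop_point_in_points[OF C]) auto
  have Fd: "F i \<in> divisors ?G" if "i < loops C" for i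
    unfolding F_def using that xp[OF that]
    by (auto intro!: divisors_add divisors_cmul divisors_0 simp: divisors_frag_of points_def chain_graph_simps)
  have Ed: "E \<in> divisors ?G" unfolding E_def using G Fd
    by (intro divisors_add divisors_cmul divisors_sum) (auto simp: divisors_frag_of points_def chain_graph_simps)
  have Feff: "0 \<le> Poly_Mapping.lookup (F i) p" for i p
    by (simp add: F_def lookup_add)
  have lsum: "Poly_Mapping.lookup (\<Sum>i<n. F i) p = (\<Sum>i<n. Poly_Mapping.lookup (F i) p)" for n p
    by (induction n) (auto simp: lookup_add)
  have "effective E" unfolding effective_def E_def
    by (auto simp: lookup_add lsum intro!: add_nonneg_nonneg sum_nonneg Feff)
  moreover have "div_degree E = int (t (loops C))"
  proof -
    have "div_degree (F i) = int (t (Suc i)) - int (t i)" if "i < loops C" for i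
      using mono[OF that] by (auto simp: F_def div_degree_simps of_nat_diff) (simp add: div_degree_def)
    hence "(\<Sum>i<loops C. div_degree (F i)) = (\<Sum>i<loops C. int (t (Suc i)) - int (t i))" by simp
    also have "\<dots> = int (t (loops C)) - int (t 0)" by (rule sum_lessThan_telescope)
    finally show ?thesis by (simp add: E_def div_degree_simps)
  qed
  moreover have "[AJ C i E = z i] (rmod loop_len C i)" if i: "i \<in> {1..loops C}" for i
  proof -
    obtain a where a: "i = Suc a" "a < loops C" using i by (cases i) auto
    have A: "AJ C i (F b) = (if b < a then upper_len C i * (real (t (Suc b)) - real (t b)) else 0)"
      if "b < loops C" "b \<noteq> a" for b
    proof -
      have "pos C i (x b) = (if Suc b < i then upper_len C i else 0)" unfolding x_def
        by (rule pos_loop_point(2)[OF C]) (use that a in auto)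
      thus ?thesis using that a mono[OF that(1)]
        by (auto simp: F_def weigh_simps of_nat_diff algebra_simps)
    qed
    have own: "AJ C i (F a) = (if t a < t (Suc a) then (z i - upper_len C i * real (t a)) rmod loop_len C i else 0)"
      using pos_loop_point(1)[OF C i] a by (simp add: F_def weigh_simps x_def)
    have "(\<Sum>b<loops C. AJ C i (F b)) = AJ C i (F a) + (\<Sum>b\<in>{..<loops C} - {a}. AJ C i (F b))"
      using a by (simp add: sum.remove)
    also have "(\<Sum>b\<in>{..<loops C} - {a}. AJ C i (F b)) =
       (\<Sum>b\<in>{..<loops C} - {a}. if b < a then upper_len C i * (real (t (Suc b)) - real (t b)) else 0)"
      by (rule sum.cong) (use A in auto)
    also have "\<dots> = (\<Sum>b<a. upper_len C i * (real (t (Suc b)) - real (t b)))"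
      by (rule sum.mono_neutral_cong_right) (use a in auto)
    also have "\<dots> = upper_len C i * (real (t a) - real (t 0))"
      by (simp add: sum_distrib_left[symmetric] sum_lessThan_telescope[of "\<lambda>n. real (t n)"])
    finally have S: "AJ C i E = AJ C i (F a) + upper_len C i * real (t a)"
      using i by (simp add: E_def weigh_simps algebra_simps)
    show ?thesis
    proof (cases "t a < t (Suc a)")
      case True
      have "[(z i - upper_len C i * real (t a)) rmod loop_len C i + upper_len C i * real (t a) =
        (z i - upper_len C i * real (t a)) + upper_len C i * real (t a)] (rmod loop_len C i)"
        by (intro rcong_add rcong_rmod_left rcong_refl)
      thus ?thesis unfolding S own using True by simp
    next
      case False
      thus ?thesis unfolding S own using z[OF a(2)] a(1) by (simp add: rcong_sym)
    qed
  qed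
  ultimately show ?thesis using Ed by blast
qed

text \<open>The least degree of an effective divisor with Abel--Jacobi image \<open>y\<close>, loop by loop.\<close>

fun greedy :: "loop_chain \<Rightarrow> (nat \<Rightarrow> real) \<Rightarrow> nat \<Rightarrow> nat" where
  "greedy C y 0 = 0"
| "greedy C y (Suc i) =
    (if [y (Suc i) = upper_len C (Suc i) * real (greedy C y i)] (rmod loop_len C (Suc i))
     then greedy C y i else Suc (greedy C y i))"

lemma greedy_cong: "(\<And>i. 1 \<le> i \<Longrightarrow> i \<le> n \<Longrightarrow> [y i = y' i] (rmod loop_len C i)) \<Longrightarrow> greedy C y n = greedy C y' n"
proof (induction n)
  case (Suc n)
  have "[y (Suc n) = y' (Suc n)] (rmod loop_len C (Suc n))" using Suc.prems by simp
  hence "[y (Suc n) = w] (rmod loop_len C (Suc n)) \<longleftrightarrow> [y' (Suc n) = w] (rmod loop_len C (Suc n))" for w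
    by (metis rcong_sym rcong_trans)
  moreover have "greedy C y n = greedy C y' n" using Suc by simp
  ultimately show ?case by simp
qed simp

lemma equiv_effective_iff:
  assumes C: "is_loop_chain C" and G: "1 \<le> loops C" and D: "D \<in> divisors (chain_graph C)"
  shows "equiv_effective (chain_graph C) D \<longleftrightarrow> int (greedy C (\<lambda>i. AJ C i D) (loops C)) \<le> div_degree D"
proof
  let ?s = "greedy C (\<lambda>i. AJ C i D)"
  assume "equiv_effective (chain_graph C) D"
  then obtain E where E: "E \<in> divisors (chain_graph C)" "effective E" "div_degree E = div_degree D"
      "\<And>i. i \<in> {1..loops C} \<Longrightarrow> [AJ C i D = AJ C i E] (rmod loop_len C i)"
    unfolding equiv_effective_def using in_div_class_iff[OF C D] by blast
  obtain t where t: "t 0 = 0" "\<And>i. t i \<le> t (Suc i)" "int (t (loops C)) = div_degree E"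
    "\<And>i. i < loops C \<Longrightarrow> t i < t (Suc i) \<or> [AJ C (Suc i) E = upper_len C (Suc i) * t i] (rmod loop_len C (Suc i))"
    using effective_data[OF C E(1,2)] by blast
  have "i \<le> loops C \<Longrightarrow> ?s i \<le> t i" for i
  proof (induction i)
    case (Suc i)
    hence IH: "?s i \<le> t i" by simp
    show ?case
    proof (cases "?s i = t i \<and> t i = t (Suc i)")
      case True
      hence "[AJ C (Suc i) E = upper_len C (Suc i) * ?s i] (rmod loop_len C (Suc i))" using t(4)[of i] Suc by simp
      hence "[AJ C (Suc i) D = upper_len C (Suc i) * ?s i] (rmod loop_len C (Suc i))"
        using E(4)[of "Suc i"] Suc by (auto intro: rcong_trans)
      thus ?thesis using True by simp
    next
      case False
      hence "Suc (?s i) \<le> t (Suc i)" using IH t(2)[of i] by linarith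
      thus ?thesis by simp
    qed
  qed simp
  thus "int (?s (loops C)) \<le> div_degree D" using t(3) E(3) by (metis of_nat_mono order.refl)
next
  let ?s = "greedy C (\<lambda>i. AJ C i D)"
  assume le: "int (?s (loops C)) \<le> div_degree D"
  define t where "t i = (if i < loops C then ?s i else nat (div_degree D))" for i
  have "\<exists>E\<in>divisors (chain_graph C). effective E \<and> div_degree E = int (t (loops C)) \<and>
    (\<forall>i\<in>{1..loops C}. [AJ C i E = AJ C i D] (rmod loop_len C i))"
  proof (rule effective_exists[OF C G])
    fix i assume i: "i < loops C"
    have s: "?s i \<le> ?s (Suc i)" by simp
    have le': "?s (Suc i) \<le> t (Suc i)"
    proof (cases "Suc i < loops C")
      case False
      hence "Suc i = loops C" using i by simp
      thus ?thesis using le by (simp add: t_def del: greedy.simps)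
    qed (simp add: t_def)
    show "t i \<le> t (Suc i)" using s le' i by (simp add: t_def del: greedy.simps)
    show "t i < t (Suc i) \<or> [AJ C (Suc i) D = upper_len C (Suc i) * real (t i)] (rmod loop_len C (Suc i))"
    proof (cases "[AJ C (Suc i) D = upper_len C (Suc i) * real (?s i)] (rmod loop_len C (Suc i))")
      case True thus ?thesis using i by (simp add: t_def)
    next
      case False
      hence "?s i < ?s (Suc i)" by simp
      thus ?thesis using le' i by (simp add: t_def del: greedy.simps)
    qed
  qed
  then obtain E where E: "E \<in> divisors (chain_graph C)" "effective E" "div_degree E = int (t (loops C))"
    "\<forall>i\<in>{1..loops C}. [AJ C i E = AJ C i D] (rmod loop_len C i)" by blast
  have "div_degree E = div_degree D" using E(3) le by (simp add: t_def)
  hence "E \<in> div_class (chain_graph C) D"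
    using in_div_class_iff[OF C D, of E] E by (auto intro: rcong_sym)
  thus "equiv_effective (chain_graph C) D" using E(2) by (auto simp: equiv_effective_def)
qed

text \<open>
  \<open>thr C y (loops C) d\<close> is the least degree in which the Abel--Jacobi image \<open>y\<close> has rank at
  least \<open>d\<close>.
\<close>

fun thr :: "loop_chain \<Rightarrow> (nat \<Rightarrow> real) \<Rightarrow> nat \<Rightarrow> nat \<Rightarrow> nat" where
  "thr C y 0 j = j"
| "thr C y (Suc i) j =
    (if [y (Suc i) = upper_len C (Suc i) * real (thr C y i j)] (rmod loop_len C (Suc i))
        \<and> (j = 0 \<or> Suc (thr C y i (j - 1)) \<noteq> thr C y i j)
     then thr C y i j else Suc (thr C y i j))"

lemma thr_mono: "thr C y i j < thr C y i (Suc j)"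
proof (induction i arbitrary: j)
  case (Suc i)
  have "thr C y i j < thr C y i (Suc j)" by (rule Suc)
  thus ?case by (cases "Suc (thr C y i j) = thr C y i (Suc j)") (auto intro: Suc_lessI)
qed simp

lemma thr_mono_add: "thr C y i j + n \<le> thr C y i (j + n)"
proof (induction n)
  case (Suc n)
  have "thr C y i (j + n) < thr C y i (Suc (j + n))" by (rule thr_mono)
  thus ?case using Suc by simp
qed simp

lemma thr_0: "thr C y i 0 = greedy C y i"
  by (induction i) auto

text \<open>\<open>z\<close> and \<open>t\<close> describe an effective divisor that an adversary
  subtracts. A chip spent on loop \<open>i + 1\<close> may cost one chip more there; starting from
  \<open>thr C y i (j - 1)\<close> this exceeds \<open>thr C y i j\<close> only if the two
  thresholds are adjacent, which is the exception in the recursion of \<open>thr\<close>.\<close>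

lemma greedy_le_thr:
  assumes "\<And>i. t i \<le> t (Suc i)" "t 0 = 0"
    and z: "\<And>i. i < n \<Longrightarrow> t i < t (Suc i) \<or>
      [z (Suc i) = upper_len C (Suc i) * real (t i)] (rmod loop_len C (Suc i))"
  shows "i \<le> n \<Longrightarrow> greedy C (\<lambda>i. y i - z i) i + t i \<le> thr C y i (t i)"
proof (induction i)
  case 0 thus ?case using assms by simp
next
  case (Suc i)
  let ?s = "greedy C (\<lambda>i. y i - z i)" and ?M = "thr C y i"
  have IH: "?s i + t i \<le> ?M (t i)" using Suc by simp
  have s: "?s (Suc i) \<le> Suc (?s i)" by simp
  have M: "?M (t (Suc i)) \<le> thr C y (Suc i) (t (Suc i))" by simp
  show ?case
  proof (cases "t i < t (Suc i)")
    case True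
    then obtain e where e: "t (Suc i) = t i + Suc e" by (metis add_Suc_right less_iff_Suc_add)
    have 1: "?M (t i) + e \<le> ?M (t i + e)" by (rule thr_mono_add)
    have 2: "?M (t i + e) < ?M (t i + Suc e)" using thr_mono by simp
    have "?M (t i) + Suc (Suc e) \<le> thr C y (Suc i) (t (Suc i))"
    proof (cases "Suc (?M (t i + e)) = ?M (t i + Suc e)")
      case True
      hence "thr C y (Suc i) (t (Suc i)) = Suc (?M (t i + Suc e))" using e by simp
      thus ?thesis using 1 2 by simp
    next
      case False
      thus ?thesis using 1 2 M e by simp
    qed
    thus ?thesis using IH s e by linarith
  next
    case False
    hence eq: "t (Suc i) = t i" using assms(1)[of i] by simp
    hence zc: "[z (Suc i) = upper_len C (Suc i) * real (t i)] (rmod loop_len C (Suc i))" using z[of i] Suc.prems by simp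
    show ?thesis
    proof (cases "?s i + t i < ?M (t i)")
      case True thus ?thesis using s M unfolding eq by linarith
    next
      case False
      hence sM: "?M (t i) = ?s i + t i" using IH by simp
      show ?thesis
      proof (cases "[y (Suc i) = upper_len C (Suc i) * real (?M (t i))] (rmod loop_len C (Suc i))")
        case True
        have "[y (Suc i) - z (Suc i) = upper_len C (Suc i) * real (?M (t i)) - upper_len C (Suc i) * real (t i)] (rmod loop_len C (Suc i))"
          by (rule rcong_diff[OF True zc])
        hence "[y (Suc i) - z (Suc i) = upper_len C (Suc i) * real (?s i)] (rmod loop_len C (Suc i))"
          by (simp add: sM algebra_simps)
        hence "?s (Suc i) = ?s i" by simp
        thus ?thesis using IH M eq by simp
      next
        case n: False
        hence "thr C y (Suc i) (t (Suc i)) = Suc (?M (t i))" using eq by simp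
        thus ?thesis using IH s unfolding eq by linarith
      qed
    qed
  qed
qed

text \<open>The adversary follows the recursion: it spends a chip on loop \<open>i + 1\<close> when
  the coordinate matches and the thresholds are adjacent, and otherwise none.\<close>

lemma thr_attained:
  assumes C: "is_loop_chain C"
  shows "i \<le> loops C \<Longrightarrow> \<exists>t z. t i = j \<and> (\<forall>a<i. t a \<le> t (Suc a)) \<and>
    (\<forall>a<i. t a < t (Suc a) \<or> [z (Suc a) = upper_len C (Suc a) * real (t a)] (rmod loop_len C (Suc a))) \<and>
    greedy C (\<lambda>i. y i - z i) i + j = thr C y i j"
proof (induction i arbitrary: j)
  case 0 show ?case by (intro exI[of _ "\<lambda>_. j"]) simp
next
  case (Suc i)
  let ?M = "thr C y i" and ?u = "upper_len C (Suc i)" and ?L = "loop_len C (Suc i)"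
  let ?P = "\<lambda>M. [y (Suc i) = ?u * real M] (rmod ?L)"
  have ext: "\<exists>t z. t (Suc i) = j \<and> (\<forall>a<Suc i. t a \<le> t (Suc a)) \<and>
    (\<forall>a<Suc i. t a < t (Suc a) \<or> [z (Suc a) = upper_len C (Suc a) * real (t a)] (rmod loop_len C (Suc a))) \<and>
    greedy C (\<lambda>i. y i - z i) (Suc i) + j = thr C y (Suc i) j"
    if t: "t i = j'" "\<forall>a<i. t a \<le> t (Suc a)"
      "\<forall>a<i. t a < t (Suc a) \<or> [z (Suc a) = upper_len C (Suc a) * real (t a)] (rmod loop_len C (Suc a))"
      and s: "greedy C (\<lambda>i. y i - z i) i = s" and j': "j' \<le> j"
      and x: "j' < j \<or> [x = ?u * real j'] (rmod ?L)"
      and fin: "(if [y (Suc i) - x = ?u * real s] (rmod ?L) then s else Suc s) + j = thr C y (Suc i) j"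
    for t z j' x s
  proof -
    define t' z' where "t' = t(Suc i := j)" and "z' = z(Suc i := x)"
    have g: "greedy C (\<lambda>i. y i - z' i) i = s" unfolding s[symmetric]
      by (rule greedy_cong) (simp add: z'_def)
    have "greedy C (\<lambda>i. y i - z' i) (Suc i) = (if [y (Suc i) - x = ?u * real s] (rmod ?L) then s else Suc s)"
      using g by (simp add: z'_def)
    thus ?thesis using t j' x fin
      by (intro exI[of _ t'] exI[of _ z']) (auto simp: t'_def z'_def less_Suc_eq)
  qed
  have L: "0 < ?L" using loop_len_pos[OF C] Suc.prems by simp
  have half: "\<not> [w + ?L / 2 = w] (rmod ?L)" for w
  proof
    assume "[w + ?L / 2 = w] (rmod ?L)"
    then obtain n :: int where "w = w + ?L / 2 + of_int n * ?L" unfolding rcong_altdef by blast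
    hence "(1 / 2 + of_int n) * ?L = 0" by (simp add: algebra_simps)
    hence "1 / 2 + real_of_int n = 0" using L by simp
    hence "real_of_int (1 + 2 * n) = 0" by simp
    hence "1 + 2 * n = 0" by (simp only: of_int_eq_0_iff)
    thus False by presburger
  qed
  show ?case
  proof (cases "?P (?M j) \<and> j \<noteq> 0 \<and> Suc (?M (j - 1)) = ?M j")
    case True
    obtain t z where t: "t i = j - 1" "\<forall>a<i. t a \<le> t (Suc a)"
      "\<forall>a<i. t a < t (Suc a) \<or> [z (Suc a) = upper_len C (Suc a) * real (t a)] (rmod loop_len C (Suc a))"
      "greedy C (\<lambda>i. y i - z i) i + (j - 1) = ?M (j - 1)"
      using Suc.IH[of "j - 1"] Suc.prems by auto
    define s where "s = greedy C (\<lambda>i. y i - z i) i"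
    \<comment> \<open>Half a turn away from the only value at which \<open>greedy\<close> would need
      no new chip.\<close>
    define x where "x = y (Suc i) - (?u * real s + ?L / 2)"
    have sj: "s + j = ?M j" using t(4) True by (cases j) (auto simp: s_def)
    show ?thesis
    proof (rule ext[OF t(1-3) s_def[symmetric]])
      show "(if [y (Suc i) - x = ?u * real s] (rmod ?L) then s else Suc s) + j = thr C y (Suc i) j"
        using True sj half[of "?u * real s"] by (simp add: x_def)
    qed (use True in auto)
  next
    case False
    obtain t z where t: "t i = j" "\<forall>a<i. t a \<le> t (Suc a)"
      "\<forall>a<i. t a < t (Suc a) \<or> [z (Suc a) = upper_len C (Suc a) * real (t a)] (rmod loop_len C (Suc a))"
      "greedy C (\<lambda>i. y i - z i) i + j = ?M j"
      using Suc.IH[of j] Suc.prems by auto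
    define s where "s = greedy C (\<lambda>i. y i - z i) i"
    have sM: "real s = real (?M j) - real j" using t(4) by (simp add: s_def)
    have "[y (Suc i) - ?u * real j = ?u * real s] (rmod ?L) \<longleftrightarrow> ?P (?M j)"
      using rcong_diff_right_cancel[of "y (Suc i)" "?u * real j" "?u * real (?M j)" ?L]
      by (simp add: sM algebra_simps)
    hence "(if [y (Suc i) - ?u * real j = ?u * real s] (rmod ?L) then s else Suc s) + j = thr C y (Suc i) j"
      using False t(4) by (auto simp: s_def)
    thus ?thesis by (intro ext[OF t(1-3) s_def[symmetric], of "?u * real j"]) auto
  qed
qed

lemma rank_ge_iff:
  assumes C: "is_loop_chain C" and G: "1 \<le> loops C" and D: "D \<in> divisors (chain_graph C)"
  shows "(\<forall>E\<in>divisors (chain_graph C). effective E \<and> div_degree E = int d \<longrightarrow>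
      equiv_effective (chain_graph C) (D - E)) \<longleftrightarrow> int (thr C (\<lambda>i. AJ C i D) (loops C) d) \<le> div_degree D"
proof
  assume le: "int (thr C (\<lambda>i. AJ C i D) (loops C) d) \<le> div_degree D"
  show "\<forall>E\<in>divisors (chain_graph C). effective E \<and> div_degree E = int d \<longrightarrow>
      equiv_effective (chain_graph C) (D - E)"
  proof (intro ballI impI)
    fix E assume E: "E \<in> divisors (chain_graph C)" "effective E \<and> div_degree E = int d"
    obtain t where t: "t 0 = 0" "\<And>i. t i \<le> t (Suc i)" "int (t (loops C)) = div_degree E"
      "\<And>i. i < loops C \<Longrightarrow> t i < t (Suc i) \<or> [AJ C (Suc i) E = upper_len C (Suc i) * t i] (rmod loop_len C (Suc i))"
      using effective_data[OF C E(1)] E(2) by blast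
    have "greedy C (\<lambda>i. AJ C i D - AJ C i E) (loops C) + t (loops C) \<le> thr C (\<lambda>i. AJ C i D) (loops C) (t (loops C))"
      by (rule greedy_le_thr[where n = "loops C", OF t(2,1,4)]) auto
    thus "equiv_effective (chain_graph C) (D - E)"
      using le t(3) E equiv_effective_iff[OF C G divisors_diff[OF D E(1)]]
      by (simp add: weigh_diff div_degree_simps)
  qed
next
  assume H: "\<forall>E\<in>divisors (chain_graph C). effective E \<and> div_degree E = int d \<longrightarrow>
      equiv_effective (chain_graph C) (D - E)"
  let ?y = "\<lambda>i. AJ C i D"
  obtain t z where t: "t (loops C) = d" "\<forall>a<loops C. t a \<le> t (Suc a)"
    "\<forall>a<loops C. t a < t (Suc a) \<or> [z (Suc a) = upper_len C (Suc a) * real (t a)] (rmod loop_len C (Suc a))"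
    "greedy C (\<lambda>i. ?y i - z i) (loops C) + d = thr C ?y (loops C) d"
    using thr_attained[OF C, of "loops C" d ?y] by auto
  obtain E where E: "E \<in> divisors (chain_graph C)" "effective E" "div_degree E = int (t (loops C))"
    "\<forall>i\<in>{1..loops C}. [AJ C i E = z i] (rmod loop_len C i)"
    using effective_exists[OF C G, of t z] t by blast
  have "greedy C (\<lambda>i. AJ C i (D - E)) (loops C) = greedy C (\<lambda>i. ?y i - z i) (loops C)"
  proof (rule greedy_cong)
    fix i assume "1 \<le> i" "i \<le> loops C"
    hence "[AJ C i E = z i] (rmod loop_len C i)" using E by simp
    thus "[AJ C i (D - E) = ?y i - z i] (rmod loop_len C i)"
      unfolding weigh_diff by (intro rcong_diff rcong_refl)
  qed
  moreover have "equiv_effective (chain_graph C) (D - E)" using H E t(1) by simp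
  ultimately have "int (greedy C (\<lambda>i. ?y i - z i) (loops C)) \<le> div_degree D - int d"
    using equiv_effective_iff[OF C G divisors_diff[OF D E(1)]] E(3) t(1) by (simp add: div_degree_simps)
  thus "int (thr C ?y (loops C) d) \<le> div_degree D" using t(4) by simp
qed

lemma bn_rank_ge_iff:
  assumes C: "is_loop_chain C" and G: "1 \<le> loops C" and D: "D \<in> divisors (chain_graph C)"
  shows "int d \<le> bn_rank (chain_graph C) D \<longleftrightarrow> int (thr C (\<lambda>i. AJ C i D) (loops C) d) \<le> div_degree D"
    and "- 1 \<le> bn_rank (chain_graph C) D"
proof -
  let ?M = "thr C (\<lambda>i. AJ C i D) (loops C)"
  let ?Q = "\<lambda>d. int (?M d) \<le> div_degree D"
  have Mge: "d \<le> ?M d" for d using thr_mono_add[of C "\<lambda>i. AJ C i D" "loops C" 0 d] by simp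
  have Mmono: "?M d \<le> ?M e" if "d \<le> e" for d e
    using thr_mono_add[of C "\<lambda>i. AJ C i D" "loops C" d "e - d"] that by simp
  have bound: "d \<le> nat (div_degree D)" if "?Q d" for d using Mge[of d] that by linarith
  have r: "bn_rank (chain_graph C) D = (if ?Q 0 then int (GREATEST d. ?Q d) else - 1)"
    unfolding bn_rank_def rank_ge_iff[OF C G D] equiv_effective_iff[OF C G D] thr_0 by simp
  show "- 1 \<le> bn_rank (chain_graph C) D" unfolding r by simp
  show "int d \<le> bn_rank (chain_graph C) D \<longleftrightarrow> ?Q d"
  proof (cases "?Q 0")
    case True
    have g: "?Q (GREATEST d. ?Q d)" by (rule GreatestI_nat[of ?Q 0, OF True]) (use bound in auto)
    show ?thesis
    proof
      assume "int d \<le> bn_rank (chain_graph C) D"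
      hence "d \<le> (GREATEST d. ?Q d)" using r True by simp
      thus "?Q d" using g Mmono by (meson of_nat_mono order.trans)
    next
      assume "?Q d"
      hence "d \<le> (GREATEST d. ?Q d)" by (rule Greatest_le_nat) (use bound in auto)
      thus "int d \<le> bn_rank (chain_graph C) D" using r True by simp
    qed
  next
    case False
    moreover have "\<not> ?Q d" using False Mmono[of 0 d] by linarith
    ultimately show ?thesis using r by simp
  qed
qed

subsection \<open>The folded chain\<close>

lemma weigh_pushforward: "weigh W (pushforward \<phi> D) = weigh (\<lambda>p. W (\<phi> p)) D"
  by (simp add: pushforward_def frag_extend_def weigh_simps) (simp add: weigh_def)

lemma div_degree_pushforward: "div_degree (pushforward \<phi> D) = div_degree D"
proof -
  have "real_of_int (div_degree (pushforward \<phi> D)) = real_of_int (div_degree D)"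
    by (simp only: div_degree_weigh weigh_pushforward)
  thus ?thesis by simp
qed

lemma rcong_weigh:
  assumes "\<And>p. p \<in> Poly_Mapping.keys D \<Longrightarrow> [W p = W' p] (rmod L)"
  shows "[weigh W D = weigh W' D] (rmod L)"
proof -
  obtain n :: "'a \<Rightarrow> int" where n: "\<And>p. p \<in> Poly_Mapping.keys D \<Longrightarrow> W' p = W p + of_int (n p) * L"
    using assms unfolding rcong_altdef by metis
  have "weigh W' D = (\<Sum>p\<in>Poly_Mapping.keys D. of_int (Poly_Mapping.lookup D p) * W p
      + of_int (Poly_Mapping.lookup D p * n p) * L)"
    unfolding weigh_def by (rule sum.cong) (simp_all add: n algebra_simps)
  also have "\<dots> = weigh W D + of_int (\<Sum>p\<in>Poly_Mapping.keys D. Poly_Mapping.lookup D p * n p) * L"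
    by (simp add: sum.distrib weigh_def sum_distrib_right)
  finally show ?thesis unfolding rcong_altdef by blast
qed

lemma pushforward_divisors:
  assumes "D \<in> divisors G" "\<And>p. p \<in> points G \<Longrightarrow> \<phi> p \<in> points H"
  shows "pushforward \<phi> D \<in> divisors H"
  unfolding pushforward_def frag_extend_def
  by (intro divisors_sum divisors_cmul) (use assms in \<open>auto simp: divisors_def\<close>)

locale folded_chain =
  fixes C :: loop_chain and g :: nat and \<Delta> :: loop_chain
  assumes C: "is_loop_chain C" and g_def: "g = loops C" and g2: "2 \<le> g"
    and \<Delta>_def: "\<Delta> = double_chain C"
begin

lemma double_simps:
  "loops \<Delta> = 2 * g - 1"
  "i < g \<Longrightarrow> upper_len \<Delta> i = upper_len C i" "i < g \<Longrightarrow> lower_len \<Delta> i = lower_len C i"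
  "i < g \<Longrightarrow> loop_len \<Delta> i = loop_len C i"
  "upper_len \<Delta> g = loop_len C g" "lower_len \<Delta> g = loop_len C g"
  "loop_len \<Delta> g = 2 * loop_len C g"
  "1 \<le> i \<Longrightarrow> i < g \<Longrightarrow> upper_len \<Delta> (2 * g - i) = upper_len C i"
  "1 \<le> i \<Longrightarrow> i < g \<Longrightarrow> lower_len \<Delta> (2 * g - i) = lower_len C i"
  "1 \<le> i \<Longrightarrow> i < g \<Longrightarrow> loop_len \<Delta> (2 * g - i) = loop_len C i"
  "i < g \<Longrightarrow> bridge_len \<Delta> i = bridge_len C i"
  "g \<le> i \<Longrightarrow> bridge_len \<Delta> i = bridge_len C (2 * g - 1 - i)"
  by (auto simp: \<Delta>_def double_chain_def Let_def g_def[symmetric] fold_index_def loop_len_def)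

lemma double_right:
  assumes "g < i" "i \<le> 2 * g - 1"
  shows "upper_len \<Delta> i = upper_len C (2 * g - i)" "lower_len \<Delta> i = lower_len C (2 * g - i)"
    "loop_len \<Delta> i = loop_len C (2 * g - i)"
  using double_simps(8-10)[of "2 * g - i"] assms by auto

lemma g_in: "g \<in> {1..loops C}" "a \<in> {1..<g} \<Longrightarrow> a \<in> {1..loops C}"
  using g2 by (auto simp: g_def)

lemma double_chain_ok: "is_loop_chain \<Delta>"
proof -
  have L: "0 < loop_len C g" using loop_len_pos[OF C g_in(1)] .
  have "0 < upper_len \<Delta> a \<and> 0 < lower_len \<Delta> a" if "a \<in> {1..2 * g - 1}" for a
  proof -
    consider "a < g" | "a = g" | "g < a" by linarith
    thus ?thesis
    proof cases
      case 1 thus ?thesis using that chain_lens[OF C, of a] double_simps(2,3)[of a] g_def by auto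
    next
      case 2 thus ?thesis using L double_simps by simp
    next
      case 3
      hence "2 * g - a \<in> {1..loops C}" using that g_def by auto
      thus ?thesis using chain_lens[OF C] double_right[OF 3] that by simp
    qed
  qed
  moreover have "0 < bridge_len \<Delta> a" if "a \<in> {1..<2 * g - 1}" for a
  proof (cases "a < g")
    case True thus ?thesis using that chain_lens(3)[OF C, of a] double_simps(11)[of a] g_def by simp
  next
    case False
    hence "2 * g - 1 - a \<in> {1..<loops C}" using that g_def by auto
    thus ?thesis using chain_lens(3)[OF C] double_simps(12)[of a] False by simp
  qed
  ultimately show ?thesis by (simp add: is_loop_chain_def double_simps)
qed

lemma in_double: "i \<in> {1..2 * g - 1} \<Longrightarrow> i \<in> {1..loops \<Delta>}" "g \<in> {1..loops \<Delta>}"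
  "a \<in> {1..<g} \<Longrightarrow> a \<in> {1..loops \<Delta>}" "a \<in> {1..<g} \<Longrightarrow> 2 * g - a \<in> {1..loops \<Delta>}"
  using g2 by (auto simp: double_simps)

lemma fold_map_points:
  assumes "p \<in> points (chain_graph \<Delta>)" shows "fold_map C p \<in> points (chain_graph C)"
  using assms
proof (cases rule: chain_point_cases)
  case (LV j)
  have "2 * g - j \<in> {1..g}" if "\<not> j \<le> g" using LV that double_simps by auto
  thus ?thesis using LV by (auto simp: points_def chain_graph_simps double_simps g_def[symmetric])
next
  case (RV j)
  have "2 * g - j \<in> {1..g}" if "\<not> j < g" using RV that double_simps by auto
  thus ?thesis using RV by (auto simp: points_def chain_graph_simps double_simps g_def[symmetric])
next
  case (Upper j s)
  have j: "j \<in> {1..2 * g - 1}" using Upper double_simps by simp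
  consider "j < g" | "j = g" | "g < j" by linarith
  thus ?thesis
  proof cases
    case 1 thus ?thesis using Upper j double_simps(2)[of j]
      by (auto simp: points_def chain_graph_simps g_def[symmetric] Let_def)
  next
    case 2 thus ?thesis using Upper loop_point_in_points[OF C g_in(1)]
      by (simp add: g_def[symmetric] Let_def)
  next
    case 3
    have "2 * g - j \<in> {1..g}" using 3 j by auto
    thus ?thesis using Upper j 3 double_right[of j]
      by (auto simp: points_def chain_graph_simps g_def[symmetric] Let_def)
  qed
next
  case (Lower j s)
  have j: "j \<in> {1..2 * g - 1}" using Lower double_simps by simp
  consider "j < g" | "j = g" | "g < j" by linarith
  thus ?thesis
  proof cases
    case 1 thus ?thesis using Lower j double_simps(3)[of j]
      by (auto simp: points_def chain_graph_simps g_def[symmetric] Let_def)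
  next
    case 2 thus ?thesis using Lower loop_point_in_points[OF C g_in(1)]
      by (simp add: g_def[symmetric] Let_def)
  next
    case 3
    have "2 * g - j \<in> {1..g}" using 3 j by auto
    thus ?thesis using Lower j 3 double_right[of j]
      by (auto simp: points_def chain_graph_simps g_def[symmetric] Let_def)
  qed
next
  case (Bridge j s)
  have j: "j \<in> {1..<2 * g - 1}" using Bridge double_simps by simp
  show ?thesis
  proof (cases "j < g")
    case True thus ?thesis using Bridge j double_simps(11)[of j]
      by (auto simp: points_def chain_graph_simps g_def[symmetric] Let_def)
  next
    case False
    have "2 * g - 1 - j \<in> {1..<g}" using False j by auto
    thus ?thesis using Bridge j False double_simps(12)[of j]
      by (auto simp: points_def chain_graph_simps g_def[symmetric] Let_def)
  qed
qed

lemma rcong_add_L: "[x + L = x] (rmod L)" "[x = x + L] (rmod L)"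
proof -
  show "[x = x + L] (rmod L)" unfolding rcong_altdef by (intro exI[of _ 1]) simp
  thus "[x + L = x] (rmod L)" by (rule rcong_sym)
qed

text \<open>Every point of the cover is beyond at least one of the loops \<open>a\<close> and
  \<open>2 * g - a\<close>, so one of the two retractions is constant on its part and the other
  describes the image. The minus sign reflects that loop \<open>2 * g - a\<close> is traversed
  backwards.\<close>

lemma pos_fold_map:
  assumes a: "a \<in> {1..<g}" and p: "p \<in> points (chain_graph \<Delta>)"
  shows "[pos C a (fold_map C p) = pos \<Delta> a p + upper_len C a - pos \<Delta> (2 * g - a) p] (rmod loop_len C a)"
proof -
  let ?u = "upper_len C a"
  have u: "upper_len \<Delta> a = ?u" "upper_len \<Delta> (2 * g - a) = ?u" "lower_len \<Delta> (2 * g - a) = lower_len C a"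
    using a double_simps(2,8,9)[of a] by auto
  have ga: "\<not> g < a" "a \<noteq> g" using a by auto
  have lpg: "pos C a (loop_point C g x) = 0" for x using pos_loop_point(2)[OF C g_in(1)] ga by simp
  show ?thesis using p
  proof (cases rule: chain_point_cases)
    case (LV j)
    have "j \<le> 2 * g - 1" "1 \<le> j" using LV double_simps by auto
    thus ?thesis using LV a u by (auto simp: g_def[symmetric])
  next
    case (RV j)
    have "j \<le> 2 * g - 1" "1 \<le> j" using RV double_simps by auto
    thus ?thesis using RV a u by (auto simp: g_def[symmetric])
  next
    case (Upper j s)
    have j: "j \<le> 2 * g - 1" "1 \<le> j" using Upper double_simps by auto
    consider "j < g" | "j = g" | "g < j" "j = 2 * g - a" | "g < j" "j < 2 * g - a" | "g < j" "2 * g - a < j" by linarith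
    thus ?thesis
    proof cases
      case 1 thus ?thesis using Upper a u by (auto simp: g_def[symmetric] Let_def)
    next
      case 2 thus ?thesis using Upper a u lpg by (auto simp: g_def[symmetric] Let_def)
    next
      case 3
      hence "2 * g - j = a" using a by auto
      thus ?thesis using Upper a u 3 by (simp add: g_def[symmetric] Let_def)
    next
      case 4
      hence "a < 2 * g - j" by auto
      thus ?thesis using Upper a u 4 by (simp add: g_def[symmetric] Let_def)
    next
      case 5
      hence "2 * g - j < a" using j by auto
      thus ?thesis using Upper a u 5 by (simp add: g_def[symmetric] Let_def)
    qed
  next
    case (Lower j s)
    have j: "j \<le> 2 * g - 1" "1 \<le> j" using Lower double_simps by auto
    consider "j < g" | "j = g" | "g < j" "j = 2 * g - a" | "g < j" "j < 2 * g - a" | "g < j" "2 * g - a < j" by linarith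
    thus ?thesis
    proof cases
      case 1 thus ?thesis using Lower a u by (auto simp: g_def[symmetric] Let_def)
    next
      case 2 thus ?thesis using Lower a u lpg by (auto simp: g_def[symmetric] Let_def)
    next
      case 3
      hence e: "2 * g - j = a" using a by auto
      have "pos C a (fold_map C p) = - s + loop_len C a"
        using Lower a u 3 e by (simp add: g_def[symmetric] Let_def loop_len_def)
      moreover have "pos \<Delta> a p + ?u - pos \<Delta> (2 * g - a) p = - s"
        using Lower a u 3 by simp
      ultimately show ?thesis using rcong_add_L(1)[of "- s" "loop_len C a"] by simp
    next
      case 4
      hence "a < 2 * g - j" by auto
      thus ?thesis using Lower a u 4 by (simp add: g_def[symmetric] Let_def)
    next
      case 5
      hence "2 * g - j < a" using j by auto
      thus ?thesis using Lower a u 5 by (simp add: g_def[symmetric] Let_def)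
    qed
  next
    case (Bridge j s)
    have j: "j < 2 * g - 1" "1 \<le> j" using Bridge double_simps by auto
    consider "j < g" | "g \<le> j" "j < 2 * g - a" | "g \<le> j" "2 * g - a \<le> j" by linarith
    thus ?thesis
    proof cases
      case 1 thus ?thesis using Bridge a u by (auto simp: g_def[symmetric] Let_def)
    next
      case 2
      hence "\<not> 2 * g - 1 - j < a" by auto
      thus ?thesis using Bridge a u 2 by (simp add: g_def[symmetric] Let_def)
    next
      case 3
      hence "2 * g - 1 - j < a" using j a by auto
      moreover have "j \<noteq> 2 * g - a \<longrightarrow> 2 * g - a < j" using 3 by auto
      ultimately show ?thesis using Bridge a u 3 by (cases "j = 2 * g - a") (simp_all add: g_def[symmetric] Let_def)
    qed
  qed
qed

lemma pos_fold_map_mid: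
  assumes p: "p \<in> points (chain_graph \<Delta>)"
  shows "[pos C g (fold_map C p) = upper_len C g + pos \<Delta> g p] (rmod loop_len C g)"
proof -
  let ?u = "upper_len C g" and ?L = "loop_len C g"
  have lpg: "pos C g (loop_point C g x) = x rmod ?L" for x using pos_loop_point(1)[OF C g_in(1)] .
  have L: "[?u = ?u + ?L] (rmod ?L)" by (rule rcong_add_L)
  show ?thesis using p
  proof (cases rule: chain_point_cases)
    case (LV j)
    have "j \<le> 2 * g - 1" "1 \<le> j" using LV double_simps by auto
    thus ?thesis using LV double_simps L by (auto simp: g_def[symmetric])
  next
    case (RV j)
    have "j \<le> 2 * g - 1" "1 \<le> j" using RV double_simps by auto
    thus ?thesis using RV double_simps L by (auto simp: g_def[symmetric])
  next
    case (Upper j s)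
    have j: "j \<le> 2 * g - 1" "1 \<le> j" using Upper double_simps by auto
    consider "j < g" | "j = g" | "g < j" by linarith
    thus ?thesis
    proof cases
      case 2 thus ?thesis using Upper lpg by (simp add: g_def[symmetric] Let_def rcong_sym)
    next
      case 3
      hence "2 * g - j < g" using g2 by arith
      thus ?thesis using Upper 3 by (simp add: g_def[symmetric] Let_def)
    qed (use Upper double_simps L in \<open>simp add: g_def[symmetric] Let_def\<close>)
  next
    case (Lower j s)
    have j: "j \<le> 2 * g - 1" "1 \<le> j" using Lower double_simps by auto
    consider "j < g" | "j = g" | "g < j" by linarith
    thus ?thesis
    proof cases
      case 2
      have "[(?u + s) rmod ?L = ?u + s + ?L] (rmod ?L)" by (intro rcong_rmod_left rcong_add_L)
      thus ?thesis using Lower lpg 2 double_simps by (simp add: g_def[symmetric] Let_def algebra_simps)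
    next
      case 3
      hence "2 * g - j < g" using g2 by arith
      thus ?thesis using Lower 3 by (simp add: g_def[symmetric] Let_def)
    qed (use Lower double_simps L in \<open>simp add: g_def[symmetric] Let_def\<close>)
  next
    case (Bridge j s)
    have j: "j < 2 * g - 1" "1 \<le> j" using Bridge double_simps by auto
    show ?thesis
    proof (cases "j < g")
      case False
      hence "2 * g - 1 - j < g" using j by auto
      thus ?thesis using Bridge False by (simp add: g_def[symmetric] Let_def)
    qed (use Bridge double_simps L in \<open>simp add: g_def[symmetric] Let_def\<close>)
  qed
qed

section \<open>The canonical divisor and the norm condition\<close>

lemma valence_chain:
  assumes "j \<in> {1..g}"
  shows "valence (chain_graph C) (LV j) = (if 1 < j then 3 else 2)"
    and "valence (chain_graph C) (RV j) = (if j < g then 3 else 2)"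
proof -
  let ?G = "chain_graph C"
  have "{e \<in> edges ?G. tail ?G e = LV j} = {Lower j}"
    using assms by (auto simp: chain_graph_simps g_def[symmetric] elim!: chain_tail.elims)
  moreover have "{e \<in> edges ?G. head ?G e = LV j} = {Upper j} \<union> (if 1 < j then {Bridge (j - 1)} else {})"
    using assms by (auto simp: chain_graph_simps g_def[symmetric] image_iff elim!: chain_head.elims)
  ultimately show "valence ?G (LV j) = (if 1 < j then 3 else 2)" by (simp add: valence_def)
  have "{e \<in> edges ?G. head ?G e = RV j} = {Lower j}"
    using assms by (auto simp: chain_graph_simps g_def[symmetric] elim!: chain_head.elims)
  moreover have "{e \<in> edges ?G. tail ?G e = RV j} = {Upper j} \<union> (if j < g then {Bridge j} else {})"
    using assms by (auto simp: chain_graph_simps g_def[symmetric] elim!: chain_tail.elims)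
  ultimately show "valence ?G (RV j) = (if j < g then 3 else 2)" by (simp add: valence_def)
qed

lemma weigh_canonical:
  "weigh W (canonical_divisor (chain_graph C)) =
    (\<Sum>j\<in>{1<..g}. W (Vertex (LV j))) + (\<Sum>j\<in>{1..<g}. W (Vertex (RV j)))"
proof -
  let ?G = "chain_graph C"
  let ?f = "\<lambda>v. of_int (int (valence ?G v) - 2) * W (Vertex v)"
  have "weigh W (canonical_divisor ?G) = (\<Sum>v\<in>verts ?G. ?f v)"
    by (simp add: canonical_divisor_def weigh_simps)
  also have "\<dots> = (\<Sum>v\<in>LV ` {1..g}. ?f v) + (\<Sum>v\<in>RV ` {1..g}. ?f v)"
    unfolding chain_graph_simps g_def[symmetric] by (rule sum.union_disjoint) auto
  also have "\<dots> = (\<Sum>j\<in>{1..g}. ?f (LV j)) + (\<Sum>j\<in>{1..g}. ?f (RV j))"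
    by (simp add: sum.reindex inj_on_def)
  also have "(\<Sum>j\<in>{1..g}. ?f (LV j)) = (\<Sum>j\<in>{1..g}. if 1 < j then W (Vertex (LV j)) else 0)"
    by (rule sum.cong) (simp_all add: valence_chain)
  also have "\<dots> = (\<Sum>j\<in>{1<..g}. W (Vertex (LV j)))"
    by (rule sum.mono_neutral_cong_right) auto
  also have "(\<Sum>j\<in>{1..g}. ?f (RV j)) = (\<Sum>j\<in>{1..g}. if j < g then W (Vertex (RV j)) else 0)"
    by (rule sum.cong) (simp_all add: valence_chain)
  also have "\<dots> = (\<Sum>j\<in>{1..<g}. W (Vertex (RV j)))"
    by (rule sum.mono_neutral_cong_right) auto
  finally show ?thesis .
qed

lemma canonical_divisors: "canonical_divisor (chain_graph C) \<in> divisors (chain_graph C)"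
  unfolding canonical_divisor_def
  by (intro divisors_sum divisors_cmul) (simp add: divisors_frag_of points_def)

lemma degree_canonical: "div_degree (canonical_divisor (chain_graph C)) = 2 * int g - 2"
proof -
  have "real_of_int (div_degree (canonical_divisor (chain_graph C))) = of_int (2 * int g - 2)"
    unfolding div_degree_weigh weigh_canonical using g2 by (simp add: of_nat_diff)
  thus ?thesis by (simp only: of_int_eq_iff)
qed

lemma AJ_canonical:
  assumes a: "a \<in> {1..g}"
  shows "AJ C a (canonical_divisor (chain_graph C)) = 2 * (real a - 1) * upper_len C a"
proof -
  have "(\<Sum>j\<in>{1<..g}. pos C a (Vertex (LV j))) = (\<Sum>j\<in>{1<..a}. upper_len C a)"
    by (rule sum.mono_neutral_cong_right) (use a in auto)
  moreover have "(\<Sum>j\<in>{1..<g}. pos C a (Vertex (RV j))) = (\<Sum>j\<in>{1..<a}. upper_len C a)"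
    by (rule sum.mono_neutral_cong_right) (use a in auto)
  ultimately show ?thesis unfolding weigh_canonical using a by (simp add: of_nat_diff algebra_simps)
qed

text \<open>The correction stands for one point on each of the \<open>i - 1\<close> earlier loops,
  retracted to the left vertex; with it the coordinates of a Prym divisor become its
  parameters.\<close>

definition coord :: "chain_divisor \<Rightarrow> nat \<Rightarrow> real" where
  "coord D i = AJ \<Delta> i D - upper_len \<Delta> i * (real i - 1)"

text \<open>The canonical divisor has a chip at each \<open>LV j\<close> with \<open>1 < j\<close>
  and at each \<open>RV j\<close> with \<open>j < g\<close>, which balances the corrections in
  \<open>coord\<close>. The middle coordinate is determined only modulo \<open>loop_len C g\<close>,
  half of its period, and the two possible values will fix the parity of the rank.\<close>

lemma norm_condition_iff:
  assumes D: "D \<in> divisors (chain_graph \<Delta>)" and deg: "div_degree D = 2 * int g - 2"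
  shows "div_class (chain_graph C) (pushforward (fold_map C) D) =
      div_class (chain_graph C) (canonical_divisor (chain_graph C)) \<longleftrightarrow>
    (\<forall>a\<in>{1..<g}. [coord D a = coord D (2 * g - a)] (rmod loop_len C a)) \<and>
    [coord D g = 0] (rmod loop_len C g)"
proof -
  let ?F = "pushforward (fold_map C) D" and ?K = "canonical_divisor (chain_graph C)"
  have F: "?F \<in> divisors (chain_graph C)" by (rule pushforward_divisors[OF D fold_map_points])
  have keys: "p \<in> points (chain_graph \<Delta>)" if "p \<in> Poly_Mapping.keys D" for p
    using D that by (auto simp: divisors_def)
  have dd: "real_of_int (div_degree D) = 2 * real g - 2" using deg by simp
  have 1: "[AJ C a ?F = AJ C a ?K] (rmod loop_len C a) \<longleftrightarrow> [coord D a = coord D (2 * g - a)] (rmod loop_len C a)"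
    if a: "a \<in> {1..<g}" for a
  proof -
    let ?u = "upper_len C a"
    have u: "upper_len \<Delta> a = ?u" "upper_len \<Delta> (2 * g - a) = ?u" using a double_simps(2,8)[of a] by auto
    have "[AJ C a ?F = weigh (\<lambda>p. pos \<Delta> a p + ?u - pos \<Delta> (2 * g - a) p) D] (rmod loop_len C a)"
      unfolding weigh_pushforward by (rule rcong_weigh) (rule pos_fold_map[OF a keys])
    moreover have "weigh (\<lambda>p. pos \<Delta> a p + ?u - pos \<Delta> (2 * g - a) p) D =
        AJ \<Delta> a D + ?u * weigh (\<lambda>_. 1) D - AJ \<Delta> (2 * g - a) D"
      by (simp add: weigh_def algebra_simps sum.distrib sum_subtractf sum_distrib_left)
    ultimately have F': "[AJ C a ?F = AJ \<Delta> a D + ?u * (2 * real g - 2) - AJ \<Delta> (2 * g - a) D] (rmod loop_len C a)"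
      by (simp add: div_degree_weigh[symmetric] dd)
    have cs: "coord D (2 * g - a) = AJ \<Delta> (2 * g - a) D - ?u * (2 * real g - real a - 1)"
      using a by (simp only: coord_def u) (simp add: of_nat_diff)
    have "AJ \<Delta> a D + ?u * (2 * real g - 2) - AJ \<Delta> (2 * g - a) D - AJ C a ?K = coord D a - coord D (2 * g - a)"
      unfolding cs using a by (simp add: AJ_canonical coord_def u(1) algebra_simps)
    hence "[AJ \<Delta> a D + ?u * (2 * real g - 2) - AJ \<Delta> (2 * g - a) D = AJ C a ?K] (rmod loop_len C a) \<longleftrightarrow>
        [coord D a = coord D (2 * g - a)] (rmod loop_len C a)"
      by (metis rcong_diff_0_iff)
    thus ?thesis using F' by (meson rcong_sym rcong_trans)
  qed
  have 2: "[AJ C g ?F = AJ C g ?K] (rmod loop_len C g) \<longleftrightarrow> [coord D g = 0] (rmod loop_len C g)"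
  proof -
    let ?u = "upper_len C g" and ?L = "loop_len C g"
    have "[AJ C g ?F = weigh (\<lambda>p. ?u + pos \<Delta> g p) D] (rmod ?L)"
      unfolding weigh_pushforward by (rule rcong_weigh) (rule pos_fold_map_mid[OF keys])
    moreover have "weigh (\<lambda>p. ?u + pos \<Delta> g p) D = ?u * weigh (\<lambda>_. 1) D + AJ \<Delta> g D"
      by (simp add: weigh_def algebra_simps sum.distrib sum_distrib_left)
    ultimately have F': "[AJ C g ?F = ?u * (2 * real g - 2) + AJ \<Delta> g D] (rmod ?L)"
      by (simp add: div_degree_weigh[symmetric] dd)
    have K: "AJ C g ?K = ?u * (2 * real g - 2)" using g2 by (simp add: AJ_canonical algebra_simps)
    have "[AJ C g ?F = AJ C g ?K] (rmod ?L) \<longleftrightarrow> [?u * (2 * real g - 2) + AJ \<Delta> g D = ?u * (2 * real g - 2) + 0] (rmod ?L)"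
      unfolding K add_0_right using F' by (meson rcong_sym rcong_trans)
    also have "\<dots> \<longleftrightarrow> [AJ \<Delta> g D = 0] (rmod ?L)" by (rule rcong_add_left_cancel)
    also have "\<dots> \<longleftrightarrow> [coord D g = 0] (rmod ?L)"
    proof -
      have "coord D g = AJ \<Delta> g D + of_int (1 - int g) * ?L"
        by (simp add: coord_def double_simps algebra_simps)
      hence "[AJ \<Delta> g D = coord D g] (rmod ?L)" unfolding rcong_altdef by blast
      thus ?thesis by (meson rcong_sym rcong_trans)
    qed
    finally show ?thesis .
  qed
  let ?Q = "\<lambda>a. [AJ C a ?F = AJ C a ?K] (rmod loop_len C a)"
  have "{1..loops C} = insert g {1..<g}" using g2 g_def by auto
  hence "(\<forall>a\<in>{1..loops C}. ?Q a) \<longleftrightarrow> (\<forall>a\<in>{1..<g}. ?Q a) \<and> ?Q g" by auto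
  also have "(\<forall>a\<in>{1..<g}. ?Q a) \<longleftrightarrow> (\<forall>a\<in>{1..<g}. [coord D a = coord D (2 * g - a)] (rmod loop_len C a))"
    by (rule ball_cong[OF refl 1])
  finally have q: "(\<forall>a\<in>{1..loops C}. ?Q a) \<longleftrightarrow>
     (\<forall>a\<in>{1..<g}. [coord D a = coord D (2 * g - a)] (rmod loop_len C a)) \<and> ?Q g" .
  show ?thesis
    by (simp only: div_class_eq_iff[OF C F canonical_divisors] div_degree_pushforward degree_canonical deg q 2 simp_thms)
qed

text \<open>Tells which bead positions can move at loop \<open>i\<close>. The guard makes it sparse
  for every index, beyond the ends of the chain as well.\<close>

definition coord_pred :: "(nat \<Rightarrow> real) \<Rightarrow> nat \<Rightarrow> int \<Rightarrow> bool" where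
  "coord_pred x i z \<longleftrightarrow> i \<in> {1..2 * g - 1} \<and> [x i = upper_len \<Delta> i * of_int z] (rmod loop_len \<Delta> i)"

lemma rcong_small: "[x = 0] (rmod L) \<Longrightarrow> 0 < x \<Longrightarrow> x < L \<Longrightarrow> False"
proof -
  assume a: "[x = 0] (rmod L)" "0 < x" "x < L"
  then obtain n :: int where n: "0 = x + of_int n * L" unfolding rcong_altdef by blast
  have L: "0 < L" using a by simp
  have "of_int n * L < 0" using n a by linarith
  hence "n < 0" using L by (simp add: mult_less_0_iff)
  hence "of_int n \<le> (-1 :: real)" by linarith
  hence "of_int n * L \<le> -1 * L" using L by (intro mult_right_mono) auto
  thus False using n a by linarith
qed

lemma sparse_coord_pred: "sparse (coord_pred x i)"
  unfolding sparse_def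
proof (intro allI impI notI)
  fix z assume a: "coord_pred x i z" "coord_pred x i (z + 1)"
  hence i: "i \<in> {1..loops \<Delta>}" by (simp add: coord_pred_def double_simps)
  have "[upper_len \<Delta> i * of_int (z + 1) = upper_len \<Delta> i * of_int z] (rmod loop_len \<Delta> i)"
    using a unfolding coord_pred_def by (meson rcong_sym rcong_trans)
  hence "[upper_len \<Delta> i * of_int (z + 1) - upper_len \<Delta> i * of_int z = 0] (rmod loop_len \<Delta> i)"
    by (simp only: rcong_diff_0_iff)
  hence "[upper_len \<Delta> i = 0] (rmod loop_len \<Delta> i)" by (simp add: algebra_simps)
  thus False using rcong_small[of "upper_len \<Delta> i" "loop_len \<Delta> i"] chain_lens(1)[OF double_chain_ok i] chain_lens(2)[OF double_chain_ok i]
    by (simp add: loop_len_def)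
qed

text \<open>At each loop a threshold stays or grows by one; after subtracting the number of loops,
  the bead moves left by one or stays.\<close>

lemma thr_eq_run:
  "i \<le> 2 * g - 1 \<Longrightarrow> int (thr \<Delta> (\<lambda>i. AJ \<Delta> i D) i j) - int i = run (coord_pred (coord D)) i int j"
proof (induction i arbitrary: j)
  case (Suc i)
  let ?M = "thr \<Delta> (\<lambda>i. AJ \<Delta> i D) i" and ?u = "upper_len \<Delta> (Suc i)" and ?L = "loop_len \<Delta> (Suc i)"
  have IH: "run (coord_pred (coord D)) i int j = int (?M j) - int i" for j using Suc by simp
  have "coord_pred (coord D) (Suc i) (int (?M j) - int i) \<longleftrightarrow> [AJ \<Delta> (Suc i) D = ?u * real (?M j)] (rmod ?L)"
  proof -
    have "[coord D (Suc i) = ?u * of_int (int (?M j) - int i)] (rmod ?L) \<longleftrightarrow>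
       [AJ \<Delta> (Suc i) D - ?u * real i = ?u * real (?M j) - ?u * real i] (rmod ?L)"
      by (simp add: coord_def algebra_simps)
    thus ?thesis using Suc.prems by (simp add: coord_pred_def)
  qed
  moreover have "(int (?M (j - 1)) - int i \<noteq> int (?M j) - int i - 1) \<longleftrightarrow> Suc (?M (j - 1)) \<noteq> ?M j" by auto
  ultimately show ?case by (simp add: lower_def IH)
qed simp

lemma prym_rank:
  assumes D: "D \<in> divisors (chain_graph \<Delta>)" and deg: "div_degree D = 2 * int g - 2"
    and sym: "\<And>a. a \<in> {1..<g} \<Longrightarrow> [coord D a = coord D (2 * g - a)] (rmod loop_len C a)"
    and mid: "[coord D g = of_int n * loop_len C g] (rmod 2 * loop_len C g)"
  shows "[bn_rank (chain_graph \<Delta>) D = n] (mod 2)"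
    and "r \<ge> -1 \<Longrightarrow> [r = n] (mod 2) \<Longrightarrow> r \<le> bn_rank (chain_graph \<Delta>) D \<longleftrightarrow>
      (\<forall>j. run (coord_pred (coord D)) (g - 1) int j \<le> 2 * int j - r)"
proof -
  let ?P = "coord_pred (coord D)" and ?R = "bn_rank (chain_graph \<Delta>) D"
  have G: "1 \<le> loops \<Delta>" using g2 double_simps by simp
  define N where "N = g - 1"
  have N: "g = Suc N" "2 * g - 1 = Suc (N + N)" using g2 by (auto simp: N_def)
  \<comment> \<open>The degree \<open>2 g - 2\<close> is one less than the number
    \<open>2 g - 1\<close> of loops subtracted from the threshold, whence the bound
    \<open>-1\<close>.\<close>
  have rk: "int d \<le> ?R \<longleftrightarrow> run ?P (Suc (N + N)) int d \<le> -1" for d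
  proof -
    have "int (2 * g - 1) = 2 * int g - 1" using g2 by simp
    hence "int (thr \<Delta> (\<lambda>i. AJ \<Delta> i D) (2 * g - 1) d) \<le> 2 * int g - 2 \<longleftrightarrow> run ?P (2 * g - 1) int d \<le> -1"
      using thr_eq_run[of "2 * g - 1" D d] by linarith
    thus ?thesis unfolding bn_rank_ge_iff(1)[OF double_chain_ok G D, of d] double_simps(1) deg N(2) .
  qed
  have R1: "-1 \<le> ?R" by (rule bn_rank_ge_iff(2)[OF double_chain_ok G D])
  have pal: "?P (Suc N + i) = ?P (Suc N - i)" if i: "1 \<le> i" "i \<le> N" for i
  proof (cases "i = N + 1")
    case False
    define a where "a = Suc N - i"
    have a: "a \<in> {1..<g}" using i N by (auto simp: a_def)
    have e: "Suc N + i = 2 * g - a" using i N by (auto simp: a_def)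
    have u: "upper_len \<Delta> (2 * g - a) = upper_len \<Delta> a" "loop_len \<Delta> (2 * g - a) = loop_len \<Delta> a"
      "loop_len \<Delta> a = loop_len C a" using a double_simps(2,4,8,10)[of a] by auto
    have "?P (2 * g - a) z \<longleftrightarrow> ?P a z" for z
      using sym[OF a] a g2 unfolding coord_pred_def u by (auto intro: rcong_trans rcong_sym)
    thus ?thesis unfolding e a_def[symmetric] by auto
  qed (use i in auto)
  have L: "0 < loop_len C g" by (rule loop_len_pos[OF C g_in(1)])
  \<comment> \<open>The middle loop has upper arc \<open>loop_len C g\<close> and total length twice
    that, so it distinguishes bead positions by parity only.\<close>
  have md: "?P (Suc N) z \<longleftrightarrow> even (z - n)" for z
  proof -
    have "?P (Suc N) z \<longleftrightarrow> [coord D g = loop_len C g * of_int z] (rmod 2 * loop_len C g)"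
      unfolding N(1)[symmetric] using g2 by (auto simp: coord_pred_def double_simps)
    also have "\<dots> \<longleftrightarrow> [of_int n * loop_len C g = loop_len C g * of_int z] (rmod 2 * loop_len C g)"
      using mid by (meson rcong_sym rcong_trans)
    also have "\<dots> \<longleftrightarrow> (\<exists>m::int. loop_len C g * of_int z = of_int n * loop_len C g + of_int m * (2 * loop_len C g))"
      by (simp add: rcong_altdef)
    also have "\<dots> \<longleftrightarrow> (\<exists>m::int. z = n + 2 * m)"
    proof -
      have "loop_len C g * of_int z = of_int n * loop_len C g + of_int m * (2 * loop_len C g) \<longleftrightarrow> z = n + 2 * m" for m
      proof -
        have "loop_len C g * of_int z = of_int n * loop_len C g + of_int m * (2 * loop_len C g) \<longleftrightarrow>
            loop_len C g * of_int z = loop_len C g * of_int (n + 2 * m)" by (simp add: algebra_simps)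
        also have "\<dots> \<longleftrightarrow> (of_int z :: real) = of_int (n + 2 * m)" using L by simp
        also have "\<dots> \<longleftrightarrow> z = n + 2 * m" by (rule of_int_eq_iff)
        finally show ?thesis .
      qed
      thus ?thesis by simp
    qed
    also have "\<dots> \<longleftrightarrow> even (z - n)" by presburger
    finally show ?thesis .
  qed
  note par = palindrome_rank_parity[OF sparse_coord_pred pal md]
  show "[?R = n] (mod 2)"
  proof (cases "?R = -1")
    case True
    hence "\<not> int 0 \<le> ?R" by simp
    hence "odd n" using par(3) rk[of 0] by blast
    thus ?thesis using True by (simp add: cong_iff_dvd_diff)
  next
    case False
    define \<rho> where "\<rho> = nat ?R"
    have \<rho>: "int \<rho> = ?R" using R1 False by (simp add: \<rho>_def)
    have "int \<rho> \<le> ?R" "\<not> int (Suc \<rho>) \<le> ?R" using \<rho> by auto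
    hence "even (int \<rho> - n)" using par(2)[of \<rho>] rk by blast
    thus ?thesis by (simp add: \<rho> cong_iff_dvd_diff)
  qed
  show "r \<le> ?R \<longleftrightarrow> (\<forall>j. run ?P (g - 1) int j \<le> 2 * int j - r)" if r: "r \<ge> -1" "[r = n] (mod 2)"
  proof (cases "r = -1")
    case True
    have "run ?P (g - 1) int j \<le> 2 * int j - r" for j
      using mayaD(2)[OF maya_run[OF maya_int], of ?P "g - 1" j] True by simp
    thus ?thesis using True R1 by simp
  next
    case False
    then obtain \<rho> where \<rho>: "r = int \<rho>" using r(1) by (metis int_ops(1) nonneg_int_cases order.not_eq_order_implies_strict zle_add1_eq_le add.commute add_minus_cancel add.right_inverse zless_add1_eq linorder_not_less)
    have "even (int \<rho> - n)" using r(2) \<rho> by (simp add: cong_iff_dvd_diff)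
    thus ?thesis using par(1)[of \<rho>] rk[of \<rho>] by (simp add: \<rho> N_def)
  qed
qed

end

subsection \<open>The Prym--Brill--Noether locus\<close>

lemma lower_mono:
  assumes "strict_mono a" "strict_mono a'" "a' \<le> a" shows "lower P a' \<le> lower P a"
proof -
  have "a \<le> raise P (lower P a)" using lower_le_iff[OF assms(1) strict_mono_lower[OF assms(1)], of P P] by simp
  hence "a' \<le> raise P (lower P a)" using assms(3) by (rule order.trans[rotated])
  thus ?thesis using lower_le_iff[OF assms(2) strict_mono_lower[OF assms(1)]] by blast
qed

text \<open>An additional letter can only move beads to the left, and by \<open>lower_mono\<close>
  the later letters preserve this.\<close>

lemma good_mono:
  assumes "good k r N v" "v \<subseteq>\<^sub>m w" "dom w \<subseteq> {1..N}" "normal k w" shows "good k r N w"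
proof -
  have sm: "strict_mono (run P n int)" for P n by (rule mayaD(3)[OF maya_run[OF maya_int]])
  have "run (\<lambda>i. res k (w i)) n int \<le> run (\<lambda>i. res k (v i)) n int" for n
  proof (induction n)
    case (Suc n)
    let ?a = "run (\<lambda>i. res k (v i)) n int"
    have 1: "lower (res k (w (Suc n))) (run (\<lambda>i. res k (w i)) n int) \<le> lower (res k (w (Suc n))) ?a"
      by (rule lower_mono[OF sm sm Suc])
    have 2: "lower (res k (w (Suc n))) ?a \<le> lower (res k (v (Suc n))) ?a"
    proof (cases "v (Suc n)")
      case None thus ?thesis by (auto simp: le_fun_def lower_def)
    next
      case (Some c)
      hence "Suc n \<in> dom v" by auto
      hence "w (Suc n) = v (Suc n)" using assms(2) unfolding map_le_def by simp
      thus ?thesis by simp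
    qed
    show ?case using order.trans[OF 1 2] by simp
  qed simp
  hence "run (\<lambda>i. res k (w i)) N int j \<le> 2 * int j - r" for j
    using assms(1) unfolding good_def le_fun_def by (meson order.trans)
  thus ?thesis using assms by (simp add: good_def)
qed

text \<open>Modulo the loop, an upper arc is minus a lower arc. The integers \<open>d\<close> for
  which \<open>d\<close> lower arcs close up form a subgroup of the integers; its least positive
  element is the torsion, and without torsion it is zero.\<close>

lemma torsion_iff:
  assumes C: "is_loop_chain C" and a: "a \<in> {1..loops C}"
    and k: "has_torsion C a k \<or> k = 0 \<and> (\<nexists>k. has_torsion C a k)"
  shows "[upper_len C a * of_int c = upper_len C a * of_int c'] (rmod loop_len C a) \<longleftrightarrow> [c = c'] (mod int k)"
proof -
  let ?m = "lower_len C a" and ?L = "loop_len C a"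
  define T where "T d \<longleftrightarrow> (\<exists>n::int. of_int d * ?m = of_int n * ?L)" for d :: int
  have T1: "[upper_len C a * of_int c = upper_len C a * of_int c'] (rmod ?L) \<longleftrightarrow> T (c - c')"
  proof -
    have u: "upper_len C a = ?L - ?m" by (simp add: loop_len_def)
    have "upper_len C a * of_int c' = upper_len C a * of_int c + of_int n * ?L \<longleftrightarrow>
        of_int (c - c') * ?m = of_int (n + (c - c')) * ?L" for n :: int
      unfolding u by (simp add: algebra_simps)
    hence "[upper_len C a * of_int c = upper_len C a * of_int c'] (rmod ?L) \<longleftrightarrow>
        (\<exists>n::int. of_int (c - c') * ?m = of_int (n + (c - c')) * ?L)" unfolding rcong_altdef by blast
    also have "\<dots> \<longleftrightarrow> T (c - c')" unfolding T_def by (metis diff_add_cancel)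
    finally show ?thesis .
  qed
  have T_diff: "T (x - y)" if xy: "T x" "T y" for x y
  proof -
    obtain n n' :: int where "of_int x * ?m = of_int n * ?L" "of_int y * ?m = of_int n' * ?L"
      using xy unfolding T_def by blast
    hence "of_int (x - y) * ?m = of_int (n - n') * ?L" by (simp add: algebra_simps)
    thus ?thesis unfolding T_def by blast
  qed
  have T_mult: "T (x * y)" if x: "T x" for x y
  proof -
    obtain n :: int where "of_int x * ?m = of_int n * ?L" using x unfolding T_def by blast
    hence "of_int (x * y) * ?m = of_int (n * y) * ?L" by (simp add: algebra_simps)
    thus ?thesis unfolding T_def by blast
  qed
  have ht: "has_torsion C a j \<longleftrightarrow> 0 < j \<and> T (int j) \<and> (\<forall>i. 0 < i \<and> T (int i) \<longrightarrow> j \<le> i)" for j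
    unfolding has_torsion_def Let_def T_def by auto
  have "T d \<longleftrightarrow> int k dvd d" for d
  proof (cases "has_torsion C a k")
    case True
    hence k0: "0 < k" and Tk: "T (int k)" and min: "\<And>i. 0 < i \<Longrightarrow> T (int i) \<Longrightarrow> k \<le> i" using ht by auto
    show ?thesis
    proof
      assume "T d"
      have "d mod int k = d - int k * (d div int k)" by (simp add: minus_mult_div_eq_mod)
      hence "T (d mod int k)" using T_diff[OF \<open>T d\<close> T_mult[OF Tk]] by simp
      moreover have "0 \<le> d mod int k" "d mod int k < int k" using k0 by auto
      ultimately have "d mod int k = 0" using min[of "nat (d mod int k)"] by (cases "d mod int k = 0") auto
      thus "int k dvd d" by (simp add: dvd_eq_mod_eq_0)
    next
      assume "int k dvd d" thus "T d" using T_mult[OF Tk] by (auto elim!: dvdE)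
    qed
  next
    case False
    hence k0: "k = 0" and no: "\<nexists>k. has_torsion C a k" using k by auto
    have "d = 0" if "T d"
    proof (rule ccontr)
      assume "d \<noteq> 0"
      have "T (- d)" using T_mult[OF that, of "-1"] by simp
      hence "0 < nat \<bar>d\<bar> \<and> T (int (nat \<bar>d\<bar>))" using that \<open>d \<noteq> 0\<close> by (cases "d \<ge> 0") auto
      hence ex: "\<exists>j. 0 < j \<and> T (int j)" by blast
      define j where "j = (LEAST j. 0 < j \<and> T (int j))"
      have "0 < j \<and> T (int j)" unfolding j_def by (rule LeastI_ex[OF ex])
      moreover have "j \<le> i" if "0 < i \<and> T (int i)" for i unfolding j_def by (rule Least_le) (rule that)
      ultimately have "has_torsion C a j" unfolding ht by blast
      thus False using no by blast
    qed
    moreover have "T 0" unfolding T_def by (intro exI[of _ 0]) simp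
    ultimately show ?thesis using k0 by auto
  qed
  thus ?thesis unfolding T1 by (simp add: cong_iff_dvd_diff)
qed

text \<open>All that is kept of the edge lengths is \<open>tor\<close>, which treats the gonal and
  the generic case alike.\<close>

locale prym_chain = folded_chain +
  fixes r :: int and k :: nat
  assumes r: "-1 \<le> r" and k1: "k \<noteq> 1"
    and tor: "\<And>a c c'. a \<in> {1..<g} \<Longrightarrow>
      [upper_len C a * of_int c = upper_len C a * of_int c'] (rmod loop_len C a) \<longleftrightarrow> [c = c'] (mod int k)"
begin

section \<open>Divisors with prescribed coordinates\<close>

text \<open>The middle value is the position of \<open>q\<close>: the right vertex of the middle
  loop is at 0 and its left vertex at \<open>loop_len C g\<close>, the length of either arc.\<close>

definition full_coord :: "(nat \<Rightarrow> real) \<Rightarrow> nat \<Rightarrow> real" where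
  "full_coord \<xi> i = (if i < g then \<xi> i else if i = g then (if even r then 0 else loop_len C g) else \<xi> (2 * g - i))"

definition pdiv :: "(nat \<Rightarrow> real) \<Rightarrow> chain_divisor" where
  "pdiv \<xi> = (\<Sum>i\<in>{1..2 * g - 1}. frag_of (loop_point \<Delta> i (full_coord \<xi> i))) - frag_of (Vertex (RV (2 * g - 1)))"

lemma pdiv_divisors: "pdiv \<xi> \<in> divisors (chain_graph \<Delta>)"
  unfolding pdiv_def
proof (intro divisors_diff divisors_sum)
  fix i assume "i \<in> {1..2 * g - 1}"
  thus "frag_of (loop_point \<Delta> i (full_coord \<xi> i)) \<in> divisors (chain_graph \<Delta>)"
    using loop_point_in_points[OF double_chain_ok in_double(1)] by (simp add: divisors_frag_of)
next
  show "frag_of (Vertex (RV (2 * g - 1))) \<in> divisors (chain_graph \<Delta>)"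
    using g2 by (auto simp: divisors_frag_of points_def chain_graph_simps double_simps)
qed

lemma pdiv_degree: "div_degree (pdiv \<xi>) = 2 * int g - 2"
  using g2 by (simp add: pdiv_def div_degree_simps of_nat_diff)

lemma coord_pdiv:
  assumes i: "i \<in> {1..2 * g - 1}"
  shows "[coord (pdiv \<xi>) i = full_coord \<xi> i] (rmod loop_len \<Delta> i)"
proof -
  let ?p = "\<lambda>j. pos \<Delta> i (loop_point \<Delta> j (full_coord \<xi> j))"
  have i': "i \<in> {1..loops \<Delta>}" using in_double(1)[OF i] .
  have "AJ \<Delta> i (pdiv \<xi>) = (\<Sum>j\<in>{1..2 * g - 1}. ?p j)"
    using i by (simp add: pdiv_def weigh_simps)
  also have "\<dots> = ?p i + (\<Sum>j\<in>{1..2 * g - 1} - {i}. ?p j)" using i by (simp add: sum.remove)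
  also have "(\<Sum>j\<in>{1..2 * g - 1} - {i}. ?p j) = (\<Sum>j\<in>{1..<i}. upper_len \<Delta> i)"
  proof (rule sum.mono_neutral_cong_right)
    show "\<forall>j\<in>{1..2 * g - 1} - {i} - {1..<i}. ?p j = 0"
    proof
      fix j assume j: "j \<in> {1..2 * g - 1} - {i} - {1..<i}"
      hence "j \<in> {1..2 * g - 1}" by simp
      from pos_loop_point(2)[OF double_chain_ok in_double(1)[OF this], of i] j show "?p j = 0" by auto
    qed
    fix j assume j: "j \<in> {1..<i}"
    hence "j \<in> {1..2 * g - 1}" using i by simp
    from pos_loop_point(2)[OF double_chain_ok in_double(1)[OF this], of i] j show "?p j = upper_len \<Delta> i" by auto
  qed (use i in auto)
  also have "?p i = full_coord \<xi> i rmod loop_len \<Delta> i" by (rule pos_loop_point(1)[OF double_chain_ok i'])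
  finally have "coord (pdiv \<xi>) i = full_coord \<xi> i rmod loop_len \<Delta> i"
    using i by (simp add: coord_def of_nat_diff algebra_simps)
  thus ?thesis by (simp add: rcong_rmod_left)
qed

lemma fold_left:
  assumes a: "a \<in> {1..<g}"
  shows "loop_point \<Delta> a x = loop_point C a x" "fold_map C (loop_point \<Delta> a x) = loop_point C a x"
proof -
  show e: "loop_point \<Delta> a x = loop_point C a x"
    using a double_simps(2-4)[of a] by (simp add: loop_point_def Let_def edge_point_def chain_graph_simps)
  have a': "a \<in> {1..loops C}" using g_in(2)[OF a] .
  have "fold_map C (loop_point C a x) = loop_point C a x"
    by (rule loop_point_cases[OF C a', of x]) (use a g_def in \<open>simp_all add: Let_def\<close>)
  thus "fold_map C (loop_point \<Delta> a x) = loop_point C a x" by (simp add: e)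
qed

lemma loop_point_pos:
  assumes a: "a \<in> {1..loops C}"
    and p: "p \<in> {Vertex (RV a), Vertex (LV a)} \<union> {Inner (Upper a) s | s. 0 < s \<and> s < upper_len C a}
      \<union> {Inner (Lower a) s | s. 0 < s \<and> s < lower_len C a}"
  shows "loop_point C a (pos C a p) = p"
proof -
  have l: "0 < upper_len C a" "0 < lower_len C a" using chain_lens(1,2)[OF C a] .
  have "pos C a p \<in> {0..<loop_len C a}" using p l by (auto simp: loop_len_def)
  hence "pos C a p rmod loop_len C a = pos C a p" using loop_len_pos[OF C a] by (intro rmod_idem) simp
  thus ?thesis using p l by (auto simp: loop_point_def Let_def edge_point_def chain_graph_simps)
qed

lemma fold_right:
  assumes a: "a \<in> {1..<g}"
  shows "fold_map C (loop_point \<Delta> (2 * g - a) x) = loop_point C a (upper_len C a - x)"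
proof -
  let ?L = "loop_len C a" and ?u = "upper_len C a" and ?p = "fold_map C (loop_point \<Delta> (2 * g - a) x)"
  have a': "a \<in> {1..loops C}" using g_in(2)[OF a] .
  have i: "2 * g - a \<in> {1..loops \<Delta>}" using in_double(4)[OF a] .
  have u: "upper_len \<Delta> (2 * g - a) = ?u" "lower_len \<Delta> (2 * g - a) = lower_len C a" "loop_len \<Delta> (2 * g - a) = ?L"
    using a double_simps(8-10)[of a] by auto
  have ix: "\<not> 2 * g - a \<le> g" "\<not> 2 * g - a < g" "2 * g - a \<noteq> g" "2 * g - (2 * g - a) = a" using a by auto
  have xs: "[x = x rmod ?L] (rmod ?L)" by simp
  have "?p \<in> {Vertex (RV a), Vertex (LV a)} \<union> {Inner (Upper a) s | s. 0 < s \<and> s < upper_len C a}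
      \<union> {Inner (Lower a) s | s. 0 < s \<and> s < lower_len C a} \<and> [pos C a ?p = ?u - x rmod ?L] (rmod ?L)"
  proof (rule loop_point_cases[OF double_chain_ok i, of x, unfolded u])
    assume "x rmod ?L = 0" "loop_point \<Delta> (2 * g - a) x = Vertex (RV (2 * g - a))"
    thus ?thesis using ix by (simp add: g_def[symmetric])
  next
    assume "x rmod ?L = ?u" "loop_point \<Delta> (2 * g - a) x = Vertex (LV (2 * g - a))"
    thus ?thesis using ix by (simp add: g_def[symmetric])
  next
    fix s assume "0 < s" "s < ?u" "x rmod ?L = s" "loop_point \<Delta> (2 * g - a) x = Inner (Upper (2 * g - a)) s"
    thus ?thesis using ix by (simp add: g_def[symmetric] Let_def)
  next
    fix s assume s: "0 < s" "s < lower_len C a" "x rmod ?L = ?u + s"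
      "loop_point \<Delta> (2 * g - a) x = Inner (Lower (2 * g - a)) s"
    have "[?u + (lower_len C a - s) = - s] (rmod ?L)"
      using rcong_add_L(1)[of "- s" ?L] by (simp add: loop_len_def algebra_simps)
    thus ?thesis using ix s by (simp add: g_def[symmetric] Let_def)
  qed
  hence p: "loop_point C a (pos C a ?p) = ?p" and c: "[pos C a ?p = ?u - x rmod ?L] (rmod ?L)"
    using loop_point_pos[OF a'] by auto
  have "[?u - x rmod ?L = ?u - x] (rmod ?L)" by (intro rcong_diff rcong_refl rcong_sym[OF xs])
  hence "loop_point C a (pos C a ?p) = loop_point C a (?u - x)"
    using c loop_point_eq_iff[OF C a'] by (meson rcong_trans)
  thus ?thesis using p by simp
qed

text \<open>A point of loop \<open>a\<close> or \<open>2 * g - a\<close> of the cover is determined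
  by its image, so the choice of \<open>p\<close> and \<open>p'\<close> is forced; on the reversed
  loop the position is again \<open>\<xi> a\<close>.\<close>

lemma prym_divisor_iff: "prym_divisor C r \<xi> D \<longleftrightarrow> D = pdiv \<xi>"
proof -
  let ?q = "Vertex (if even r then RV g else LV g) :: chain_point" and ?w = "Vertex (RV (2 * g - 1)) :: chain_point"
  let ?l = "\<lambda>a. loop_point \<Delta> a (\<xi> a)" and ?r = "\<lambda>a. loop_point \<Delta> (2 * g - a) (\<xi> a)"
  have L: "0 < loop_len C g" by (rule loop_len_pos[OF C g_in(1)])
  have q: "loop_point \<Delta> g (full_coord \<xi> g) = ?q"
    using L by (auto simp: full_coord_def loop_point_def double_simps Let_def edge_point_def chain_graph_simps)
  have "(\<Sum>i\<in>{1..2 * g - 1}. frag_of (loop_point \<Delta> i (full_coord \<xi> i)))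
      = (\<Sum>i\<in>{1..<g}. frag_of (loop_point \<Delta> i (full_coord \<xi> i))) +
        (frag_of ?q + (\<Sum>i\<in>{g<..2 * g - 1}. frag_of (loop_point \<Delta> i (full_coord \<xi> i))))"
  proof -
    have e: "{1..2 * g - 1} = {1..<g} \<union> insert g {g<..2 * g - 1}" using g2 by auto
    show ?thesis unfolding e by (subst sum.union_disjoint) (auto simp: q)
  qed
  also have "(\<Sum>i\<in>{1..<g}. frag_of (loop_point \<Delta> i (full_coord \<xi> i))) = (\<Sum>a\<in>{1..<g}. frag_of (?l a))"
    by (rule sum.cong) (auto simp: full_coord_def)
  also have "(\<Sum>i\<in>{g<..2 * g - 1}. frag_of (loop_point \<Delta> i (full_coord \<xi> i))) = (\<Sum>a\<in>{1..<g}. frag_of (?r a))"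
    by (rule sum.reindex_bij_witness[of _ "\<lambda>a. 2 * g - a" "\<lambda>a. 2 * g - a"]) (auto simp: full_coord_def)
  finally have pd: "pdiv \<xi> = (\<Sum>a\<in>{1..<g}. frag_of (?l a) + frag_of (?r a)) + frag_of ?q - frag_of ?w"
    by (simp add: pdiv_def sum.distrib algebra_simps)
  have left: "p \<in> range (loop_point \<Delta> a) \<and> fold_map C p = loop_point C a (\<xi> a) \<longleftrightarrow> p = ?l a"
    if a: "a \<in> {1..<g}" for a p
    using fold_left[OF a] by auto
  have right: "p \<in> range (loop_point \<Delta> (2 * g - a)) \<and> fold_map C p = loop_point C a (upper_len C a - \<xi> a) \<longleftrightarrow> p = ?r a"
    if a: "a \<in> {1..<g}" for a p
  proof
    assume h: "p \<in> range (loop_point \<Delta> (2 * g - a)) \<and> fold_map C p = loop_point C a (upper_len C a - \<xi> a)"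
    then obtain x where x: "p = loop_point \<Delta> (2 * g - a) x" by auto
    hence "[upper_len C a - x = upper_len C a - \<xi> a] (rmod loop_len C a)"
      using h fold_right[OF a] loop_point_eq_iff[OF C g_in(2)[OF a]] by simp
    hence "[x = \<xi> a] (rmod loop_len C a)" by simp
    thus "p = ?r a" unfolding x
      using loop_point_eq_iff[OF double_chain_ok in_double(4)[OF a]] double_simps(10)[of a] a by simp
  qed (use fold_right[OF a] in auto)
  have "prym_divisor C r \<xi> D \<longleftrightarrow> (\<exists>p p'.
       (\<forall>a\<in>{1..<g}. (p a \<in> range (loop_point \<Delta> a) \<and> fold_map C (p a) = loop_point C a (\<xi> a)) \<and>
          (p' a \<in> range (loop_point \<Delta> (2 * g - a)) \<and>
          fold_map C (p' a) = loop_point C a (upper_len C a - \<xi> a))) \<and>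
       D = (\<Sum>a\<in>{1..<g}. frag_of (p a) + frag_of (p' a)) + frag_of ?q - frag_of ?w)"
    unfolding prym_divisor_def Let_def g_def[symmetric] \<Delta>_def[symmetric] conj_assoc by (rule refl)
  also have "\<dots> \<longleftrightarrow> (\<exists>p p'. (\<forall>a\<in>{1..<g}. p a = ?l a \<and> p' a = ?r a) \<and>
       D = (\<Sum>a\<in>{1..<g}. frag_of (p a) + frag_of (p' a)) + frag_of ?q - frag_of ?w)"
  proof -
    have "(\<forall>a\<in>{1..<g}. (p a \<in> range (loop_point \<Delta> a) \<and> fold_map C (p a) = loop_point C a (\<xi> a)) \<and>
          (p' a \<in> range (loop_point \<Delta> (2 * g - a)) \<and>
          fold_map C (p' a) = loop_point C a (upper_len C a - \<xi> a))) \<longleftrightarrow>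
        (\<forall>a\<in>{1..<g}. p a = ?l a \<and> p' a = ?r a)" for p p'
      by (intro ball_cong refl conj_cong left right)
    thus ?thesis by (simp only:)
  qed
  also have "\<dots> \<longleftrightarrow> D = pdiv \<xi>"
  proof
    assume "\<exists>p p'. (\<forall>a\<in>{1..<g}. p a = ?l a \<and> p' a = ?r a) \<and>
       D = (\<Sum>a\<in>{1..<g}. frag_of (p a) + frag_of (p' a)) + frag_of ?q - frag_of ?w"
    then obtain p p' where pp: "\<forall>a\<in>{1..<g}. p a = ?l a \<and> p' a = ?r a"
       "D = (\<Sum>a\<in>{1..<g}. frag_of (p a) + frag_of (p' a)) + frag_of ?q - frag_of ?w" by blast
    have "(\<Sum>a\<in>{1..<g}. frag_of (p a) + frag_of (p' a)) = (\<Sum>a\<in>{1..<g}. frag_of (?l a) + frag_of (?r a))"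
      by (rule sum.cong) (use pp(1) in auto)
    thus "D = pdiv \<xi>" using pp(2) pd by simp
  next
    assume "D = pdiv \<xi>"
    thus "\<exists>p p'. (\<forall>a\<in>{1..<g}. p a = ?l a \<and> p' a = ?r a) \<and>
       D = (\<Sum>a\<in>{1..<g}. frag_of (p a) + frag_of (p' a)) + frag_of ?q - frag_of ?w"
      using pd by (intro exI[of _ ?l] exI[of _ ?r]) simp
  qed
  finally show ?thesis .
qed

definition pclass :: "(nat \<Rightarrow> real) \<Rightarrow> chain_divisor set" where
  "pclass \<xi> = div_class (chain_graph \<Delta>) (pdiv \<xi>)"

lemma coord_eq_iff:
  assumes D: "D \<in> divisors (chain_graph \<Delta>)" "div_degree D = 2 * int g - 2"
    and E: "E \<in> divisors (chain_graph \<Delta>)" "div_degree E = 2 * int g - 2"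
  shows "div_class (chain_graph \<Delta>) D = div_class (chain_graph \<Delta>) E \<longleftrightarrow>
    (\<forall>i\<in>{1..2 * g - 1}. [coord D i = coord E i] (rmod loop_len \<Delta> i))"
  unfolding div_class_eq_iff[OF double_chain_ok D(1) E(1)] D(2) E(2) double_simps(1) coord_def
  by simp

lemma pclass_eq_iff: "pclass \<xi> = pclass \<xi>' \<longleftrightarrow> (\<forall>a\<in>{1..<g}. [\<xi> a = \<xi>' a] (rmod loop_len C a))"
proof -
  have "pclass \<xi> = pclass \<xi>' \<longleftrightarrow> (\<forall>i\<in>{1..2 * g - 1}. [full_coord \<xi> i = full_coord \<xi>' i] (rmod loop_len \<Delta> i))"
    unfolding pclass_def coord_eq_iff[OF pdiv_divisors pdiv_degree pdiv_divisors pdiv_degree]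
    using coord_pdiv by (meson rcong_sym rcong_trans)
  also have "\<dots> \<longleftrightarrow> (\<forall>a\<in>{1..<g}. [\<xi> a = \<xi>' a] (rmod loop_len C a))"
  proof
    assume H: "\<forall>i\<in>{1..2 * g - 1}. [full_coord \<xi> i = full_coord \<xi>' i] (rmod loop_len \<Delta> i)"
    show "\<forall>a\<in>{1..<g}. [\<xi> a = \<xi>' a] (rmod loop_len C a)"
    proof
      fix a assume a: "a \<in> {1..<g}"
      hence "a \<in> {1..2 * g - 1}" by auto
      hence "[full_coord \<xi> a = full_coord \<xi>' a] (rmod loop_len \<Delta> a)" by (rule bspec[OF H])
      thus "[\<xi> a = \<xi>' a] (rmod loop_len C a)" using a double_simps(4)[of a] by (simp add: full_coord_def)
    qed
  next
    assume H: "\<forall>a\<in>{1..<g}. [\<xi> a = \<xi>' a] (rmod loop_len C a)"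
    show "\<forall>i\<in>{1..2 * g - 1}. [full_coord \<xi> i = full_coord \<xi>' i] (rmod loop_len \<Delta> i)"
    proof
      fix i assume i: "i \<in> {1..2 * g - 1}"
      consider "i < g" | "i = g" | "g < i" by linarith
      thus "[full_coord \<xi> i = full_coord \<xi>' i] (rmod loop_len \<Delta> i)"
      proof cases
        case 1 thus ?thesis using H i double_simps(4)[of i] by (simp add: full_coord_def)
      next
        case 2 thus ?thesis by (simp add: full_coord_def)
      next
        case 3
        hence "2 * g - i \<in> {1..<g}" using i by auto
        thus ?thesis using H 3 i double_right(3)[of i] by (simp add: full_coord_def)
      qed
    qed
  qed
  finally show ?thesis .
qed

text \<open>By \<open>tor\<close> the bead positions that can move at a loop form at most one
  residue class modulo \<open>k\<close>; its representative is the letter.\<close>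

definition word :: "(nat \<Rightarrow> real) \<Rightarrow> nat \<Rightarrow> int option" where
  "word \<xi> i = (if i \<in> {1..<g} \<and> (\<exists>c. coord_pred \<xi> i c) then Some ((SOME c. coord_pred \<xi> i c) mod int k) else None)"

lemma coord_pred_left:
  "i \<in> {1..<g} \<Longrightarrow> coord_pred \<xi> i z \<longleftrightarrow> [\<xi> i = upper_len C i * of_int z] (rmod loop_len C i)"
  using double_simps(2,4)[of i] by (auto simp: coord_pred_def)

lemma coord_pred_cong: "i \<in> {1..<g} \<Longrightarrow> coord_pred \<xi> i c \<Longrightarrow> coord_pred \<xi> i z \<longleftrightarrow> [z = c] (mod int k)"
  using tor[of i z c] by (simp add: coord_pred_left) (meson rcong_sym rcong_trans)

lemma word_Some_iff: "i \<in> {1..<g} \<Longrightarrow> word \<xi> i = Some c \<longleftrightarrow> coord_pred \<xi> i c \<and> c mod int k = c"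
proof
  assume i: "i \<in> {1..<g}"
  let ?s = "SOME c. coord_pred \<xi> i c"
  show "coord_pred \<xi> i c \<and> c mod int k = c" if w: "word \<xi> i = Some c"
  proof -
    have ex: "\<exists>c. coord_pred \<xi> i c" and c: "c = ?s mod int k" using w by (auto simp: word_def split: if_splits)
    have s: "coord_pred \<xi> i ?s" by (rule someI_ex[OF ex])
    show ?thesis using coord_pred_cong[OF i s, of c] c by (simp add: cong_def)
  qed
  show "word \<xi> i = Some c" if c: "coord_pred \<xi> i c \<and> c mod int k = c"
  proof -
    have s: "coord_pred \<xi> i ?s" by (rule someI[of _ c]) (use c in blast)
    hence "?s mod int k = c" using coord_pred_cong[OF i s, of c] c by (simp add: cong_def)
    thus ?thesis using i c by (auto simp: word_def)
  qed
qed

lemma res_word: "i \<in> {1..<g} \<Longrightarrow> res k (word \<xi> i) = coord_pred \<xi> i"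
proof
  fix z assume i: "i \<in> {1..<g}"
  show "res k (word \<xi> i) z = coord_pred \<xi> i z"
  proof (cases "word \<xi> i")
    case None
    hence "\<not> (\<exists>c. coord_pred \<xi> i c)" using i by (auto simp: word_def split: if_splits)
    thus ?thesis using None by simp
  next
    case (Some c)
    hence "coord_pred \<xi> i c" using word_Some_iff[OF i] by blast
    from coord_pred_cong[OF i this, of z] show ?thesis using Some by simp
  qed
qed

lemma word_normal: "normal k (word \<xi>)" "dom (word \<xi>) \<subseteq> {1..g - 1}"
proof -
  show "normal k (word \<xi>)" unfolding normal_def by (auto simp: word_def split: if_splits)
  show "dom (word \<xi>) \<subseteq> {1..g - 1}" by (auto simp: word_def split: if_splits)
qed

lemma good_word_iff:
  "good k r (g - 1) (word \<xi>) \<longleftrightarrow> (\<forall>j. run (coord_pred \<xi>) (g - 1) int j \<le> 2 * int j - r)"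
proof -
  have "run (\<lambda>i. res k (word \<xi> i)) (g - 1) int = run (coord_pred \<xi>) (g - 1) int"
    by (rule run_cong) (simp add: res_word)
  thus ?thesis using word_normal by (simp add: good_def)
qed

lemma run_coord_cong:
  assumes "\<And>i. i \<in> {1..<g} \<Longrightarrow> [x i = x' i] (rmod loop_len C i)"
  shows "run (coord_pred x) (g - 1) int = run (coord_pred x') (g - 1) int"
proof (rule run_cong)
  fix i assume "1 \<le> i" "i \<le> g - 1"
  hence i: "i \<in> {1..<g}" using g2 by auto
  show "coord_pred x i = coord_pred x' i"
    unfolding fun_eq_iff coord_pred_left[OF i] using assms[OF i] by (meson rcong_sym rcong_trans)
qed

lemma prym_locus_eq: "prym_locus C r = {pclass \<xi> | \<xi>. good k r (g - 1) (word \<xi>)}"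
proof -
  let ?G = "chain_graph \<Delta>" and ?L = "loop_len C g"
  have locus: "prym_locus C r = {div_class ?G D | D. D \<in> divisors ?G \<and> div_degree D = 2 * int g - 2 \<and>
        div_class (chain_graph C) (pushforward (fold_map C) D) =
          div_class (chain_graph C) (canonical_divisor (chain_graph C)) \<and>
        r \<le> bn_rank ?G D \<and> [bn_rank ?G D = r] (mod 2)}"
    unfolding prym_locus_def g_def \<Delta>_def by (rule refl)
  have midr: "full_coord \<xi> g = of_int (if even r then 0 else 1) * ?L" for \<xi> by (simp add: full_coord_def)
  show ?thesis
  proof (intro equalityI subsetI)
    fix X assume "X \<in> prym_locus C r"
    then obtain D where X: "X = div_class ?G D" and D: "D \<in> divisors ?G" "div_degree D = 2 * int g - 2"
      and nm: "div_class (chain_graph C) (pushforward (fold_map C) D) =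
          div_class (chain_graph C) (canonical_divisor (chain_graph C))"
      and rk: "r \<le> bn_rank ?G D" "[bn_rank ?G D = r] (mod 2)" unfolding locus by blast
    have sym: "[coord D a = coord D (2 * g - a)] (rmod loop_len C a)" if "a \<in> {1..<g}" for a
      using norm_condition_iff[OF D] nm that by blast
    have "[0 = coord D g] (rmod ?L)" using norm_condition_iff[OF D] nm rcong_sym by blast
    \<comment> \<open>The norm condition only makes the middle coordinate a multiple of
      \<open>?L\<close>, while its period is \<open>2 * ?L\<close>; the parity of \<open>n\<close>
      is the remaining information.\<close>
    then obtain n :: int where n: "coord D g = of_int n * ?L" unfolding rcong_altdef by auto
    hence mid: "[coord D g = of_int n * ?L] (rmod 2 * ?L)" by simp
    have "[bn_rank ?G D = n] (mod 2)" by (rule prym_rank(1)[OF D sym mid])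
    hence rn: "[r = n] (mod 2)" using rk(2) by (meson cong_sym cong_trans)
    have "r \<le> bn_rank ?G D \<longleftrightarrow> (\<forall>j. run (coord_pred (coord D)) (g - 1) int j \<le> 2 * int j - r)"
      by (rule prym_rank(2)[OF D sym mid r rn])
    hence run: "\<forall>j. run (coord_pred (coord D)) (g - 1) int j \<le> 2 * int j - r" using rk(1) by blast
    have "X = pclass (coord D)" unfolding X pclass_def coord_eq_iff[OF D pdiv_divisors pdiv_degree]
    proof
      fix i assume i: "i \<in> {1..2 * g - 1}"
      have "[coord D i = full_coord (coord D) i] (rmod loop_len \<Delta> i)"
      proof -
        consider "i < g" | "i = g" | "g < i" by linarith
        thus ?thesis
        proof cases
          case 1 thus ?thesis by (simp add: full_coord_def)
        next
          case 2
          obtain m where m: "n = (if even r then 0 else 1) + 2 * m"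
          proof -
            have "even (n - (if even r then 0 else 1))" using rn by (auto simp: cong_iff_dvd_diff)
            thus ?thesis using that by (metis add_diff_cancel_left' diff_add_cancel evenE add.commute)
          qed
          have "coord D g = full_coord (coord D) g + of_int m * (2 * ?L)"
            unfolding n midr m by (simp add: algebra_simps)
          hence "[full_coord (coord D) g = coord D g] (rmod 2 * ?L)" unfolding rcong_altdef by blast
          thus ?thesis using 2 double_simps(7) rcong_sym by simp
        next
          case 3
          hence a: "2 * g - i \<in> {1..<g}" using i by auto
          have "2 * g - (2 * g - i) = i" using i by auto
          hence "[coord D i = coord D (2 * g - i)] (rmod loop_len C (2 * g - i))"
            using sym[OF a] rcong_sym by metis
          thus ?thesis using 3 i double_right(3)[of i] by (simp add: full_coord_def)
        qed
      qed
      thus "[coord D i = coord (pdiv (coord D)) i] (rmod loop_len \<Delta> i)"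
        using coord_pdiv[OF i] by (meson rcong_sym rcong_trans)
    qed
    thus "X \<in> {pclass \<xi> | \<xi>. good k r (g - 1) (word \<xi>)}" using good_word_iff run by blast
  next
    fix X assume "X \<in> {pclass \<xi> | \<xi>. good k r (g - 1) (word \<xi>)}"
    then obtain \<xi> where X: "X = pclass \<xi>" and gw: "good k r (g - 1) (word \<xi>)" by blast
    let ?D = "pdiv \<xi>" and ?n = "if even r then 0 else (1::int)"
    note D = pdiv_divisors[of \<xi>] pdiv_degree[of \<xi>]
    have left: "[coord ?D a = \<xi> a] (rmod loop_len C a)" if a: "a \<in> {1..<g}" for a
    proof -
      have "a \<in> {1..2 * g - 1}" using a by auto
      from coord_pdiv[OF this, of \<xi>] show ?thesis using a double_simps(4)[of a] by (simp add: full_coord_def)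
    qed
    have sym: "[coord ?D a = coord ?D (2 * g - a)] (rmod loop_len C a)" if a: "a \<in> {1..<g}" for a
    proof -
      have "[coord ?D (2 * g - a) = full_coord \<xi> (2 * g - a)] (rmod loop_len \<Delta> (2 * g - a))"
        by (rule coord_pdiv) (use a in auto)
      moreover have "full_coord \<xi> (2 * g - a) = \<xi> a" using a by (auto simp: full_coord_def)
      ultimately show ?thesis using left[OF a] double_simps(10)[of a] a
        by simp (meson rcong_sym rcong_trans)
    qed
    have mid: "[coord ?D g = of_int ?n * ?L] (rmod 2 * ?L)"
      using coord_pdiv[of g \<xi>] g2 unfolding midr double_simps(7) by simp
    have "[coord ?D g = 0] (rmod ?L)"
    proof -
      obtain m :: int where "of_int ?n * ?L = coord ?D g + of_int m * (2 * ?L)"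
        using mid unfolding rcong_altdef by blast
      hence "0 = coord ?D g + of_int (2 * m - ?n) * ?L" by (simp add: algebra_simps split: if_splits)
      thus ?thesis unfolding rcong_altdef by blast
    qed
    hence nm: "div_class (chain_graph C) (pushforward (fold_map C) ?D) =
          div_class (chain_graph C) (canonical_divisor (chain_graph C))"
      using norm_condition_iff[OF D] sym by blast
    have rn: "[r = ?n] (mod 2)" by (auto simp: cong_iff_dvd_diff)
    have pr1: "[bn_rank ?G ?D = ?n] (mod 2)" by (rule prym_rank(1)[OF D sym mid])
    have pr2: "r \<le> bn_rank ?G ?D \<longleftrightarrow> (\<forall>j. run (coord_pred (coord ?D)) (g - 1) int j \<le> 2 * int j - r)"
      by (rule prym_rank(2)[OF D sym mid r rn])
    have "run (coord_pred (coord ?D)) (g - 1) int = run (coord_pred \<xi>) (g - 1) int"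
      by (rule run_coord_cong) (rule left)
    hence "r \<le> bn_rank ?G ?D" using pr2 gw good_word_iff by simp
    moreover have "[bn_rank ?G ?D = r] (mod 2)" using pr1 rn by (meson cong_sym cong_trans)
    ultimately show "X \<in> prym_locus C r" unfolding locus X pclass_def using D nm by blast
  qed
qed

subsection \<open>Cells\<close>

definition sat :: "(nat \<Rightarrow> int option) \<Rightarrow> (nat \<Rightarrow> real) \<Rightarrow> bool" where
  "sat w \<xi> \<longleftrightarrow> (\<forall>a\<in>{1..<g}. \<forall>c. w a = Some c \<longrightarrow> [\<xi> a = upper_len C a * of_int c] (rmod loop_len C a))"

definition torus :: "(nat \<Rightarrow> int option) \<Rightarrow> chain_divisor set set" where
  "torus w = {pclass \<xi> | \<xi>. sat w \<xi>}"

lemma sat_cong: "pclass \<xi> = pclass \<xi>' \<Longrightarrow> sat w \<xi> \<longleftrightarrow> sat w \<xi>'"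
  unfolding sat_def pclass_eq_iff by (meson rcong_sym rcong_trans)

lemma pclass_in_torus: "pclass \<xi> \<in> torus w \<longleftrightarrow> sat w \<xi>"
  unfolding torus_def using sat_cong by blast

lemma sat_iff_word:
  assumes "normal k w" "dom w \<subseteq> {1..<g}" shows "sat w \<xi> \<longleftrightarrow> w \<subseteq>\<^sub>m word \<xi>"
proof
  assume s: "sat w \<xi>"
  show "w \<subseteq>\<^sub>m word \<xi>" unfolding map_le_def
  proof
    fix a assume "a \<in> dom w"
    then obtain c where c: "w a = Some c" and a: "a \<in> {1..<g}" using assms(2) by auto
    have "coord_pred \<xi> a c" using s a c by (simp add: sat_def coord_pred_left)
    moreover have "c mod int k = c" using assms(1) c by (auto simp: normal_def)
    ultimately have "word \<xi> a = Some c" using word_Some_iff[OF a] by blast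
    thus "w a = word \<xi> a" using c by simp
  qed
next
  assume w: "w \<subseteq>\<^sub>m word \<xi>"
  show "sat w \<xi>" unfolding sat_def
  proof (intro ballI allI impI)
    fix a c assume a: "a \<in> {1..<g}" and c: "w a = Some c"
    hence "a \<in> dom w" by auto
    hence "word \<xi> a = Some c" using w c unfolding map_le_def by simp
    thus "[\<xi> a = upper_len C a * of_int c] (rmod loop_len C a)"
      using word_Some_iff[OF a] coord_pred_left[OF a] by blast
  qed
qed

text \<open>Gives a second point on every circle, the test by which fixed and free coordinates are
  told apart.\<close>

lemma half_not_cong: "a \<in> {1..<g} \<Longrightarrow> \<not> [x + loop_len C a / 2 = x] (rmod loop_len C a)"
proof
  assume a: "a \<in> {1..<g}" and "[x + loop_len C a / 2 = x] (rmod loop_len C a)"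
  hence "[loop_len C a / 2 + x = 0 + x] (rmod loop_len C a)" by (simp add: add.commute)
  hence "[loop_len C a / 2 = 0] (rmod loop_len C a)" by (simp only: rcong_add_right_cancel)
  moreover have "0 < loop_len C a" using loop_len_pos[OF C] a g_def by simp
  ultimately show False using rcong_small[of "loop_len C a / 2" "loop_len C a"] by simp
qed

definition witness :: "(nat \<Rightarrow> int option) \<Rightarrow> nat \<Rightarrow> real" where
  "witness w a = (case w a of None \<Rightarrow> 0 | Some c \<Rightarrow> upper_len C a * of_int c)"

lemma sat_witness: "sat w (witness w)"
  by (auto simp: sat_def witness_def)

lemma torus_subset_iff:
  assumes w: "normal k w" "dom w \<subseteq> {1..<g}" and v: "normal k v" "dom v \<subseteq> {1..<g}"
  shows "torus w \<subseteq> torus v \<longleftrightarrow> v \<subseteq>\<^sub>m w"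
proof
  assume sub: "torus w \<subseteq> torus v"
  have sat: "sat v \<xi>" if "sat w \<xi>" for \<xi> using sub that pclass_in_torus by blast
  show "v \<subseteq>\<^sub>m w" unfolding map_le_def
  proof
    fix a assume "a \<in> dom v"
    then obtain c where c: "v a = Some c" and a: "a \<in> {1..<g}" using v(2) by auto
    have vc: "[witness w a = upper_len C a * of_int c] (rmod loop_len C a)"
      using sat[OF sat_witness] a c by (simp add: sat_def)
    show "v a = w a"
    proof (cases "w a")
      case None
      \<comment> \<open>Coordinate \<open>a\<close> is free in \<open>torus w\<close>, so it may be
        put half a turn away from the value that \<open>v\<close> prescribes.\<close>
      define \<xi> where "\<xi> = (witness w)(a := upper_len C a * of_int c + loop_len C a / 2)"
      have "sat w \<xi>" using sat_witness[of w] None by (auto simp: sat_def \<xi>_def)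
      hence "[\<xi> a = upper_len C a * of_int c] (rmod loop_len C a)" using sat a c by (simp add: sat_def)
      thus ?thesis using half_not_cong[OF a] by (simp add: \<xi>_def)
    next
      case (Some d)
      hence "[upper_len C a * of_int d = upper_len C a * of_int c] (rmod loop_len C a)"
        using vc by (simp add: witness_def)
      hence "[d = c] (mod int k)" using tor[OF a] by blast
      moreover have "d mod int k = d" "c mod int k = c" using w(1) v(1) Some c by (auto simp: normal_def)
      ultimately show ?thesis using Some c by (simp add: cong_def)
    qed
  qed
next
  assume "v \<subseteq>\<^sub>m w"
  hence "sat v \<xi>" if "sat w \<xi>" for \<xi> using that unfolding sat_def map_le_def by (metis domI)
  thus "torus w \<subseteq> torus v" unfolding torus_def by blast
qed

text \<open>The free coordinates can be read off the set itself by half turns, so \<open>F\<close>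
  is unique and the description in \<open>cell_dim\<close> is well defined.\<close>

lemma is_coordinate_torus_iff:
  assumes w: "normal k w" "dom w \<subseteq> {1..<g}"
  shows "is_coordinate_torus C r F (torus w) \<longleftrightarrow> F = {1..<g} - dom w"
proof -
  have def': "is_coordinate_torus C r F X \<longleftrightarrow> F \<subseteq> {1..<g} \<and>
      (\<exists>\<xi>0. X = {pclass \<xi> | \<xi>. \<forall>a\<in>{1..<g} - F. \<xi> a = \<xi>0 a})" for X
    unfolding is_coordinate_torus_def prym_divisor_iff g_def[symmetric] \<Delta>_def[symmetric] pclass_def
    by simp
  show ?thesis
  proof
    assume F: "F = {1..<g} - dom w"
    have "torus w = {pclass \<xi> | \<xi>. \<forall>a\<in>{1..<g} - F. \<xi> a = witness w a}"
    proof (intro equalityI subsetI)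
      fix X assume "X \<in> torus w"
      then obtain \<xi> where X: "X = pclass \<xi>" "sat w \<xi>" by (auto simp: torus_def)
      define \<xi>' where "\<xi>' a = (if a \<in> dom w then witness w a else \<xi> a)" for a
      have "[\<xi> a = \<xi>' a] (rmod loop_len C a)" if "a \<in> {1..<g}" for a
        using X(2) that by (auto simp: \<xi>'_def witness_def sat_def)
      hence "pclass \<xi> = pclass \<xi>'" by (simp add: pclass_eq_iff)
      thus "X \<in> {pclass \<xi> | \<xi>. \<forall>a\<in>{1..<g} - F. \<xi> a = witness w a}"
        unfolding X by (intro CollectI exI[of _ \<xi>']) (auto simp: F \<xi>'_def)
    next
      fix X assume "X \<in> {pclass \<xi> | \<xi>. \<forall>a\<in>{1..<g} - F. \<xi> a = witness w a}"
      then obtain \<xi> where X: "X = pclass \<xi>" "\<forall>a\<in>{1..<g} - F. \<xi> a = witness w a" by blast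
      have "sat w \<xi>" unfolding sat_def
      proof (intro ballI allI impI)
        fix a c assume ac: "a \<in> {1..<g}" "w a = Some c"
        hence "a \<in> {1..<g} - F" unfolding F by blast
        hence "\<xi> a = upper_len C a * of_int c" using X(2) ac by (simp add: witness_def)
        thus "[\<xi> a = upper_len C a * of_int c] (rmod loop_len C a)" by (simp add: rcong_refl)
      qed
      thus "X \<in> torus w" using X by (auto simp: torus_def)
    qed
    thus "is_coordinate_torus C r F (torus w)" unfolding def' using F by blast
  next
    assume "is_coordinate_torus C r F (torus w)"
    then obtain \<xi>0 where F: "F \<subseteq> {1..<g}" and eq: "torus w = {pclass \<xi> | \<xi>. \<forall>a\<in>{1..<g} - F. \<xi> a = \<xi>0 a}"
      unfolding def' by blast
    have "pclass \<xi>0 \<in> torus w" unfolding eq by blast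
    hence s0: "sat w \<xi>0" by (simp add: pclass_in_torus)
    have "a \<in> F \<longleftrightarrow> a \<notin> dom w" if a: "a \<in> {1..<g}" for a
    proof -
      define \<xi>1 where "\<xi>1 = \<xi>0(a := \<xi>0 a + loop_len C a / 2)"
      show ?thesis
      proof
        assume aF: "a \<in> F"
        hence "pclass \<xi>1 \<in> torus w" unfolding eq by (intro CollectI exI[of _ \<xi>1]) (auto simp: \<xi>1_def)
        hence s1: "sat w \<xi>1" by (simp add: pclass_in_torus)
        show "a \<notin> dom w"
        proof
          assume "a \<in> dom w"
          then obtain c where c: "w a = Some c" by auto
          have c0: "[\<xi>0 a = upper_len C a * of_int c] (rmod loop_len C a)"
            using s0 a c unfolding sat_def by blast
          have c1: "[\<xi>1 a = upper_len C a * of_int c] (rmod loop_len C a)"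
            using s1 a c unfolding sat_def by blast
          have "[\<xi>1 a = \<xi>0 a] (rmod loop_len C a)" by (rule rcong_trans[OF c1 rcong_sym[OF c0]])
          thus False using half_not_cong[OF a, of "\<xi>0 a"] by (simp add: \<xi>1_def)
        qed
      next
        assume "a \<notin> dom w"
        hence "sat w \<xi>1" using s0 by (auto simp: sat_def \<xi>1_def)
        hence "pclass \<xi>1 \<in> torus w" by (simp add: pclass_in_torus)
        then obtain \<xi> where \<xi>: "pclass \<xi>1 = pclass \<xi>" "\<forall>a\<in>{1..<g} - F. \<xi> a = \<xi>0 a" unfolding eq by blast
        show "a \<in> F"
        proof (rule ccontr)
          assume "a \<notin> F"
          hence "\<xi> a = \<xi>0 a" using \<xi>(2) a by simp
          moreover have "[\<xi>1 a = \<xi> a] (rmod loop_len C a)" using \<xi>(1) a by (simp add: pclass_eq_iff)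
          ultimately show False using half_not_cong[OF a, of "\<xi>0 a"] by (simp add: \<xi>1_def)
        qed
      qed
    qed
    thus "F = {1..<g} - dom w" using F by blast
  qed
qed

lemma cell_dim_torus:
  assumes "normal k w" "dom w \<subseteq> {1..<g}"
  shows "cell_dim C r (torus w) = g - 1 - card (dom w)"
proof -
  have "finite (dom w)" using assms(2) finite_subset by blast
  hence "card ({1..<g} - dom w) = g - 1 - card (dom w)" using assms(2) by (simp add: card_Diff_subset)
  thus ?thesis unfolding cell_dim_def is_coordinate_torus_iff[OF assms] by simp
qed

text \<open>Up to full turns, \<open>x - y\<close> lower arcs are the same as \<open>y - x\<close>
  upper arcs.\<close>

lemma tableau_torus_eq:
  assumes t: "t \<in> prym_tableaux g r k"
  shows "tableau_torus C r t = torus (tab_word k r t)"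
proof -
  let ?w = "tab_word k r t"
  let ?Q = "\<lambda>\<xi>. \<forall>a \<in> t ` staircase r. \<exists>(x, y) \<in> staircase r. t (x, y) = a \<and> \<xi> a = lower_len C a * (real x - real y)"
  have lc: "[lower_len C a * (real x - real y) = upper_len C a * of_int ((int y - int x) mod int k)] (rmod loop_len C a)"
    if a: "a \<in> {1..<g}" for a x y
  proof -
    have "upper_len C a * of_int (int y - int x) =
        lower_len C a * (real x - real y) + of_int (int y - int x) * loop_len C a"
      by (simp add: loop_len_def algebra_simps)
    hence "[lower_len C a * (real x - real y) = upper_len C a * of_int (int y - int x)] (rmod loop_len C a)"
      unfolding rcong_altdef by blast
    moreover have "[upper_len C a * of_int (int y - int x) = upper_len C a * of_int ((int y - int x) mod int k)] (rmod loop_len C a)"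
      unfolding tor[OF a] by (simp add: cong_def)
    ultimately show ?thesis by (rule rcong_trans)
  qed
  have "tableau_torus C r t = {pclass \<xi> | \<xi>. ?Q \<xi>}"
    unfolding tableau_torus_def prym_divisor_iff \<Delta>_def[symmetric] pclass_def by simp
  also have "\<dots> = torus ?w"
  proof (intro equalityI subsetI)
    fix X assume "X \<in> {pclass \<xi> | \<xi>. ?Q \<xi>}"
    then obtain \<xi> where X: "X = pclass \<xi>" "?Q \<xi>" by blast
    have "sat ?w \<xi>" unfolding sat_def
    proof (intro ballI allI impI)
      fix a c assume a: "a \<in> {1..<g}" and c: "?w a = Some c"
      have "a \<in> t ` staircase r" using c by (auto simp: tab_word_def split: if_splits)
      then obtain x y where xy: "(x, y) \<in> staircase r" "t (x, y) = a" "\<xi> a = lower_len C a * (real x - real y)"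
        using X(2) by blast
      have "c = (int y - int x) mod int k" using tab_word_box[OF t xy(1)] xy(2) c by simp
      thus "[\<xi> a = upper_len C a * of_int c] (rmod loop_len C a)" using lc[OF a, of x y] xy(3) by simp
    qed
    thus "X \<in> torus ?w" using X by (auto simp: torus_def)
  next
    fix X assume "X \<in> torus ?w"
    then obtain \<xi> where X: "X = pclass \<xi>" "sat ?w \<xi>" by (auto simp: torus_def)
    define b where "b a = (SOME b. b \<in> staircase r \<and> t b = a)" for a
    have b: "b a \<in> staircase r \<and> t (b a) = a" if "a \<in> t ` staircase r" for a
      unfolding b_def by (rule someI_ex) (use that in auto)
    define \<xi>' where "\<xi>' a = (if a \<in> t ` staircase r then lower_len C a * (real (fst (b a)) - real (snd (b a))) else \<xi> a)" for a
    have "[\<xi> a = \<xi>' a] (rmod loop_len C a)" if a: "a \<in> {1..<g}" for a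
    proof (cases "a \<in> t ` staircase r")
      case True
      obtain x y where xy: "b a = (x, y)" by (cases "b a")
      have "?w a = Some ((int y - int x) mod int k)" using tab_word_box[OF t, of x y] b[OF True] xy by simp
      hence "[\<xi> a = upper_len C a * of_int ((int y - int x) mod int k)] (rmod loop_len C a)"
        using X(2) a by (simp add: sat_def)
      hence "[\<xi> a = lower_len C a * (real x - real y)] (rmod loop_len C a)"
        using lc[OF a, of x y] by (meson rcong_sym rcong_trans)
      thus ?thesis using True xy by (simp add: \<xi>'_def)
    qed (simp add: \<xi>'_def)
    hence "pclass \<xi> = pclass \<xi>'" by (simp add: pclass_eq_iff)
    moreover have "?Q \<xi>'"
    proof
      fix a assume a: "a \<in> t ` staircase r"
      obtain x y where xy: "b a = (x, y)" by (cases "b a")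
      show "\<exists>(x, y)\<in>staircase r. t (x, y) = a \<and> \<xi>' a = lower_len C a * (real x - real y)"
        by (rule bexI[of _ "(x, y)"]) (use b[OF a] xy a in \<open>auto simp: \<xi>'_def\<close>)
    qed
    ultimately show "X \<in> {pclass \<xi> | \<xi>. ?Q \<xi>}" using X by blast
  qed
  finally show ?thesis .
qed

section \<open>Cells as tori of good words\<close>

abbreviation gd :: "(nat \<Rightarrow> int option) \<Rightarrow> bool" where
  "gd \<equiv> good k r (g - 1)"

abbreviation mgd :: "(nat \<Rightarrow> int option) \<Rightarrow> bool" where
  "mgd \<equiv> min_good k r (g - 1)"

lemma gdD: "gd w \<Longrightarrow> normal k w" "gd w \<Longrightarrow> dom w \<subseteq> {1..<g}" "gd w \<Longrightarrow> finite (dom w)"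
proof -
  have e: "{1..g - 1} = {1..<g}" using g2 by auto
  show "gd w \<Longrightarrow> normal k w" "gd w \<Longrightarrow> dom w \<subseteq> {1..<g}" "gd w \<Longrightarrow> finite (dom w)"
    using good_finite[of k r "g - 1" w] unfolding good_def e by auto
qed

lemma tab_gd: "t \<in> prym_tableaux g r k \<Longrightarrow> gd (tab_word k r t)"
  using tab_word_good[of t "g - 1" r k] g2 by simp

lemma gd_tab: "gd w \<Longrightarrow> \<exists>t\<in>prym_tableaux g r k. tab_word k r t \<subseteq>\<^sub>m w"
  using good_tab_word[of k r "g - 1" w] g2 by simp

lemma torus_nonempty: "torus w \<noteq> {}"
  using sat_witness[of w] by (auto simp: torus_def)

lemma cell_torus:
  assumes "X \<in> prym_cells C r k" shows "\<exists>w. gd w \<and> X = torus w"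
proof -
  obtain T where X: "X \<noteq> {}" and T: "T \<noteq> {}" "T \<subseteq> prym_tableaux g r k"
    and eq: "X = (\<Inter>t\<in>T. tableau_torus C r t)"
    using assms unfolding prym_cells_def g_def by blast
  have eq': "X = (\<Inter>t\<in>T. torus (tab_word k r t))"
    unfolding eq using T(2) tableau_torus_eq by (intro INF_cong refl) blast
  obtain t0 where t0: "t0 \<in> T" using T(1) by blast
  obtain x where x: "x \<in> X" using X by blast
  hence "x \<in> torus (tab_word k r t0)" using eq' t0 by blast
  then obtain \<xi>0 where \<xi>0: "x = pclass \<xi>0" by (auto simp: torus_def)
  have s0: "sat (tab_word k r t) \<xi>0" if "t \<in> T" for t
    using x eq' that unfolding \<xi>0 by (simp add: pclass_in_torus)
  have le: "tab_word k r t \<subseteq>\<^sub>m word \<xi>0" if t: "t \<in> T" for t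
    using s0[OF t] sat_iff_word[OF gdD(1,2)[OF tab_gd]] T(2) t by blast
  \<comment> \<open>All words of tableaux in \<open>T\<close> are contained in the word of the
    common point \<open>\<xi>0\<close>, hence are compatible. \<open>W\<close> is their union, and
    the intersection of the tori is its torus.\<close>
  define W where "W a = (if \<exists>t\<in>T. a \<in> dom (tab_word k r t) then word \<xi>0 a else None)" for a
  have leW: "tab_word k r t \<subseteq>\<^sub>m W" if t: "t \<in> T" for t
    using le[OF t] t by (auto simp: map_le_def W_def)
  have Wn: "normal k W" using word_normal(1)[of \<xi>0] by (auto simp: normal_def W_def split: if_splits)
  have Wd: "dom W \<subseteq> {1..g - 1}" using word_normal(2)[of \<xi>0] by (auto simp: W_def split: if_splits)
  have gW: "gd W" by (rule good_mono[OF tab_gd leW Wd Wn]) (use t0 T(2) in auto)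
  have "X = torus W"
  proof (intro equalityI subsetI)
    fix X' assume X': "X' \<in> X"
    hence "X' \<in> torus (tab_word k r t0)" using eq' t0 by blast
    then obtain \<xi> where \<xi>: "X' = pclass \<xi>" by (auto simp: torus_def)
    have s: "sat (tab_word k r t) \<xi>" if "t \<in> T" for t
      using X' eq' that unfolding \<xi> by (simp add: pclass_in_torus)
    have "sat W \<xi>" unfolding sat_def
    proof (intro ballI allI impI)
      fix a c assume a: "a \<in> {1..<g}" and c: "W a = Some c"
      then obtain t where t: "t \<in> T" "a \<in> dom (tab_word k r t)" by (auto simp: W_def split: if_splits)
      hence "tab_word k r t a = Some c" using leW[OF t(1)] c by (auto simp: map_le_def)
      thus "[\<xi> a = upper_len C a * of_int c] (rmod loop_len C a)" using s[OF t(1)] a by (simp add: sat_def)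
    qed
    thus "X' \<in> torus W" unfolding \<xi> by (simp add: pclass_in_torus)
  next
    fix X' assume "X' \<in> torus W"
    moreover have "torus W \<subseteq> torus (tab_word k r t)" if "t \<in> T" for t
    proof -
      have "gd (tab_word k r t)" using tab_gd T(2) that by blast
      thus ?thesis using torus_subset_iff[OF gdD(1,2)[OF gW], of "tab_word k r t"] gdD leW[OF that] by blast
    qed
    ultimately show "X' \<in> X" unfolding eq' by blast
  qed
  thus ?thesis using gW by blast
qed

lemma tableaux_cell:
  assumes "T \<noteq> {}" "T \<subseteq> prym_tableaux g r k" "(\<Inter>t\<in>T. torus (tab_word k r t)) \<noteq> {}"
  shows "(\<Inter>t\<in>T. torus (tab_word k r t)) \<in> prym_cells C r k"
proof -
  have "(\<Inter>t\<in>T. torus (tab_word k r t)) = (\<Inter>t\<in>T. tableau_torus C r t)"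
    using assms(2) tableau_torus_eq by (intro INF_cong refl) (metis subsetD)
  thus ?thesis using assms unfolding prym_cells_def g_def[symmetric] by auto
qed

lemma mgd_gd: "mgd w \<Longrightarrow> gd w"
  by (simp add: min_good_def)

lemma mgd_tab: assumes "mgd w" shows "\<exists>t\<in>prym_tableaux g r k. tab_word k r t = w"
proof -
  obtain t where t: "t \<in> prym_tableaux g r k" "tab_word k r t \<subseteq>\<^sub>m w" using gd_tab[OF mgd_gd[OF assms]] by blast
  thus ?thesis using assms tab_gd unfolding min_good_def by blast
qed

lemma mgd_cell: "mgd w \<Longrightarrow> torus w \<in> prym_cells C r k"
proof -
  assume "mgd w"
  then obtain t where t: "t \<in> prym_tableaux g r k" "tab_word k r t = w" using mgd_tab by blast
  thus ?thesis using tableaux_cell[of "{t}"] torus_nonempty by simp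
qed

text \<open>The common extension \<open>W\<close> makes the two words agree where both are defined,
  so \<open>w ++ v\<close> is their union, whose conditions are those of both.\<close>

lemma mgd_inter_cell:
  assumes w: "mgd w" and v: "mgd v" and W: "w \<subseteq>\<^sub>m W" "v \<subseteq>\<^sub>m W"
  shows "torus w \<inter> torus v = torus (w ++ v)" "torus (w ++ v) \<in> prym_cells C r k"
    "normal k (w ++ v)" "dom (w ++ v) \<subseteq> {1..<g}"
proof -
  have agree: "w a = Some c \<Longrightarrow> v a = Some d \<Longrightarrow> c = d" for a c d
    using W unfolding map_le_def by (metis domI option.inject)
  have sat: "sat (w ++ v) \<xi> \<longleftrightarrow> sat w \<xi> \<and> sat v \<xi>" for \<xi>
  proof
    assume s: "sat (w ++ v) \<xi>"
    have "(w ++ v) a = Some c" if "w a = Some c" for a c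
      using that agree[of a c] by (cases "v a") (auto simp: map_add_def)
    moreover have "(w ++ v) a = Some c" if "v a = Some c" for a c using that by simp
    ultimately show "sat w \<xi> \<and> sat v \<xi>" using s unfolding sat_def by blast
  next
    assume "sat w \<xi> \<and> sat v \<xi>"
    thus "sat (w ++ v) \<xi>" unfolding sat_def map_add_Some_iff by blast
  qed
  show eq: "torus w \<inter> torus v = torus (w ++ v)"
  proof (intro equalityI subsetI)
    fix X assume X: "X \<in> torus w \<inter> torus v"
    then obtain \<xi> where \<xi>: "X = pclass \<xi>" by (auto simp: torus_def)
    show "X \<in> torus (w ++ v)" using X unfolding \<xi> by (simp add: pclass_in_torus sat)
  next
    fix X assume X: "X \<in> torus (w ++ v)"
    then obtain \<xi> where \<xi>: "X = pclass \<xi>" by (auto simp: torus_def)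
    show "X \<in> torus w \<inter> torus v" using X unfolding \<xi> by (simp add: pclass_in_torus sat)
  qed
  obtain t s where ts: "t \<in> prym_tableaux g r k" "tab_word k r t = w" "s \<in> prym_tableaux g r k" "tab_word k r s = v"
    using mgd_tab[OF w] mgd_tab[OF v] by blast
  have "(\<Inter>t\<in>{t, s}. torus (tab_word k r t)) = torus (w ++ v)" using ts eq by simp
  thus "torus (w ++ v) \<in> prym_cells C r k"
    using tableaux_cell[of "{t, s}"] ts torus_nonempty[of "w ++ v"] by simp
  show "normal k (w ++ v)" using gdD(1)[OF mgd_gd[OF w]] gdD(1)[OF mgd_gd[OF v]]
    unfolding normal_def map_add_Some_iff by blast
  show "dom (w ++ v) \<subseteq> {1..<g}" using gdD(2)[OF mgd_gd[OF w]] gdD(2)[OF mgd_gd[OF v]] by auto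
qed

text \<open>The word of any cell contains a minimal good word, and the torus of the latter is itself
  a cell containing the given one.\<close>

lemma maximal_cell:
  assumes "X \<in> maximal_cells C r k" shows "\<exists>w. mgd w \<and> X = torus w"
proof -
  have X: "X \<in> prym_cells C r k" and max: "\<And>Y. Y \<in> prym_cells C r k \<Longrightarrow> X \<subseteq> Y \<Longrightarrow> Y = X"
    using assms by (auto simp: maximal_cells_def)
  obtain W where W: "gd W" "X = torus W" using cell_torus[OF X] by blast
  obtain w where w: "w \<subseteq>\<^sub>m W" "mgd w" using min_good_exists[OF W(1)] by blast
  have "X \<subseteq> torus w"
    unfolding W(2) torus_subset_iff[OF gdD(1,2)[OF W(1)] gdD(1,2)[OF mgd_gd[OF w(2)]]] by (rule w(1))
  thus ?thesis using max[OF mgd_cell[OF w(2)]] w(2) by blast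
qed

lemma locus_union: "prym_locus C r = \<Union> (prym_cells C r k)"
proof (intro equalityI subsetI)
  fix X assume "X \<in> prym_locus C r"
  then obtain \<xi> where \<xi>: "X = pclass \<xi>" "gd (word \<xi>)" unfolding prym_locus_eq by blast
  obtain w where w: "w \<subseteq>\<^sub>m word \<xi>" "mgd w" using min_good_exists[OF \<xi>(2)] by blast
  have "sat w \<xi>" using sat_iff_word[OF gdD(1,2)[OF mgd_gd[OF w(2)]]] w(1) by blast
  hence "X \<in> torus w" by (simp add: \<xi> pclass_in_torus)
  thus "X \<in> \<Union> (prym_cells C r k)" using mgd_cell[OF w(2)] by blast
next
  fix X assume "X \<in> \<Union> (prym_cells C r k)"
  then obtain w where w: "gd w" "X \<in> torus w" using cell_torus by blast
  then obtain \<xi> where \<xi>: "X = pclass \<xi>" "sat w \<xi>" by (auto simp: torus_def)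
  have "w \<subseteq>\<^sub>m word \<xi>" using sat_iff_word[OF gdD(1,2)[OF w(1)]] \<xi>(2) by blast
  hence "gd (word \<xi>)" by (rule good_mono[OF w(1) _ word_normal(2,1)])
  thus "X \<in> prym_locus C r" unfolding prym_locus_eq using \<xi>(1) by blast
qed

lemma locus_dim_eq:
  assumes w: "mgd w" shows "locus_dim C r k = int (g - 1 - card (dom w))"
proof -
  let ?d = "\<lambda>X. int (cell_dim C r X)" and ?n = "card (dom w)"
  have bound: "cell_dim C r X \<le> g - 1 - ?n" if X: "X \<in> prym_cells C r k" for X
  proof -
    obtain W where W: "gd W" "X = torus W" using cell_torus[OF X] by blast
    obtain v where v: "v \<subseteq>\<^sub>m W" "mgd v" using min_good_exists[OF W(1)] by blast
    have "card (dom v) \<le> card (dom W)" using map_le_implies_dom_le[OF v(1)] gdD(3)[OF W(1)] by (rule card_mono[rotated])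
    hence "?n \<le> card (dom W)" using min_good_card[OF k1 r w v(2)] by simp
    thus ?thesis unfolding W(2) cell_dim_torus[OF gdD(1,2)[OF W(1)]] by simp
  qed
  have mem: "int (g - 1 - ?n) \<in> ?d ` prym_cells C r k"
    using mgd_cell[OF w] cell_dim_torus[OF gdD(1,2)[OF mgd_gd[OF w]]] by (metis imageI)
  have "?d ` prym_cells C r k \<subseteq> int ` {..g - 1 - ?n}" using bound by auto
  hence fin: "finite (?d ` prym_cells C r k)" by (rule finite_subset) simp
  have "Max (?d ` prym_cells C r k) = int (g - 1 - ?n)"
    by (rule Max_eqI[OF fin _ mem]) (use bound in auto)
  moreover have "prym_cells C r k \<noteq> {}" using mgd_cell[OF w] by blast
  ultimately show ?thesis by (simp add: locus_dim_def)
qed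

text \<open>Every link contributes the intersection of its two tori as an intermediate cell; its
  word has at most one letter more, so its codimension is at most 1.\<close>

lemma linked_path:
  assumes "(w, v) \<in> (linked k r (g - 1))\<^sup>*" "mgd w"
  shows "\<exists>Xs. Xs \<noteq> [] \<and> hd Xs = torus w \<and> last Xs = torus v \<and> connecting_sequence C r k Xs"
  using assms(1)
proof induction
  case base
  have "connecting_sequence C r k [torus w]"
    unfolding connecting_sequence_def
    using mgd_cell[OF assms(2)] locus_dim_eq[OF assms(2)] cell_dim_torus[OF gdD(1,2)[OF mgd_gd[OF assms(2)]]]
    by simp
  thus ?case by (intro exI[of _ "[torus w]"]) simp
next
  case (step v u)
  then obtain Xs where Xs: "Xs \<noteq> []" "hd Xs = torus w" "last Xs = torus v" "connecting_sequence C r k Xs" by blast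
  obtain W where v: "mgd v" and u: "mgd u" and W: "v \<subseteq>\<^sub>m W" "u \<subseteq>\<^sub>m W" "finite (dom W)" "card (dom W) \<le> Suc (card (dom v))"
    using step(2) by (auto simp: linked_def)
  note ic = mgd_inter_cell[OF v u W(1,2)]
  have "dom (v ++ u) \<subseteq> dom W" using map_le_implies_dom_le[OF W(1)] map_le_implies_dom_le[OF W(2)] by auto
  hence "card (dom (v ++ u)) \<le> Suc (card (dom v))" using card_mono[OF W(3)] W(4) by (meson le_trans)
  hence d1: "locus_dim C r k - int (cell_dim C r (torus (v ++ u))) \<le> 1"
    unfolding locus_dim_eq[OF v] cell_dim_torus[OF ic(3,4)] by linarith
  have d2: "locus_dim C r k - int (cell_dim C r (torus u)) \<le> 1"
    unfolding locus_dim_eq[OF u] cell_dim_torus[OF gdD(1,2)[OF mgd_gd[OF u]]] by simp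
  have sub: "torus (v ++ u) \<subseteq> torus v" "torus (v ++ u) \<subseteq> torus u" using ic(1) by blast+
  have "connecting_sequence C r k (Xs @ [torus (v ++ u), torus u])"
    using Xs ic(2) mgd_cell[OF u] d1 d2 sub
    by (auto simp: connecting_sequence_def successively_append_iff)
  thus ?case using Xs by (intro exI[of _ "Xs @ [torus (v ++ u), torus u]"]) simp
qed

lemma pure_connected:
  shows "\<forall>X \<in> maximal_cells C r k. \<forall>Y \<in> maximal_cells C r k. cell_dim C r X = cell_dim C r Y"
    and "locus_dim C r k \<ge> 1 \<Longrightarrow>
        \<forall>X \<in> maximal_cells C r k. \<forall>Y \<in> maximal_cells C r k.
           \<exists>Xs. Xs \<noteq> [] \<and> hd Xs = X \<and> last Xs = Y \<and> connecting_sequence C r k Xs"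
proof -
  show "\<forall>X \<in> maximal_cells C r k. \<forall>Y \<in> maximal_cells C r k. cell_dim C r X = cell_dim C r Y"
  proof (intro ballI)
    fix X Y assume "X \<in> maximal_cells C r k" "Y \<in> maximal_cells C r k"
    then obtain w v where wv: "mgd w" "X = torus w" "mgd v" "Y = torus v" using maximal_cell by metis
    show "cell_dim C r X = cell_dim C r Y"
      using min_good_card[OF k1 r wv(1,3)] cell_dim_torus gdD(1,2) mgd_gd wv by metis
  qed
  assume dim: "locus_dim C r k \<ge> 1"
  show "\<forall>X \<in> maximal_cells C r k. \<forall>Y \<in> maximal_cells C r k.
           \<exists>Xs. Xs \<noteq> [] \<and> hd Xs = X \<and> last Xs = Y \<and> connecting_sequence C r k Xs"
  proof (intro ballI)
    fix X Y assume "X \<in> maximal_cells C r k" "Y \<in> maximal_cells C r k"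
    then obtain w v where wv: "mgd w" "X = torus w" "mgd v" "Y = torus v" using maximal_cell by metis
    have "card (dom w) < g - 1" using dim locus_dim_eq[OF wv(1)] by simp
    hence "(w, v) \<in> (linked k r (g - 1))\<^sup>*" by (rule min_good_connected[OF k1 r wv(1,3)])
    thus "\<exists>Xs. Xs \<noteq> [] \<and> hd Xs = X \<and> last Xs = Y \<and> connecting_sequence C r k Xs"
      using linked_path[OF _ wv(1)] wv by simp
  qed
qed

end

theorem theorem2:
  fixes C :: loop_chain and k :: nat and r :: int
  assumes "is_loop_chain C" and "loops C \<ge> 2"
    and "k \<ge> 2 \<and> uniform_gonal C k \<or> k = 0 \<and> generic_lengths C"
    and "r \<ge> - 1"
  shows "prym_locus C r = \<Union> (prym_cells C r k)
    \<and> (\<forall>X \<in> maximal_cells C r k. \<forall>Y \<in> maximal_cells C r k. cell_dim C r X = cell_dim C r Y)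
    \<and> (locus_dim C r k \<ge> 1 \<longrightarrow>
        (\<forall>X \<in> maximal_cells C r k. \<forall>Y \<in> maximal_cells C r k.
           \<exists>Xs. Xs \<noteq> [] \<and> hd Xs = X \<and> last Xs = Y \<and> connecting_sequence C r k Xs))"
proof -
  interpret prym_chain C "loops C" "double_chain C" r k
  proof
    fix a c c' assume a: "a \<in> {1..<loops C}"
    hence a': "a \<in> {1..loops C}" by simp
    have "has_torsion C a k \<or> k = 0 \<and> (\<nexists>k. has_torsion C a k)"
      using assms(3) a' unfolding uniform_gonal_def generic_lengths_def by blast
    thus "[upper_len C a * of_int c = upper_len C a * of_int c'] (rmod loop_len C a) \<longleftrightarrow> [c = c'] (mod int k)"
      by (rule torsion_iff[OF assms(1) a'])
  qed (use assms in auto)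
  show ?thesis using locus_union pure_connected by blast
qed

end
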